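(* Consider a standard tropical linear program (in the sense defined in the context) with $n$ variables and $m$ inequalities, i.e. the problem of minimizing $c\odot x=\max_j(c_j+x_j)$ over $x\in\mathcal P(A,b)$, where $A\in\mathbb{T}_{\pm}^{m\times n}$, $b\in\mathbb{T}_{\pm}^m$, $c\in\mathbb{T}^{1\times n}$. Then the tropical simplex algorithm described in the context terminates and returns an optimal solution for any tropical pivoting rule. Every iteration (pivoting and computing the tropical reduced costs) can be done in time $O(n(m+n))$. Moreover, the algorithm traces the image by the valuation map of the path followed by the classical simplex algorithm applied to any lift of this program to the field of real Puiseux series, with a compatible pivoting rule.
   Context: Tropical arithmetic: $\mathbb{T}=\mathbb{R}\cup\{-\infty\}$ with $a\oplus b=\max(a,b)$, $a\odot b=a+b$; matrix products are $(M\odot N)_{ij}=\max_k(m_{ik}+n_{kj})$. Signed tropical numbers $\mathbb{T}_{\pm}$: two copies of $\mathbb{T}$, the positive numbers $a$ and the negative numbers $\ominus a$ ($a\in\mathbb{T}$), with $-\infty$ and $\ominus(-\infty)$ identified. The modulus is $|a|=|\ominus a|=a$. A signed number is tropically positive if it is some $a\neq-\infty$, tropically negative if it is some $\ominus a$ with $a\ne-\infty$, and tropically non-negative if it is positive or $-\infty$. Positive part: $x^+=|x|$ if $x$ is positive, $-\infty$ otherwise; negative part: $x^-=|x|$ if $x$ is negative, $-\infty$ otherwise (entrywise for matrices). The product $x\odot y$ of signed numbers has modulus $|x|+|y|$ and sign the product of the signs. For a square matrix $M\in\mathbb{T}^{p\times p}$, $\operatorname{tper}(M)=\max_{\sigma\in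 S_p}\sum_i m_{i\sigma(i)}$; $M$ is tropically singular if $\operatorname{tper}(M)=-\infty$ or the maximum is attained by at least two permutations. A signed square matrix $M$ is tropically sign singular if $\operatorname{tper}(|M|)=-\infty$ or there are two maximizing permutations $\sigma,\pi$ of $\operatorname{tper}(|M|)$ such that $\operatorname{sgn}(\sigma)\cdot\prod_i\operatorname{sign}(m_{i\sigma(i)})$ and $\operatorname{sgn}(\pi)\cdot\prod_i\operatorname{sign}(m_{i\pi(i)})$ are opposite. A rectangular signed matrix $W$ is tropically generic (resp. tropically sign generic) if for every square submatrix $U$, either $\operatorname{tper}(|U|)=-\infty$ or $|U|$ is not tropically singular (resp. $U$ is not tropically sign singular). Polyhedra: $\mathcal P(A,b)=\{x\in\mathbb{T}^n: A^+\odot x\oplus b^+\ge A^-\odot x\oplus b^-\}$ (entrywise); for a row $A_i$, the s-hyperplane is $\mathcal H(A_i,b_i)=\{x: A_i^+\odot x\oplus b_i^+=A_i^-\odot x\oplus b_i^-\}$, and $\mathcal P_I(A,b)=\bigcap_{i\in I}\mathcal H(A_i,b_i)\cap\mathcal P(A,b)$. Each row of $(A\ b)$ has an entry different from $-\infty$. Standard program: the tropical linear program is standard if (1) $W=(A\ b)$ is tropically generic; (2) every point of the cone $\{x\in\mathbb{T}^{n+1}: W^+\odot x\ge W^-\odot x\}$ other than $(-\infty,\dots,-\infty)$ has all coordinates finite; (3) the matrix $(A^{T}\ c^{T})$ (with $c$ viewed as a vector of positive signed numbers) is tropically sign generic. Tropical basic points and edges: for $I\subset[m]$ with $|I|=n$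 and $\operatorname{tper}(|A_I|)>-\infty$ ($A_I$ the rows of $A$ indexed by $I$), if $\mathcal P_I(A,b)\neq\emptyset$ then it consists of a single point $x^I$, the tropical basic point for $I$. For $K\subset[m]$ with $|K|=n-1$, the set $\mathcal P_K(A,b)$ (when nonempty) is the tropical edge $\mathcal E_K$; if $K=I\setminus\{k\}$ for a basic set $I$, it contains $x^I$ and one other tropical basic point $x^{I'}$ with $I'=K\cup\{i\}$, $i\notin I$. Tropical reduced costs for a basic set $I$: the unique $y\in\mathbb{T}_{\pm}^m$ such that $y_i=-\infty$ for $i\notin I$ and, for each $j\in[n]$, among the signed numbers $a_{ij}\odot y_i$ ($i\in[m]$) together with $\ominus c_j$, the maximal modulus is $-\infty$ or is attained by at least one positive and at least one negative element. Tropical simplex algorithm (Phase II): input a tropical basic point $x^I$ and $I$; compute the tropical reduced costs $y$ for $I$; while some $y_k$ ($k\in I$) is tropically negative: choose such a $k$ (the choice rule is a tropical pivoting rule), set $K=I\setminus\{k\}$, move along the tropical edge $\mathcal E_K$ to its other tropical basic point $x^{I'}$, $I'=K\cup\{i\}$, set $I\leftarrow I'$ and recompute reduced costs; return $x^I$. Puiseux lifts: $\mathbb K$ is the field of real generalized Puiseux series $\mathbf x=\sum_{\alpha\in\mathbb{R}}x_\alpha t^\alpha$ whose support is finite or the set of terms of an increasing unbounded sequence; $\operatorname{val}(\mathbf x)=-\min\{\alpha: x_\alpha\neq0\}$, $\operatorname{val}(0)=-\infty$; $\mathbf x>0$ iff the coefficient of the smallest exponent is positive; $\operatorname{sval}(\mathbf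 x)=\operatorname{val}(\mathbf x)$ if $\mathbf x\ge0$ and $\ominus\operatorname{val}(\mathbf x)$ otherwise (entrywise on matrices). A lift of the program is the Puiseux linear program minimize $\mathbf c\mathbf x$ subject to $\mathbf A\mathbf x+\mathbf b\ge0$ with $\operatorname{sval}(\mathbf A,\mathbf b,\mathbf c)=(A,b,c)$. The classical simplex algorithm on it moves between basic points $\mathbf x^I$ (for $|I|=n$, $\mathbf A_I$ nonsingular, $\mathbf x^I$ the solution of $\mathbf A_I\mathbf x+\mathbf b_I=0$, assumed feasible), selecting $k\in I$ with negative reduced cost $\mathbf y_k$ (where $\mathbf A_I^T\mathbf y=\mathbf c^T$) and moving along the edge $\{\mathbf x:\mathbf A_i\mathbf x+\mathbf b_i=0\ \forall i\in I\setminus\{k\},\ \mathbf A\mathbf x+\mathbf b\ge0\}$ to its other basic point. A classical pivoting rule is compatible with a tropical one if they select the same index $k$. *)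

theory Defs
  imports
    "Jordan_Normal_Form.Determinant"
    "Jordan_Normal_Form.DL_Submatrix"
    "HOL-Library.While_Combinator"
    Complex_Main
begin

section \<open>Tropical numbers\<close>

text \<open>Addition on \<open>trop\<close> is the maximum and multiplication is the usual addition; \<open>0\<close> is minus
  infinity and \<open>1\<close> is the real number 0.  Matrix-vector products and scalar products of the matrix
  library over this semiring are therefore the tropical ones.\<close>

datatype trop = NegInf | Fin real

instantiation trop :: linorder
begin

fun less_eq_trop :: "trop \<Rightarrow> trop \<Rightarrow> bool" where
  "NegInf \<le> y \<longleftrightarrow> True"
| "Fin a \<le> NegInf \<longleftrightarrow> False"
| "Fin a \<le> Fin b \<longleftrightarrow> a \<le> b"

definition less_trop :: "trop \<Rightarrow> trop \<Rightarrow> bool" where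
  "x < y \<longleftrightarrow> x \<le> y \<and> \<not> y \<le> x" for x y :: trop

instance
proof
  fix x y z :: trop
  show "(x < y) = (x \<le> y \<and> \<not> y \<le> x)" by (rule less_trop_def)
  show "x \<le> x" by (cases x) auto
  show "x \<le> y \<Longrightarrow> y \<le> z \<Longrightarrow> x \<le> z" by (cases x; cases y; cases z) auto
  show "x \<le> y \<Longrightarrow> y \<le> x \<Longrightarrow> x = y" by (cases x; cases y) auto
  show "x \<le> y \<or> y \<le> x" by (cases x; cases y) auto
qed

end

instantiation trop :: comm_semiring_1
begin

definition zero_trop :: trop where "0 = NegInf"
definition one_trop :: trop where "1 = Fin 0"
definition plus_trop :: "trop \<Rightarrow> trop \<Rightarrow> trop" where "x + y = max x y" for x y :: trop

fun times_trop :: "trop \<Rightarrow> trop \<Rightarrow> trop" where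
  "NegInf * y = NegInf"
| "Fin a * NegInf = NegInf"
| "Fin a * Fin b = Fin (a + b)"

instance
proof
  fix x y z :: trop
  show "x + y + z = x + (y + z)" by (simp add: plus_trop_def max.assoc)
  show "x + y = y + x" by (simp add: plus_trop_def max.commute)
  show "0 + x = x" by (simp add: plus_trop_def zero_trop_def max_def)
  show "x * y * z = x * (y * z)" by (cases x; cases y; cases z) auto
  show "x * y = y * x" by (cases x; cases y) auto
  show "1 * x = x" by (cases x) (auto simp: one_trop_def)
  show "0 * x = 0" by (simp add: zero_trop_def)
  show "x * 0 = 0" by (cases x) (auto simp: zero_trop_def)
  show "(x + y) * z = x * z + y * z"
    by (cases x; cases y; cases z) (auto simp: plus_trop_def max_def)
  show "(0 :: trop) \<noteq> 1" by (simp add: zero_trop_def one_trop_def)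
qed

end

text \<open>Signed tropical numbers; the single constructor \<open>SNegInf\<close> builds in the identification of
  minus infinity with its opposite.\<close>

datatype strop = SNegInf | Pos real | Neg real

fun modulus :: "strop \<Rightarrow> trop" where
  "modulus SNegInf = NegInf"
| "modulus (Pos a) = Fin a"
| "modulus (Neg a) = Fin a"

fun strop_sgn :: "strop \<Rightarrow> int" where
  "strop_sgn SNegInf = 0"
| "strop_sgn (Pos a) = 1"
| "strop_sgn (Neg a) = - 1"

definition tpositive :: "strop \<Rightarrow> bool" where
  "tpositive x \<longleftrightarrow> (\<exists>a. x = Pos a)"

definition tnegative :: "strop \<Rightarrow> bool" where
  "tnegative x \<longleftrightarrow> (\<exists>a. x = Neg a)"

definition pos_part :: "strop \<Rightarrow> trop" where
  "pos_part x = (if tpositive x then modulus x else NegInf)"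

definition neg_part :: "strop \<Rightarrow> trop" where
  "neg_part x = (if tnegative x then modulus x else NegInf)"

fun of_trop :: "trop \<Rightarrow> strop" where
  "of_trop NegInf = SNegInf"
| "of_trop (Fin a) = Pos a"

fun sneg :: "strop \<Rightarrow> strop" where
  "sneg SNegInf = SNegInf"
| "sneg (Pos a) = Neg a"
| "sneg (Neg a) = Pos a"

fun stimes :: "strop \<Rightarrow> strop \<Rightarrow> strop" where
  "stimes SNegInf y = SNegInf"
| "stimes x SNegInf = SNegInf"
| "stimes (Pos a) (Pos b) = Pos (a + b)"
| "stimes (Pos a) (Neg b) = Neg (a + b)"
| "stimes (Neg a) (Pos b) = Neg (a + b)"
| "stimes (Neg a) (Neg b) = Pos (a + b)"

section \<open>Tropical permanents and genericity\<close>

definition tper :: "trop mat \<Rightarrow> trop" where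
  "tper M = (\<Sum>\<sigma> | \<sigma> permutes {0..<dim_row M}. \<Prod>i = 0..<dim_row M. M $$ (i, \<sigma> i))"

definition maximizing_perm :: "trop mat \<Rightarrow> (nat \<Rightarrow> nat) \<Rightarrow> bool" where
  "maximizing_perm M \<sigma> \<longleftrightarrow>
     \<sigma> permutes {0..<dim_row M} \<and> (\<Prod>i = 0..<dim_row M. M $$ (i, \<sigma> i)) = tper M"

definition trop_singular :: "trop mat \<Rightarrow> bool" where
  "trop_singular M \<longleftrightarrow> tper M = NegInf \<or>
     (\<exists>\<sigma> \<pi>. \<sigma> \<noteq> \<pi> \<and> maximizing_perm M \<sigma> \<and> maximizing_perm M \<pi>)"

definition perm_term_sgn :: "strop mat \<Rightarrow> (nat \<Rightarrow> nat) \<Rightarrow> int" where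
  "perm_term_sgn M \<sigma> = sign \<sigma> * (\<Prod>i = 0..<dim_row M. strop_sgn (M $$ (i, \<sigma> i)))"

definition trop_sign_singular :: "strop mat \<Rightarrow> bool" where
  "trop_sign_singular M \<longleftrightarrow> tper (map_mat modulus M) = NegInf \<or>
     (\<exists>\<sigma> \<pi>. maximizing_perm (map_mat modulus M) \<sigma> \<and> maximizing_perm (map_mat modulus M) \<pi> \<and>
        perm_term_sgn M \<sigma> = - perm_term_sgn M \<pi>)"

definition square_submatrices :: "'a mat \<Rightarrow> 'a mat set" where
  "square_submatrices W =
     {submatrix W R S | R S. R \<subseteq> {..<dim_row W} \<and> S \<subseteq> {..<dim_col W} \<and> card R = card S}"

definition trop_generic :: "strop mat \<Rightarrow> bool" where
  "trop_generic W \<longleftrightarrow> (\<forall>U \<in> square_submatrices W.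
     tper (map_mat modulus U) = NegInf \<or> \<not> trop_singular (map_mat modulus U))"

definition trop_sign_generic :: "strop mat \<Rightarrow> bool" where
  "trop_sign_generic W \<longleftrightarrow> (\<forall>U \<in> square_submatrices W.
     tper (map_mat modulus U) = NegInf \<or> \<not> trop_sign_singular U)"

section \<open>Tropical linear programs\<close>

definition append_col :: "'a mat \<Rightarrow> 'a vec \<Rightarrow> 'a mat" where
  "append_col A b = mat (dim_row A) (Suc (dim_col A))
     (\<lambda>(i, j). if j < dim_col A then A $$ (i, j) else b $ i)"

definition trop_lp :: "nat \<Rightarrow> nat \<Rightarrow> strop mat \<Rightarrow> strop vec \<Rightarrow> trop vec \<Rightarrow> bool" where
  "trop_lp n m A b c \<longleftrightarrow> 0 < n \<and> A \<in> carrier_mat m n \<and> b \<in> carrier_vec m \<and> c \<in> carrier_vec n \<and>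
     (\<forall>i<m. \<exists>j\<le>n. append_col A b $$ (i, j) \<noteq> SNegInf)"

definition trop_polyhedron :: "strop mat \<Rightarrow> strop vec \<Rightarrow> trop vec set" where
  "trop_polyhedron A b = {x \<in> carrier_vec (dim_col A).
     map_mat neg_part A *\<^sub>v x + map_vec neg_part b \<le> map_mat pos_part A *\<^sub>v x + map_vec pos_part b}"

definition s_hyperplane :: "strop vec \<Rightarrow> strop \<Rightarrow> trop vec set" where
  "s_hyperplane a \<beta> = {x \<in> carrier_vec (dim_vec a).
     map_vec pos_part a \<bullet> x + pos_part \<beta> = map_vec neg_part a \<bullet> x + neg_part \<beta>}"

definition trop_face :: "strop mat \<Rightarrow> strop vec \<Rightarrow> nat set \<Rightarrow> trop vec set" where
  "trop_face A b I = {x \<in> trop_polyhedron A b. \<forall>i\<in>I. x \<in> s_hyperplane (row A i) (b $ i)}"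

definition trop_cone :: "strop mat \<Rightarrow> trop vec set" where
  "trop_cone W = {x \<in> carrier_vec (dim_col W). map_mat neg_part W *\<^sub>v x \<le> map_mat pos_part W *\<^sub>v x}"

definition standard_lp :: "strop mat \<Rightarrow> strop vec \<Rightarrow> trop vec \<Rightarrow> bool" where
  "standard_lp A b c \<longleftrightarrow>
     trop_generic (append_col A b) \<and>
     (\<forall>x \<in> trop_cone (append_col A b).
        (\<forall>j<dim_vec x. x $ j = NegInf) \<or> (\<forall>j<dim_vec x. x $ j \<noteq> NegInf)) \<and>
     trop_sign_generic (append_col (transpose_mat A) (map_vec of_trop c))"

definition trop_optimal :: "strop mat \<Rightarrow> strop vec \<Rightarrow> trop vec \<Rightarrow> trop vec \<Rightarrow> bool" where
  "trop_optimal A b c x \<longleftrightarrow>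
     x \<in> trop_polyhedron A b \<and> (\<forall>z \<in> trop_polyhedron A b. c \<bullet> x \<le> c \<bullet> z)"

section \<open>The tropical simplex algorithm\<close>

definition trop_basic :: "strop mat \<Rightarrow> strop vec \<Rightarrow> nat set \<Rightarrow> bool" where
  "trop_basic A b I \<longleftrightarrow> I \<subseteq> {..<dim_row A} \<and> card I = dim_col A \<and>
     tper (map_mat modulus (submatrix A I UNIV)) \<noteq> NegInf \<and> trop_face A b I \<noteq> {}"

definition trop_basic_point :: "strop mat \<Rightarrow> strop vec \<Rightarrow> nat set \<Rightarrow> trop vec" where
  "trop_basic_point A b I = (THE x. x \<in> trop_face A b I)"

text \<open>The maximal modulus of \<open>S\<close> is minus infinity, or it is attained with both signs.\<close>

definition balanced :: "strop set \<Rightarrow> bool" where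
  "balanced S \<longleftrightarrow> Max (modulus ` S) = NegInf \<or>
     (\<exists>p\<in>S. tpositive p \<and> modulus p = Max (modulus ` S)) \<and>
     (\<exists>q\<in>S. tnegative q \<and> modulus q = Max (modulus ` S))"

definition is_trop_reduced_costs ::
  "strop mat \<Rightarrow> trop vec \<Rightarrow> nat set \<Rightarrow> strop vec \<Rightarrow> bool" where
  "is_trop_reduced_costs A c I y \<longleftrightarrow> y \<in> carrier_vec (dim_row A) \<and>
     (\<forall>i<dim_row A. i \<notin> I \<longrightarrow> y $ i = SNegInf) \<and>
     (\<forall>j<dim_col A. balanced
        (insert (sneg (of_trop (c $ j))) ((\<lambda>i. stimes (A $$ (i, j)) (y $ i)) ` {..<dim_row A})))"

definition trop_reduced_costs :: "strop mat \<Rightarrow> trop vec \<Rightarrow> nat set \<Rightarrow> strop vec" where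
  "trop_reduced_costs A c I = (THE y. is_trop_reduced_costs A c I y)"

definition trop_improvable :: "strop mat \<Rightarrow> trop vec \<Rightarrow> nat set \<Rightarrow> bool" where
  "trop_improvable A c I \<longleftrightarrow> (\<exists>k\<in>I. tnegative (trop_reduced_costs A c I $ k))"

text \<open>The tropical edge for \<open>K = I - {k}\<close> is \<open>trop_face A b K\<close>; \<open>I'\<close> is the basic set of its other
  basic point.\<close>

definition is_trop_pivot ::
  "strop mat \<Rightarrow> strop vec \<Rightarrow> nat set \<Rightarrow> nat \<Rightarrow> nat set \<Rightarrow> bool" where
  "is_trop_pivot A b I k I' \<longleftrightarrow> (\<exists>i. i \<notin> I \<and> I' = insert i (I - {k})) \<and> trop_basic A b I' \<and>
     trop_basic_point A b I' \<in> trop_face A b (I - {k}) \<and>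
     trop_basic_point A b I' \<noteq> trop_basic_point A b I"

definition trop_pivot :: "strop mat \<Rightarrow> strop vec \<Rightarrow> nat set \<Rightarrow> nat \<Rightarrow> nat set" where
  "trop_pivot A b I k = (THE I'. is_trop_pivot A b I k I')"

text \<open>A pivoting rule may use the whole history of the run.  Since the basic points and the reduced
  costs are determined by the program and the basic sets, the history is recorded as the nonempty
  list of the basic sets visited so far, the current one last.\<close>

type_synonym pivoting_rule = "nat set list \<Rightarrow> nat"

definition trop_pivoting_rule ::
  "strop mat \<Rightarrow> strop vec \<Rightarrow> trop vec \<Rightarrow> pivoting_rule \<Rightarrow> bool" where
  "trop_pivoting_rule A b c \<phi> \<longleftrightarrow>
     (\<forall>h. h \<noteq> [] \<and> (\<forall>I\<in>set h. trop_basic A b I) \<and> trop_improvable A c (last h) \<longrightarrow>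
        \<phi> h \<in> last h \<and> tnegative (trop_reduced_costs A c (last h) $ \<phi> h))"

text \<open>The result is \<open>Some h\<close> iff the loop terminates, and then \<open>h\<close> is the full list of visited basic
  sets; the point returned is the basic point of \<open>last h\<close>.\<close>

definition trop_simplex ::
  "strop mat \<Rightarrow> strop vec \<Rightarrow> trop vec \<Rightarrow> pivoting_rule \<Rightarrow> nat set \<Rightarrow> nat set list option" where
  "trop_simplex A b c \<phi> I =
     while_option (\<lambda>h. trop_improvable A c (last h)) (\<lambda>h. h @ [trop_pivot A b (last h) (\<phi> h)]) [I]"

section \<open>The ordered field of real generalized Puiseux series\<close>

definition puiseux_support :: "real set \<Rightarrow> bool" where
  "puiseux_support S \<longleftrightarrow> finite S \<or>
     (\<exists>s :: nat \<Rightarrow> real. strict_mono s \<and> filterlim s at_top sequentially \<and> S = range s)"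

definition left_finite :: "real set \<Rightarrow> bool" where
  "left_finite S \<longleftrightarrow> (\<forall>r. finite {a \<in> S. a \<le> r})"

lemma left_finite_imp_sequence:
  assumes lf: "left_finite S" and inf: "infinite S"
  shows "\<exists>s :: nat \<Rightarrow> real. strict_mono s \<and> filterlim s at_top sequentially \<and> S = range s"
proof -
  define c where "c x = card {a \<in> S. a < x}" for x
  have fin: "finite {a \<in> S. a < x}" for x
    by (rule finite_subset[of _ "{a \<in> S. a \<le> x}"]) (use lf in \<open>auto simp: left_finite_def\<close>)
  have c_less: "c x < c y" if "x \<in> S" "x < y" for x y
    unfolding c_def by (rule psubset_card_mono[OF fin]) (use that in auto)
  have inj: "inj_on c S"
    by (rule inj_onI) (metis c_less less_irrefl linorder_neqE_linordered_idom)
  have down: "k \<in> c ` S" if "x \<in> S" "k < c x" for x k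
  proof -
    let ?L = "{a \<in> S. a < x}"
    have "c ` ?L \<subseteq> {..<c x}" using c_less by auto
    moreover have "card (c ` ?L) = card {..<c x}"
      by (subst card_image) (auto intro: inj_on_subset[OF inj] simp: c_def)
    ultimately have "c ` ?L = {..<c x}" by (intro card_subset_eq) auto
    then show ?thesis using that by (metis (no_types, lifting) imageE imageI lessThan_iff mem_Collect_eq)
  qed
  have "infinite (c ` S)" using inf inj by (simp add: finite_image_iff)
  then have "k \<in> c ` S" for k
    using down by (metis finite_nat_set_iff_bounded imageE linorder_neqE_nat)
  then have bij: "bij_betw c S UNIV" using inj by (auto simp: bij_betw_def)
  define s where "s = inv_into S c"
  have s: "s k \<in> S" "c (s k) = k" for k
    using bij unfolding s_def by (auto simp: bij_betw_def inv_into_into f_inv_into_f)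
  have mono: "strict_mono s"
    by (rule strict_monoI) (metis c_less s linorder_neqE_linordered_idom not_less_iff_gr_or_eq)
  have range: "S = range s"
    using s bij unfolding s_def by (metis bij_betw_def bij_betw_inv_into)
  have "filterlim s at_top sequentially"
    unfolding filterlim_at_top
  proof
    fix Z
    have "finite {k. s k \<le> Z}"
    proof (rule finite_imageD[of s])
      show "finite (s ` {k. s k \<le> Z})"
        by (rule finite_subset[of _ "{a \<in> S. a \<le> Z}"]) (use lf s in \<open>auto simp: left_finite_def\<close>)
      show "inj_on s {k. s k \<le> Z}" using mono by (meson inj_on_subset strict_mono_imp_inj_on subset_UNIV)
    qed
    then have "eventually (\<lambda>k. k \<notin> {k. s k \<le> Z}) sequentially"
      by (simp add: eventually_cofinite flip: cofinite_eq_sequentially)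
    then show "\<forall>\<^sub>F k in sequentially. Z \<le> s k" by (rule eventually_mono) auto
  qed
  with mono range show ?thesis by blast
qed

lemma puiseux_support_iff: "puiseux_support S \<longleftrightarrow> left_finite S"
proof
  assume "left_finite S"
  then show "puiseux_support S" using left_finite_imp_sequence unfolding puiseux_support_def by blast
next
  assume *: "puiseux_support S"
  show "left_finite S"
  proof (cases "finite S")
    case True then show ?thesis by (simp add: left_finite_def)
  next
    case False
    then obtain s :: "nat \<Rightarrow> real" where s: "filterlim s at_top sequentially" "S = range s"
      using * by (auto simp: puiseux_support_def)
    show ?thesis unfolding left_finite_def
    proof
      fix r
      have "eventually (\<lambda>k. r + 1 \<le> s k) sequentially" using s(1) by (simp add: filterlim_at_top)
      then obtain N where N: "\<And>k. k \<ge> N \<Longrightarrow> r + 1 \<le> s k" by (auto simp: eventually_sequentially)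
      have "{a \<in> S. a \<le> r} \<subseteq> s ` {..<N}"
      proof
        fix a assume "a \<in> {a \<in> S. a \<le> r}"
        then obtain k where k: "a = s k" "s k \<le> r" using s(2) by auto
        then have "k < N" using N[of k] by (cases "k < N") auto
        then show "a \<in> s ` {..<N}" using k by auto
      qed
      then show "finite {a \<in> S. a \<le> r}" by (rule finite_subset) simp
    qed
  qed
qed

typedef puiseux = "{f :: real \<Rightarrow> real. puiseux_support {a. f a \<noteq> 0}}"
  morphisms pcoeff Abs_puiseux
  by (rule exI[of _ "\<lambda>_. 0"]) (simp add: puiseux_support_def)

lemma puiseux_eqI: "(\<And>a. pcoeff x a = pcoeff y a) \<Longrightarrow> x = y"
  by (simp add: pcoeff_inject[symmetric] fun_eq_iff)

lemma left_finite_coeff: "finite {a. pcoeff x a \<noteq> 0 \<and> a \<le> r}"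
  using pcoeff[of x] by (simp add: puiseux_support_iff left_finite_def)

lemma pcoeff_Abs: "(\<And>r. finite {a. f a \<noteq> 0 \<and> a \<le> r}) \<Longrightarrow> pcoeff (Abs_puiseux f) = f"
  by (rule Abs_puiseux_inverse) (simp add: puiseux_support_iff left_finite_def)

lemma pcoeff_lower_bound: obtains l where "\<And>a. pcoeff x a \<noteq> 0 \<Longrightarrow> l \<le> a"
proof (cases "\<exists>b. pcoeff x b \<noteq> 0")
  case True
  then obtain b where b: "pcoeff x b \<noteq> 0" by blast
  have "Min {a. pcoeff x a \<noteq> 0 \<and> a \<le> b} \<le> a" if "pcoeff x a \<noteq> 0" for a
  proof (cases "a \<le> b")
    case True then show ?thesis using that left_finite_coeff by (intro Min_le) auto
  next
    case False
    have "Min {a. pcoeff x a \<noteq> 0 \<and> a \<le> b} \<le> b" using b left_finite_coeff by (intro Min_le) auto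
    with False show ?thesis by simp
  qed
  then show ?thesis by (rule that)
qed (use that in auto)

lemma finite_mult_support: "finite {a. pcoeff x a \<noteq> 0 \<and> pcoeff y (r - a) \<noteq> 0}"
proof -
  obtain l where "\<And>a. pcoeff y a \<noteq> 0 \<Longrightarrow> l \<le> a" by (rule pcoeff_lower_bound[of y]) blast
  then have "{a. pcoeff x a \<noteq> 0 \<and> pcoeff y (r - a) \<noteq> 0} \<subseteq> {a. pcoeff x a \<noteq> 0 \<and> a \<le> r - l}"
    by fastforce
  then show ?thesis using left_finite_coeff by (rule finite_subset)
qed

instantiation puiseux :: "{zero, one, plus, minus, uminus, times}"
begin

definition zero_puiseux :: puiseux where "0 = Abs_puiseux (\<lambda>_. 0)"
definition one_puiseux :: puiseux where "1 = Abs_puiseux (\<lambda>a. if a = 0 then 1 else 0)"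
definition plus_puiseux :: "puiseux \<Rightarrow> puiseux \<Rightarrow> puiseux" where
  "x + y = Abs_puiseux (\<lambda>a. pcoeff x a + pcoeff y a)"
definition uminus_puiseux :: "puiseux \<Rightarrow> puiseux" where
  "- x = Abs_puiseux (\<lambda>a. - pcoeff x a)"
definition minus_puiseux :: "puiseux \<Rightarrow> puiseux \<Rightarrow> puiseux" where
  "x - y = Abs_puiseux (\<lambda>a. pcoeff x a - pcoeff y a)"
definition times_puiseux :: "puiseux \<Rightarrow> puiseux \<Rightarrow> puiseux" where
  "x * y = Abs_puiseux (\<lambda>r. \<Sum>a | pcoeff x a \<noteq> 0 \<and> pcoeff y (r - a) \<noteq> 0. pcoeff x a * pcoeff y (r - a))"

instance ..

end

lemma pcoeff_0 [simp]: "pcoeff 0 a = 0"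
  by (simp add: zero_puiseux_def pcoeff_Abs)

lemma pcoeff_1: "pcoeff 1 a = (if a = 0 then 1 else 0)"
proof -
  have "finite {a::real. (if a = 0 then 1 else 0::real) \<noteq> 0 \<and> a \<le> r}" for r
    by (rule finite_subset[of _ "{0}"]) auto
  then show ?thesis by (simp add: one_puiseux_def pcoeff_Abs)
qed

lemma pcoeff_uminus [simp]: "pcoeff (- x) a = - pcoeff x a"
  by (simp add: uminus_puiseux_def pcoeff_Abs left_finite_coeff)

lemma pcoeff_add [simp]: "pcoeff (x + y) a = pcoeff x a + pcoeff y a"
proof -
  have "finite {a. pcoeff x a + pcoeff y a \<noteq> 0 \<and> a \<le> r}" for r
    by (rule finite_subset[OF _ finite_UnI[OF left_finite_coeff[of x r] left_finite_coeff[of y r]]]) auto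
  then show ?thesis by (simp add: plus_puiseux_def pcoeff_Abs)
qed

lemma pcoeff_minus [simp]: "pcoeff (x - y) a = pcoeff x a - pcoeff y a"
proof -
  have "finite {a. pcoeff x a - pcoeff y a \<noteq> 0 \<and> a \<le> r}" for r
    by (rule finite_subset[OF _ finite_UnI[OF left_finite_coeff[of x r] left_finite_coeff[of y r]]]) auto
  then show ?thesis by (simp add: minus_puiseux_def pcoeff_Abs)
qed

lemma pcoeff_mult:
  "pcoeff (x * y) r = (\<Sum>a | pcoeff x a \<noteq> 0 \<and> pcoeff y (r - a) \<noteq> 0. pcoeff x a * pcoeff y (r - a))"
proof -
  let ?f = "\<lambda>r. \<Sum>a | pcoeff x a \<noteq> 0 \<and> pcoeff y (r - a) \<noteq> 0. pcoeff x a * pcoeff y (r - a)"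
  obtain k where k: "\<And>a. pcoeff x a \<noteq> 0 \<Longrightarrow> k \<le> a" by (rule pcoeff_lower_bound[of x]) blast
  obtain l where l: "\<And>a. pcoeff y a \<noteq> 0 \<Longrightarrow> l \<le> a" by (rule pcoeff_lower_bound[of y]) blast
  have "finite {r. ?f r \<noteq> 0 \<and> r \<le> s}" for s
  proof (rule finite_subset)
    show "{r. ?f r \<noteq> 0 \<and> r \<le> s} \<subseteq>
      (\<lambda>(a, b). a + b) ` ({a. pcoeff x a \<noteq> 0 \<and> a \<le> s - l} \<times> {b. pcoeff y b \<noteq> 0 \<and> b \<le> s - k})"
    proof
      fix r assume "r \<in> {r. ?f r \<noteq> 0 \<and> r \<le> s}"
      then have r: "?f r \<noteq> 0" "r \<le> s" by auto
      from r(1) obtain a where "a \<in> {a. pcoeff x a \<noteq> 0 \<and> pcoeff y (r - a) \<noteq> 0}"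
        by (rule sum.not_neutral_contains_not_neutral)
      then have a: "pcoeff x a \<noteq> 0" "pcoeff y (r - a) \<noteq> 0" by auto
      show "r \<in> (\<lambda>(a, b). a + b) ` ({a. pcoeff x a \<noteq> 0 \<and> a \<le> s - l} \<times> {b. pcoeff y b \<noteq> 0 \<and> b \<le> s - k})"
        by (rule image_eqI[of _ _ "(a, r - a)"]) (use a k[OF a(1)] l[OF a(2)] r in auto)
    qed
    show "finite ((\<lambda>(a, b). a + b) ` ({a. pcoeff x a \<noteq> 0 \<and> a \<le> s - l} \<times> {b. pcoeff y b \<noteq> 0 \<and> b \<le> s - k}))"
      by (intro finite_imageI finite_cartesian_product left_finite_coeff)
  qed
  from pcoeff_Abs[of ?f, OF this] show ?thesis by (simp add: times_puiseux_def)
qed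

lemma pcoeff_mult_superset:
  assumes "finite F" "{a. pcoeff x a \<noteq> 0 \<and> pcoeff y (r - a) \<noteq> 0} \<subseteq> F"
  shows "pcoeff (x * y) r = (\<Sum>a\<in>F. pcoeff x a * pcoeff y (r - a))"
  unfolding pcoeff_mult by (rule sum.mono_neutral_left[OF assms]) auto

lemma pcoeff_mult_nonzeroD:
  assumes "pcoeff (x * y) r \<noteq> 0"
  obtains a b where "pcoeff x a \<noteq> 0" "pcoeff y b \<noteq> 0" "r = a + b"
proof -
  from assms obtain a where "a \<in> {a. pcoeff x a \<noteq> 0 \<and> pcoeff y (r - a) \<noteq> 0}"
    unfolding pcoeff_mult by (rule sum.not_neutral_contains_not_neutral)
  then show ?thesis using that[of a "r - a"] by simp
qed

instance puiseux :: comm_ring_1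
proof
  fix x y z :: puiseux
  show "x + y + z = x + (y + z)" "x + y = y + x" "0 + x = x" "- x + x = 0" "x - y = x + - y"
    by (auto intro!: puiseux_eqI)
  show comm: "x * y = y * x" for x y :: puiseux
  proof (rule puiseux_eqI)
    fix r
    show "pcoeff (x * y) r = pcoeff (y * x) r" unfolding pcoeff_mult
      by (rule sum.reindex_bij_witness[of _ "\<lambda>a. r - a" "\<lambda>a. r - a"]) (auto simp: mult.commute)
  qed
  show "1 * x = x"
  proof (rule puiseux_eqI)
    fix r
    have "pcoeff (1 * x) r = (\<Sum>a\<in>{0}. pcoeff 1 a * pcoeff x (r - a))"
      by (rule pcoeff_mult_superset) (auto simp: pcoeff_1 split: if_splits)
    then show "pcoeff (1 * x) r = pcoeff x r" by (simp add: pcoeff_1)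
  qed
  show "(x + y) * z = x * z + y * z"
  proof (rule puiseux_eqI)
    fix r
    let ?F = "{a. pcoeff x a \<noteq> 0 \<and> pcoeff z (r - a) \<noteq> 0} \<union> {a. pcoeff y a \<noteq> 0 \<and> pcoeff z (r - a) \<noteq> 0}"
    have F: "finite ?F" using finite_mult_support by blast
    have "pcoeff ((x + y) * z) r = (\<Sum>a\<in>?F. pcoeff (x + y) a * pcoeff z (r - a))"
      by (rule pcoeff_mult_superset[OF F]) auto
    also have "\<dots> = (\<Sum>a\<in>?F. pcoeff x a * pcoeff z (r - a)) + (\<Sum>a\<in>?F. pcoeff y a * pcoeff z (r - a))"
      by (simp add: distrib_right sum.distrib)
    also have "(\<Sum>a\<in>?F. pcoeff x a * pcoeff z (r - a)) = pcoeff (x * z) r"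
      by (rule pcoeff_mult_superset[OF F, symmetric]) auto
    also have "(\<Sum>a\<in>?F. pcoeff y a * pcoeff z (r - a)) = pcoeff (y * z) r"
      by (rule pcoeff_mult_superset[OF F, symmetric]) auto
    finally show "pcoeff ((x + y) * z) r = pcoeff (x * z + y * z) r" by simp
  qed
  show "(0::puiseux) \<noteq> 1" by (metis pcoeff_0 pcoeff_1 zero_neq_one)
  show "x * y * z = x * (y * z)"
  proof (rule puiseux_eqI)
    fix r
    obtain j where j: "\<And>a. pcoeff x a \<noteq> 0 \<Longrightarrow> j \<le> a" by (rule pcoeff_lower_bound[of x]) blast
    obtain k where k: "\<And>a. pcoeff y a \<noteq> 0 \<Longrightarrow> k \<le> a" by (rule pcoeff_lower_bound[of y]) blast
    obtain l where l: "\<And>a. pcoeff z a \<noteq> 0 \<Longrightarrow> l \<le> a" by (rule pcoeff_lower_bound[of z]) blast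
    define F where "F = {a. pcoeff x a \<noteq> 0 \<and> a \<le> r - k - l}"
    define G where "G = {b. pcoeff y b \<noteq> 0 \<and> b \<le> r - j - l}"
    define H where "H = (\<lambda>(a, b). a + b) ` (F \<times> G)"
    have fin: "finite F" "finite G" "finite H"
      by (auto simp: F_def G_def H_def left_finite_coeff)
    have "pcoeff (x * y * z) r = (\<Sum>s\<in>H. pcoeff (x * y) s * pcoeff z (r - s))"
    proof (rule pcoeff_mult_superset[OF fin(3)], safe)
      fix s assume xy: "pcoeff (x * y) s \<noteq> 0" and z: "pcoeff z (r - s) \<noteq> 0"
      from xy obtain a b where ab: "pcoeff x a \<noteq> 0" "pcoeff y b \<noteq> 0" "s = a + b" by (rule pcoeff_mult_nonzeroD)
      then show "s \<in> H" unfolding H_def F_def G_def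
        using j[OF ab(1)] k[OF ab(2)] l[OF z] by (intro image_eqI[of _ _ "(a, b)"]) auto
    qed
    also have "\<dots> = (\<Sum>s\<in>H. \<Sum>a\<in>F. pcoeff x a * pcoeff y (s - a) * pcoeff z (r - s))"
    proof (rule sum.cong[OF refl])
      fix s
      show "pcoeff (x * y) s * pcoeff z (r - s) = (\<Sum>a\<in>F. pcoeff x a * pcoeff y (s - a) * pcoeff z (r - s))"
      proof (cases "pcoeff z (r - s) = 0")
        case False
        have "pcoeff (x * y) s = (\<Sum>a\<in>F. pcoeff x a * pcoeff y (s - a))"
          by (rule pcoeff_mult_superset[OF fin(1)]) (use k l[OF False] in \<open>fastforce simp: F_def\<close>)
        then show ?thesis by (simp add: sum_distrib_right)
      qed simp
    qed
    also have "\<dots> = (\<Sum>a\<in>F. pcoeff x a * (\<Sum>s\<in>H. pcoeff y (s - a) * pcoeff z (r - s)))"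
      by (subst sum.swap) (simp add: sum_distrib_left mult.assoc)
    also have "\<dots> = (\<Sum>a\<in>F. pcoeff x a * pcoeff (y * z) (r - a))"
    proof (rule sum.cong[OF refl])
      fix a assume a: "a \<in> F"
      have "pcoeff (y * z) (r - a) = (\<Sum>b\<in>(\<lambda>s. s - a) ` H. pcoeff y b * pcoeff z (r - a - b))"
      proof (rule pcoeff_mult_superset, safe)
        fix b assume b: "pcoeff y b \<noteq> 0" and z: "pcoeff z (r - a - b) \<noteq> 0"
        have "pcoeff x a \<noteq> 0" using a by (simp add: F_def)
        then have "b \<in> G" using b j[of a] l[OF z] by (simp add: G_def)
        then have "a + b \<in> H" using a unfolding H_def by (intro image_eqI[of _ _ "(a, b)"]) auto
        then show "b \<in> (\<lambda>s. s - a) ` H" by (rule rev_image_eqI) simp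
      qed (use fin in simp)
      also have "\<dots> = (\<Sum>s\<in>H. pcoeff y (s - a) * pcoeff z (r - s))"
        by (subst sum.reindex) (auto simp: inj_on_def algebra_simps)
      finally show "pcoeff x a * (\<Sum>s\<in>H. pcoeff y (s - a) * pcoeff z (r - s)) = pcoeff x a * pcoeff (y * z) (r - a)"
        by simp
    qed
    also have "\<dots> = pcoeff (x * (y * z)) r"
    proof (rule pcoeff_mult_superset[OF fin(1), symmetric], safe)
      fix a assume a: "pcoeff x a \<noteq> 0" "pcoeff (y * z) (r - a) \<noteq> 0"
      from a(2) obtain b c where bc: "pcoeff y b \<noteq> 0" "pcoeff z c \<noteq> 0" "r - a = b + c" by (rule pcoeff_mult_nonzeroD)
      show "a \<in> F" unfolding F_def using a bc(3) k[OF bc(1)] l[OF bc(2)] by auto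
    qed
    finally show "pcoeff (x * y * z) r = pcoeff (x * (y * z)) r" .
  qed
qed

definition lead_exp :: "puiseux \<Rightarrow> real" where
  "lead_exp x = (LEAST a. pcoeff x a \<noteq> 0)"

definition lead :: "puiseux \<Rightarrow> real" where
  "lead x = pcoeff x (lead_exp x)"

lemma lead_exp_props:
  assumes "x \<noteq> 0"
  shows "pcoeff x (lead_exp x) \<noteq> 0" "\<And>a. pcoeff x a \<noteq> 0 \<Longrightarrow> lead_exp x \<le> a"
proof -
  obtain b where b: "pcoeff x b \<noteq> 0" using assms by (metis pcoeff_0 puiseux_eqI)
  let ?S = "{a. pcoeff x a \<noteq> 0 \<and> a \<le> b}"
  have S: "finite ?S" "?S \<noteq> {}" using b left_finite_coeff by auto
  have 1: "pcoeff x (Min ?S) \<noteq> 0" using Min_in[OF S] by simp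
  have 2: "Min ?S \<le> a" if "pcoeff x a \<noteq> 0" for a
    using that Min_le[OF S(1), of a] Min_le[OF S(1), of b] b by (cases "a \<le> b") auto
  have "lead_exp x = Min ?S" unfolding lead_exp_def by (rule Least_equality) (use 1 2 in auto)
  with 1 2 show "pcoeff x (lead_exp x) \<noteq> 0" "\<And>a. pcoeff x a \<noteq> 0 \<Longrightarrow> lead_exp x \<le> a" by auto
qed

lemma lead_exp_eqI:
  assumes "pcoeff x a \<noteq> 0" "\<And>b. b < a \<Longrightarrow> pcoeff x b = 0"
  shows "lead_exp x = a"
  unfolding lead_exp_def by (rule Least_equality) (use assms in \<open>auto simp: not_less[symmetric]\<close>)

lemma pcoeff_below_lead: "b < lead_exp x \<Longrightarrow> pcoeff x b = 0"
  by (cases "x = 0") (use lead_exp_props(2) in fastforce)+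

lemma pcoeff_mult_lead:
  assumes "x \<noteq> 0" "y \<noteq> 0"
  shows "pcoeff (x * y) (lead_exp x + lead_exp y) = lead x * lead y"
    and "b < lead_exp x + lead_exp y \<Longrightarrow> pcoeff (x * y) b = 0"
proof -
  have "pcoeff (x * y) (lead_exp x + lead_exp y) =
      (\<Sum>a\<in>{lead_exp x}. pcoeff x a * pcoeff y (lead_exp x + lead_exp y - a))"
  proof (rule pcoeff_mult_superset, safe)
    fix a assume a: "pcoeff x a \<noteq> 0" "pcoeff y (lead_exp x + lead_exp y - a) \<noteq> 0"
    show "a = lead_exp x"
      using lead_exp_props(2)[OF assms(1) a(1)] lead_exp_props(2)[OF assms(2) a(2)] by simp
  qed
  then show "pcoeff (x * y) (lead_exp x + lead_exp y) = lead x * lead y" by (simp add: lead_def)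
  show "pcoeff (x * y) b = 0" if "b < lead_exp x + lead_exp y"
  proof (rule ccontr)
    assume "pcoeff (x * y) b \<noteq> 0"
    then obtain c d where "pcoeff x c \<noteq> 0" "pcoeff y d \<noteq> 0" "b = c + d" by (rule pcoeff_mult_nonzeroD)
    then show False using lead_exp_props(2)[OF assms(1)] lead_exp_props(2)[OF assms(2)] that by fastforce
  qed
qed

lemma lead_nonzero: "x \<noteq> 0 \<Longrightarrow> lead x \<noteq> 0"
  by (simp add: lead_def lead_exp_props)

lemma lead_exp_mult: "x \<noteq> 0 \<Longrightarrow> y \<noteq> 0 \<Longrightarrow> lead_exp (x * y) = lead_exp x + lead_exp y"
  by (rule lead_exp_eqI) (simp_all add: pcoeff_mult_lead lead_nonzero)

lemma lead_mult: "x \<noteq> 0 \<Longrightarrow> y \<noteq> 0 \<Longrightarrow> lead (x * y) = lead x * lead y"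
  using lead_exp_mult pcoeff_mult_lead(1) by (simp add: lead_def)

lemma lead_0 [simp]: "lead 0 = 0"
  by (simp add: lead_def)

lemma lead_uminus [simp]: "lead (- x) = - lead x"
  by (simp add: lead_def lead_exp_def)

lemma lead_add_pos:
  assumes "lead x > 0" "lead y > 0"
  shows "lead (x + y) > 0"
proof -
  let ?l = "min (lead_exp x) (lead_exp y)"
  have x: "pcoeff x ?l \<ge> 0" "lead_exp x \<le> lead_exp y \<Longrightarrow> pcoeff x ?l > 0"
    using assms(1) pcoeff_below_lead[of ?l x]
    by (cases "lead_exp x \<le> lead_exp y"; auto simp: lead_def min_def)+
  have y: "pcoeff y ?l \<ge> 0" "lead_exp y \<le> lead_exp x \<Longrightarrow> pcoeff y ?l > 0"
    using assms(2) pcoeff_below_lead[of ?l y]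
    by (cases "lead_exp y \<le> lead_exp x"; auto simp: lead_def min_def)+
  have pos: "pcoeff (x + y) ?l > 0"
    using x y by (cases "lead_exp x \<le> lead_exp y") auto
  have "lead_exp (x + y) = ?l"
    by (rule lead_exp_eqI) (use pos in \<open>auto simp: pcoeff_below_lead\<close>)
  then show ?thesis using pos by (simp add: lead_def)
qed

lemma lead_mult_pos: "lead x > 0 \<Longrightarrow> lead y > 0 \<Longrightarrow> lead (x * y) > 0"
  by (cases "x = 0"; cases "y = 0") (auto simp: lead_mult)

instance puiseux :: idom
proof
  fix x y :: puiseux
  assume "x \<noteq> 0" "y \<noteq> 0"
  then show "x * y \<noteq> 0" by (metis lead_0 lead_mult lead_nonzero mult_eq_0_iff)
qed

lemma geometric_inverse:
  fixes h :: puiseux and \<delta> :: real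
  assumes "\<delta> > 0" and h: "\<And>a. pcoeff h a \<noteq> 0 \<Longrightarrow> \<delta> \<le> a"
  shows "\<exists>g. (1 - h) * g = 1"
proof -
  have pow: "pcoeff (h ^ n) a \<noteq> 0 \<Longrightarrow> of_nat n * \<delta> \<le> a" for n a
  proof (induction n arbitrary: a)
    case 0 then show ?case by (simp add: pcoeff_1 split: if_splits)
  next
    case (Suc n)
    from Suc.prems have "pcoeff (h * h ^ n) a \<noteq> 0" by simp
    then obtain b c where "pcoeff h b \<noteq> 0" "pcoeff (h ^ n) c \<noteq> 0" "a = b + c" by (rule pcoeff_mult_nonzeroD)
    then show ?case using h[of b] Suc.IH[of c] by (simp add: algebra_simps)
  qed
  define S where "S N = (\<Sum>n<N. h ^ n)" for N
  have S_Suc: "pcoeff (S (Suc N)) a = pcoeff (S N) a + pcoeff (h ^ N) a" for N a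
    by (simp add: S_def)
  have stable: "pcoeff (S M) a = pcoeff (S N) a" if "N \<le> M" "a < of_nat N * \<delta>" for M N a
    using that
  proof (induction M rule: dec_induct)
    case (step M)
    have "a < of_nat M * \<delta>" using step assms(1)
      by (meson less_le_trans mult_right_mono of_nat_le_iff order_less_imp_le)
    then have "pcoeff (h ^ M) a = 0" using pow[of M a] by linarith
    with step show ?case by (simp add: S_Suc)
  qed simp
  have "\<exists>N::nat. a < of_nat N * \<delta>" for a
    using reals_Archimedean3[OF assms(1)] by blast
  then obtain N :: "real \<Rightarrow> nat" where N: "\<And>a. a < of_nat (N a) * \<delta>" by metis
  define f where "f a = pcoeff (S (N a)) a" for a
  have f: "f a = pcoeff (S M) a" if "a < of_nat M * \<delta>" for M a
    unfolding f_def using stable[of "N a" M a] stable[of M "N a" a] that N[of a] by (cases "N a \<le> M") auto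
  have fin: "finite {a. f a \<noteq> 0 \<and> a \<le> r}" for r
  proof (rule finite_subset[OF _ left_finite_coeff[of "S (N r)" r]], safe)
    fix a assume "f a \<noteq> 0" "a \<le> r" "pcoeff (S (N r)) a = 0"
    then show False using f[of a "N r"] N[of r] by simp
  qed
  define g where "g = Abs_puiseux f"
  have g: "pcoeff g a = f a" for a by (simp add: g_def pcoeff_Abs[OF fin])
  have tele: "(1 - h) * S M = 1 - h ^ M" for M
    by (simp add: S_def one_diff_power_eq)
  have "(1 - h) * g = 1"
  proof (rule puiseux_eqI)
    fix r
    let ?M = "N r"
    have nonneg: "pcoeff (1 - h) a \<noteq> 0 \<Longrightarrow> 0 \<le> a" for a
      using h[of a] assms(1) by (cases "a = 0") (auto simp: pcoeff_1)
    let ?F = "{a. pcoeff (1 - h) a \<noteq> 0 \<and> a \<le> r} \<union> {a. pcoeff (1 - h) a \<noteq> 0 \<and> pcoeff g (r - a) \<noteq> 0}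
      \<union> {a. pcoeff (1 - h) a \<noteq> 0 \<and> pcoeff (S ?M) (r - a) \<noteq> 0}"
    have F: "finite ?F" using left_finite_coeff finite_mult_support by blast
    have "pcoeff ((1 - h) * g) r = (\<Sum>a\<in>?F. pcoeff (1 - h) a * pcoeff g (r - a))"
      by (rule pcoeff_mult_superset[OF F]) blast
    also have "\<dots> = (\<Sum>a\<in>?F. pcoeff (1 - h) a * pcoeff (S ?M) (r - a))"
    proof (rule sum.cong[OF refl])
      fix a assume "a \<in> ?F"
      then have "0 \<le> a" using nonneg by blast
      then have "r - a < of_nat ?M * \<delta>" using N[of r] by linarith
      then show "pcoeff (1 - h) a * pcoeff g (r - a) = pcoeff (1 - h) a * pcoeff (S ?M) (r - a)"
        by (simp add: g f)
    qed
    also have "\<dots> = pcoeff ((1 - h) * S ?M) r"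
      by (rule pcoeff_mult_superset[OF F, symmetric]) blast
    also have "\<dots> = pcoeff 1 r"
      using pow[of ?M r] N[of r] by (fastforce simp: tele)
    finally show "pcoeff ((1 - h) * g) r = pcoeff 1 r" .
  qed
  then show ?thesis ..
qed

definition monomial :: "real \<Rightarrow> real \<Rightarrow> puiseux" where
  "monomial c a = Abs_puiseux (\<lambda>b. if b = a then c else 0)"

lemma pcoeff_monomial: "pcoeff (monomial c a) b = (if b = a then c else 0)"
proof -
  have "finite {b::real. (if b = a then c else 0::real) \<noteq> 0 \<and> b \<le> r}" for r
    by (rule finite_subset[of _ "{a}"]) auto
  then show ?thesis by (simp add: monomial_def pcoeff_Abs)
qed

lemma pcoeff_monomial_mult: "pcoeff (monomial c a * x) r = c * pcoeff x (r - a)"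
proof -
  have "pcoeff (monomial c a * x) r = (\<Sum>b\<in>{a}. pcoeff (monomial c a) b * pcoeff x (r - b))"
    by (rule pcoeff_mult_superset) (auto simp: pcoeff_monomial split: if_splits)
  then show ?thesis by (simp add: pcoeff_monomial)
qed

lemma inverse_exists:
  fixes x :: puiseux
  assumes "x \<noteq> 0"
  shows "\<exists>y. x * y = 1"
proof -
  define m where "m = monomial (1 / lead x) (- lead_exp x)"
  define h where "h = 1 - m * x"
  have mx: "pcoeff (m * x) r = pcoeff x (r + lead_exp x) / lead x" for r
    by (simp add: m_def pcoeff_monomial_mult)
  have h_pos: "0 < a" if "pcoeff h a \<noteq> 0" for a
  proof (rule ccontr)
    assume "\<not> 0 < a"
    then consider "a = 0" | "a < 0" by linarith
    then have "pcoeff h a = 0"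
      by cases (simp_all add: h_def mx pcoeff_1 pcoeff_below_lead lead_nonzero[OF assms] flip: lead_def)
    with that show False by simp
  qed
  obtain \<delta> where "\<delta> > 0" "\<And>a. pcoeff h a \<noteq> 0 \<Longrightarrow> \<delta> \<le> a"
  proof (cases "h = 0")
    case True then show ?thesis using that[of 1] by simp
  next
    case False then show ?thesis using that[of "lead_exp h"] lead_exp_props[OF False] h_pos by blast
  qed
  then obtain g where "(1 - h) * g = 1" using geometric_inverse by blast
  then have "x * (m * g) = 1" by (simp add: h_def mult_ac)
  then show ?thesis ..
qed

text \<open>The indeterminate is a positive infinitesimal: a series is positive iff the coefficient of
  its smallest exponent is.\<close>

instantiation puiseux :: linordered_field
begin

definition less_puiseux :: "puiseux \<Rightarrow> puiseux \<Rightarrow> bool" where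
  "x < y \<longleftrightarrow> lead (y - x) > 0"
definition less_eq_puiseux :: "puiseux \<Rightarrow> puiseux \<Rightarrow> bool" where
  "x \<le> y \<longleftrightarrow> x = y \<or> lead (y - x) > 0"
definition abs_puiseux :: "puiseux \<Rightarrow> puiseux" where
  "\<bar>x :: puiseux\<bar> = (if x < 0 then - x else x)"
definition sgn_puiseux :: "puiseux \<Rightarrow> puiseux" where
  "sgn (x :: puiseux) = (if x = 0 then 0 else if 0 < x then 1 else - 1)"
definition inverse_puiseux :: "puiseux \<Rightarrow> puiseux" where
  "inverse (x :: puiseux) = (if x = 0 then 0 else (THE y. x * y = 1))"
definition divide_puiseux :: "puiseux \<Rightarrow> puiseux \<Rightarrow> puiseux" where
  "x div y = x * inverse y" for x y :: puiseux

instance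
proof
  fix x y z :: puiseux
  have anti: "\<not> lead (y - x) > 0" if "lead (x - y) > 0" for x y
  proof -
    have "lead (y - x) = - lead (x - y)" using lead_uminus[of "x - y"] by simp
    with that show ?thesis by simp
  qed
  show "(x < y) = (x \<le> y \<and> \<not> y \<le> x)"
    using anti by (auto simp: less_puiseux_def less_eq_puiseux_def)
  show "x \<le> x" by (simp add: less_eq_puiseux_def)
  show "x \<le> y \<Longrightarrow> y \<le> x \<Longrightarrow> x = y"
    using anti by (auto simp: less_eq_puiseux_def)
  show "x \<le> y \<Longrightarrow> y \<le> z \<Longrightarrow> x \<le> z"
    using lead_add_pos[of "y - x" "z - y"] by (auto simp: less_eq_puiseux_def)
  show "x \<le> y \<or> y \<le> x"
  proof (cases "x = y")
    case False
    then have "lead (y - x) \<noteq> 0" by (simp add: lead_nonzero)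
    moreover have "lead (x - y) = - lead (y - x)" using lead_uminus[of "y - x"] by simp
    ultimately show ?thesis by (auto simp: less_eq_puiseux_def)
  qed (simp add: less_eq_puiseux_def)
  show "x \<le> y \<Longrightarrow> z + x \<le> z + y" by (simp add: less_eq_puiseux_def)
  show "x < y \<Longrightarrow> 0 < z \<Longrightarrow> z * x < z * y"
    using lead_mult_pos[of z "y - x"] by (simp add: less_puiseux_def right_diff_distrib)
  show "\<bar>x\<bar> = (if x < 0 then - x else x)" by (rule abs_puiseux_def)
  show "sgn x = (if x = 0 then 0 else if 0 < x then 1 else - 1)" by (rule sgn_puiseux_def)
  show "x \<noteq> 0 \<Longrightarrow> inverse x * x = 1"
  proof -
    assume x: "x \<noteq> 0"
    have "\<exists>!y. x * y = 1" using inverse_exists[OF x] x by (metis mult_cancel_left)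
    then have "x * (THE y. x * y = 1) = 1" by (rule theI')
    then show ?thesis using x by (simp add: inverse_puiseux_def mult.commute)
  qed
  show "x div y = x * inverse y" by (rule divide_puiseux_def)
  show "inverse (0::puiseux) = 0" by (simp add: inverse_puiseux_def)
qed

end

definition val :: "puiseux \<Rightarrow> trop" where
  "val x = (if x = 0 then NegInf else Fin (- lead_exp x))"

definition sval :: "puiseux \<Rightarrow> strop" where
  "sval x = (if 0 \<le> x then of_trop (val x) else sneg (of_trop (val x)))"

section \<open>The classical simplex algorithm on lifts\<close>

definition is_lift ::
  "puiseux mat \<Rightarrow> puiseux vec \<Rightarrow> puiseux vec \<Rightarrow> strop mat \<Rightarrow> strop vec \<Rightarrow> trop vec \<Rightarrow> bool" where
  "is_lift \<AA> \<bb> \<cc> A b c \<longleftrightarrow>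
     map_mat sval \<AA> = A \<and> map_vec sval \<bb> = b \<and> map_vec sval \<cc> = map_vec of_trop c"

definition puiseux_polyhedron :: "puiseux mat \<Rightarrow> puiseux vec \<Rightarrow> puiseux vec set" where
  "puiseux_polyhedron \<AA> \<bb> = {x \<in> carrier_vec (dim_col \<AA>). 0\<^sub>v (dim_row \<AA>) \<le> \<AA> *\<^sub>v x + \<bb>}"

definition puiseux_face :: "puiseux mat \<Rightarrow> puiseux vec \<Rightarrow> nat set \<Rightarrow> puiseux vec set" where
  "puiseux_face \<AA> \<bb> I = {x \<in> puiseux_polyhedron \<AA> \<bb>. \<forall>i\<in>I. row \<AA> i \<bullet> x + \<bb> $ i = 0}"

definition puiseux_basic_point :: "puiseux mat \<Rightarrow> puiseux vec \<Rightarrow> nat set \<Rightarrow> puiseux vec" where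
  "puiseux_basic_point \<AA> \<bb> I =
     (THE x. x \<in> carrier_vec (dim_col \<AA>) \<and> (\<forall>i\<in>I. row \<AA> i \<bullet> x + \<bb> $ i = 0))"

definition puiseux_basic :: "puiseux mat \<Rightarrow> puiseux vec \<Rightarrow> nat set \<Rightarrow> bool" where
  "puiseux_basic \<AA> \<bb> I \<longleftrightarrow> I \<subseteq> {..<dim_row \<AA>} \<and> card I = dim_col \<AA> \<and>
     det (submatrix \<AA> I UNIV) \<noteq> 0 \<and> puiseux_basic_point \<AA> \<bb> I \<in> puiseux_polyhedron \<AA> \<bb>"

text \<open>The reduced costs are indexed by \<open>I\<close>; as in the tropical case they are extended by zero to all
  rows, so that the defining system on the rows in \<open>I\<close> becomes one for the full transpose.\<close>

definition puiseux_reduced_costs :: "puiseux mat \<Rightarrow> puiseux vec \<Rightarrow> nat set \<Rightarrow> puiseux vec" where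
  "puiseux_reduced_costs \<AA> \<cc> I = (THE y. y \<in> carrier_vec (dim_row \<AA>) \<and>
     (\<forall>i<dim_row \<AA>. i \<notin> I \<longrightarrow> y $ i = 0) \<and> transpose_mat \<AA> *\<^sub>v y = \<cc>)"

definition puiseux_improvable :: "puiseux mat \<Rightarrow> puiseux vec \<Rightarrow> nat set \<Rightarrow> bool" where
  "puiseux_improvable \<AA> \<cc> I \<longleftrightarrow> (\<exists>k\<in>I. puiseux_reduced_costs \<AA> \<cc> I $ k < 0)"

definition is_puiseux_pivot ::
  "puiseux mat \<Rightarrow> puiseux vec \<Rightarrow> nat set \<Rightarrow> nat \<Rightarrow> nat set \<Rightarrow> bool" where
  "is_puiseux_pivot \<AA> \<bb> I k I' \<longleftrightarrow>
     (\<exists>i. i \<notin> I \<and> I' = insert i (I - {k})) \<and> puiseux_basic \<AA> \<bb> I' \<and>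
     puiseux_basic_point \<AA> \<bb> I' \<in> puiseux_face \<AA> \<bb> (I - {k}) \<and>
     puiseux_basic_point \<AA> \<bb> I' \<noteq> puiseux_basic_point \<AA> \<bb> I"

definition puiseux_pivot :: "puiseux mat \<Rightarrow> puiseux vec \<Rightarrow> nat set \<Rightarrow> nat \<Rightarrow> nat set" where
  "puiseux_pivot \<AA> \<bb> I k = (THE I'. is_puiseux_pivot \<AA> \<bb> I k I')"

definition puiseux_pivoting_rule ::
  "puiseux mat \<Rightarrow> puiseux vec \<Rightarrow> puiseux vec \<Rightarrow> pivoting_rule \<Rightarrow> bool" where
  "puiseux_pivoting_rule \<AA> \<bb> \<cc> \<Phi> \<longleftrightarrow>
     (\<forall>h. h \<noteq> [] \<and> (\<forall>I\<in>set h. puiseux_basic \<AA> \<bb> I) \<and> puiseux_improvable \<AA> \<cc> (last h) \<longrightarrow>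
        \<Phi> h \<in> last h \<and> puiseux_reduced_costs \<AA> \<cc> (last h) $ \<Phi> h < 0)"

definition puiseux_simplex ::
  "puiseux mat \<Rightarrow> puiseux vec \<Rightarrow> puiseux vec \<Rightarrow> pivoting_rule \<Rightarrow> nat set \<Rightarrow> nat set list option" where
  "puiseux_simplex \<AA> \<bb> \<cc> \<Phi> I =
     while_option (\<lambda>h. puiseux_improvable \<AA> \<cc> (last h)) (\<lambda>h. h @ [puiseux_pivot \<AA> \<bb> (last h) (\<Phi> h)]) [I]"

text \<open>Agreement is only required on histories for which both rules have to make a choice.\<close>

definition compatible_rules ::
  "strop mat \<Rightarrow> strop vec \<Rightarrow> trop vec \<Rightarrow> pivoting_rule \<Rightarrow>
   puiseux mat \<Rightarrow> puiseux vec \<Rightarrow> puiseux vec \<Rightarrow> pivoting_rule \<Rightarrow> bool" where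
  "compatible_rules A b c \<phi> \<AA> \<bb> \<cc> \<Phi> \<longleftrightarrow>
     (\<forall>h. h \<noteq> [] \<and> (\<forall>I\<in>set h. trop_basic A b I \<and> puiseux_basic \<AA> \<bb> I) \<and>
        trop_improvable A c (last h) \<and> puiseux_improvable \<AA> \<cc> (last h) \<longrightarrow> \<phi> h = \<Phi> h)"

section \<open>Cost model\<close>

text \<open>Running time is measured on a unit-cost random access machine over signed tropical numbers,
  given as a small imperative language.  Memory consists of natural-number registers, arrays of
  natural numbers (for indices) and arrays of signed tropical numbers.  Indices can only be added,
  subtracted and compared; signed tropical numbers can only be multiplied, inverted, negated, replaced
  by their modulus, tested for positivity and compared by modulus.  Every operator in an expression
  and every command costs one unit each time it is evaluated.  A program is a fixed term, so it does
  not depend on the dimensions or the data of the instance.\<close>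

record memory =
  ireg :: "string \<Rightarrow> nat"
  iarr :: "string \<Rightarrow> nat \<Rightarrow> nat"
  tarr :: "string \<Rightarrow> nat \<Rightarrow> strop"

datatype iexp = INum nat | IReg string | IArr string iexp | IPlus iexp iexp | IMinus iexp iexp

datatype texp = TNegInf | TOne | TArr string iexp | TTimes texp texp | TInv texp | TNeg texp | TAbs texp

datatype bexp = ILess iexp iexp | TLess texp texp | TPos texp | BNot bexp | BAnd bexp bexp

datatype com =
    Skip
  | SetReg string iexp
  | SetIArr string iexp iexp
  | SetTArr string iexp texp
  | Seq com com
  | Cond bexp com com
  | While bexp com

text \<open>The inverse for the signed product, with minus infinity sent to itself.\<close>

fun sinv :: "strop \<Rightarrow> strop" where
  "sinv SNegInf = SNegInf"
| "sinv (Pos a) = Pos (- a)"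
| "sinv (Neg a) = Neg (- a)"

primrec ival :: "iexp \<Rightarrow> memory \<Rightarrow> nat" where
  "ival (INum k) s = k"
| "ival (IReg r) s = ireg s r"
| "ival (IArr a e) s = iarr s a (ival e s)"
| "ival (IPlus e f) s = ival e s + ival f s"
| "ival (IMinus e f) s = ival e s - ival f s"

primrec icost :: "iexp \<Rightarrow> nat" where
  "icost (INum k) = 1"
| "icost (IReg r) = 1"
| "icost (IArr a e) = 1 + icost e"
| "icost (IPlus e f) = 1 + icost e + icost f"
| "icost (IMinus e f) = 1 + icost e + icost f"

primrec tval :: "texp \<Rightarrow> memory \<Rightarrow> strop" where
  "tval TNegInf s = SNegInf"
| "tval TOne s = Pos 0"
| "tval (TArr a e) s = tarr s a (ival e s)"
| "tval (TTimes e f) s = stimes (tval e s) (tval f s)"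
| "tval (TInv e) s = sinv (tval e s)"
| "tval (TNeg e) s = sneg (tval e s)"
| "tval (TAbs e) s = of_trop (modulus (tval e s))"

primrec tcost :: "texp \<Rightarrow> nat" where
  "tcost TNegInf = 1"
| "tcost TOne = 1"
| "tcost (TArr a e) = 1 + icost e"
| "tcost (TTimes e f) = 1 + tcost e + tcost f"
| "tcost (TInv e) = 1 + tcost e"
| "tcost (TNeg e) = 1 + tcost e"
| "tcost (TAbs e) = 1 + tcost e"

primrec bval :: "bexp \<Rightarrow> memory \<Rightarrow> bool" where
  "bval (ILess e f) s \<longleftrightarrow> ival e s < ival f s"
| "bval (TLess e f) s \<longleftrightarrow> modulus (tval e s) < modulus (tval f s)"
| "bval (TPos e) s \<longleftrightarrow> tpositive (tval e s)"
| "bval (BNot g) s \<longleftrightarrow> \<not> bval g s"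
| "bval (BAnd g h) s \<longleftrightarrow> bval g s \<and> bval h s"

primrec bcost :: "bexp \<Rightarrow> nat" where
  "bcost (ILess e f) = 1 + icost e + icost f"
| "bcost (TLess e f) = 1 + tcost e + tcost f"
| "bcost (TPos e) = 1 + tcost e"
| "bcost (BNot g) = 1 + bcost g"
| "bcost (BAnd g h) = 1 + bcost g + bcost h"

text \<open>\<open>exec p s t s'\<close>: started in memory \<open>s\<close>, program \<open>p\<close> halts after \<open>t\<close> units of time in memory \<open>s'\<close>.\<close>

inductive exec :: "com \<Rightarrow> memory \<Rightarrow> nat \<Rightarrow> memory \<Rightarrow> bool" where
  "exec Skip s 1 s"
| "exec (SetReg r e) s (1 + icost e) (s\<lparr>ireg := (ireg s)(r := ival e s)\<rparr>)"
| "exec (SetIArr a e f) s (1 + icost e + icost f)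
     (s\<lparr>iarr := (iarr s)(a := (iarr s a)(ival e s := ival f s))\<rparr>)"
| "exec (SetTArr a e f) s (1 + icost e + tcost f)
     (s\<lparr>tarr := (tarr s)(a := (tarr s a)(ival e s := tval f s))\<rparr>)"
| "exec p s t s' \<Longrightarrow> exec q s' u s'' \<Longrightarrow> exec (Seq p q) s (1 + t + u) s''"
| "bval g s \<Longrightarrow> exec p s t s' \<Longrightarrow> exec (Cond g p q) s (1 + bcost g + t) s'"
| "\<not> bval g s \<Longrightarrow> exec q s t s' \<Longrightarrow> exec (Cond g p q) s (1 + bcost g + t) s'"
| "\<not> bval g s \<Longrightarrow> exec (While g p) s (1 + bcost g) s"
| "bval g s \<Longrightarrow> exec p s t s' \<Longrightarrow> exec (While g p) s' u s'' \<Longrightarrow>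
     exec (While g p) s (1 + bcost g + t + u) s''"

text \<open>Memory layout of a program together with a basic set \<open>I\<close> and a point \<open>x\<close>: the matrix is stored
  row by row and \<open>I\<close> as an array listing its elements in any order.  All other memory is
  unconstrained.\<close>

definition stores_state ::
  "memory \<Rightarrow> nat \<Rightarrow> nat \<Rightarrow> strop mat \<Rightarrow> strop vec \<Rightarrow> trop vec \<Rightarrow> nat set \<Rightarrow> trop vec \<Rightarrow> bool" where
  "stores_state s n m A b c I x \<longleftrightarrow>
     ireg s ''n'' = n \<and> ireg s ''m'' = m \<and>
     (\<forall>i<m. \<forall>j<n. tarr s ''A'' (i * n + j) = A $$ (i, j)) \<and>
     (\<forall>i<m. tarr s ''b'' i = b $ i) \<and>
     (\<forall>j<n. tarr s ''c'' j = of_trop (c $ j)) \<and>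
     bij_betw (iarr s ''I'') {..<n} I \<and>
     (\<forall>j<n. tarr s ''x'' j = of_trop (x $ j))"

definition stores_costs :: "memory \<Rightarrow> nat \<Rightarrow> strop vec \<Rightarrow> bool" where
  "stores_costs s m y \<longleftrightarrow> (\<forall>i<m. tarr s ''y'' i = y $ i)"

end

theory Submission
  imports Defs
begin

text \<open>Scaling the columns of \<open>(A b)\<close> by a finite point \<open>u\<close> of the polyhedron and the rows by their
  maxima makes all moduli at most 1. The entries of modulus 1 form the tangent graph; by genericity
  this bipartite graph is acyclic on the tight rows, and it determines the signs and valuations of
  all quantities of a lift at \<open>u\<close>. Hence basic points, edges and pivots of every lift are mapped
  onto their tropical counterparts, and sign genericity gives the same for the reduced costs, which
  are quotients of determinants by Cramer's rule. Termination and optimality are inherited from the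
  classical simplex algorithm on one lift.

  A pivot is computed by a shortest-path search on the normalized matrix: it finds the direction in
  which the point leaves the hyperplane \<open>k\<close>, and a ratio test finds the first inequality that becomes
  tight. The reduced costs are found similarly, after matching the rows of the basis with the columns
  by growing the tangent tree from the column of \<open>b\<close>.\<close>

section \<open>Order and algebra of tropical numbers\<close>

text \<open>The obstacle is that different claims need different lifts. A basic set leaves no
  freedom: its \<open>n\<close> tight rows make the tangent graph a spanning tree on the
  \<open>n + 1\<close> columns, and every lift behaves alike there. But an inner point of an edge,
  or a competitor in the proof of optimality, is not evidently the valuation of a feasible point of
  a given lift. Such a point gets a lift built for it, and the result is carried over to all other
  lifts by a description that no longer mentions the lift: an edge is the tropical segment between
  its end points, and a reduced cost is a quotient of minors whose signed valuations are fixed by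
  sign genericity.

  Finiteness of the cone enters twice. It keeps Puiseux polyhedra in the positive orthant, where
  valuations of sums are tropical sums, and it bounds every edge.

  Both searches are of Dijkstra type, with maxima in place of minima. Linear scans are enough to
  select the next item: \<open>n\<close> rounds of \<open>O(n)\<close> operations fit into the bound
  because a basis has \<open>n \<le> m\<close> rows.\<close>

lemma trop_zero_le [simp]: "(0::trop) \<le> x"
  by (simp add: zero_trop_def)

lemma trop_le_zero [simp]: "x \<le> (0::trop) \<longleftrightarrow> x = 0"
  by (cases x) (auto simp: zero_trop_def)

lemma trop_mult_eq_0 [simp]: "x * y = (0::trop) \<longleftrightarrow> x = 0 \<or> y = 0"
  by (cases x; cases y) (auto simp: zero_trop_def)

lemma trop_mult_left_mono: "a \<le> b \<Longrightarrow> c * a \<le> c * (b::trop)"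
  by (cases a; cases b; cases c) auto

lemma trop_mult_mono: "a \<le> b \<Longrightarrow> c \<le> d \<Longrightarrow> a * c \<le> b * (d::trop)"
  by (cases a; cases b; cases c; cases d) auto

lemma trop_mult_left_le_iff: "c \<noteq> 0 \<Longrightarrow> c * a \<le> c * b \<longleftrightarrow> a \<le> (b::trop)"
  by (cases a; cases b; cases c) (auto simp: zero_trop_def)

lemma trop_mult_left_cancel: "c \<noteq> 0 \<Longrightarrow> c * a = c * b \<longleftrightarrow> a = (b::trop)"
  by (cases a; cases b; cases c) (auto simp: zero_trop_def)

lemma trop_add_le_iff: "x + y \<le> z \<longleftrightarrow> x \<le> z \<and> y \<le> (z::trop)"
  by (simp add: plus_trop_def)

lemma trop_sum_le_iff: "finite S \<Longrightarrow> sum f S \<le> c \<longleftrightarrow> (\<forall>x\<in>S. f x \<le> (c::trop))"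
  by (induction S rule: finite_induct) (auto simp: trop_add_le_iff)

lemma trop_le_sum: "finite S \<Longrightarrow> x \<in> S \<Longrightarrow> f x \<le> (sum f S :: trop)"
  using trop_sum_le_iff[of S f "sum f S"] by simp

lemma trop_sum_attained:
  assumes "finite S" "sum f S \<noteq> (0::trop)"
  shows "\<exists>x\<in>S. f x = sum f S"
  using assms
proof (induction S rule: finite_induct)
  case (insert x S)
  show ?case
  proof (cases "sum f S \<le> f x")
    case True
    with insert show ?thesis by (auto simp: plus_trop_def max_def)
  next
    case False
    then have "sum f (insert x S) = sum f S" "sum f S \<noteq> 0"
      using insert by (auto simp: plus_trop_def max_def)
    with insert show ?thesis by auto
  qed
qed simp

lemma trop_prod_eq_0: "finite S \<Longrightarrow> prod f S = (0::trop) \<longleftrightarrow> (\<exists>x\<in>S. f x = 0)"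
  by (induction S rule: finite_induct) auto

lemma trop_prod_Fin: "finite S \<Longrightarrow> (\<Prod>x\<in>S. Fin (f x)) = Fin (\<Sum>x\<in>S. f x)"
  by (induction S rule: finite_induct) (auto simp: one_trop_def)

lemma trop_prod_mono: "finite S \<Longrightarrow> (\<And>x. x \<in> S \<Longrightarrow> f x \<le> g x) \<Longrightarrow> prod f S \<le> (prod g S :: trop)"
  by (induction S rule: finite_induct) (auto intro: trop_mult_mono)

lemma Fin_neq_0 [simp]: "Fin a \<noteq> 0" "0 \<noteq> Fin a"
  by (auto simp: zero_trop_def)

lemma trop_neq_0E: "x \<noteq> (0::trop) \<Longrightarrow> (\<And>a. x = Fin a \<Longrightarrow> thesis) \<Longrightarrow> thesis"
  by (cases x) (auto simp: zero_trop_def)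

lemma modulus_eq_0 [simp]: "modulus x = 0 \<longleftrightarrow> x = SNegInf"
  by (cases x) (auto simp: zero_trop_def)

lemma modulus_stimes [simp]: "modulus (stimes x y) = modulus x * modulus y"
  by (cases x; cases y) auto

lemma modulus_sneg [simp]: "modulus (sneg x) = modulus x"
  by (cases x) auto

lemma modulus_of_trop [simp]: "modulus (of_trop x) = x"
  by (cases x) auto

lemma pos_part_simps [simp]: "pos_part SNegInf = 0" "pos_part (Pos a) = Fin a" "pos_part (Neg a) = 0"
  by (auto simp: pos_part_def tpositive_def zero_trop_def)

lemma neg_part_simps [simp]: "neg_part SNegInf = 0" "neg_part (Pos a) = 0" "neg_part (Neg a) = Fin a"
  by (auto simp: neg_part_def tnegative_def zero_trop_def)

section \<open>Acyclic families of sets\<close>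

text \<open>A family of column sets indexed by rows is acyclic, as a bipartite graph, iff no set of rows
  is matched with one set of columns in two ways.\<close>

definition acyclic_family :: "'r set \<Rightarrow> ('r \<Rightarrow> 'c set) \<Rightarrow> bool" where
  "acyclic_family R S \<longleftrightarrow>
     (\<forall>R' f g. R' \<subseteq> R \<and> inj_on f R' \<and> inj_on g R' \<and> f ` R' = g ` R' \<and>
        (\<forall>r\<in>R'. f r \<in> S r \<and> g r \<in> S r) \<longrightarrow> (\<forall>r\<in>R'. f r = g r))"

lemma acyclic_familyD:
  assumes "acyclic_family R S" "R' \<subseteq> R" "inj_on f R'" "inj_on g R'" "f ` R' = g ` R'"
    "\<And>r. r \<in> R' \<Longrightarrow> f r \<in> S r" "\<And>r. r \<in> R' \<Longrightarrow> g r \<in> S r" "r \<in> R'"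
  shows "f r = g r"
proof -
  have "R' \<subseteq> R \<and> inj_on f R' \<and> inj_on g R' \<and> f ` R' = g ` R' \<and> (\<forall>r\<in>R'. f r \<in> S r \<and> g r \<in> S r)"
    using assms by simp
  then show ?thesis using assms(1,8) unfolding acyclic_family_def by blast
qed

lemma acyclic_family_mono:
  "acyclic_family R S \<Longrightarrow> R' \<subseteq> R \<Longrightarrow> (\<And>r. r \<in> R' \<Longrightarrow> S' r \<subseteq> S r) \<Longrightarrow> acyclic_family R' S'"
  unfolding acyclic_family_def by (intro allI impI) (smt (verit) subset_iff)

text \<open>Induction on the rows: contracting the columns of one row to a single column keeps the family
  acyclic.\<close>

lemma acyclic_family_bound:
  assumes "finite R" "finite Q" "Q \<noteq> {}" "acyclic_family R S" "\<And>r. r \<in> R \<Longrightarrow> S r \<subseteq> Q \<and> S r \<noteq> {}"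
  shows "(\<Sum>r\<in>R. card (S r) - 1) < card Q"
  using assms
proof (induction R arbitrary: S Q rule: finite_induct)
  case empty
  then show ?case by (simp add: card_gt_0_iff)
next
  case (insert r0 R)
  let ?P = "S r0"
  have P: "?P \<subseteq> Q" "?P \<noteq> {}" "finite ?P" using insert.prems finite_subset by (metis insertI1)+
  then obtain p where p: "p \<in> ?P" by blast
  define \<pi> where "\<pi> c = (if c \<in> ?P then p else c)" for c
  define S' where "S' r = \<pi> ` S r" for r
  have Q': "\<pi> ` Q = insert p (Q - ?P)" using P p by (auto simp: \<pi>_def)
  have cQ': "card (\<pi> ` Q) = Suc (card Q - card ?P)"
    using P p insert.prems(1) unfolding Q' by (simp add: card_Diff_subset)
  have inj\<pi>: "inj_on \<pi> (S r)" if r: "r \<in> R" for r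
  proof (rule inj_onI, rule ccontr)
    fix x y assume xy: "x \<in> S r" "y \<in> S r" "\<pi> x = \<pi> y" "x \<noteq> y"
    have "x \<in> ?P \<and> y \<in> ?P"
      using xy p by (auto simp: \<pi>_def split: if_splits)
    have rr: "r \<noteq> r0" using r insert.hyps by auto
    \<comment> \<open>Two columns shared by \<open>r0\<close> and \<open>r\<close> would match these
      two rows in two ways.\<close>
    have "(\<lambda>s. if s = r0 then x else y) r0 = (\<lambda>s. if s = r0 then y else x) r0"
      by (rule acyclic_familyD[OF insert.prems(3), of "{r0, r}"])
        (use r rr xy \<open>x \<in> ?P \<and> y \<in> ?P\<close> in \<open>auto simp: inj_on_def\<close>)
    with xy show False by simp
  qed
  have acyc: "acyclic_family R S'"
    unfolding acyclic_family_def
  proof (intro allI impI, elim conjE)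
    fix R' f' g'
    assume R': "R' \<subseteq> R" and inj: "inj_on f' R'" "inj_on g' R'" and im: "f' ` R' = g' ` R'"
      and S': "\<forall>r\<in>R'. f' r \<in> S' r \<and> g' r \<in> S' r"
    have "\<forall>r\<in>R'. \<exists>c. c \<in> S r \<and> \<pi> c = f' r" "\<forall>r\<in>R'. \<exists>c. c \<in> S r \<and> \<pi> c = g' r"
      using S' by (auto simp: S'_def image_iff) metis+
    then obtain f g where f: "\<And>r. r \<in> R' \<Longrightarrow> f r \<in> S r" "\<And>r. r \<in> R' \<Longrightarrow> \<pi> (f r) = f' r"
      and g: "\<And>r. r \<in> R' \<Longrightarrow> g r \<in> S r" "\<And>r. r \<in> R' \<Longrightarrow> \<pi> (g r) = g' r"
      by (metis (no_types))
    have injfg: "inj_on f R'" "inj_on g R'"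
      using inj f(2) g(2) by (metis (no_types, lifting) inj_onD inj_onI)+
    have out: "\<pi> c = d \<Longrightarrow> d \<noteq> p \<Longrightarrow> c = d \<and> c \<notin> ?P" and inP: "\<pi> c = p \<Longrightarrow> c \<in> ?P" for c d
      using p by (auto simp: \<pi>_def split: if_splits)
    have fg: "\<forall>r\<in>R'. f' r = g' r" if "f ` R' = g ` R'"
    proof
      fix r assume r: "r \<in> R'"
      have "f r = g r"
        by (rule acyclic_familyD[OF insert.prems(3), of R']) (use R' injfg that f g r in auto)
      then show "f' r = g' r" using f(2) g(2) r by metis
    qed
    show "\<forall>r\<in>R'. f' r = g' r"
    proof (cases "p \<in> f' ` R'")
      case False
      then have "f r = f' r" "g r = g' r" if "r \<in> R'" for r
        using that im f(2) g(2) out by (metis image_eqI)+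
      then have "f ` R' = f' ` R'" "g ` R' = g' ` R'" by (auto simp: image_iff)
      then show ?thesis using fg im by simp
    next
      case True
      then obtain a where a: "a \<in> R'" "f' a = p" by auto
      from True im obtain e where e: "e \<in> R'" "g' e = p" by (metis imageE)
      have fa: "f a \<in> ?P" and ge: "g e \<in> ?P" using a e f(2) g(2) inP by auto
      have fo: "f r = f' r" "f r \<notin> ?P" if "r \<in> R'" "r \<noteq> a" for r
        using that out f(2) a inj(1) by (metis inj_onD)+
      have go: "g r = g' r" "g r \<notin> ?P" if "r \<in> R'" "r \<noteq> e" for r
        using that out g(2) e inj(2) by (metis inj_onD)+
      have "f ` (R' - {a}) = f' ` (R' - {a})" "g ` (R' - {e}) = g' ` (R' - {e})"
        using fo go by (auto simp: image_iff)
      moreover have "f' ` (R' - {a}) = f' ` R' - {p}" "g' ` (R' - {e}) = g' ` R' - {p}"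
        using a e inj by (auto simp: inj_on_def)
      ultimately have eq: "f ` (R' - {a}) = g ` (R' - {e})" using im by simp
      have fim: "f ` R' = insert (f a) (f ` (R' - {a}))" and gim: "g ` R' = insert (g e) (g ` (R' - {e}))"
        using a e by auto
      show ?thesis
      proof (cases "f a = g e")
        case True
        then show ?thesis using fg eq fim gim by simp
      next
        case False
        have r0: "r0 \<notin> R'" using R' insert.hyps by auto
        have upd: "inj_on (h(r0 := y)) (insert r0 R')" if "inj_on h R'" "y \<notin> h ` R'" for h y
        proof -
          have "inj_on (h(r0 := y)) R'" using that(1) r0 by (subst inj_on_cong[of _ _ h]) auto
          moreover have "(h(r0 := y)) ` (R' - {r0}) = h ` R'" using r0 by auto
          ultimately show ?thesis using that(2) by simp
        qed
        \<comment> \<open>The images of \<open>f\<close> and \<open>g\<close> differ only in the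
          columns \<open>f a\<close> and \<open>g e\<close>, both in \<open>?P\<close>. Giving
          \<open>r0\<close> the missing column on each side equalizes them, and acyclicity at
          \<open>r0\<close> then forces \<open>g e = f a\<close>.\<close>
        have "(f(r0 := g e)) r0 = (g(r0 := f a)) r0"
        proof (rule acyclic_familyD[OF insert.prems(3), of "insert r0 R'" "f(r0 := g e)" "g(r0 := f a)" r0])
          have "g e \<notin> f ` R'" using fo(2) ge False by (metis imageE)
          then show "inj_on (f(r0 := g e)) (insert r0 R')"
            using injfg(1) upd by simp
          have "f a \<notin> g ` R'" using go(2) fa False by (metis imageE)
          then show "inj_on (g(r0 := f a)) (insert r0 R')"
            using injfg(2) upd by simp
          have "(f(r0 := g e)) ` insert r0 R' = insert (g e) (f ` R')"
            "(g(r0 := f a)) ` insert r0 R' = insert (f a) (g ` R')" using r0 by auto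
          then show "(f(r0 := g e)) ` insert r0 R' = (g(r0 := f a)) ` insert r0 R'"
            using eq fim gim by auto
        qed (use R' f(1) g(1) fa ge in auto)
        with False show ?thesis by simp
      qed
    qed
  qed
  \<comment> \<open>Contraction loses \<open>card ?P - 1\<close> columns, exactly the share of
    \<open>r0\<close> in the sum. The resulting bound is the edge count of a forest.\<close>
  have "(\<Sum>r\<in>R. card (S' r) - 1) < card (\<pi> ` Q)"
  proof (rule insert.IH[OF _ _ acyc])
    show "S' r \<subseteq> \<pi> ` Q \<and> S' r \<noteq> {}" if "r \<in> R" for r
      using insert.prems(4)[of r] that unfolding S'_def by blast
  qed (use insert.prems in auto)
  moreover have "(\<Sum>r\<in>R. card (S' r) - 1) = (\<Sum>r\<in>R. card (S r) - 1)"
    unfolding S'_def using card_image inj\<pi> by (intro sum.cong) fastforce+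
  moreover have "card ?P \<le> card Q" "card ?P > 0"
    using P insert.prems(1) by (auto intro: card_mono simp: card_gt_0_iff)
  ultimately show ?case using cQ' insert.hyps by simp
qed

section \<open>Valuations of Puiseux series\<close>

lemma val_eq_0 [simp]: "val x = 0 \<longleftrightarrow> x = 0"
  by (auto simp: val_def zero_trop_def)

lemma val_0 [simp]: "val 0 = 0"
  by simp

lemma val_mult [simp]: "val (x * y) = val x * val y"
  by (cases "x = 0"; cases "y = 0") (auto simp: val_def lead_exp_mult)

lemma lead_exp_uminus [simp]: "lead_exp (- x) = lead_exp x"
  by (simp add: lead_exp_def)

lemma val_uminus [simp]: "val (- x) = val x"
  by (simp add: val_def)

lemma val_1 [simp]: "val 1 = 1"
proof -
  have "lead_exp 1 = 0" by (rule lead_exp_eqI) (auto simp: pcoeff_1)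
  then show ?thesis by (simp add: val_def one_trop_def)
qed

text \<open>Later estimates work with a common bound \<open>Fin a\<close> and the real coefficients
  at exponent \<open>- a\<close> instead of leading terms. Both are compatible with sums even when
  leading terms cancel, and a summand of smaller valuation simply contributes the coefficient
  0.\<close>

lemma val_le_iff: "val x \<le> Fin a \<longleftrightarrow> (\<forall>b < - a. pcoeff x b = 0)"
proof (cases "x = 0")
  case True
  then show ?thesis by (simp add: val_def)
next
  case False
  have "- a \<le> lead_exp x \<longleftrightarrow> (\<forall>b < - a. pcoeff x b = 0)"
    using lead_exp_props[OF False] pcoeff_below_lead by (metis less_le_trans not_less)
  with False show ?thesis by (auto simp: val_def)
qed

lemma val_less_iff: "val x < Fin a \<longleftrightarrow> val x \<le> Fin a \<and> pcoeff x (- a) = 0"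
proof (cases "x = 0")
  case True
  then show ?thesis by (simp add: val_def less_le)
next
  case False
  then have "val x < Fin a \<longleftrightarrow> - a < lead_exp x" by (auto simp: val_def less_le)
  moreover have "val x \<le> Fin a \<longleftrightarrow> - a \<le> lead_exp x" using False by (auto simp: val_def)
  ultimately show ?thesis using lead_exp_props(1)[OF False] pcoeff_below_lead[of "- a" x]
    by (auto simp: less_le)
qed

lemma val_eq_iff: "val x = Fin a \<longleftrightarrow> val x \<le> Fin a \<and> pcoeff x (- a) \<noteq> 0"
  using val_less_iff[of x a] by (auto simp: less_le)

text \<open>Once a bound is known, a single coefficient decides valuation and sign together.
  Positivity of a sum is thereby reduced to adding real numbers at one level.\<close>

lemma val_positive_iff: "val x = Fin a \<and> 0 < x \<longleftrightarrow> val x \<le> Fin a \<and> 0 < pcoeff x (- a)"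
proof -
  have "0 < x \<longleftrightarrow> 0 < pcoeff x (- a)" if "val x = Fin a"
  proof -
    have "lead_exp x = - a" using that by (auto simp: val_def split: if_splits)
    then show ?thesis by (simp add: less_puiseux_def lead_def)
  qed
  then show ?thesis using val_eq_iff[of x a] by force
qed

lemma val_add_le: "val x \<le> c \<Longrightarrow> val y \<le> c \<Longrightarrow> val (x + y) \<le> c"
  by (cases c) (auto simp: val_le_iff simp flip: zero_trop_def)

lemma val_sum_le: "(\<And>i. i \<in> S \<Longrightarrow> val (f i) \<le> c) \<Longrightarrow> val (sum f S) \<le> c"
  by (induction S rule: infinite_finite_induct) (auto intro: val_add_le)

lemma pcoeff_sum: "pcoeff (sum f S) a = (\<Sum>i\<in>S. pcoeff (f i) a)"
  by (induction S rule: infinite_finite_induct) auto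

text \<open>At the maximal admissible level only one pair of exponents can contribute, so taking the
  coefficient there is multiplicative.\<close>

lemma pcoeff_mult_level:
  assumes "val x \<le> Fin a" "val y \<le> Fin b"
  shows "pcoeff (x * y) (- (a + b)) = pcoeff x (- a) * pcoeff y (- b)"
proof -
  have "pcoeff (x * y) (- (a + b)) = (\<Sum>e\<in>{- a}. pcoeff x e * pcoeff y (- (a + b) - e))"
  proof (rule pcoeff_mult_superset, safe)
    fix e assume e: "pcoeff x e \<noteq> 0" "pcoeff y (- (a + b) - e) \<noteq> 0"
    then have "\<not> e < - a" "\<not> - (a + b) - e < - b" using assms by (auto simp: val_le_iff)
    then show "e = - a" by simp
  qed
  then show ?thesis by simp
qed

text \<open>Nonnegative series cannot cancel: at the maximal level all coefficients are nonnegative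
  and at least one is positive.\<close>

lemma val_sum_nonneg:
  assumes "finite S" "\<And>i. i \<in> S \<Longrightarrow> 0 \<le> f i"
  shows "val (sum f S) = (\<Sum>i\<in>S. val (f i))"
proof (rule antisym)
  show "val (sum f S) \<le> (\<Sum>i\<in>S. val (f i))"
    by (rule val_sum_le) (use assms in \<open>auto intro: trop_le_sum\<close>)
  show "(\<Sum>i\<in>S. val (f i)) \<le> val (sum f S)"
  proof (cases "(\<Sum>i\<in>S. val (f i)) = 0")
    case False
    then obtain i where i: "i \<in> S" "val (f i) = (\<Sum>i\<in>S. val (f i))"
      using trop_sum_attained assms(1) by blast
    from False obtain a where a: "(\<Sum>i\<in>S. val (f i)) = Fin a" by (auto elim: trop_neq_0E)
    have le: "val (f j) \<le> Fin a" if "j \<in> S" for j using trop_le_sum[OF assms(1) that] a by metis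
    have nn: "0 \<le> pcoeff (f j) (- a)" if j: "j \<in> S" for j
    proof (cases "f j = 0")
      case False
      then have "0 < f j" using assms(2)[OF j] by simp
      then show ?thesis using le[OF j] val_less_iff[of "f j" a] val_positive_iff[of "f j" a]
        by (cases "val (f j) = Fin a") (auto simp: less_le)
    qed simp
    have "f i \<noteq> 0" using i a by auto
    then have "0 < f i" using assms(2)[OF i(1)] by simp
    then have "0 < pcoeff (f i) (- a)" using val_positive_iff[of "f i" a] i a by auto
    then have "0 < pcoeff (sum f S) (- a)"
      unfolding pcoeff_sum using nn i(1) assms(1) by (intro sum_pos2[of S i]) auto
    then show ?thesis using a val_positive_iff[of "sum f S" a] val_sum_le[of S f "Fin a"] le by auto
  qed simp
qed

lemma val_add_nonneg: "0 \<le> x \<Longrightarrow> 0 \<le> y \<Longrightarrow> val (x + y) = val x + val y"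
  using val_sum_nonneg[of "{0::nat, 1}" "\<lambda>i. if i = 0 then x else y"] by auto

lemma val_mono: "0 \<le> x \<Longrightarrow> x \<le> y \<Longrightarrow> val x \<le> val y"
  using val_add_nonneg[of x "y - x"] by (auto simp: plus_trop_def)

lemma modulus_sval [simp]: "modulus (sval x) = val x"
  by (simp add: sval_def)

lemma sval_eq_SNegInf [simp]: "sval x = SNegInf \<longleftrightarrow> x = 0"
  by (metis modulus_eq_0 modulus_sval val_eq_0)

lemma of_trop_0 [simp]: "of_trop 0 = SNegInf"
  by (simp add: zero_trop_def)

lemma sval_0 [simp]: "sval 0 = SNegInf"
  by simp

lemma sval_eq_Pos: "sval x = Pos a \<longleftrightarrow> 0 < x \<and> val x = Fin a"
  by (cases "val x"; cases "x = 0") (auto simp: sval_def zero_trop_def[symmetric] less_le)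

lemma sval_eq_Neg: "sval x = Neg a \<longleftrightarrow> x < 0 \<and> val x = Fin a"
  by (cases "val x") (auto simp: sval_def zero_trop_def[symmetric] not_le)

lemma sval_PosI: "0 < x \<Longrightarrow> val x = Fin a \<Longrightarrow> sval x = Pos a"
  by (simp add: sval_eq_Pos)

lemma sval_NegI: "x < 0 \<Longrightarrow> val x = Fin a \<Longrightarrow> sval x = Neg a"
  by (simp add: sval_eq_Neg)

lemma tnegative_sval [simp]: "tnegative (sval x) \<longleftrightarrow> x < 0"
proof -
  have "x < 0 \<Longrightarrow> \<exists>a. val x = Fin a" by (auto simp: val_def)
  then show ?thesis by (auto simp: tnegative_def sval_eq_Neg)
qed

lemma tpositive_sval [simp]: "tpositive (sval x) \<longleftrightarrow> 0 < x"
proof -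
  have "0 < x \<Longrightarrow> \<exists>a. val x = Fin a" by (auto simp: val_def)
  then show ?thesis by (auto simp: tpositive_def sval_eq_Pos)
qed

lemma sval_cases:
  obtains "x = 0" "sval x = SNegInf"
  | a where "0 < x" "sval x = Pos a" "val x = Fin a"
  | a where "x < 0" "sval x = Neg a" "val x = Fin a"
  by (cases "sval x") (auto simp: sval_eq_Pos sval_eq_Neg)

lemma sval_mult [simp]: "sval (x * y) = stimes (sval x) (sval y)"
  by (cases x rule: sval_cases; cases y rule: sval_cases)
    (auto intro!: sval_PosI sval_NegI simp: mult_pos_pos mult_neg_neg mult_pos_neg mult_neg_pos)

lemma sval_uminus [simp]: "sval (- x) = sneg (sval x)"
  by (cases x rule: sval_cases) (auto intro!: sval_PosI sval_NegI)

lemma sval_eq_of_trop: "sval x = of_trop c \<longleftrightarrow> 0 \<le> x \<and> val x = c"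
  by (cases x rule: sval_cases; cases c) (auto simp: sval_def zero_trop_def[symmetric])

lemma sval_monomial [simp]:
  "sval (monomial r e) = (if r = 0 then SNegInf else if 0 < r then Pos (- e) else Neg (- e))"
proof (cases "r = 0")
  case True
  then have "monomial r e = 0" by (intro puiseux_eqI) (simp add: pcoeff_monomial)
  with True show ?thesis by simp
next
  case False
  have e: "lead_exp (monomial r e) = e"
    by (rule lead_exp_eqI) (use False in \<open>auto simp: pcoeff_monomial\<close>)
  have l: "lead (monomial r e) = r" by (simp add: lead_def e pcoeff_monomial)
  have "monomial r e \<noteq> 0" using False l by auto
  then have v: "val (monomial r e) = Fin (- e)" by (simp add: val_def e)
  show ?thesis
  proof (cases "0 < r")
    case True
    then have "0 < monomial r e" using l by (simp add: less_puiseux_def)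
    with v True show ?thesis by (simp add: sval_eq_Pos)
  next
    case f: False
    have "lead (0 - monomial r e) = - r" using lead_uminus[of "monomial r e"] l by simp
    then have "monomial r e < 0" using False f by (simp add: less_puiseux_def)
    with v False f show ?thesis by (simp add: sval_eq_Neg)
  qed
qed

lemma stimes_right_cancel: "stimes x z = stimes y z \<Longrightarrow> z \<noteq> SNegInf \<Longrightarrow> x = y"
  by (cases x; cases y; cases z) auto

text \<open>The coefficients at the maximal level are not all zero but add up to zero, so both signs
  occur among them.\<close>

lemma balanced_sval_sum_zero:
  assumes "finite S" "S \<noteq> {}" "(\<Sum>i\<in>S. f i) = 0"
  shows "balanced ((\<lambda>i. sval (f i)) ` S)"
proof (cases "Max (modulus ` (\<lambda>i. sval (f i)) ` S) = NegInf")
  case True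
  then show ?thesis by (simp add: balanced_def)
next
  case False
  let ?M = "modulus ` (\<lambda>i. sval (f i)) ` S"
  obtain a where a: "Max ?M = Fin a" using False by (cases "Max ?M") auto
  have M: "finite ?M" "?M \<noteq> {}" using assms by auto
  have le: "val (f i) \<le> Fin a" if "i \<in> S" for i
    using Max_ge[OF M(1), of "val (f i)"] that a by (auto simp: image_image)
  obtain k where k: "k \<in> S" "val (f k) = Fin a" using Max_in[OF M] a by (auto simp: image_image)
  have sum0: "(\<Sum>i\<in>S. pcoeff (f i) (- a)) = 0" using assms(3) by (metis pcoeff_sum pcoeff_0)
  have k0: "pcoeff (f k) (- a) \<noteq> 0" using k val_eq_iff by blast
  have "\<exists>i\<in>S. 0 < pcoeff (f i) (- a)"
  proof (rule ccontr)
    assume "\<not> ?thesis"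
    then have "\<forall>i\<in>S. 0 \<le> - pcoeff (f i) (- a)" by force
    moreover have "(\<Sum>i\<in>S. - pcoeff (f i) (- a)) = 0" using sum0 by (simp add: sum_negf)
    ultimately show False using sum_nonneg_eq_0_iff[of S "\<lambda>i. - pcoeff (f i) (- a)"] assms(1) k k0 by auto
  qed
  then obtain p where p: "p \<in> S" "0 < pcoeff (f p) (- a)" by blast
  have "\<exists>i\<in>S. pcoeff (f i) (- a) < 0"
  proof (rule ccontr)
    assume "\<not> ?thesis"
    then have "\<forall>i\<in>S. 0 \<le> pcoeff (f i) (- a)" by force
    then show False using sum_nonneg_eq_0_iff[of S "\<lambda>i. pcoeff (f i) (- a)"] assms(1) k k0 sum0 by auto
  qed
  then obtain q where q: "q \<in> S" "pcoeff (f q) (- a) < 0" by blast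
  have "val (f p) = Fin a \<and> 0 < f p" using p le val_positive_iff by blast
  moreover have "val (- f q) = Fin a \<and> 0 < - f q" using q le val_positive_iff[of "- f q" a] by simp
  ultimately show ?thesis
    unfolding balanced_def a using p(1) q(1) by (auto simp: image_iff intro!: bexI)
qed

section \<open>Lifts of signed tropical numbers\<close>

text \<open>Positive and negative entries have separate leading coefficients so that a lift can
  favour the positive ones; this makes it possible to keep a prescribed tropical point
  feasible.\<close>

fun coeff_lift :: "real \<Rightarrow> real \<Rightarrow> strop \<Rightarrow> puiseux" where
  "coeff_lift r s SNegInf = 0"
| "coeff_lift r s (Pos a) = monomial r (- a)"
| "coeff_lift r s (Neg a) = monomial (- s) (- a)"

lemma sval_coeff_lift: "0 < r \<Longrightarrow> 0 < s \<Longrightarrow> sval (coeff_lift r s x) = x"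
  by (cases x) auto

abbreviation unit_lift :: "strop \<Rightarrow> puiseux" where
  "unit_lift \<equiv> coeff_lift 1 1"

text \<open>A balanced family can be lifted so that its sum vanishes: of two terms of maximal modulus and
  opposite signs, one gets a large coefficient and the other one absorbs all remaining terms.\<close>

lemma exact_lift:
  fixes X :: "'i \<Rightarrow> puiseux"
  assumes S: "finite S" "S \<noteq> {}" and bal: "balanced ((\<lambda>j. stimes (w j) (sval (X j))) ` S)"
  shows "\<exists>\<ww>. (\<forall>j\<in>S. sval (\<ww> j) = w j) \<and> (\<Sum>j\<in>S. \<ww> j * X j) = 0"
proof -
  let ?t = "\<lambda>j. stimes (w j) (sval (X j))"
  let ?M = "modulus ` ?t ` S"
  have sv: "sval (unit_lift (w j)) = w j" for j by (rule sval_coeff_lift) auto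
  have mem: "modulus (?t j) \<le> Max ?M" if "j \<in> S" for j
    using S that by (intro Max_ge imageI) auto
  show ?thesis
  proof (cases "Max ?M = NegInf")
    case True
    have "unit_lift (w j) * X j = 0" if "j \<in> S" for j
    proof -
      have "modulus (?t j) \<le> NegInf" using mem[OF that] True by simp
      then have "sval (unit_lift (w j) * X j) = SNegInf" using sv
        by (metis modulus_eq_0 sval_mult trop_le_zero zero_trop_def)
      then show ?thesis by (simp only: sval_eq_SNegInf)
    qed
    then have "(\<Sum>j\<in>S. unit_lift (w j) * X j) = 0" by (rule sum.neutral[OF ballI])
    then show ?thesis by (intro exI[of _ "\<lambda>j. unit_lift (w j)"] conjI ballI sv)
  next
    case False
    then obtain a where a: "Max ?M = Fin a" by (cases "Max ?M") auto
    have sgn: "tpositive x \<Longrightarrow> modulus x = Fin a \<Longrightarrow> x = Pos a"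
      "tnegative x \<Longrightarrow> modulus x = Fin a \<Longrightarrow> x = Neg a" for x
      by (auto simp: tpositive_def tnegative_def)
    from bal False obtain p q where p: "p \<in> S" "?t p = Pos a" and q: "q \<in> S" "?t q = Neg a"
      unfolding balanced_def a using sgn by (metis (no_types, lifting) imageE)
    have pq: "p \<noteq> q" using p q by auto
    have le: "val (unit_lift (w j) * X j) \<le> Fin a" if "j \<in> S" for j
    proof -
      have "modulus (?t j) \<le> Fin a" using mem[OF that] a by simp
      then show ?thesis using sv by (metis modulus_sval sval_mult)
    qed
    define R where "R = (\<Sum>j\<in>S - {p, q}. unit_lift (w j) * X j)"
    have R: "val R \<le> Fin a" unfolding R_def by (rule val_sum_le) (use le in auto)
    define Y where "Y = unit_lift (w q) * X q"
    have "sval Y = Neg a" unfolding Y_def sval_mult sv by (rule q)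
    then have "val (- Y) = Fin a \<and> 0 < - Y" by (simp add: sval_eq_Neg)
    then have Y: "val Y \<le> Fin a" "pcoeff Y (- a) < 0" using val_positive_iff[of "- Y" a] by auto
    \<comment> \<open>Chosen such that the coefficient of \<open>Z\<close> at the level
      \<open>a\<close> is \<open>\<bar>pcoeff R (- a)\<bar> + 1 - pcoeff R (- a)\<close>, which is
      positive whatever the other terms contribute.\<close>
    define N where "N = (\<bar>pcoeff R (- a)\<bar> + 1) / - pcoeff Y (- a)"
    have N: "0 < N" unfolding N_def using Y by (intro divide_pos_pos) auto
    have mN: "sval (monomial N 0) = Pos 0" using N by simp
    then have vN: "val (monomial N 0) = Fin 0" unfolding sval_eq_Pos by simp
    define Z where "Z = - (R + monomial N 0 * Y)"
    have "pcoeff Z (- a) = \<bar>pcoeff R (- a)\<bar> + 1 - pcoeff R (- a)"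
      using Y by (simp add: Z_def pcoeff_monomial_mult N_def)
    then have "0 < pcoeff Z (- a)" by simp
    moreover have "val (monomial N 0 * Y) \<le> Fin a"
      using Y by (cases "val Y") (auto simp: vN)
    then have "val Z \<le> Fin a" unfolding Z_def val_uminus using R val_add_le by blast
    ultimately have Z: "sval Z = Pos a" using val_positive_iff[of Z a] by (simp add: sval_eq_Pos)
    have Xp: "X p \<noteq> 0" using p by (cases "w p") (auto dest: sym)
    define \<ww> where "\<ww> j = (if j = p then Z / X p else if j = q then monomial N 0 * unit_lift (w q)
      else unit_lift (w j))" for j
    have "stimes (sval (\<ww> p)) (sval (X p)) = stimes (w p) (sval (X p))"
      unfolding p(2) using Z Xp by (simp add: \<ww>_def flip: sval_mult)
    then have wp: "sval (\<ww> p) = w p" by (rule stimes_right_cancel) (use Xp in simp)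
    have "sval (\<ww> q) = w q" using pq mN sv by (cases "w q") (auto simp: \<ww>_def)
    then have "\<forall>j\<in>S. sval (\<ww> j) = w j" using wp sv by (auto simp: \<ww>_def)
    moreover have "(\<Sum>j\<in>S. \<ww> j * X j) = \<ww> p * X p + (\<ww> q * X q + (\<Sum>j\<in>S - {p, q}. \<ww> j * X j))"
    proof -
      have "(\<Sum>j\<in>S. \<ww> j * X j) = \<ww> p * X p + (\<Sum>j\<in>S - {p}. \<ww> j * X j)"
        using S p by (simp add: sum.remove)
      also have "(\<Sum>j\<in>S - {p}. \<ww> j * X j) = \<ww> q * X q + (\<Sum>j\<in>S - {p} - {q}. \<ww> j * X j)"
        using S q pq by (intro sum.remove) auto
      also have "S - {p} - {q} = S - {p, q}" by auto
      finally show ?thesis .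
    qed
    moreover have "(\<Sum>j\<in>S - {p, q}. \<ww> j * X j) = R"
      unfolding R_def by (rule sum.cong) (auto simp: \<ww>_def)
    moreover have "\<ww> p * X p = Z" "\<ww> q * X q = monomial N 0 * Y"
      using Xp pq by (auto simp: \<ww>_def Y_def)
    ultimately show ?thesis by (intro exI[of _ \<ww>]) (auto simp: Z_def)
  qed
qed

section \<open>Homogeneous coordinates and normalized rows\<close>

lemma bij_betw_pick: "finite C \<Longrightarrow> bij_betw (pick C) {..<card C} C"
proof -
  assume C: "finite C"
  have inj: "inj_on (pick C) {..<card C}"
    by (rule inj_onI) (metis lessThan_iff linorder_neqE_nat nat_less_le pick_mono_le)
  moreover have "pick C ` {..<card C} = C"
    by (rule card_subset_eq[OF C]) (use card_image[OF inj] pick_in_set_le in auto)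
  ultimately show ?thesis by (simp add: bij_betw_def)
qed

lemma submatrix_carrier:
  assumes "M \<in> carrier_mat k l" "R \<subseteq> {..<k}" "C \<subseteq> {..<l}"
  shows "submatrix M R C \<in> carrier_mat (card R) (card C)"
    "\<And>i j. i < card R \<Longrightarrow> j < card C \<Longrightarrow> submatrix M R C $$ (i, j) = M $$ (pick R i, pick C j)"
proof -
  have "{i. i < k \<and> i \<in> R} = R" "{j. j < l \<and> j \<in> C} = C" using assms by auto
  then show "submatrix M R C \<in> carrier_mat (card R) (card C)"
    "\<And>i j. i < card R \<Longrightarrow> j < card C \<Longrightarrow> submatrix M R C $$ (i, j) = M $$ (pick R i, pick C j)"
    using assms by (auto simp: submatrix_def)
qed

text \<open>Maximality of the matchings is witnessed by the potentials \<open>u\<close> and \<open>S\<close>.\<close>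

lemma trop_generic_unique_matching:
  assumes gen: "trop_generic M" and M: "M \<in> carrier_mat k l"
    and R: "R \<subseteq> {..<k}" and C: "C \<subseteq> {..<l}" and f: "bij_betw f R C" and g: "bij_betw g R C"
    and le: "\<And>r c. r \<in> R \<Longrightarrow> c \<in> C \<Longrightarrow> modulus (M $$ (r, c)) \<le> Fin (S r - u c)"
    and feq: "\<And>r. r \<in> R \<Longrightarrow> modulus (M $$ (r, f r)) = Fin (S r - u (f r))"
    and geq: "\<And>r. r \<in> R \<Longrightarrow> modulus (M $$ (r, g r)) = Fin (S r - u (g r))"
    and r: "r \<in> R"
  shows "f r = g r"
proof -
  define N where "N = card R"
  have fin: "finite R" "finite C" using finite_subset[OF R] finite_subset[OF C] by simp_all
  have cC: "card C = N" using f N_def bij_betw_same_card by fastforce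
  have pR: "bij_betw (pick R) {..<N} R" and pC: "bij_betw (pick C) {..<N} C"
    using bij_betw_pick fin cC N_def by metis+
  have pRin: "pick R i \<in> R" and pCin: "pick C i \<in> C" if "i < N" for i
    using pR pC that bij_betwE by blast+
  define U where "U = map_mat modulus (submatrix M R C)"
  have U: "dim_row U = N" "\<And>i j. i < N \<Longrightarrow> j < N \<Longrightarrow> U $$ (i, j) = modulus (M $$ (pick R i, pick C j))"
    using submatrix_carrier[OF M R C] cC by (auto simp: U_def N_def)
  define B where "B = (\<Sum>r\<in>R. S r) - (\<Sum>c\<in>C. u c)"
  have bound: "(\<Prod>i = 0..<N. Fin (S (pick R i) - u (pick C (\<sigma> i)))) = Fin B"
    if "\<sigma> permutes {0..<N}" for \<sigma>
  proof -
    have "(\<Sum>i = 0..<N. S (pick R i)) = (\<Sum>r\<in>R. S r)"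
      using sum.reindex_bij_betw[OF pR, of S] by (simp add: atLeast0LessThan)
    moreover have "(\<Sum>i = 0..<N. u (pick C (\<sigma> i))) = (\<Sum>c\<in>C. u c)"
      using sum.reindex_bij_betw[OF pC, of u] sum.permute[OF that, of "\<lambda>i. u (pick C i)"]
      by (simp add: atLeast0LessThan comp_def)
    ultimately show ?thesis by (simp add: trop_prod_Fin sum_subtractf B_def)
  qed
  have "(\<Prod>i = 0..<N. U $$ (i, \<sigma> i)) \<le> Fin B" if "\<sigma> permutes {0..<N}" for \<sigma>
  proof -
    have "(\<Prod>i = 0..<N. U $$ (i, \<sigma> i)) \<le> (\<Prod>i = 0..<N. Fin (S (pick R i) - u (pick C (\<sigma> i))))"
    proof (rule trop_prod_mono)
      fix i assume i: "i \<in> {0..<N}"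
      then have "\<sigma> i < N" using permutes_in_image[OF that, of i] by auto
      then show "U $$ (i, \<sigma> i) \<le> Fin (S (pick R i) - u (pick C (\<sigma> i)))"
        using i U(2)[of i "\<sigma> i"] le[OF pRin pCin] by simp
    qed simp
    then show ?thesis using bound[OF that] by simp
  qed
  then have tper_le: "tper U \<le> Fin B"
    by (simp add: tper_def U trop_sum_le_iff finite_permutations)
  \<comment> \<open>\<open>submatrix\<close> renumbers rows and columns by \<open>pick\<close>. This
    is the matching \<open>h\<close> in the new numbering, extended by the identity as
    \<open>permutes\<close> demands.\<close>
  define \<tau> where "\<tau> h i = (if i < N then inv_into {..<N} (pick C) (h (pick R i)) else i)" for h i
  have max: "maximizing_perm U (\<tau> h) \<and> tper U = Fin B"
    if h: "bij_betw h R C" "\<And>r. r \<in> R \<Longrightarrow> modulus (M $$ (r, h r)) = Fin (S r - u (h r))" for h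
  proof -
    have "bij_betw (inv_into {..<N} (pick C) \<circ> (h \<circ> pick R)) {..<N} {..<N}"
      by (intro bij_betw_trans[OF bij_betw_trans[OF pR h(1)] bij_betw_inv_into[OF pC]])
    then have "bij_betw (\<tau> h) {..<N} {..<N}"
      by (rule bij_betw_cong[THEN iffD1, rotated]) (auto simp: \<tau>_def)
    then have perm: "\<tau> h permutes {0..<N}"
      unfolding atLeast0LessThan by (rule bij_imp_permutes) (auto simp: \<tau>_def)
    have pk: "pick C (\<tau> h i) = h (pick R i)" "\<tau> h i < N" if "i < N" for i
    proof -
      have "h (pick R i) \<in> C" using bij_betwE[OF h(1)] pRin[OF that] by blast
      then have "h (pick R i) \<in> pick C ` {..<N}" using bij_betw_imp_surj_on[OF pC] by simp
      from f_inv_into_f[OF this] inv_into_into[OF this]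
      show "pick C (\<tau> h i) = h (pick R i)" "\<tau> h i < N" using that by (auto simp: \<tau>_def)
    qed
    have "(\<Prod>i = 0..<N. U $$ (i, \<tau> h i)) = (\<Prod>i = 0..<N. Fin (S (pick R i) - u (pick C (\<tau> h i))))"
      using U(2) pk h(2)[OF pRin] by (intro prod.cong) auto
    then have eq: "(\<Prod>i = 0..<N. U $$ (i, \<tau> h i)) = Fin B" using bound[OF perm] by simp
    then have "Fin B \<le> tper U"
      using trop_le_sum[of "{\<sigma>. \<sigma> permutes {0..<N}}" "\<tau> h" "\<lambda>\<sigma>. \<Prod>i = 0..<N. U $$ (i, \<sigma> i)"] perm
      by (simp add: tper_def U finite_permutations)
    with tper_le have "tper U = Fin B" by simp
    with perm eq show ?thesis by (simp add: maximizing_perm_def U)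
  qed
  have "submatrix M R C \<in> square_submatrices M"
    unfolding square_submatrices_def mem_Collect_eq using M R C cC N_def by (intro exI[of _ R] exI[of _ C]) auto
  with gen have "tper U = NegInf \<or> \<not> trop_singular U"
    unfolding trop_generic_def U_def by blast
  then have eq: "\<tau> f = \<tau> g"
    using max[OF f feq] max[OF g geq] by (auto simp: trop_singular_def)
  obtain i where i: "i < N" "pick R i = r" using r by (metis bij_betw_imp_surj_on[OF pR] imageE lessThan_iff)
  have "inv_into {..<N} (pick C) (f r) = inv_into {..<N} (pick C) (g r)"
    using fun_cong[OF eq, of i] i by (simp add: \<tau>_def)
  moreover have "f r \<in> pick C ` {..<N}" "g r \<in> pick C ` {..<N}" using r bij_betwE[OF f] bij_betwE[OF g] bij_betw_imp_surj_on[OF pC] by auto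
  ultimately show ?thesis by (metis f_inv_into_f)
qed

section \<open>Standard programs in coordinates relative to a finite point\<close>

locale trop_program =
  fixes n m :: nat and A :: "strop mat" and b :: "strop vec" and c :: "trop vec"
  assumes lp: "trop_lp n m A b c" and std: "standard_lp A b c"
begin

lemma dims: "A \<in> carrier_mat m n" "b \<in> carrier_vec m" "c \<in> carrier_vec n" "0 < n"
  "dim_row A = m" "dim_col A = n" "dim_vec b = m" "dim_vec c = n"
  using lp by (auto simp: trop_lp_def)

abbreviation W :: "nat \<Rightarrow> nat \<Rightarrow> strop" where
  "W i j \<equiv> append_col A b $$ (i, j)"

lemma W_simps: "i < m \<Longrightarrow> j < n \<Longrightarrow> W i j = A $$ (i, j)" "i < m \<Longrightarrow> W i n = b $ i"
  "append_col A b \<in> carrier_mat m (Suc n)"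
  using dims by (auto simp: append_col_def)

lemma row_finite: "i < m \<Longrightarrow> \<exists>j\<le>n. W i j \<noteq> SNegInf"
  using lp by (auto simp: trop_lp_def)

text \<open>Evaluated at arbitrary functions on the \<open>n + 1\<close> columns: besides
  homogenized points, also directions with infinite coordinates and combinations of both are
  substituted.\<close>

definition rowp :: "nat \<Rightarrow> (nat \<Rightarrow> trop) \<Rightarrow> trop" where
  "rowp i X = (\<Sum>j\<le>n. pos_part (W i j) * X j)"

definition rown :: "nat \<Rightarrow> (nat \<Rightarrow> trop) \<Rightarrow> trop" where
  "rown i X = (\<Sum>j\<le>n. neg_part (W i j) * X j)"

definition hom :: "trop vec \<Rightarrow> nat \<Rightarrow> trop" where
  "hom x j = (if j < n then x $ j else 1)"

lemma rowp_hom: "x \<in> carrier_vec n \<Longrightarrow> i < m \<Longrightarrow> rowp i (hom x) = map_vec pos_part (row A i) \<bullet> x + pos_part (b $ i)"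
  using dims by (simp add: rowp_def hom_def scalar_prod_def atLeast0LessThan W_simps
      lessThan_Suc_atMost[symmetric])

lemma rown_hom: "x \<in> carrier_vec n \<Longrightarrow> i < m \<Longrightarrow> rown i (hom x) = map_vec neg_part (row A i) \<bullet> x + neg_part (b $ i)"
  using dims by (simp add: rown_def hom_def scalar_prod_def atLeast0LessThan W_simps
      lessThan_Suc_atMost[symmetric])

lemma polyhedron_iff:
  "x \<in> trop_polyhedron A b \<longleftrightarrow> x \<in> carrier_vec n \<and> (\<forall>i<m. rown i (hom x) \<le> rowp i (hom x))"
proof (cases "x \<in> carrier_vec n")
  case True
  have "row (map_mat f A) i = map_vec f (row A i)" if "i < m" for f :: "strop \<Rightarrow> trop" and i
    using dims that by (intro eq_vecI) auto
  then show ?thesis using True dims rowp_hom[OF True] rown_hom[OF True]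
    by (auto simp: trop_polyhedron_def less_eq_vec_def)
qed (use dims in \<open>simp add: trop_polyhedron_def\<close>)

lemma hyperplane_iff:
  "i < m \<Longrightarrow> x \<in> carrier_vec n \<Longrightarrow> x \<in> s_hyperplane (row A i) (b $ i) \<longleftrightarrow> rowp i (hom x) = rown i (hom x)"
  using dims rowp_hom rown_hom by (simp add: s_hyperplane_def)

text \<open>The finiteness condition of a standard program. For a point of the polyhedron it gives
  finite coordinates; for a direction with a coordinate minus infinity it gives a violated
  inequality, which is why edges end.\<close>

lemma cone_finite:
  assumes X: "\<And>i. i < m \<Longrightarrow> rown i X \<le> rowp i X" and j: "j \<le> n" "X j \<noteq> 0" and k: "k \<le> n"
  shows "X k \<noteq> 0"
proof -
  let ?x = "vec (Suc n) X"
  have "row (map_mat f (append_col A b)) i \<bullet> ?x = (\<Sum>j\<le>n. f (W i j) * X j)"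
    if "i < m" for i and f :: "strop \<Rightarrow> trop"
    using that W_simps(3) by (simp add: scalar_prod_def atLeast0LessThan lessThan_Suc_atMost del: sum.lessThan_Suc)
  then have "?x \<in> trop_cone (append_col A b)"
    using X W_simps(3) by (auto simp: trop_cone_def less_eq_vec_def rowp_def rown_def)
  then have "(\<forall>j<Suc n. ?x $ j = NegInf) \<or> (\<forall>j<Suc n. ?x $ j \<noteq> NegInf)"
    using std by (auto simp: standard_lp_def)
  then show ?thesis using j k by (auto simp: zero_trop_def less_Suc_eq_le)
qed

definition pt :: "(nat \<Rightarrow> real) \<Rightarrow> trop vec" where
  "pt u = vec n (\<lambda>j. Fin (u j))"

lemma hom_pt: "u n = 0 \<Longrightarrow> j \<le> n \<Longrightarrow> hom (pt u) j = Fin (u j)"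
  by (auto simp: hom_def pt_def one_trop_def)

lemma polyhedron_finite:
  assumes "x \<in> trop_polyhedron A b"
  obtains u where "u n = 0" "x = pt u"
proof -
  have x: "x \<in> carrier_vec n" "\<And>i. i < m \<Longrightarrow> rown i (hom x) \<le> rowp i (hom x)"
    using assms by (auto simp: polyhedron_iff)
  have nz: "hom x j \<noteq> 0" if "j \<le> n" for j
    by (rule cone_finite[OF x(2), of n]) (use that in \<open>auto simp: hom_def\<close>)
  define u where "u j = (if j < n then (THE a. x $ j = Fin a) else 0)" for j
  have "x $ j = Fin (u j)" if "j < n" for j
    using nz[of j] that by (cases "x $ j") (auto simp: hom_def u_def zero_trop_def)
  then have "x = pt u" using x(1) by (intro eq_vecI) (auto simp: pt_def)
  moreover have "u n = 0" by (simp add: u_def)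
  ultimately show thesis using that by blast
qed

definition lev :: "(nat \<Rightarrow> real) \<Rightarrow> nat \<Rightarrow> trop" where
  "lev u i = (\<Sum>j\<le>n. modulus (W i j) * Fin (u j))"

text \<open>Every row has a finite entry, so for a row of the program \<open>lev u i\<close> is
  finite and the inverse is a true division. Signs are unchanged by the scaling.\<close>

definition V :: "(nat \<Rightarrow> real) \<Rightarrow> nat \<Rightarrow> nat \<Rightarrow> strop" where
  "V u i j = stimes (stimes (W i j) (Pos (u j))) (sinv (of_trop (lev u i)))"

lemma lev_neq_0: "i < m \<Longrightarrow> lev u i \<noteq> 0"
proof -
  assume "i < m"
  then obtain j where j: "j \<le> n" "W i j \<noteq> SNegInf" using row_finite by blast
  have "modulus (W i j) * Fin (u j) \<le> lev u i" unfolding lev_def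
    using trop_le_sum[of "{..n}" j "\<lambda>j. modulus (W i j) * Fin (u j)"] j by simp
  moreover have "modulus (W i j) * Fin (u j) \<noteq> 0" using j by simp
  ultimately show ?thesis by auto
qed

lemma V_scale:
  assumes "i < m"
  shows "modulus (V u i j) * lev u i = modulus (W i j) * Fin (u j)"
    "pos_part (V u i j) * lev u i = pos_part (W i j) * Fin (u j)"
    "neg_part (V u i j) * lev u i = neg_part (W i j) * Fin (u j)"
proof -
  obtain a where a: "lev u i = Fin a" using lev_neq_0[OF assms] by (auto elim: trop_neq_0E)
  show "modulus (V u i j) * lev u i = modulus (W i j) * Fin (u j)"
    "pos_part (V u i j) * lev u i = pos_part (W i j) * Fin (u j)"
    "neg_part (V u i j) * lev u i = neg_part (W i j) * Fin (u j)"
    unfolding V_def a by (cases "W i j"; simp)+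
qed

definition vp :: "(nat \<Rightarrow> real) \<Rightarrow> nat \<Rightarrow> (nat \<Rightarrow> trop) \<Rightarrow> trop" where
  "vp u i X = (\<Sum>j\<le>n. pos_part (V u i j) * X j)"

definition vn :: "(nat \<Rightarrow> real) \<Rightarrow> nat \<Rightarrow> (nat \<Rightarrow> trop) \<Rightarrow> trop" where
  "vn u i X = (\<Sum>j\<le>n. neg_part (V u i j) * X j)"

text \<open>Change of coordinates with \<open>u\<close> as origin: a point \<open>u + X\<close>
  satisfies a row iff \<open>X\<close> satisfies the normalized row, since the factor
  \<open>lev u i\<close> can be cancelled.\<close>

lemma row_scale:
  assumes "i < m"
  shows "rowp i (\<lambda>j. Fin (u j) * X j) = lev u i * vp u i X"
    "rown i (\<lambda>j. Fin (u j) * X j) = lev u i * vn u i X"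
  using V_scale[OF assms, of u] unfolding rowp_def rown_def vp_def vn_def sum_distrib_left
  by (auto intro!: sum.cong simp: mult.assoc[symmetric]) (metis mult.commute)+

lemma V_le_1: "i < m \<Longrightarrow> j \<le> n \<Longrightarrow> modulus (V u i j) \<le> 1"
proof -
  assume ij: "i < m" "j \<le> n"
  have "modulus (V u i j) * lev u i \<le> 1 * lev u i"
    using V_scale(1)[OF ij(1), of u j] trop_le_sum[of "{..n}" j "\<lambda>j. modulus (W i j) * Fin (u j)"] ij
    by (simp add: lev_def)
  then show ?thesis using lev_neq_0[OF ij(1), of u] by (metis mult.commute trop_mult_left_le_iff)
qed

lemma V_attained: "i < m \<Longrightarrow> \<exists>j\<le>n. modulus (V u i j) = 1"
proof -
  assume i: "i < m"
  then obtain j where j: "j \<le> n" "modulus (W i j) * Fin (u j) = lev u i"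
    using trop_sum_attained[of "{..n}" "\<lambda>j. modulus (W i j) * Fin (u j)"] lev_neq_0[OF i, of u]
    by (auto simp: lev_def)
  then have "lev u i * modulus (V u i j) = lev u i * 1" using V_scale(1)[OF i, of u j] by (simp add: mult.commute)
  then show ?thesis using j trop_mult_left_cancel[OF lev_neq_0[OF i, of u]] by blast
qed

lemma modulus_eq_1: "modulus x = 1 \<longleftrightarrow> x = Pos 0 \<or> x = Neg 0"
  by (cases x) (auto simp: one_trop_def)

lemma vp_le_1: "i < m \<Longrightarrow> (\<And>j. j \<le> n \<Longrightarrow> X j \<le> 1) \<Longrightarrow> vp u i X \<le> 1"
  unfolding vp_def trop_sum_le_iff[OF finite_atMost]
proof
  fix j assume *: "i < m" "\<And>j. j \<le> n \<Longrightarrow> X j \<le> 1" "j \<in> {..n}"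
  have "pos_part (V u i j) \<le> 1" using V_le_1[of i j u] * by (cases "V u i j") auto
  then have "pos_part (V u i j) * X j \<le> 1 * 1" using * by (intro trop_mult_mono) auto
  then show "pos_part (V u i j) * X j \<le> 1" by simp
qed

lemma vn_le_1: "i < m \<Longrightarrow> (\<And>j. j \<le> n \<Longrightarrow> X j \<le> 1) \<Longrightarrow> vn u i X \<le> 1"
  unfolding vn_def trop_sum_le_iff[OF finite_atMost]
proof
  fix j assume *: "i < m" "\<And>j. j \<le> n \<Longrightarrow> X j \<le> 1" "j \<in> {..n}"
  have "neg_part (V u i j) \<le> 1" using V_le_1[of i j u] * by (cases "V u i j") auto
  then have "neg_part (V u i j) * X j \<le> 1 * 1" using * by (intro trop_mult_mono) auto
  then show "neg_part (V u i j) * X j \<le> 1" by simp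
qed

lemma vp_1_iff: "i < m \<Longrightarrow> vp u i (\<lambda>_. 1) = 1 \<longleftrightarrow> (\<exists>j\<le>n. V u i j = Pos 0)"
proof
  assume i: "i < m" and "vp u i (\<lambda>_. 1) = 1"
  then obtain j where j: "j \<le> n" "pos_part (V u i j) = 1"
    using trop_sum_attained[of "{..n}" "\<lambda>j. pos_part (V u i j) * 1"] by (auto simp: vp_def)
  then show "\<exists>j\<le>n. V u i j = Pos 0" by (cases "V u i j") (auto simp: one_trop_def)
next
  assume i: "i < m" and "\<exists>j\<le>n. V u i j = Pos 0"
  then obtain j where j: "j \<le> n" "V u i j = Pos 0" by blast
  have "1 \<le> vp u i (\<lambda>_. 1)" unfolding vp_def
    using trop_le_sum[of "{..n}" j "\<lambda>j. pos_part (V u i j) * 1"] j by (simp add: one_trop_def)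
  then show "vp u i (\<lambda>_. 1) = 1" using vp_le_1[OF i, of "\<lambda>_. 1"] by (simp add: antisym)
qed

lemma vn_1_iff: "i < m \<Longrightarrow> vn u i (\<lambda>_. 1) = 1 \<longleftrightarrow> (\<exists>j\<le>n. V u i j = Neg 0)"
proof
  assume i: "i < m" and "vn u i (\<lambda>_. 1) = 1"
  then obtain j where j: "j \<le> n" "neg_part (V u i j) = 1"
    using trop_sum_attained[of "{..n}" "\<lambda>j. neg_part (V u i j) * 1"] by (auto simp: vn_def)
  then show "\<exists>j\<le>n. V u i j = Neg 0" by (cases "V u i j") (auto simp: one_trop_def)
next
  assume i: "i < m" and "\<exists>j\<le>n. V u i j = Neg 0"
  then obtain j where j: "j \<le> n" "V u i j = Neg 0" by blast
  have "1 \<le> vn u i (\<lambda>_. 1)" unfolding vn_def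
    using trop_le_sum[of "{..n}" j "\<lambda>j. neg_part (V u i j) * 1"] j by (simp add: one_trop_def)
  then show "vn u i (\<lambda>_. 1) = 1" using vn_le_1[OF i, of "\<lambda>_. 1"] by (simp add: antisym)
qed

text \<open>The row maximum is 1, so at the point itself one of the two sides equals 1. Feasibility
  and tightness therefore depend only on which signs occur among the maximal entries.\<close>

lemma polyhedron_V:
  assumes "u n = 0"
  shows "pt u \<in> trop_polyhedron A b \<longleftrightarrow> (\<forall>i<m. \<exists>j\<le>n. V u i j = Pos 0)"
    and "i < m \<Longrightarrow> pt u \<in> s_hyperplane (row A i) (b $ i) \<longleftrightarrow>
           (\<exists>j\<le>n. V u i j = Pos 0) \<and> (\<exists>j\<le>n. V u i j = Neg 0)"
proof -
  have r: "rowp i (hom (pt u)) = lev u i * vp u i (\<lambda>_. 1)" "rown i (hom (pt u)) = lev u i * vn u i (\<lambda>_. 1)"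
    if "i < m" for i
    using row_scale[OF that, of u "\<lambda>_. 1"] hom_pt[of u, OF assms] by (auto simp: rowp_def rown_def)
  have one: "vp u i (\<lambda>_. 1) = 1 \<or> vn u i (\<lambda>_. 1) = 1" if "i < m" for i
    using V_attained[OF that, of u] vp_1_iff[OF that, of u] vn_1_iff[OF that, of u] modulus_eq_1 by blast
  have le: "vp u i (\<lambda>_. 1) \<le> 1" "vn u i (\<lambda>_. 1) \<le> 1" if "i < m" for i
    using vp_le_1 vn_le_1 that by auto
  have "rown i (hom (pt u)) \<le> rowp i (hom (pt u)) \<longleftrightarrow> (\<exists>j\<le>n. V u i j = Pos 0)" if "i < m" for i
    using one[OF that] le[OF that] vp_1_iff[OF that, of u] r[OF that] trop_mult_left_le_iff[OF lev_neq_0[OF that, of u]]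
    by auto
  then show "pt u \<in> trop_polyhedron A b \<longleftrightarrow> (\<forall>i<m. \<exists>j\<le>n. V u i j = Pos 0)"
    by (auto simp: polyhedron_iff pt_def)
  show "pt u \<in> s_hyperplane (row A i) (b $ i) \<longleftrightarrow> (\<exists>j\<le>n. V u i j = Pos 0) \<and> (\<exists>j\<le>n. V u i j = Neg 0)"
    if i: "i < m"
  proof -
    have "pt u \<in> s_hyperplane (row A i) (b $ i) \<longleftrightarrow> vp u i (\<lambda>_. 1) = vn u i (\<lambda>_. 1)"
      using hyperplane_iff[OF i] r[OF i] trop_mult_left_cancel[OF lev_neq_0[OF i, of u]] by (simp add: pt_def)
    also have "\<dots> \<longleftrightarrow> vp u i (\<lambda>_. 1) = 1 \<and> vn u i (\<lambda>_. 1) = 1" using one[OF i] by metis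
    finally show ?thesis using vp_1_iff[OF i, of u] vn_1_iff[OF i, of u] by simp
  qed
qed

definition tight :: "(nat \<Rightarrow> real) \<Rightarrow> nat set \<Rightarrow> bool" where
  "tight u I \<longleftrightarrow> I \<subseteq> {..<m} \<and> (\<forall>i\<in>I. (\<exists>j\<le>n. V u i j = Pos 0) \<and> (\<exists>j\<le>n. V u i j = Neg 0))"

lemma face_V:
  assumes "u n = 0" "I \<subseteq> {..<m}"
  shows "pt u \<in> trop_face A b I \<longleftrightarrow> (\<forall>i<m. \<exists>j\<le>n. V u i j = Pos 0) \<and> tight u I"
  using polyhedron_V[of u, OF assms(1)] assms(2) unfolding trop_face_def tight_def by blast

lemma face_finite:
  assumes "x \<in> trop_face A b I"
  obtains u where "u n = 0" "x = pt u"
  using assms polyhedron_finite unfolding trop_face_def by blast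

section \<open>The tangent graph\<close>

definition args :: "(nat \<Rightarrow> real) \<Rightarrow> nat \<Rightarrow> nat set" where
  "args u i = {j. j \<le> n \<and> modulus (V u i j) = 1}"

lemma args_iff: "j \<in> args u i \<longleftrightarrow> j \<le> n \<and> (V u i j = Pos 0 \<or> V u i j = Neg 0)"
  by (auto simp: args_def modulus_eq_1)

lemma args_finite [simp]: "finite (args u i)" "args u i \<subseteq> {..n}"
  by (auto simp: args_def)

text \<open>With \<open>u\<close> and the row levels as dual potentials, exactly the edges of the
  tangent graph are saturated. Two matchings of the same rows and columns inside it would be two
  maximizing permutations of one submatrix, against genericity.\<close>

lemma acyclic_args: "acyclic_family {..<m} (args u)"
  unfolding acyclic_family_def
proof (intro allI impI ballI, elim conjE)
  fix R f g r
  assume R: "R \<subseteq> {..<m}" and inj: "inj_on f R" "inj_on g R" and im: "f ` R = g ` R"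
    and args: "\<forall>r\<in>R. f r \<in> args u r \<and> g r \<in> args u r" and r: "r \<in> R"
  define S where "S i = (THE a. lev u i = Fin a)" for i
  have S: "lev u i = Fin (S i)" if "i \<in> R" for i
    using lev_neq_0[of i u] that R unfolding S_def by (cases "lev u i") (auto simp: zero_trop_def)
  have W: "modulus (W i j) * Fin (u j) = modulus (V u i j) * Fin (S i)" if "i \<in> R" for i j
    using V_scale(1)[of i u j] S[OF that] that R by auto
  show "f r = g r"
  proof (rule trop_generic_unique_matching[of "append_col A b" m "Suc n" R "f ` R" f g S u])
    show "trop_generic (append_col A b)" using std by (simp add: standard_lp_def)
    show "append_col A b \<in> carrier_mat m (Suc n)" by (rule W_simps)
    show "f ` R \<subseteq> {..<Suc n}" using args by (auto simp: args_def)
    then show "modulus (W i j) \<le> Fin (S i - u j)" if "i \<in> R" "j \<in> f ` R" for i j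
      using W[OF that(1), of j] V_le_1[of i j u] that(1) R subsetD[OF \<open>f ` R \<subseteq> {..<Suc n}\<close> that(2)]
      by (cases "modulus (W i j)"; cases "modulus (V u i j)") (auto simp: one_trop_def)
    show "modulus (W i (f i)) = Fin (S i - u (f i))" "modulus (W i (g i)) = Fin (S i - u (g i))"
      if "i \<in> R" for i
      using W[OF that, of "f i"] W[OF that, of "g i"] args that
      by (cases "modulus (W i (f i))"; cases "modulus (W i (g i))"; force simp: args_def one_trop_def)+
  qed (use R inj im r in \<open>auto simp: bij_betw_def\<close>)
qed

lemma tight_card_args: "tight u I \<Longrightarrow> i \<in> I \<Longrightarrow> 2 \<le> card (args u i)"
proof -
  assume "tight u I" "i \<in> I"
  then obtain p q where "p \<in> args u i" "q \<in> args u i" "V u i p = Pos 0" "V u i q = Neg 0"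
    unfolding tight_def by (metis args_iff)
  moreover from this have "p \<noteq> q" by auto
  ultimately have "{p, q} \<subseteq> args u i" "card {p, q} = 2" by auto
  then show ?thesis by (metis args_finite(1) card_mono)
qed

lemma tight_finite: "tight u I \<Longrightarrow> finite I"
  by (auto simp: tight_def intro: finite_subset)

lemma tight_args_bound:
  assumes "tight u I" "J \<subseteq> I" "Q \<subseteq> {..n}" "Q \<noteq> {}" "\<And>i. i \<in> J \<Longrightarrow> args u i \<subseteq> Q"
  shows "(\<Sum>i\<in>J. card (args u i) - 1) < card Q"
proof (rule acyclic_family_bound)
  show "acyclic_family J (args u)"
    by (rule acyclic_family_mono[OF acyclic_args]) (use assms in \<open>auto simp: tight_def\<close>)
  show "args u i \<subseteq> Q \<and> args u i \<noteq> {}" if "i \<in> J" for i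
    using that assms tight_card_args[of u I i] by fastforce
  show "finite J" using assms tight_finite finite_subset by blast
  show "finite Q" using assms finite_subset by blast
qed (use assms in auto)

text \<open>A tight row carries a maximal entry of either sign, hence contributes at least 1 to the
  forest count.\<close>

lemma tight_card_bound:
  assumes "tight u I" "J \<subseteq> I" "Q \<subseteq> {..n}" "Q \<noteq> {}" "\<And>i. i \<in> J \<Longrightarrow> args u i \<subseteq> Q"
  shows "card J < card Q"
proof -
  have "card J = (\<Sum>i\<in>J. 1)" by simp
  also have "\<dots> \<le> (\<Sum>i\<in>J. card (args u i) - 1)"
  proof (rule sum_mono)
    fix i assume "i \<in> J"
    then show "1 \<le> card (args u i) - 1" using tight_card_args[of u I i] assms by auto
  qed
  finally show ?thesis using tight_args_bound[OF assms] by simp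
qed

lemma tight_card: "tight u I \<Longrightarrow> card I \<le> n"
  using tight_card_bound[of u I I "{..n}"] by simp

text \<open>The forest bound allows a total of at most \<open>n\<close>, and each of the
  \<open>n\<close> tight rows already contributes 1. There is no room for a third maximal
  entry.\<close>

lemma tight_two_args:
  assumes "tight u I" "card I = n" "i \<in> I"
  shows "card (args u i) = 2"
proof (rule ccontr)
  assume "card (args u i) \<noteq> 2"
  then have "1 < card (args u i) - 1" using tight_card_args[OF assms(1,3)] by simp
  moreover have le: "1 \<le> card (args u k) - 1" if "k \<in> I" for k using tight_card_args[OF assms(1) that] by simp
  ultimately have "(\<Sum>i\<in>I. 1) < (\<Sum>i\<in>I. card (args u i) - 1)"
    using assms(3) tight_finite[OF assms(1)] le by (intro sum_strict_mono_ex1) auto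
  then show False using tight_args_bound[of u I I "{..n}"] assms by simp
qed

text \<open>Connectedness of the tangent graph in the form of a cut condition. If no row crossed the
  cut, the forest bound on both sides would give at most \<open>(card Q - 1) + (n - card Q)\<close>
  rows, one fewer than there are.\<close>

lemma tight_crossing:
  assumes "tight u I" "card I = n" "Q \<subseteq> {..n}" "Q \<noteq> {}" "Q \<noteq> {..n}"
  shows "\<exists>i\<in>I. args u i \<inter> Q \<noteq> {} \<and> args u i - Q \<noteq> {}"
proof (rule ccontr)
  assume not: "\<not> ?thesis"
  let ?I1 = "{i \<in> I. args u i \<subseteq> Q}" and ?I2 = "{i \<in> I. args u i \<subseteq> {..n} - Q}"
  have "I = ?I1 \<union> ?I2" using not by (fastforce simp: args_def)
  then have "card I \<le> card ?I1 + card ?I2" by (metis card_Un_le)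
  moreover have "card ?I1 < card Q" by (rule tight_card_bound[OF assms(1)]) (use assms in auto)
  moreover have "card ?I2 < card ({..n} - Q)" by (rule tight_card_bound[OF assms(1)]) (use assms in auto)
  moreover have "card ({..n} - Q) = Suc n - card Q" using assms(3) by (simp add: card_Diff_subset finite_subset)
  moreover have "card Q \<le> Suc n" using card_mono[OF _ assms(3)] by simp
  ultimately show False using assms(2) by simp
qed

lemma tight_args_pair:
  assumes "tight u I" "card I = n" "i \<in> I"
  obtains p q where "args u i = {p, q}" "p \<noteq> q" "V u i p = Pos 0" "V u i q = Neg 0" "p \<le> n" "q \<le> n"
proof -
  obtain p q where pq: "p \<le> n" "q \<le> n" "V u i p = Pos 0" "V u i q = Neg 0"
    using assms unfolding tight_def by blast
  then have "{p, q} \<subseteq> args u i" "p \<noteq> q" by (auto simp: args_iff)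
  then have "{p, q} = args u i" using tight_two_args[OF assms] by (intro card_subset_eq) auto
  then show thesis using that pq \<open>p \<noteq> q\<close> by metis
qed

text \<open>The rows of the tangent graph force neighbouring entries of a kernel vector to have the same
  sign, and the graph is connected.\<close>

lemma tight_kernel:
  fixes w :: "nat \<Rightarrow> nat \<Rightarrow> real"
  assumes t: "tight u I" "card I = n"
    and w: "\<And>i j. i \<in> I \<Longrightarrow> j \<le> n \<Longrightarrow> V u i j = Pos 0 \<Longrightarrow> 0 < w i j"
      "\<And>i j. i \<in> I \<Longrightarrow> j \<le> n \<Longrightarrow> V u i j = Neg 0 \<Longrightarrow> w i j < 0"
    and ker: "\<And>i. i \<in> I \<Longrightarrow> (\<Sum>j\<in>args u i. w i j * \<eta> j) = 0"
  shows "(\<forall>j\<le>n. 0 < \<eta> j) \<or> (\<forall>j\<le>n. \<eta> j < 0) \<or> (\<forall>j\<le>n. \<eta> j = 0)"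
proof -
  have same: "(0 < \<eta> j \<longleftrightarrow> 0 < \<eta> k) \<and> (\<eta> j < 0 \<longleftrightarrow> \<eta> k < 0)" if i: "i \<in> I" "j \<in> args u i" "k \<in> args u i" for i j k
  proof -
    obtain p q where pq: "args u i = {p, q}" "p \<noteq> q" "V u i p = Pos 0" "V u i q = Neg 0" "p \<le> n" "q \<le> n"
      using tight_args_pair[OF t i(1)] .
    have "0 < w i p" "w i q < 0" using w pq i by auto
    moreover have "w i p * \<eta> p = - w i q * \<eta> q" using ker[OF i(1)] pq by simp
    ultimately have "(0 < \<eta> p \<longleftrightarrow> 0 < \<eta> q) \<and> (\<eta> p < 0 \<longleftrightarrow> \<eta> q < 0)"
      by (smt (verit) mult_pos_pos mult_pos_neg mult_neg_neg mult_neg_pos mult_eq_0_iff)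
    then show ?thesis using i pq by auto
  qed
  have all: "Q = {} \<or> Q = {..n}" if Q: "Q \<subseteq> {..n}" and closed: "\<And>i j k. i \<in> I \<Longrightarrow> j \<in> args u i \<Longrightarrow> k \<in> args u i \<Longrightarrow> j \<in> Q \<Longrightarrow> k \<in> Q" for Q
    using tight_crossing[OF t Q] closed by blast
  have "{j. j \<le> n \<and> 0 < \<eta> j} = {} \<or> {j. j \<le> n \<and> 0 < \<eta> j} = {..n}"
    by (rule all) (use same args_iff in blast)+
  moreover have "{j. j \<le> n \<and> \<eta> j < 0} = {} \<or> {j. j \<le> n \<and> \<eta> j < 0} = {..n}"
    by (rule all) (use same args_iff in blast)+
  ultimately consider "{j. j \<le> n \<and> 0 < \<eta> j} = {..n}" | "{j. j \<le> n \<and> \<eta> j < 0} = {..n}"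
    | "{j. j \<le> n \<and> 0 < \<eta> j} = {}" "{j. j \<le> n \<and> \<eta> j < 0} = {}" by argo
  then show ?thesis
  proof cases
    case 3
    then have "\<not> 0 < \<eta> j" "\<not> \<eta> j < 0" if "j \<le> n" for j using that by blast+
    then show ?thesis by force
  qed auto
qed

end

section \<open>Lifts of a standard program\<close>

lemma det_nonzero_solve:
  fixes M :: "'a :: field mat"
  assumes M: "M \<in> carrier_mat k k" "det M \<noteq> 0"
  shows "r \<in> carrier_vec k \<Longrightarrow> \<exists>x\<in>carrier_vec k. M *\<^sub>v x = r"
    and "x \<in> carrier_vec k \<Longrightarrow> y \<in> carrier_vec k \<Longrightarrow> M *\<^sub>v x = M *\<^sub>v y \<Longrightarrow> x = y"
proof -
  from det_non_zero_imp_unit[OF M, of "()"] obtain B where B: "B \<in> carrier_mat k k"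
    and BM: "B * M = 1\<^sub>m k" and MB: "M * B = 1\<^sub>m k"
    unfolding Units_def ring_mat_def by auto
  show "\<exists>x\<in>carrier_vec k. M *\<^sub>v x = r" if r: "r \<in> carrier_vec k"
    using assoc_mult_mat_vec[OF M(1) B r] MB r B by (intro bexI[of _ "B *\<^sub>v r"]) auto
  show "x = y" if "x \<in> carrier_vec k" "y \<in> carrier_vec k" "M *\<^sub>v x = M *\<^sub>v y"
    using assoc_mult_mat_vec[OF B M(1) that(1)] assoc_mult_mat_vec[OF B M(1) that(2)] BM that by simp
qed

lemma tper_sval_neq_NegInf:
  assumes M: "M \<in> carrier_mat k k" "det M \<noteq> 0"
  shows "tper (map_mat modulus (map_mat sval M)) \<noteq> NegInf"
proof -
  let ?U = "map_mat modulus (map_mat sval M)"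
  obtain p where p: "p permutes {0..<k}" "(\<Prod>i = 0..<k. M $$ (i, p i)) \<noteq> 0"
    using M unfolding det_def'[OF M(1)] by (metis (mono_tags, lifting) mem_Collect_eq mult_zero_right sum.neutral)
  have "p i < k" if "i < k" for i using permutes_in_image[OF p(1), of i] that by simp
  then have "?U $$ (i, p i) \<noteq> 0" if "i < k" for i using p(2) M that by auto
  then have "(\<Prod>i = 0..<k. ?U $$ (i, p i)) \<noteq> 0" by (simp add: trop_prod_eq_0)
  moreover have "(\<Prod>i = 0..<k. ?U $$ (i, p i)) \<le> tper ?U"
    using trop_le_sum[of "{\<sigma>. \<sigma> permutes {0..<k}}" p "\<lambda>\<sigma>. \<Prod>i = 0..<k. ?U $$ (i, \<sigma> i)"] M p(1)
    by (simp add: tper_def finite_permutations)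
  ultimately show ?thesis by (auto simp flip: zero_trop_def)
qed

lemma map_mat_submatrix: "map_mat f (submatrix M R C) = submatrix (map_mat f M) R C"
proof -
  have "pick R i < dim_row M" if "i < card {i. i < dim_row M \<and> i \<in> R}" for i
    using pick_le[OF that] .
  moreover have "pick C j < dim_col M" if "j < card {j. j < dim_col M \<and> j \<in> C}" for j
    using pick_le[OF that] .
  ultimately show ?thesis by (intro eq_matI) (auto simp: submatrix_def)
qed

lemma val_max_0: "val (max x 0) = pos_part (sval x)" "val (max (- x) 0) = neg_part (sval x)"
  by (cases x rule: sval_cases; simp add: max_def)+

locale trop_lift = trop_program +
  fixes \<AA> :: "puiseux mat" and \<bb> :: "puiseux vec" and \<cc> :: "puiseux vec"
  assumes lift: "is_lift \<AA> \<bb> \<cc> A b c"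
begin

lemma lift_dims: "\<AA> \<in> carrier_mat m n" "\<bb> \<in> carrier_vec m" "\<cc> \<in> carrier_vec n"
  "dim_row \<AA> = m" "dim_col \<AA> = n" "dim_vec \<bb> = m" "dim_vec \<cc> = n"
proof -
  have "map_mat sval \<AA> \<in> carrier_mat m n" "map_vec sval \<bb> \<in> carrier_vec m"
    "map_vec sval \<cc> \<in> carrier_vec n"
    using lift dims by (auto simp: is_lift_def)
  then show "\<AA> \<in> carrier_mat m n" "\<bb> \<in> carrier_vec m" "\<cc> \<in> carrier_vec n"
    "dim_row \<AA> = m" "dim_col \<AA> = n" "dim_vec \<bb> = m" "dim_vec \<cc> = n" by auto
qed

abbreviation \<WW> :: "nat \<Rightarrow> nat \<Rightarrow> puiseux" where
  "\<WW> i j \<equiv> append_col \<AA> \<bb> $$ (i, j)"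

lemma WW_simps: "i < m \<Longrightarrow> j < n \<Longrightarrow> \<WW> i j = \<AA> $$ (i, j)" "i < m \<Longrightarrow> \<WW> i n = \<bb> $ i"
  using lift_dims by (auto simp: append_col_def)

lemma sval_AA: "i < m \<Longrightarrow> j < n \<Longrightarrow> sval (\<AA> $$ (i, j)) = A $$ (i, j)"
  and sval_bb: "i < m \<Longrightarrow> sval (\<bb> $ i) = b $ i"
  and sval_cc: "j < n \<Longrightarrow> sval (\<cc> $ j) = of_trop (c $ j)"
proof -
  have l: "A = map_mat sval \<AA>" "b = map_vec sval \<bb>" "map_vec sval \<cc> = map_vec of_trop c"
    using lift by (auto simp: is_lift_def)
  show "i < m \<Longrightarrow> j < n \<Longrightarrow> sval (\<AA> $$ (i, j)) = A $$ (i, j)" "i < m \<Longrightarrow> sval (\<bb> $ i) = b $ i"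
    unfolding l(1,2) using lift_dims by auto
  show "j < n \<Longrightarrow> sval (\<cc> $ j) = of_trop (c $ j)"
    using arg_cong[OF l(3), of "\<lambda>v. v $ j"] lift_dims dims by simp
qed

lemma sval_WW: "i < m \<Longrightarrow> j \<le> n \<Longrightarrow> sval (\<WW> i j) = W i j"
  using WW_simps W_simps sval_AA sval_bb by (cases "j = n") auto

text \<open>Homogeneous, so that it covers affine points (last coordinate 1) as well as kernel
  vectors of the matrix alone (last coordinate 0).\<close>

definition slk :: "nat \<Rightarrow> (nat \<Rightarrow> puiseux) \<Rightarrow> puiseux" where
  "slk i X = (\<Sum>j\<le>n. \<WW> i j * X j)"

definition phom :: "puiseux vec \<Rightarrow> nat \<Rightarrow> puiseux" where
  "phom x j = (if j < n then x $ j else 1)"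

abbreviation slack :: "nat \<Rightarrow> puiseux vec \<Rightarrow> puiseux" where
  "slack i x \<equiv> slk i (phom x)"

lemma row_AA_prod: "x \<in> carrier_vec n \<Longrightarrow> i < m \<Longrightarrow> row \<AA> i \<bullet> x = (\<Sum>j<n. \<AA> $$ (i, j) * x $ j)"
  using lift_dims by (simp add: scalar_prod_def atLeast0LessThan)

lemma slack_eq: "x \<in> carrier_vec n \<Longrightarrow> i < m \<Longrightarrow> row \<AA> i \<bullet> x + \<bb> $ i = slack i x"
  using row_AA_prod by (simp add: slk_def phom_def lessThan_Suc_atMost[symmetric] WW_simps)

lemma puiseux_polyhedron_iff:
  "x \<in> puiseux_polyhedron \<AA> \<bb> \<longleftrightarrow> x \<in> carrier_vec n \<and> (\<forall>i<m. 0 \<le> slack i x)"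
  using lift_dims slack_eq by (auto simp: puiseux_polyhedron_def less_eq_vec_def)

lemma puiseux_face_iff:
  "I \<subseteq> {..<m} \<Longrightarrow> x \<in> puiseux_face \<AA> \<bb> I \<longleftrightarrow> x \<in> carrier_vec n \<and> (\<forall>i<m. 0 \<le> slack i x) \<and> (\<forall>i\<in>I. slack i x = 0)"
  using slack_eq by (auto simp: puiseux_face_def puiseux_polyhedron_iff subset_iff)

text \<open>Separating the coefficients by sign leaves two sums of nonnegative terms. Neither can
  cancel, so their valuations are the two sides of the tropical inequality.\<close>

lemma slk_split:
  assumes X: "\<And>j. j \<le> n \<Longrightarrow> 0 \<le> X j" and i: "i < m"
  obtains P N where "0 \<le> P" "0 \<le> N" "slk i X = P - N"
    "val P = rowp i (\<lambda>j. val (X j))" "val N = rown i (\<lambda>j. val (X j))"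
proof -
  define P where "P = (\<Sum>j\<le>n. max (\<WW> i j) 0 * X j)"
  define N where "N = (\<Sum>j\<le>n. max (- \<WW> i j) 0 * X j)"
  have parts: "val (max (\<WW> i j) 0) = pos_part (W i j)" "val (max (- \<WW> i j) 0) = neg_part (W i j)" if "j \<le> n" for j
    unfolding sval_WW[OF i that, symmetric] by (rule val_max_0)+
  have "0 \<le> P" "0 \<le> N" unfolding P_def N_def using X by (auto intro!: sum_nonneg mult_nonneg_nonneg)
  moreover have "slk i X = P - N"
    unfolding slk_def P_def N_def sum_subtractf[symmetric] by (intro sum.cong) (auto simp: max_def)
  moreover have "val P = rowp i (\<lambda>j. val (X j))" "val N = rown i (\<lambda>j. val (X j))"
    unfolding P_def N_def rowp_def rown_def
    using X parts by (subst val_sum_nonneg; auto intro!: sum.cong mult_nonneg_nonneg)+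
  ultimately show thesis by (rule that)
qed

lemma slk_nonneg_imp: "(\<And>j. j \<le> n \<Longrightarrow> 0 \<le> X j) \<Longrightarrow> i < m \<Longrightarrow> 0 \<le> slk i X \<Longrightarrow>
    rown i (\<lambda>j. val (X j)) \<le> rowp i (\<lambda>j. val (X j))"
  by (rule slk_split[of X i]) (auto dest: val_mono)

lemma slk_zero_imp: "(\<And>j. j \<le> n \<Longrightarrow> 0 \<le> X j) \<Longrightarrow> i < m \<Longrightarrow> slk i X = 0 \<Longrightarrow>
    rowp i (\<lambda>j. val (X j)) = rown i (\<lambda>j. val (X j))"
  by (rule slk_split[of X i]) auto

lemma slk_pos: "(\<And>j. j \<le> n \<Longrightarrow> 0 \<le> X j) \<Longrightarrow> i < m \<Longrightarrow>
    rown i (\<lambda>j. val (X j)) < rowp i (\<lambda>j. val (X j)) \<Longrightarrow> 0 < slk i X"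
  by (rule slk_split[of X i]) (auto dest: val_mono simp: not_le[symmetric])

lemma val_in_polyhedron:
  assumes "x \<in> puiseux_polyhedron \<AA> \<bb>" "\<And>j. j < n \<Longrightarrow> 0 \<le> x $ j"
  shows "map_vec val x \<in> trop_polyhedron A b"
    "i < m \<Longrightarrow> slack i x = 0 \<Longrightarrow> map_vec val x \<in> s_hyperplane (row A i) (b $ i)"
proof -
  have x: "x \<in> carrier_vec n" "\<And>i. i < m \<Longrightarrow> 0 \<le> slack i x" using assms by (auto simp: puiseux_polyhedron_iff)
  have h: "rowp i (hom (map_vec val x)) = rowp i (\<lambda>j. val (phom x j))"
    "rown i (hom (map_vec val x)) = rown i (\<lambda>j. val (phom x j))" for i
    using x unfolding rowp_def rown_def by (auto intro!: sum.cong simp: hom_def phom_def)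
  have p: "0 \<le> phom x j" if "j \<le> n" for j using assms(2) by (auto simp: phom_def)
  show "map_vec val x \<in> trop_polyhedron A b"
    using slk_nonneg_imp[OF p] x by (auto simp: polyhedron_iff h)
  show "map_vec val x \<in> s_hyperplane (row A i) (b $ i)" if "i < m" "slack i x = 0"
    using slk_zero_imp[OF p that] x that by (simp add: hyperplane_iff h)
qed

text \<open>Comparing the coefficients at the dominant exponents reduces a linear relation over the
  Puiseux series to one over the reals whose support is the tangent graph.\<close>

lemma lift_kernel:
  assumes t: "tight u I" "card I = n" and ker: "\<And>i. i \<in> I \<Longrightarrow> slk i X = 0"
    and nz: "j0 \<le> n" "X j0 \<noteq> 0"
  obtains M where "\<And>j. j \<le> n \<Longrightarrow> val (X j) = Fin (M + u j)"
    "(\<forall>j\<le>n. 0 < X j) \<or> (\<forall>j\<le>n. X j < 0)"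
proof -
  define Z where "Z = {j. j \<le> n \<and> X j \<noteq> 0}"
  define \<nu> where "\<nu> j = - lead_exp (X j) - u j" for j
  \<comment> \<open>The smallest shift for which \<open>M + u\<close> dominates the valuations of
    \<open>X\<close>. The coefficients at these levels form a real vector which is not zero.\<close>
  define M where "M = Max (\<nu> ` Z)"
  have Z: "finite Z" "Z \<noteq> {}" using nz by (auto simp: Z_def)
  have le: "val (X j) \<le> Fin (M + u j)" if "j \<le> n" for j
  proof (cases "X j = 0")
    case False
    then have "\<nu> j \<le> M" unfolding M_def using Z that by (intro Max_ge) (auto simp: Z_def)
    then show ?thesis using False by (simp add: val_def \<nu>_def)
  qed (simp add: val_def)
  define \<eta> where "\<eta> j = pcoeff (X j) (- (M + u j))" for j
  have "M \<in> \<nu> ` Z" unfolding M_def using Z by (intro Max_in) auto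
  then obtain k where k: "k \<le> n" "X k \<noteq> 0" "M = \<nu> k" by (auto simp: Z_def)
  then have "val (X k) = Fin (M + u k)" by (simp add: val_def \<nu>_def)
  then have \<eta>k: "\<eta> k \<noteq> 0" using val_eq_iff by (simp add: \<eta>_def)
  define S where "S i = (THE a. lev u i = Fin a)" for i
  have I: "i < m" if "i \<in> I" for i using t that by (auto simp: tight_def)
  have S: "lev u i = Fin (S i)" if "i \<in> I" for i
    using lev_neq_0[OF I[OF that], of u] unfolding S_def by (cases "lev u i") (auto simp: zero_trop_def)
  have WV: "modulus (W i j) * Fin (u j) = modulus (V u i j) * Fin (S i)"
    "pos_part (W i j) * Fin (u j) = pos_part (V u i j) * Fin (S i)"
    "neg_part (W i j) * Fin (u j) = neg_part (V u i j) * Fin (S i)" if "i \<in> I" for i j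
    using V_scale[OF I[OF that], of u j] S[OF that] by auto
  define w where "w i j = pcoeff (\<WW> i j) (- (S i - u j))" for i j
  have vW: "val (\<WW> i j) = modulus (W i j)" if "i \<in> I" "j \<le> n" for i j
    using sval_WW[OF I[OF that(1)] that(2)] by (metis modulus_sval)
  have Wle: "val (\<WW> i j) \<le> Fin (S i - u j)" if "i \<in> I" "j \<le> n" for i j
    using WV(1)[OF that(1), of j] V_le_1[OF I[OF that(1)] that(2), of u] vW[OF that]
    by (cases "modulus (W i j)"; cases "modulus (V u i j)") (auto simp: one_trop_def)
  have pcoeff0: "pcoeff (\<WW> i j) (- (S i - u j)) = 0" if "i \<in> I" "j \<le> n" "j \<notin> args u i" for i j
  proof -
    have "modulus (V u i j) < 1" using V_le_1[OF I[OF that(1)] that(2), of u] that by (auto simp: args_def less_le)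
    then have "val (\<WW> i j) < Fin (S i - u j)"
      using WV(1)[OF that(1), of j] vW[OF that(1,2)]
      by (cases "modulus (W i j)"; cases "modulus (V u i j)") (auto simp: one_trop_def less_le)
    then show ?thesis using val_less_iff by blast
  qed
  have ker': "(\<Sum>j\<in>args u i. w i j * \<eta> j) = 0" if i: "i \<in> I" for i
  proof -
    have "0 = pcoeff (slk i X) (- (S i + M))" using ker[OF i] by simp
    \<comment> \<open>The level \<open>S i - u j\<close> of the entry and the level
      \<open>M + u j\<close> of the coordinate have a sum that does not depend on \<open>j\<close>,
      so one coefficient of the relation collects all dominant terms.\<close>
    also have "\<dots> = (\<Sum>j\<le>n. pcoeff (\<WW> i j * X j) (- ((S i - u j) + (M + u j))))"
      by (simp add: slk_def pcoeff_sum)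
    also have "\<dots> = (\<Sum>j\<le>n. w i j * \<eta> j)"
      unfolding w_def \<eta>_def
      by (intro sum.cong[OF refl] pcoeff_mult_level Wle[OF i] le) auto
    also have "\<dots> = (\<Sum>j\<in>args u i. w i j * \<eta> j)"
      by (rule sum.mono_neutral_right) (use pcoeff0[OF i] in \<open>auto simp: w_def args_def\<close>)
    finally show ?thesis by simp
  qed
  have wpos: "0 < w i j" if "i \<in> I" "j \<le> n" "V u i j = Pos 0" for i j
  proof -
    have "W i j = Pos (S i - u j)" using WV(2)[OF that(1), of j] that(3) by (cases "W i j") auto
    then have "sval (\<WW> i j) = Pos (S i - u j)" using sval_WW[OF I[OF that(1)] that(2)] by simp
    then show ?thesis unfolding sval_eq_Pos w_def using val_positive_iff by blast
  qed
  have wneg: "w i j < 0" if "i \<in> I" "j \<le> n" "V u i j = Neg 0" for i j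
  proof -
    have "W i j = Neg (S i - u j)" using WV(3)[OF that(1), of j] that(3) by (cases "W i j") auto
    then have "sval (\<WW> i j) = Neg (S i - u j)" using sval_WW[OF I[OF that(1)] that(2)] by simp
    then have "0 < - \<WW> i j \<and> val (- \<WW> i j) = Fin (S i - u j)" unfolding sval_eq_Neg by simp
    then have "0 < pcoeff (- \<WW> i j) (- (S i - u j))" using val_positive_iff by blast
    then show ?thesis by (simp add: w_def)
  qed
  have tri: "(\<forall>j\<le>n. 0 < \<eta> j) \<or> (\<forall>j\<le>n. \<eta> j < 0) \<or> (\<forall>j\<le>n. \<eta> j = 0)"
    by (rule tight_kernel[OF t wpos wneg ker'])
  have v: "val (X j) = Fin (M + u j)" if "j \<le> n" "\<eta> j \<noteq> 0" for j
    using le[OF that(1)] that(2) val_eq_iff by (simp add: \<eta>_def)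
  have pos: "0 < X j" if "j \<le> n" "0 < \<eta> j" for j
    using le[OF that(1)] that(2) val_positive_iff unfolding \<eta>_def by blast
  have neg: "X j < 0" if "j \<le> n" "\<eta> j < 0" for j
    using le[OF that(1)] that(2) val_positive_iff[of "- X j" "M + u j"] by (simp add: \<eta>_def)
  show thesis
  proof (rule that[of M])
    show "val (X j) = Fin (M + u j)" if "j \<le> n" for j using v[OF that] tri \<eta>k k(1) that by force
    show "(\<forall>j\<le>n. 0 < X j) \<or> (\<forall>j\<le>n. X j < 0)" using tri \<eta>k k(1) pos neg by blast
  qed
qed

lemma submatrix_AA:
  assumes "I \<subseteq> {..<m}" "card I = n"
  shows "submatrix \<AA> I UNIV \<in> carrier_mat n n"
    "\<And>r j. r < n \<Longrightarrow> j < n \<Longrightarrow> submatrix \<AA> I UNIV $$ (r, j) = \<AA> $$ (pick I r, j)"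
    "\<And>x r. x \<in> carrier_vec n \<Longrightarrow> r < n \<Longrightarrow> (submatrix \<AA> I UNIV *\<^sub>v x) $ r = row \<AA> (pick I r) \<bullet> x"
proof -
  have "{i. i < m \<and> i \<in> I} = I" "{j. j < n \<and> j \<in> (UNIV :: nat set)} = {..<n}" using assms by auto
  then show s: "submatrix \<AA> I UNIV \<in> carrier_mat n n"
    "\<And>r j. r < n \<Longrightarrow> j < n \<Longrightarrow> submatrix \<AA> I UNIV $$ (r, j) = \<AA> $$ (pick I r, j)"
    using lift_dims assms by (auto simp: submatrix_def pick_UNIV)
  show "(submatrix \<AA> I UNIV *\<^sub>v x) $ r = row \<AA> (pick I r) \<bullet> x" if "x \<in> carrier_vec n" "r < n" for x r
  proof -
    have "pick I r \<in> I" using pick_in_set_le assms that by simp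
    then have "pick I r < m" using assms by auto
    then have "row (submatrix \<AA> I UNIV) r = row \<AA> (pick I r)"
      using s that lift_dims by (intro eq_vecI) auto
    then show ?thesis using s that by simp
  qed
qed

lemma pick_surj:
  assumes "I \<subseteq> {..<m}" "card I = n" "i \<in> I"
  obtains r where "r < n" "pick I r = i"
  using bij_betw_imp_surj_on[OF bij_betw_pick[of I]] assms finite_subset[OF assms(1)]
  by (metis finite_lessThan imageE lessThan_iff)

text \<open>A kernel vector extended by last coordinate 0 would satisfy the hypotheses of
  \<open>lift_kernel\<close>, which makes every coordinate nonzero, including the last one.\<close>

lemma det_neq_0:
  assumes t: "tight u I" "card I = n"
  shows "det (submatrix \<AA> I UNIV) \<noteq> 0"
proof
  have I: "I \<subseteq> {..<m}" using t by (simp add: tight_def)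
  note sub = submatrix_AA[OF I t(2)]
  assume "det (submatrix \<AA> I UNIV) = 0"
  then obtain v where v: "v \<in> carrier_vec n" "v \<noteq> 0\<^sub>v n" "submatrix \<AA> I UNIV *\<^sub>v v = 0\<^sub>v n"
    using det_0_iff_vec_prod_zero_field[OF sub(1)] by blast
  define X where "X j = (if j < n then v $ j else 0)" for j
  have "slk i X = 0" if i: "i \<in> I" for i
  proof -
    obtain r where r: "r < n" "pick I r = i" using pick_surj[OF I t(2) i] .
    have "slk i X = row \<AA> i \<bullet> v"
      using I i row_AA_prod[OF v(1), of i] by (auto simp: slk_def X_def lessThan_Suc_atMost[symmetric] WW_simps)
    also have "\<dots> = 0" using sub(3)[OF v(1) r(1)] v(3) r by simp
    finally show ?thesis .
  qed
  moreover obtain j where "j < n" "v $ j \<noteq> 0" using v(1,2) by (metis carrier_vecD eq_vecI index_zero_vec)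
  then have "j \<le> n" "X j \<noteq> 0" by (auto simp: X_def)
  ultimately obtain M where "\<And>j. j \<le> n \<Longrightarrow> val (X j) = Fin (M + u j)" using lift_kernel[OF t] by blast
  from this[of n] show False by (simp add: X_def)
qed

lemma slack_inj:
  assumes I: "I \<subseteq> {..<m}" "card I = n" "det (submatrix \<AA> I UNIV) \<noteq> 0"
    and x: "x \<in> carrier_vec n" "y \<in> carrier_vec n" "\<And>i. i \<in> I \<Longrightarrow> slack i x = slack i y"
  shows "x = y"
proof (rule det_nonzero_solve(2)[OF submatrix_AA(1)[OF I(1,2)] I(3) x(1,2)])
  note sub = submatrix_AA[OF I(1,2)]
  show "submatrix \<AA> I UNIV *\<^sub>v x = submatrix \<AA> I UNIV *\<^sub>v y"
  proof (rule eq_vecI)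
    fix r assume "r < dim_vec (submatrix \<AA> I UNIV *\<^sub>v y)"
    then have r: "r < n" using sub(1) by simp
    then have "pick I r \<in> I" using pick_in_set_le I by simp
    then have "row \<AA> (pick I r) \<bullet> x = row \<AA> (pick I r) \<bullet> y"
      using x slack_eq[OF x(1), of "pick I r"] slack_eq[OF x(2), of "pick I r"] I(1) by auto
    then show "(submatrix \<AA> I UNIV *\<^sub>v x) $ r = (submatrix \<AA> I UNIV *\<^sub>v y) $ r"
      using sub(3) x r by simp
  qed (use sub(1) in simp)
qed

lemma basic_point:
  assumes I: "I \<subseteq> {..<m}" "card I = n" "det (submatrix \<AA> I UNIV) \<noteq> 0"
  shows "puiseux_basic_point \<AA> \<bb> I \<in> carrier_vec n"
    "\<And>i. i \<in> I \<Longrightarrow> slack i (puiseux_basic_point \<AA> \<bb> I) = 0"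
    "\<And>x. x \<in> carrier_vec n \<Longrightarrow> (\<And>i. i \<in> I \<Longrightarrow> slack i x = 0) \<Longrightarrow> puiseux_basic_point \<AA> \<bb> I = x"
proof -
  note sub = submatrix_AA[OF I(1,2)]
  let ?P = "\<lambda>x. x \<in> carrier_vec n \<and> (\<forall>i\<in>I. row \<AA> i \<bullet> x + \<bb> $ i = 0)"
  have P: "?P x \<longleftrightarrow> x \<in> carrier_vec n \<and> (\<forall>i\<in>I. slack i x = 0)" for x
    using slack_eq I(1) by (auto simp: subset_iff)
  obtain x where x: "x \<in> carrier_vec n" "submatrix \<AA> I UNIV *\<^sub>v x = vec n (\<lambda>r. - \<bb> $ pick I r)"
    using det_nonzero_solve(1)[OF sub(1) I(3), of "vec n (\<lambda>r. - \<bb> $ pick I r)"] by auto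
  have "row \<AA> i \<bullet> x + \<bb> $ i = 0" if i: "i \<in> I" for i
  proof -
    obtain r where r: "r < n" "pick I r = i" using pick_surj[OF I(1,2) i] .
    then show ?thesis using sub(3)[OF x(1) r(1)] x(2) by simp
  qed
  then have "?P x" using x by simp
  moreover have "y = x" if "?P y" for y
    using slack_inj[OF I, of y x] that \<open>?P x\<close> P by metis
  ultimately have "\<exists>!x. ?P x" by blast
  from theI'[OF this] this have "?P (puiseux_basic_point \<AA> \<bb> I)" "\<And>y. ?P y \<Longrightarrow> puiseux_basic_point \<AA> \<bb> I = y"
    unfolding puiseux_basic_point_def lift_dims by auto
  then show "puiseux_basic_point \<AA> \<bb> I \<in> carrier_vec n"
    "\<And>i. i \<in> I \<Longrightarrow> slack i (puiseux_basic_point \<AA> \<bb> I) = 0"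
    "\<And>x. x \<in> carrier_vec n \<Longrightarrow> (\<And>i. i \<in> I \<Longrightarrow> slack i x = 0) \<Longrightarrow> puiseux_basic_point \<AA> \<bb> I = x"
    using P by blast+
qed

text \<open>The homogenized basic point lies in the kernel of the rows of \<open>I\<close>, so its
  valuation is \<open>u\<close> up to a shift and its coordinates have one sign. The last coordinate
  1 makes the shift zero and the sign positive.\<close>

lemma lift_basic_point:
  assumes I: "I \<subseteq> {..<m}" "card I = n" and u: "u n = 0" "pt u \<in> trop_face A b I"
  defines "x \<equiv> puiseux_basic_point \<AA> \<bb> I"
  shows "det (submatrix \<AA> I UNIV) \<noteq> 0" "x \<in> carrier_vec n" "\<And>i. i \<in> I \<Longrightarrow> slack i x = 0"
    "\<And>j. j < n \<Longrightarrow> 0 < x $ j" "map_vec val x = pt u"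
    "\<And>i. i < m \<Longrightarrow> i \<notin> I \<Longrightarrow> 0 < slack i x" "puiseux_basic \<AA> \<bb> I"
proof -
  have t: "tight u I" and pos: "\<And>i. i < m \<Longrightarrow> \<exists>j\<le>n. V u i j = Pos 0" using face_V[of u, OF u(1) I(1)] u(2) by auto
  show d: "det (submatrix \<AA> I UNIV) \<noteq> 0" by (rule det_neq_0[OF t I(2)])
  note bp = basic_point[OF I d, folded x_def]
  show x: "x \<in> carrier_vec n" "\<And>i. i \<in> I \<Longrightarrow> slack i x = 0" by (fact bp)+
  obtain M where M: "\<And>j. j \<le> n \<Longrightarrow> val (phom x j) = Fin (M + u j)"
    "(\<forall>j\<le>n. 0 < phom x j) \<or> (\<forall>j\<le>n. phom x j < 0)"
    by (rule lift_kernel[OF t I(2) x(2), of n]) (auto simp: phom_def)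
  have "M = 0" using M(1)[of n] u(1) by (simp add: phom_def one_trop_def)
  have "\<not> phom x n < 0" by (simp add: phom_def)
  then have p: "\<And>j. j \<le> n \<Longrightarrow> 0 < phom x j" using M(2) by blast
  then show xp: "0 < x $ j" if "j < n" for j using p[of j] that by (simp add: phom_def)
  have v: "val (phom x j) = Fin (u j)" if "j \<le> n" for j using M(1)[OF that] \<open>M = 0\<close> by simp
  have "val (x $ j) = Fin (u j)" if "j < n" for j using v[of j] that by (simp add: phom_def)
  then show "map_vec val x = pt u" using x(1) by (intro eq_vecI) (auto simp: pt_def)
  have slack: "0 < slack i x" if i: "i < m" "i \<notin> I" for i
  proof (rule slk_pos)
    \<comment> \<open>\<open>n + 1\<close> tight rows would exceed the forest bound. Hence row
      \<open>i\<close> has no negative maximal entry and its inequality is strict.\<close>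
    have "\<not> tight u (insert i I)" using tight_card[of u "insert i I"] I i tight_finite[OF t] by auto
    then have "\<not> (\<exists>j\<le>n. V u i j = Neg 0)" using t pos[OF i(1)] i(1) by (auto simp: tight_def)
    then have "vn u i (\<lambda>_. 1) < 1" "vp u i (\<lambda>_. 1) = 1"
      using vn_1_iff[OF i(1), of u] vn_le_1[OF i(1), of "\<lambda>_. 1" u] vp_1_iff[OF i(1), of u] pos[OF i(1)] by (auto simp: less_le)
    then have "rown i (\<lambda>j. Fin (u j) * 1) < rowp i (\<lambda>j. Fin (u j) * 1)"
      unfolding row_scale[OF i(1)] using trop_mult_left_le_iff[OF lev_neq_0[OF i(1), of u]] by (metis not_le)
    then show "rown i (\<lambda>j. val (phom x j)) < rowp i (\<lambda>j. val (phom x j))"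
      using v by (simp add: rowp_def rown_def)
  qed (use p i in \<open>auto intro: less_imp_le\<close>)
  then show "\<And>i. i < m \<Longrightarrow> i \<notin> I \<Longrightarrow> 0 < slack i x" .
  have "0 \<le> slack i x" if "i < m" for i
    using x(2)[of i] slack[OF that] by (cases "i \<in> I") auto
  then have "x \<in> puiseux_polyhedron \<AA> \<bb>" using x by (simp add: puiseux_polyhedron_iff)
  then show "puiseux_basic \<AA> \<bb> I" using I d by (simp add: puiseux_basic_def lift_dims x_def)
qed

lemma phom_combination:
  "slack i (vec n (\<lambda>j. (1 - s) * x $ j + s * y $ j)) = (1 - s) * slack i x + s * slack i y"
proof -
  have "phom (vec n (\<lambda>j. (1 - s) * x $ j + s * y $ j)) j = (1 - s) * phom x j + s * phom y j" for j
    by (simp add: phom_def)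
  then have "slack i (vec n (\<lambda>j. (1 - s) * x $ j + s * y $ j)) = (\<Sum>j\<le>n. \<WW> i j * ((1 - s) * phom x j + s * phom y j))"
    unfolding slk_def by presburger
  then show ?thesis unfolding slk_def by (simp add: distrib_left sum.distrib sum_distrib_left mult_ac)
qed

text \<open>On the segment from a positive point to a point with a nonpositive coordinate, the first point
  with a vanishing coordinate would violate the finiteness of the tropical cone.\<close>

lemma polyhedron_positive:
  assumes p: "p \<in> puiseux_polyhedron \<AA> \<bb>" "\<And>j. j < n \<Longrightarrow> 0 < p $ j"
    and x: "x \<in> puiseux_polyhedron \<AA> \<bb>" and j: "j < n"
  shows "0 < x $ j"
proof (rule ccontr)
  assume neg: "\<not> 0 < x $ j"
  define J where "J = {j. j < n \<and> x $ j \<le> 0}"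
  define \<tau> where "\<tau> j = p $ j / (p $ j - x $ j)" for j
  define s where "s = Min (\<tau> ` J)"
  have J: "finite J" "J \<noteq> {}" using j neg by (auto simp: J_def)
  have d: "0 < p $ j - x $ j" if "j \<in> J" for j using that p(2)[of j] by (auto simp: J_def)
  have "s \<in> \<tau> ` J" unfolding s_def using J by (intro Min_in) auto
  then obtain k where k: "k \<in> J" "s = \<tau> k" by auto
  have s0: "0 < s" unfolding k(2) \<tau>_def using k(1) d[OF k(1)] p(2)[of k] by (auto simp: J_def)
  have s1: "s \<le> 1" unfolding k(2) \<tau>_def using k(1) d[OF k(1)] by (auto simp: J_def divide_le_eq_1)
  define z where "z = vec n (\<lambda>j. (1 - s) * p $ j + s * x $ j)"
  have z: "0 \<le> z $ j" if "j < n" for j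
  proof (cases "j \<in> J")
    case True
    have "s \<le> \<tau> j" unfolding s_def using J True by (intro Min_le) auto
    then have "s * (p $ j - x $ j) \<le> p $ j" using d[OF True] by (simp add: \<tau>_def pos_le_divide_eq)
    then show ?thesis using that by (simp add: z_def algebra_simps)
  next
    case False
    then have "0 < x $ j" using that by (auto simp: J_def)
    then show ?thesis using p(2)[OF that] s0 s1 that by (simp add: z_def)
  qed
  have "s * (p $ k - x $ k) = p $ k" using d[OF k(1)] by (simp add: k(2) \<tau>_def)
  then have zk: "z $ k = 0" using k(1) by (simp add: z_def J_def algebra_simps)
  have "z \<in> puiseux_polyhedron \<AA> \<bb>"
    using p(1) x s0 s1 by (auto simp: puiseux_polyhedron_iff z_def phom_combination)
  from val_in_polyhedron(1)[OF this z] have "map_vec val z \<in> trop_polyhedron A b" .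
  then obtain v where "map_vec val z = pt v" using polyhedron_finite by blast
  then have "map_vec val z $ k = pt v $ k" by simp
  then show False using zk k(1) by (simp add: z_def pt_def J_def)
qed

end

context trop_program
begin

lemma coeff_lift_is_lift:
  assumes "0 < r" "0 < s"
  shows "trop_lift n m A b c (map_mat (coeff_lift r s) A) (map_vec (coeff_lift r s) b) (map_vec (coeff_lift r s \<circ> of_trop) c)"
proof
  have "sval (coeff_lift r s x) = x" for x by (rule sval_coeff_lift[OF assms])
  then show "is_lift (map_mat (coeff_lift r s) A) (map_vec (coeff_lift r s) b) (map_vec (coeff_lift r s \<circ> of_trop) c) A b c"
    by (auto simp: is_lift_def intro!: eq_matI eq_vecI)
qed

text \<open>Both points are the valuation of the same basic point of any one lift.\<close>

lemma face_unique:
  assumes "I \<subseteq> {..<m}" "card I = n" "x \<in> trop_face A b I" "y \<in> trop_face A b I"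
  shows "x = y"
proof -
  obtain \<AA> \<bb> \<cc> where "trop_lift n m A b c \<AA> \<bb> \<cc>" using coeff_lift_is_lift[of 1 1] by auto
  then interpret trop_lift n m A b c \<AA> \<bb> \<cc> .
  obtain u v where "u n = 0" "x = pt u" "v n = 0" "y = pt v" using assms face_finite by metis
  then show ?thesis using lift_basic_point(5)[OF assms(1,2), of u] lift_basic_point(5)[OF assms(1,2), of v] assms by metis
qed

text \<open>A nonempty face of \<open>n\<close> rows is enough: the determinant of a lift does not
  vanish, so some permutation of the tropical submatrix has finite weight.\<close>

lemma trop_basicI:
  assumes I: "I \<subseteq> {..<m}" "card I = n" "x \<in> trop_face A b I"
  shows "trop_basic A b I"
proof -
  obtain \<AA> \<bb> \<cc> where "trop_lift n m A b c \<AA> \<bb> \<cc>" using coeff_lift_is_lift[of 1 1] by auto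
  then interpret trop_lift n m A b c \<AA> \<bb> \<cc> .
  obtain u where "u n = 0" "x = pt u" using assms face_finite by metis
  then have "det (submatrix \<AA> I UNIV) \<noteq> 0" using lift_basic_point(1)[OF I(1,2)] I(3) by metis
  from tper_sval_neq_NegInf[OF submatrix_AA(1)[OF I(1,2)] this]
  have "tper (map_mat modulus (submatrix (map_mat sval \<AA>) I UNIV)) \<noteq> NegInf" by (simp add: map_mat_submatrix)
  moreover have "map_mat sval \<AA> = A" using lift by (simp add: is_lift_def)
  ultimately show ?thesis using I dims by (auto simp: trop_basic_def)
qed

lemma trop_basicD:
  assumes "trop_basic A b I"
  shows "I \<subseteq> {..<m}" "card I = n" "finite I" "\<exists>!x. x \<in> trop_face A b I" "trop_basic_point A b I \<in> trop_face A b I"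
    "\<And>x. x \<in> trop_face A b I \<Longrightarrow> trop_basic_point A b I = x"
proof -
  show I: "I \<subseteq> {..<m}" "card I = n" using assms dims by (auto simp: trop_basic_def)
  then show "finite I" using finite_subset by auto
  show ex: "\<exists>!x. x \<in> trop_face A b I" using assms face_unique[OF I] by (auto simp: trop_basic_def)
  show 1: "trop_basic_point A b I \<in> trop_face A b I" unfolding trop_basic_point_def by (rule theI'[OF ex])
  show "\<And>x. x \<in> trop_face A b I \<Longrightarrow> trop_basic_point A b I = x" using 1 ex by blast
qed

end

section \<open>Following a tropical edge\<close>

lemma trop_not_less_zero [simp]: "\<not> x < (0::trop)"
  by (simp add: not_less)

text \<open>A shortest-path computation on a normalized matrix \<open>v\<close> whose rows attain modulus 1 at \<open>p r\<close>
  with positive and at \<open>q r\<close> with negative sign. Raising the columns \<open>j\<close> with \<open>d j \<noteq> -\<infinity>\<close> keeps a row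
  balanced until one of these columns reaches the maximum of the row; then the maximal column of
  opposite sign has to be raised as well. The key \<open>G r\<close> of a row is the signed dominant term of the
  raised columns, \<open>F\<close> is the set of the rows which have been treated, together with the row \<open>rk\<close>
  that is left, and \<open>g\<close> is the last raised column.\<close>

locale edge_search =
  fixes n :: nat and v :: "nat \<Rightarrow> nat \<Rightarrow> strop" and p q :: "nat \<Rightarrow> nat" and rk :: nat
  assumes v_le: "\<And>r j. r < n \<Longrightarrow> j \<le> n \<Longrightarrow> modulus (v r j) \<le> 1"
    and p: "\<And>r. r < n \<Longrightarrow> p r \<le> n \<and> v r (p r) = Pos 0"
    and q: "\<And>r. r < n \<Longrightarrow> q r \<le> n \<and> v r (q r) = Neg 0"
    and rk: "rk < n"
begin

definition exhausted :: "(nat \<Rightarrow> strop) \<Rightarrow> nat set \<Rightarrow> bool" where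
  "exhausted d F \<longleftrightarrow> (\<forall>r<n. r \<notin> F \<longrightarrow> (\<forall>j\<le>n. modulus (v r j) * modulus (d j) = 0))"

text \<open>Columns are raised in the order of decreasing \<open>d\<close>. The keys
  \<open>G\<close> account for all raised columns except the last one, \<open>g\<close>, which
  \<open>relaxed\<close> merges in. A treated row is balanced at a level not below
  \<open>d g\<close>; later columns enter at or below that level and cannot disturb it. At most
  \<open>card F\<close> columns are raised, so at least one of the \<open>n + 1\<close> stays at
  minus infinity. The last clause admits idle rounds after the search has run dry, so that it can
  always be run for \<open>n\<close> rounds.\<close>

definition search_inv :: "nat \<Rightarrow> (nat \<Rightarrow> strop) \<Rightarrow> nat set \<Rightarrow> (nat \<Rightarrow> strop) \<Rightarrow> nat \<Rightarrow> bool" where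
  "search_inv t d F G g \<longleftrightarrow>
     (\<forall>j\<le>n. d j = SNegInf \<or> (\<exists>a\<le>0. d j = Pos a)) \<and>
     g \<le> n \<and> d g \<noteq> SNegInf \<and> (\<forall>j\<le>n. d j \<noteq> SNegInf \<longrightarrow> modulus (d g) \<le> modulus (d j)) \<and>
     rk \<in> F \<and> F \<subseteq> {..<n} \<and>
     (\<forall>r<n. r \<notin> F \<longrightarrow> (\<forall>j\<le>n. j \<noteq> g \<longrightarrow> modulus (v r j) * modulus (d j) \<le> modulus (G r)) \<and>
        (G r = SNegInf \<or> (\<exists>j\<le>n. G r = stimes (v r j) (d j))) \<and> modulus (G r) \<le> modulus (d g)) \<and>
     (\<forall>r\<in>F - {rk}. \<exists>a. modulus (d g) \<le> Fin a \<and> (\<forall>j\<le>n. modulus (v r j) * modulus (d j) \<le> Fin a) \<and>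
        (\<exists>j\<le>n. stimes (v r j) (d j) = Pos a) \<and> (\<exists>j\<le>n. stimes (v r j) (d j) = Neg a)) \<and>
     d (p rk) = Pos 0 \<and>
     card {j. j \<le> n \<and> d j \<noteq> SNegInf} \<le> card F \<and>
     (card F = Suc t \<or> exhausted d F \<and> (\<forall>r<n. r \<notin> F \<longrightarrow> G r = SNegInf))"

lemma search_init: "search_inv 0 ((\<lambda>_. SNegInf)(p rk := Pos 0)) {rk} (\<lambda>_. SNegInf) (p rk)"
proof -
  have "{j. j \<le> n \<and> ((\<lambda>_. SNegInf)(p rk := Pos 0)) j \<noteq> SNegInf} = {p rk}"
    using p[OF rk] by auto
  then show ?thesis using p[OF rk] rk
    by (auto simp: search_inv_def zero_trop_def[symmetric])
qed

definition relaxed :: "(nat \<Rightarrow> strop) \<Rightarrow> nat set \<Rightarrow> (nat \<Rightarrow> strop) \<Rightarrow> nat \<Rightarrow> nat \<Rightarrow> strop" where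
  "relaxed d F G g r = (if r \<notin> F \<and> modulus (G r) < modulus (stimes (v r g) (d g)) then stimes (v r g) (d g) else G r)"

lemma relaxed_props:
  assumes inv: "search_inv t d F G g" and r: "r < n" "r \<notin> F"
  shows "\<And>j. j \<le> n \<Longrightarrow> modulus (v r j) * modulus (d j) \<le> modulus (relaxed d F G g r)"
    "relaxed d F G g r = SNegInf \<or> (\<exists>j\<le>n. relaxed d F G g r = stimes (v r j) (d j))"
    "modulus (relaxed d F G g r) \<le> modulus (d g)"
proof -
  have I: "\<And>j. j \<le> n \<Longrightarrow> j \<noteq> g \<Longrightarrow> modulus (v r j) * modulus (d j) \<le> modulus (G r)"
    "G r = SNegInf \<or> (\<exists>j\<le>n. G r = stimes (v r j) (d j))" "modulus (G r) \<le> modulus (d g)" "g \<le> n"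
    using inv r by (auto simp: search_inv_def)
  show "modulus (v r j) * modulus (d j) \<le> modulus (relaxed d F G g r)" if "j \<le> n" for j
    using I(1)[OF that] r by (cases "j = g") (auto simp: relaxed_def)
  show "relaxed d F G g r = SNegInf \<or> (\<exists>j\<le>n. relaxed d F G g r = stimes (v r j) (d j))"
    using I by (auto simp: relaxed_def)
  have "modulus (v r g) * modulus (d g) \<le> 1 * modulus (d g)"
    using v_le[OF r(1) I(4)] by (intro trop_mult_mono) auto
  then show "modulus (relaxed d F G g r) \<le> modulus (d g)" using I(3) by (auto simp: relaxed_def)
qed

lemma search_stop:
  assumes inv: "search_inv t d F G g"
    and none: "\<And>r. r < n \<Longrightarrow> r \<notin> F \<Longrightarrow> relaxed d F G g r = SNegInf"
  shows "search_inv t' d F (relaxed d F G g) g"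
proof -
  have "modulus (v r j) * modulus (d j) = 0" if "r < n" "r \<notin> F" "j \<le> n" for r j
    using relaxed_props(1)[OF inv that] none[OF that(1,2)] by (metis modulus_eq_0 trop_le_zero)
  then have "exhausted d F" unfolding exhausted_def by blast
  moreover have "\<forall>r<n. r \<notin> F \<longrightarrow>
      (\<forall>j\<le>n. j \<noteq> g \<longrightarrow> modulus (v r j) * modulus (d j) \<le> modulus (relaxed d F G g r)) \<and>
      (relaxed d F G g r = SNegInf \<or> (\<exists>j\<le>n. relaxed d F G g r = stimes (v r j) (d j))) \<and>
      modulus (relaxed d F G g r) \<le> modulus (d g)"
    using relaxed_props[OF inv] by blast
  moreover have "\<forall>r<n. r \<notin> F \<longrightarrow> relaxed d F G g r = SNegInf" using none by blast
  ultimately show ?thesis using inv unfolding search_inv_def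
    by (elim conjE) (intro conjI disjI2; assumption)
qed

lemma search_step:
  assumes inv: "search_inv t d F G g"
    and f: "f < n" "f \<notin> F" "relaxed d F G g f \<noteq> SNegInf"
    and max: "\<And>r. r < n \<Longrightarrow> r \<notin> F \<Longrightarrow> modulus (relaxed d F G g r) \<le> modulus (relaxed d F G g f)"
    and g': "g' = (if tpositive (relaxed d F G g f) then q f else p f)"
    and d': "d' = d(g' := of_trop (modulus (relaxed d F G g f)))"
  shows "search_inv (Suc t) d' (insert f F) (relaxed d F G g) g'"
proof -
  let ?G = "relaxed d F G g"
  have I1: "\<And>j. j \<le> n \<Longrightarrow> d j = SNegInf \<or> (\<exists>a\<le>0. d j = Pos a)" and
    I2: "g \<le> n" "d g \<noteq> SNegInf" "\<And>j. j \<le> n \<Longrightarrow> d j \<noteq> SNegInf \<Longrightarrow> modulus (d g) \<le> modulus (d j)" and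
    I3: "rk \<in> F" "F \<subseteq> {..<n}" and
    I5: "\<And>r. r \<in> F - {rk} \<Longrightarrow> \<exists>a. modulus (d g) \<le> Fin a \<and> (\<forall>j\<le>n. modulus (v r j) * modulus (d j) \<le> Fin a) \<and>
        (\<exists>j\<le>n. stimes (v r j) (d j) = Pos a) \<and> (\<exists>j\<le>n. stimes (v r j) (d j) = Neg a)" and
    I6: "d (p rk) = Pos 0" and I7: "card {j. j \<le> n \<and> d j \<noteq> SNegInf} \<le> card F" and
    I8: "card F = Suc t \<or> exhausted d F \<and> (\<forall>r<n. r \<notin> F \<longrightarrow> G r = SNegInf)"
    using inv unfolding search_inv_def by auto
  note rel = relaxed_props[OF inv f(1,2)]
  obtain e where e: "modulus (?G f) = Fin e" using f(3) by (cases "?G f") auto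
  have g'n: "g' \<le> n" "modulus (v f g') = 1" using g' p[OF f(1)] q[OF f(1)] by (auto simp: one_trop_def)
  have d'g: "d' g' = Pos e" by (simp add: d' e)
  \<comment> \<open>The column to be raised may have been raised before, but then to the same level:
    its entry in row \<open>f\<close> has modulus 1, so its value is at most the key, and the key is
    at most \<open>d g\<close>, the least value so far.\<close>
  have old: "d' j = d j" if "j \<le> n" "d j \<noteq> SNegInf" for j
  proof (cases "j = g'")
    case True
    have "modulus (d g') \<le> modulus (?G f)" using rel(1)[OF g'n(1)] g'n(2) by simp
    moreover have "modulus (?G f) \<le> modulus (d g')" using rel(3) I2(3)[of g'] that True by auto
    ultimately have "modulus (d g') = Fin e" using e by simp
    then have "d g' = Pos e" using I1[OF that(1)] True by (cases "d g'") auto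
    then show ?thesis using True d'g by simp
  qed (simp add: d')
  have e_le: "Fin e \<le> modulus (d g)" using rel(3) e by simp
  have e0: "e \<le> 0" using e_le I1[OF I2(1)] I2(2) by auto
  have exact: "stimes (v r j) (d' j) = stimes (v r j) (d j)" if "j \<le> n" "stimes (v r j) (d j) \<noteq> SNegInf" for r j
    using that old[of j] by (cases "d j"; cases "v r j") auto
  have vg: "modulus (v r g') * Fin e \<le> Fin e" if "r < n" for r
    using trop_mult_mono[OF v_le[OF that g'n(1)], of "Fin e" "Fin e"] by simp
  have d'_cases: "d' j = (if j = g' then Pos e else d j)" for j by (simp add: d' e)
  have 1: "\<forall>j\<le>n. d' j = SNegInf \<or> (\<exists>a\<le>0. d' j = Pos a)" using I1 e0 by (auto simp: d'_cases)
  have 2: "\<forall>j\<le>n. d' j \<noteq> SNegInf \<longrightarrow> modulus (d' g') \<le> modulus (d' j)"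
    using I2(3) e_le by (auto simp: d'_cases intro: order_trans)
  have 4: "(\<forall>j\<le>n. j \<noteq> g' \<longrightarrow> modulus (v r j) * modulus (d' j) \<le> modulus (?G r)) \<and>
        (?G r = SNegInf \<or> (\<exists>j\<le>n. ?G r = stimes (v r j) (d' j))) \<and> modulus (?G r) \<le> modulus (d' g')"
    if r: "r < n" "r \<notin> insert f F" for r
  proof -
    have r': "r \<notin> F" using r by simp
    note relr = relaxed_props[OF inv r(1) r']
    have "?G r = SNegInf \<or> (\<exists>j\<le>n. ?G r = stimes (v r j) (d' j))" using relr(2) exact by metis
    then show ?thesis using relr(1) max[OF r(1) r'] e d'g by (auto simp: d'_cases)
  qed
  have 5: "\<exists>a. modulus (d' g') \<le> Fin a \<and> (\<forall>j\<le>n. modulus (v r j) * modulus (d' j) \<le> Fin a) \<and>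
        (\<exists>j\<le>n. stimes (v r j) (d' j) = Pos a) \<and> (\<exists>j\<le>n. stimes (v r j) (d' j) = Neg a)"
    if r: "r \<in> insert f F - {rk}" for r
  proof (cases "r = f")
    case True
    have "\<exists>j\<le>n. stimes (v f j) (d' j) = ?G f" using rel(2) f(3) exact by metis
    moreover have "stimes (v f g') (d' g') = sneg (?G f)"
      using p[OF f(1)] q[OF f(1)] g' e d'g by (cases "?G f") (auto simp: tpositive_def)
    ultimately have "(\<exists>j\<le>n. stimes (v f j) (d' j) = Pos e) \<and> (\<exists>j\<le>n. stimes (v f j) (d' j) = Neg e)"
      using e g'n(1) by (cases "?G f") auto
    moreover have "modulus (v f j) * modulus (d' j) \<le> Fin e" if "j \<le> n" for j
      using rel(1)[OF that] e vg[OF f(1)] by (simp add: d'_cases)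
    ultimately show ?thesis using True d'g by auto
  next
    case False
    then have rF: "r \<in> F - {rk}" using r by simp
    then have rn: "r < n" using I3 by auto
    obtain a where a: "modulus (d g) \<le> Fin a" "\<And>j. j \<le> n \<Longrightarrow> modulus (v r j) * modulus (d j) \<le> Fin a"
      "\<exists>j\<le>n. stimes (v r j) (d j) = Pos a" "\<exists>j\<le>n. stimes (v r j) (d j) = Neg a"
      using I5[OF rF] by blast
    have ea: "Fin e \<le> Fin a" using e_le a(1) by (rule order_trans)
    have "modulus (v r j) * modulus (d' j) \<le> Fin a" if "j \<le> n" for j
      using a(2)[OF that] order_trans[OF vg[OF rn] ea] by (simp add: d'_cases)
    moreover have "\<exists>j\<le>n. stimes (v r j) (d' j) = Pos a" "\<exists>j\<le>n. stimes (v r j) (d' j) = Neg a"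
      using a(3,4) exact by (metis strop.distinct(1,3))+
    ultimately show ?thesis using ea d'g by auto
  qed
  have 6: "d' (p rk) = Pos 0" using old[of "p rk"] p[OF rk] I6 by simp
  have finF: "finite F" using I3(2) finite_subset by blast
  have "{j. j \<le> n \<and> d' j \<noteq> SNegInf} \<subseteq> insert g' {j. j \<le> n \<and> d j \<noteq> SNegInf}"
    by (auto simp: d'_cases)
  then have "card {j. j \<le> n \<and> d' j \<noteq> SNegInf} \<le> card (insert g' {j. j \<le> n \<and> d j \<noteq> SNegInf})"
    by (intro card_mono) auto
  also have "\<dots> \<le> Suc (card {j. j \<le> n \<and> d j \<noteq> SNegInf})" by (rule card_insert_le_m1) auto
  finally have 7: "card {j. j \<le> n \<and> d' j \<noteq> SNegInf} \<le> card (insert f F)"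
    using I7 f(2) finF by simp
  \<comment> \<open>A proper step cannot follow an idle one: in an exhausted search the key of
    \<open>f\<close> would still be minus infinity. So the row counter is exact.\<close>
  have "\<not> (exhausted d F \<and> (\<forall>r<n. r \<notin> F \<longrightarrow> G r = SNegInf))"
  proof
    assume *: "exhausted d F \<and> (\<forall>r<n. r \<notin> F \<longrightarrow> G r = SNegInf)"
    then have "modulus (stimes (v f g) (d g)) = 0" using f I2(1) by (auto simp: exhausted_def)
    then have "?G f = G f" unfolding relaxed_def by (simp only: trop_not_less_zero) simp
    then show False using * f by simp
  qed
  then have "card F = Suc t" using I8 by blast
  then have 8: "card (insert f F) = Suc (Suc t)" using f(2) finF by simp
  show ?thesis unfolding search_inv_def using 1 2 4 5 6 7 8 g'n(1) d'g I3 f(1) by auto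
qed

lemma search_result:
  assumes inv: "search_inv n d F G g"
  shows "\<And>j. j \<le> n \<Longrightarrow> modulus (d j) \<le> 1" "\<exists>j\<le>n. d j = SNegInf"
    "\<And>j. j \<le> n \<Longrightarrow> d j = SNegInf \<or> (\<exists>a. d j = Pos a)"
    "(\<Sum>j\<le>n. pos_part (v rk j) * modulus (d j)) = 1"
    "\<And>r. r < n \<Longrightarrow> r \<noteq> rk \<Longrightarrow>
       (\<Sum>j\<le>n. pos_part (v r j) * modulus (d j)) = (\<Sum>j\<le>n. neg_part (v r j) * modulus (d j))"
proof -
  have I1: "\<And>j. j \<le> n \<Longrightarrow> d j = SNegInf \<or> (\<exists>a\<le>0. d j = Pos a)"
    and I3: "rk \<in> F" "F \<subseteq> {..<n}"
    and I5: "\<And>r. r \<in> F - {rk} \<Longrightarrow> \<exists>a. modulus (d g) \<le> Fin a \<and> (\<forall>j\<le>n. modulus (v r j) * modulus (d j) \<le> Fin a) \<and>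
        (\<exists>j\<le>n. stimes (v r j) (d j) = Pos a) \<and> (\<exists>j\<le>n. stimes (v r j) (d j) = Neg a)"
    and I6: "d (p rk) = Pos 0" and I7: "card {j. j \<le> n \<and> d j \<noteq> SNegInf} \<le> card F"
    and I8: "card F = Suc n \<or> exhausted d F"
    using inv unfolding search_inv_def by auto
  \<comment> \<open>There are only \<open>n\<close> rows, so after \<open>n\<close> rounds the count
    \<open>Suc n\<close> is impossible and the search has run dry. The same bound leaves a column
    that is not raised.\<close>
  have cF: "card F \<le> n" using card_mono[OF _ I3(2)] by simp
  with I8 have exh: "exhausted d F" by auto
  show le: "modulus (d j) \<le> 1" if "j \<le> n" for j using I1[OF that] by (auto simp: one_trop_def)
  show "\<exists>j\<le>n. d j = SNegInf"
  proof (rule ccontr)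
    assume "\<not> ?thesis"
    then have "{j. j \<le> n \<and> d j \<noteq> SNegInf} = {..n}" by auto
    then show False using I7 cF by simp
  qed
  show pos: "d j = SNegInf \<or> (\<exists>a. d j = Pos a)" if "j \<le> n" for j using I1[OF that] by blast
  have pp: "pos_part x \<le> modulus x" "neg_part x \<le> modulus x" for x by (cases x; simp)+
  show "(\<Sum>j\<le>n. pos_part (v rk j) * modulus (d j)) = 1"
  proof (rule antisym)
    have "pos_part (v rk j) * modulus (d j) \<le> 1 * 1" if "j \<le> n" for j
      using v_le[OF rk that] pp(1)[of "v rk j"] le[OF that] by (intro trop_mult_mono) auto
    then show "(\<Sum>j\<le>n. pos_part (v rk j) * modulus (d j)) \<le> 1" by (simp add: trop_sum_le_iff)
    show "1 \<le> (\<Sum>j\<le>n. pos_part (v rk j) * modulus (d j))"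
      using trop_le_sum[of "{..n}" "p rk" "\<lambda>j. pos_part (v rk j) * modulus (d j)"] p[OF rk] I6
      by (simp add: one_trop_def)
  qed
  show "(\<Sum>j\<le>n. pos_part (v r j) * modulus (d j)) = (\<Sum>j\<le>n. neg_part (v r j) * modulus (d j))"
    if r: "r < n" "r \<noteq> rk" for r
  proof (cases "r \<in> F")
    case True
    then obtain a where a: "\<And>j. j \<le> n \<Longrightarrow> modulus (v r j) * modulus (d j) \<le> Fin a"
      "\<exists>j\<le>n. stimes (v r j) (d j) = Pos a" "\<exists>j\<le>n. stimes (v r j) (d j) = Neg a"
      using I5[of r] r by auto
    have "pos_part (v r j) * modulus (d j) \<le> Fin a" "neg_part (v r j) * modulus (d j) \<le> Fin a" if "j \<le> n" for j
      using a(1)[OF that] trop_mult_mono[OF pp(1)[of "v r j"] order_refl[of "modulus (d j)"]]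
        trop_mult_mono[OF pp(2)[of "v r j"] order_refl[of "modulus (d j)"]] by auto
    then have "(\<Sum>j\<le>n. pos_part (v r j) * modulus (d j)) \<le> Fin a" "(\<Sum>j\<le>n. neg_part (v r j) * modulus (d j)) \<le> Fin a"
      by (auto simp: trop_sum_le_iff)
    moreover obtain i j where ij: "i \<le> n" "stimes (v r i) (d i) = Pos a" "j \<le> n" "stimes (v r j) (d j) = Neg a"
      using a by blast
    have "pos_part (v r i) * modulus (d i) = Fin a"
      using ij(2) pos[OF ij(1)] by (cases "v r i"; auto)
    then have "Fin a \<le> (\<Sum>j\<le>n. pos_part (v r j) * modulus (d j))"
      using trop_le_sum[of "{..n}" i "\<lambda>j. pos_part (v r j) * modulus (d j)"] ij(1) by simp
    moreover have "neg_part (v r j) * modulus (d j) = Fin a"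
      using ij(4) pos[OF ij(3)] by (cases "v r j"; auto)
    then have "Fin a \<le> (\<Sum>j\<le>n. neg_part (v r j) * modulus (d j))"
      using trop_le_sum[of "{..n}" j "\<lambda>j. neg_part (v r j) * modulus (d j)"] ij(3) by simp
    ultimately show ?thesis by (metis antisym)
  next
    case False
    then have "modulus (v r j) = 0 \<or> modulus (d j) = 0" if "j \<le> n" for j
      using exh r that by (auto simp: exhausted_def)
    then have "pos_part (v r j) * modulus (d j) = 0" "neg_part (v r j) * modulus (d j) = 0" if "j \<le> n" for j
      using that by fastforce+
    then show ?thesis by (metis (no_types, lifting) atMost_iff sum.neutral)
  qed
qed

text \<open>The abstract run gives the existence of a direction and thus of a pivot; the program
  later maintains the same invariant.\<close>

lemma search_exists: "\<exists>d F G g. search_inv t d F G g"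
proof (induction t)
  case 0
  then show ?case using search_init by blast
next
  case (Suc t)
  then obtain d F G g where inv: "search_inv t d F G g" by blast
  let ?U = "{r. r < n \<and> r \<notin> F}"
  show ?case
  proof (cases "\<forall>r\<in>?U. relaxed d F G g r = SNegInf")
    case True
    then show ?thesis using search_stop[OF inv] by blast
  next
    case False
    then have U: "finite ?U" "?U \<noteq> {}" by auto
    let ?M = "Max ((\<lambda>r. modulus (relaxed d F G g r)) ` ?U)"
    have "?M \<in> (\<lambda>r. modulus (relaxed d F G g r)) ` ?U" using U by (intro Max_in) auto
    then obtain f where f: "f < n" "f \<notin> F" "modulus (relaxed d F G g f) = ?M" by auto
    have max: "modulus (relaxed d F G g r) \<le> modulus (relaxed d F G g f)" if "r < n" "r \<notin> F" for r
      unfolding f(3) using U that by (intro Max_ge) auto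
    have "relaxed d F G g f \<noteq> SNegInf"
      using False max by (metis (mono_tags, lifting) mem_Collect_eq modulus_eq_0 trop_le_zero)
    then show ?thesis using search_step[OF inv f(1,2) _ max refl refl] by blast
  qed
qed

end

section \<open>Edge directions and the length of a step\<close>

context trop_program
begin

text \<open>In coordinates relative to \<open>u\<close>, the points
  \<open>1 + \<mu> * \<delta>\<close> with growing \<open>\<mu>\<close> run along the edge.
  \<open>vp u k \<delta> = 1\<close> keeps row \<open>k\<close> on its feasible side, and a
  coordinate minus infinity ensures that the direction is not a mere rescaling of homogeneous
  coordinates.\<close>

definition edge_direction :: "(nat \<Rightarrow> real) \<Rightarrow> nat set \<Rightarrow> nat \<Rightarrow> (nat \<Rightarrow> trop) \<Rightarrow> bool" where
  "edge_direction u I k \<delta> \<longleftrightarrow> (\<forall>j\<le>n. \<delta> j \<le> 1) \<and> (\<exists>j\<le>n. \<delta> j = 0) \<and> vp u k \<delta> = 1 \<and>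
     (\<forall>i\<in>I - {k}. vp u i \<delta> = vn u i \<delta>)"

definition blocks :: "(nat \<Rightarrow> real) \<Rightarrow> nat set \<Rightarrow> (nat \<Rightarrow> trop) \<Rightarrow> nat \<Rightarrow> bool" where
  "blocks u I \<delta> i \<longleftrightarrow> i < m \<and> i \<notin> I \<and> vp u i \<delta> < vn u i \<delta>"

text \<open>Without a blocking row the direction itself would lie in the tropical cone, with both a
  finite and an infinite coordinate.\<close>

lemma edge_blocked:
  assumes I: "I \<subseteq> {..<m}" "k \<in> I" and \<delta>: "edge_direction u I k \<delta>"
  shows "\<exists>i. blocks u I \<delta> i"
proof (rule ccontr)
  assume not: "\<nexists>i. blocks u I \<delta> i"
  have k: "k < m" using I by auto
  have le: "vn u i \<delta> \<le> vp u i \<delta>" if "i < m" for i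
  proof (cases "i \<in> I")
    case True
    have "vn u k \<delta> \<le> vp u k \<delta>" using vn_le_1[OF k, of \<delta> u] \<delta> by (simp add: edge_direction_def)
    then show ?thesis using True \<delta> by (cases "i = k") (auto simp: edge_direction_def)
  next
    case False
    then show ?thesis using not that by (metis blocks_def not_less)
  qed
  have cone: "rown i (\<lambda>j. Fin (u j) * \<delta> j) \<le> rowp i (\<lambda>j. Fin (u j) * \<delta> j)" if "i < m" for i
    unfolding row_scale[OF that] using le[OF that] by (rule trop_mult_left_mono)
  have "vp u k \<delta> \<noteq> 0" using \<delta> by (simp add: edge_direction_def)
  then obtain j where j: "j \<in> {..n}" "pos_part (V u k j) * \<delta> j = vp u k \<delta>"
    using trop_sum_attained[of "{..n}" "\<lambda>j. pos_part (V u k j) * \<delta> j"] unfolding vp_def by blast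
  then have "j \<le> n" "\<delta> j \<noteq> 0" using \<open>vp u k \<delta> \<noteq> 0\<close> by auto
  moreover obtain l where "l \<le> n" "\<delta> l = 0" using \<delta> by (auto simp: edge_direction_def)
  ultimately show False using cone_finite[of "\<lambda>j. Fin (u j) * \<delta> j" j l] cone by auto
qed

lemma vp_linear: "vp u i (\<lambda>j. X j + \<mu> * Y j) = vp u i X + \<mu> * vp u i Y"
  and vn_linear: "vn u i (\<lambda>j. X j + \<mu> * Y j) = vn u i X + \<mu> * vn u i Y"
proof -
  have "w * (x + \<mu> * y) = w * x + \<mu> * (w * y)" for w x y :: trop
    using distrib_left[of w x "\<mu> * y"] mult.left_commute[of w \<mu> y] by simp
  then show "vp u i (\<lambda>j. X j + \<mu> * Y j) = vp u i X + \<mu> * vp u i Y"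
    "vn u i (\<lambda>j. X j + \<mu> * Y j) = vn u i X + \<mu> * vn u i Y"
    unfolding vp_def vn_def sum_distrib_left sum.distrib[symmetric] by (auto intro!: sum.cong)
qed

text \<open>At \<open>u\<close> a blocking row has negative side below 1 and positive side 1; it
  becomes tight when \<open>\<mu> * vn u i \<delta>\<close> reaches 1. The row with the largest
  \<open>vn u i \<delta>\<close> is the first to do so, at \<open>\<mu> = Fin (- \<beta>)\<close>,
  and all other rows are still satisfied there.\<close>

lemma edge_step:
  assumes I: "I \<subseteq> {..<m}" "card I = n" "k \<in> I" and u: "u n = 0" "pt u \<in> trop_face A b I"
    and \<delta>: "edge_direction u I k \<delta>" and i0: "blocks u I \<delta> i0"
    and max: "\<And>i. blocks u I \<delta> i \<Longrightarrow> vn u i \<delta> \<le> vn u i0 \<delta>"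
    and \<beta>: "vn u i0 \<delta> = Fin \<beta>"
    and \<zeta>: "\<And>j. j \<le> n \<Longrightarrow> 1 + Fin (- \<beta>) * \<delta> j = Fin (\<zeta> j)"
  shows "pt (\<lambda>j. u j + \<zeta> j - \<zeta> n) \<in> trop_face A b (insert i0 (I - {k}))"
    "is_trop_pivot A b I k (insert i0 (I - {k}))"
proof -
  define z where "z j = 1 + Fin (- \<beta>) * \<delta> j" for j
  define x' where "x' = pt (\<lambda>j. u j + \<zeta> j - \<zeta> n)"
  let ?I' = "insert i0 (I - {k})"
  have t: "tight u I" and pos: "\<And>i. i < m \<Longrightarrow> \<exists>j\<le>n. V u i j = Pos 0"
    using face_V[of u, OF u(1) I(1)] u(2) by auto
  have i0m: "i0 < m" "i0 \<notin> I" "vp u i0 \<delta> < Fin \<beta>" using i0 \<beta> by (auto simp: blocks_def)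
  have D1: "\<And>j. j \<le> n \<Longrightarrow> \<delta> j \<le> 1" "vp u k \<delta> = 1" "\<And>i. i \<in> I - {k} \<Longrightarrow> vp u i \<delta> = vn u i \<delta>"
    using \<delta> by (auto simp: edge_direction_def)
  obtain l where l: "l \<le> n" "\<delta> l = 0" using \<delta> by (auto simp: edge_direction_def)
  have vp1: "vp u i (\<lambda>_. 1) = 1" if "i < m" for i using vp_1_iff[OF that] pos[OF that] by blast
  have vn1: "vn u i (\<lambda>_. 1) = 1" if "i \<in> I" for i
    using vn_1_iff[of i u] t that by (auto simp: tight_def)
  have vn1': "vn u i (\<lambda>_. 1) < 1" if "i < m" "i \<notin> I" for i
  proof -
    have "\<not> tight u (insert i I)" using tight_card[of u "insert i I"] I that tight_finite[OF t] by auto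
    then have "\<not> (\<exists>j\<le>n. V u i j = Neg 0)" using t pos[OF that(1)] that(1) by (auto simp: tight_def)
    then show ?thesis using vn_1_iff[OF that(1)] vn_le_1[OF that(1), of "\<lambda>_. 1" u] by (auto simp: less_le)
  qed
  have vpz: "vp u i z = vp u i (\<lambda>_. 1) + Fin (- \<beta>) * vp u i \<delta>"
    and vnz: "vn u i z = vn u i (\<lambda>_. 1) + Fin (- \<beta>) * vn u i \<delta>" for i
    unfolding z_def by (rule vp_linear, rule vn_linear)
  \<comment> \<open>Row \<open>i0\<close> was not tight at \<open>u\<close>, and
    \<open>\<delta> \<le> 1\<close> cannot increase its negative side. So the step length
    \<open>- \<beta>\<close> is positive.\<close>
  have \<beta>0: "\<beta> < 0"
  proof -
    have "vn u i0 \<delta> \<le> vn u i0 (\<lambda>_. 1)" unfolding vn_def trop_sum_le_iff[OF finite_atMost]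
    proof
      fix j assume j: "j \<in> {..n}"
      have "neg_part (V u i0 j) * \<delta> j \<le> neg_part (V u i0 j) * 1" using D1(1) j by (intro trop_mult_left_mono) auto
      also have "\<dots> \<le> (\<Sum>j\<le>n. neg_part (V u i0 j) * 1)" using j by (intro trop_le_sum) auto
      finally show "neg_part (V u i0 j) * \<delta> j \<le> (\<Sum>j\<le>n. neg_part (V u i0 j) * 1)" .
    qed
    then have "Fin \<beta> < 1" using vn1'[OF i0m(1,2)] \<beta> by simp
    then show ?thesis by (auto simp: one_trop_def less_le)
  qed
  have le_inv: "Fin (- \<beta>) * x \<le> 1" if "x \<le> Fin \<beta>" for x
    using trop_mult_left_mono[OF that, of "Fin (- \<beta>)"] by (simp add: one_trop_def)
  have feas: "vn u i z \<le> vp u i z" if i: "i < m" for i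
  proof (cases "i \<in> I")
    case iI: True
    show ?thesis
    proof (cases "i = k")
      case True
      have "vn u k \<delta> \<le> 1" using vn_le_1[OF _ D1(1)] i True by simp
      then have "Fin (- \<beta>) * vn u k \<delta> \<le> Fin (- \<beta>) * 1" by (rule trop_mult_left_mono)
      then show ?thesis using vp1[OF i] vn1[OF iI] True D1(2)
        by (auto simp: vpz vnz plus_trop_def le_max_iff_disj)
    next
      case False
      then show ?thesis using vp1[OF i] vn1[OF iI] D1(3)[of i] iI by (simp add: vpz vnz)
    qed
  next
    case False
    show ?thesis
    proof (cases "vp u i \<delta> < vn u i \<delta>")
      case True
      then have "vn u i \<delta> \<le> Fin \<beta>" using max[of i] \<beta> i False by (simp add: blocks_def)
      then have "Fin (- \<beta>) * vn u i \<delta> \<le> 1" by (rule le_inv)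
      then show ?thesis using vn1'[OF i False] vp1[OF i]
        by (auto simp: vpz vnz plus_trop_def le_max_iff_disj)
    next
      case False
      then have "Fin (- \<beta>) * vn u i \<delta> \<le> Fin (- \<beta>) * vp u i \<delta>" by (intro trop_mult_left_mono) simp
      moreover have "vn u i (\<lambda>_. 1) \<le> 1" using vn_le_1[OF i] by simp
      ultimately show ?thesis using vp1[OF i] by (auto simp: vpz vnz plus_trop_def le_max_iff_disj)
    qed
  qed
  have eq: "vp u i z = vn u i z" if "i \<in> ?I'" for i
  proof (cases "i = i0")
    case True
    have "Fin (- \<beta>) * vp u i0 \<delta> \<le> 1" using i0m(3) by (intro le_inv) simp
    then have "vp u i0 z = 1" using vp1[OF i0m(1)] by (simp add: vpz plus_trop_def max_def)
    moreover have "vn u i0 z = 1" using vn1'[OF i0m(1,2)] \<beta>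
      by (simp add: vnz plus_trop_def one_trop_def[symmetric])
    ultimately show ?thesis using True by simp
  next
    case False
    then have "i \<in> I - {k}" "i < m" using that I by auto
    then show ?thesis using vp1 vn1 D1(3) by (simp add: vpz vnz)
  qed
  \<comment> \<open>Subtracting \<open>\<zeta> n\<close> in every coordinate brings the last
    homogeneous coordinate back to 1.\<close>
  have homx: "hom x' j = Fin (- \<zeta> n) * (Fin (u j) * z j)" if "j \<le> n" for j
  proof -
    have "hom x' j = Fin (u j + \<zeta> j - \<zeta> n)"
      unfolding x'_def by (rule hom_pt) (use that u in auto)
    then show ?thesis using \<zeta>[OF that] by (simp add: z_def)
  qed
  have rows: "rowp i (hom x') = Fin (- \<zeta> n) * (lev u i * vp u i z)"
    "rown i (hom x') = Fin (- \<zeta> n) * (lev u i * vn u i z)" if "i < m" for i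
    unfolding row_scale[OF that, symmetric] rowp_def rown_def sum_distrib_left
    by (rule sum.cong[OF refl], simp only: atMost_iff homx, rule mult.left_commute)+
  have x'c: "x' \<in> carrier_vec n" by (simp add: x'_def pt_def)
  have poly: "x' \<in> trop_polyhedron A b"
    unfolding polyhedron_iff using x'c rows feas by (auto intro!: trop_mult_left_mono)
  have I'm: "?I' \<subseteq> {..<m}" using I i0m by auto
  have "x' \<in> s_hyperplane (row A i) (b $ i)" if "i \<in> ?I'" for i
    using hyperplane_iff[OF _ x'c, of i] rows[of i] eq[OF that] that I'm by auto
  then show face: "pt (\<lambda>j. u j + \<zeta> j - \<zeta> n) \<in> trop_face A b ?I'"
    using poly by (simp add: trop_face_def flip: x'_def)
  have cI': "card ?I' = n" using I i0m finite_subset[OF I(1)] dims(4) by simp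
  note basic = trop_basicI[OF I'm cI' face]
  have bp: "trop_basic_point A b ?I' = x'" using trop_basicD(6)[OF basic face] by (simp add: x'_def)
  have bI: "trop_basic_point A b I = pt u" by (rule trop_basicD(6)[OF trop_basicI[OF I(1,2) u(2)] u(2)])
  \<comment> \<open>The new point could equal the old one only if all \<open>\<zeta> j\<close>
    agree. But column \<open>l\<close> is not raised, so \<open>\<zeta> l = 0\<close>, whereas a
    column that makes row \<open>k\<close> leave its hyperplane has
    \<open>\<zeta> j = - \<beta> > 0\<close>.\<close>
  have "x' \<noteq> pt u"
  proof
    assume "x' = pt u"
    then have xj: "x' $ j = pt u $ j" for j by simp
    have \<zeta>n: "\<zeta> j = \<zeta> n" if "j \<le> n" for j
      using that xj[of j] by (cases "j = n") (auto simp: x'_def pt_def)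
    have "\<zeta> l = 0" using \<zeta>[OF l(1)] l(2) by (simp add: one_trop_def)
    then have zero: "\<zeta> j = 0" if "j \<le> n" for j using \<zeta>n[OF that] \<zeta>n[OF l(1)] by simp
    have k: "k < m" using I by auto
    obtain j where j: "j \<le> n" "pos_part (V u k j) * \<delta> j = 1"
      using trop_sum_attained[of "{..n}" "\<lambda>j. pos_part (V u k j) * \<delta> j"] D1(2) by (auto simp: vp_def)
    have "pos_part (V u k j) \<le> 1" using V_le_1[OF k j(1), of u] by (cases "V u k j") auto
    then have "\<delta> j = 1" using j D1(1)[OF j(1)]
      by (cases "pos_part (V u k j)"; cases "\<delta> j") (auto simp: one_trop_def)
    then show False using \<zeta>[OF j(1)] zero[OF j(1)] \<beta>0 by (auto simp: one_trop_def plus_trop_def max_def)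
  qed
  then show "is_trop_pivot A b I k ?I'"
    unfolding is_trop_pivot_def bp bI using basic i0m(2) face by (auto simp: trop_face_def x'_def)
qed

lemma pivot_exists:
  assumes I: "trop_basic A b I" "k \<in> I"
  shows "\<exists>I'. is_trop_pivot A b I k I'"
proof -
  note B = trop_basicD[OF I(1)]
  obtain u where u: "u n = 0" "trop_basic_point A b I = pt u" using face_finite[OF B(5)] .
  have uI: "pt u \<in> trop_face A b I" using B(5) u by simp
  have t: "tight u I" using face_V[of u, OF u(1) B(1)] uI by simp
  have pick: "bij_betw (pick I) {..<n} I" using bij_betw_pick[OF B(3)] B(2) by simp
  then have pm: "pick I r < m" "pick I r \<in> I" if "r < n" for r using that B(1) bij_betwE by blast+
  obtain rk where rk: "rk < n" "pick I rk = k" using pick I(2) by (metis bij_betw_imp_surj_on imageE lessThan_iff)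
  have "\<forall>r<n. (\<exists>j\<le>n. V u (pick I r) j = Pos 0) \<and> (\<exists>j\<le>n. V u (pick I r) j = Neg 0)"
    using t pm(2) by (simp add: tight_def)
  then obtain p q where pq: "\<And>r. r < n \<Longrightarrow> p r \<le> n \<and> V u (pick I r) (p r) = Pos 0"
    "\<And>r. r < n \<Longrightarrow> q r \<le> n \<and> V u (pick I r) (q r) = Neg 0" by metis
  interpret S: edge_search n "\<lambda>r. V u (pick I r)" p q rk
    by unfold_locales (use V_le_1 pm pq rk in auto)
  obtain d F G g where inv: "S.search_inv n d F G g" using S.search_exists by blast
  note R = S.search_result[OF inv]
  define \<delta> where "\<delta> j = modulus (d j)" for j
  have "vp u i \<delta> = vn u i \<delta>" if i: "i \<in> I - {k}" for i
  proof -
    obtain r where "r < n" "pick I r = i" using pick i by (metis DiffD1 bij_betw_imp_surj_on imageE lessThan_iff)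
    then show ?thesis using R(5)[of r] i rk by (auto simp: vp_def vn_def \<delta>_def)
  qed
  then have dir: "edge_direction u I k \<delta>"
    using R(1,2,4) rk by (auto simp: edge_direction_def \<delta>_def vp_def)
  let ?B = "{i. blocks u I \<delta> i}"
  have fin: "finite ?B" by (rule finite_subset[of _ "{..<m}"]) (auto simp: blocks_def)
  obtain i1 where i1: "i1 \<in> ?B" using edge_blocked[OF B(1) I(2) dir] by blast
  have "Max ((\<lambda>i. vn u i \<delta>) ` ?B) \<in> (\<lambda>i. vn u i \<delta>) ` ?B" using fin i1 by (intro Max_in) auto
  then obtain i0 where i0: "blocks u I \<delta> i0" "vn u i0 \<delta> = Max ((\<lambda>i. vn u i \<delta>) ` ?B)" by auto
  have max: "vn u i \<delta> \<le> vn u i0 \<delta>" if "blocks u I \<delta> i" for i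
    unfolding i0(2) using fin that by (intro Max_ge) auto
  have "vn u i0 \<delta> \<noteq> 0" using i0(1) by (auto simp: blocks_def)
  then obtain \<beta> where \<beta>: "vn u i0 \<delta> = Fin \<beta>" by (auto elim: trop_neq_0E)
  have "\<exists>e. 1 + Fin (- \<beta>) * \<delta> j = Fin e" for j
    by (cases "\<delta> j") (auto simp: plus_trop_def one_trop_def max_def)
  then obtain \<zeta> where "\<And>j. 1 + Fin (- \<beta>) * \<delta> j = Fin (\<zeta> j)" by metis
  then show ?thesis using edge_step(2)[OF B(1,2) I(2) u(1) uI dir i0(1) max \<beta>] by blast
qed

end

section \<open>Edges and pivots in a lift\<close>

context trop_lift
begin

lemma basic_lift:
  assumes "trop_basic A b I"
  defines "x \<equiv> puiseux_basic_point \<AA> \<bb> I"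
  shows "puiseux_basic \<AA> \<bb> I" "trop_basic_point A b I = map_vec val x" "x \<in> carrier_vec n"
    "det (submatrix \<AA> I UNIV) \<noteq> 0" "\<And>i. i \<in> I \<Longrightarrow> slack i x = 0"
    "\<And>i. i < m \<Longrightarrow> i \<notin> I \<Longrightarrow> 0 < slack i x" "\<And>j. j < n \<Longrightarrow> 0 < x $ j"
    "x \<in> puiseux_polyhedron \<AA> \<bb>"
proof -
  note B = trop_basicD[OF assms(1)]
  obtain u where u: "u n = 0" "trop_basic_point A b I = pt u" using face_finite[OF B(5)] .
  have uI: "pt u \<in> trop_face A b I" using B(5) u by simp
  note L = lift_basic_point[of I u, OF B(1,2) u(1) uI, folded x_def]
  show "puiseux_basic \<AA> \<bb> I" "trop_basic_point A b I = map_vec val x" "x \<in> carrier_vec n"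
    "det (submatrix \<AA> I UNIV) \<noteq> 0" "\<And>i. i \<in> I \<Longrightarrow> slack i x = 0"
    "\<And>i. i < m \<Longrightarrow> i \<notin> I \<Longrightarrow> 0 < slack i x" "\<And>j. j < n \<Longrightarrow> 0 < x $ j"
    using L u by auto
  show "x \<in> puiseux_polyhedron \<AA> \<bb>" using L(7) by (simp add: puiseux_basic_def x_def)
qed

definition on_line :: "puiseux vec \<Rightarrow> puiseux vec \<Rightarrow> puiseux \<Rightarrow> puiseux vec" where
  "on_line x y s = vec n (\<lambda>j. (1 - s) * x $ j + s * y $ j)"

lemma slack_on_line: "slack i (on_line x y s) = (1 - s) * slack i x + s * slack i y"
  unfolding on_line_def by (rule phom_combination)

text \<open>The slacks of the rows in \<open>I\<close> are affine coordinates of the space. On the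
  line of an edge all of them vanish except that of \<open>k\<close>, which serves as the
  parameter.\<close>

lemma on_line_param:
  assumes I: "trop_basic A b I" "k \<in> I"
    and y: "y \<in> carrier_vec n" "\<And>i. i \<in> I - {k} \<Longrightarrow> slack i y = 0" "slack k y \<noteq> 0"
    and z: "z \<in> carrier_vec n" "\<And>i. i \<in> I - {k} \<Longrightarrow> slack i z = 0"
  shows "z = on_line (puiseux_basic_point \<AA> \<bb> I) y (slack k z / slack k y)"
proof (rule slack_inj)
  note B = trop_basicD[OF I(1)] and L = basic_lift[OF I(1)]
  show "I \<subseteq> {..<m}" "card I = n" "det (submatrix \<AA> I UNIV) \<noteq> 0" by (rule B(1), rule B(2), rule L(4))
  show "slack i z = slack i (on_line (puiseux_basic_point \<AA> \<bb> I) y (slack k z / slack k y))" if "i \<in> I" for i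
  proof (cases "i = k")
    case True
    then show ?thesis unfolding slack_on_line using L(5)[OF that] y(3) by simp
  next
    case False
    then show ?thesis unfolding slack_on_line using L(5)[OF that] y(2)[of i] z(2)[of i] that by simp
  qed
qed (use z in \<open>auto simp: on_line_def\<close>)

text \<open>On the line through \<open>x\<close> and \<open>x'\<close>, the leaving row
  \<open>k\<close> gives \<open>0 \<le> s\<close> and the entering row, positive at \<open>x\<close>
  and zero at \<open>x'\<close>, gives \<open>s \<le> 1\<close>. Any other row outside
  \<open>I\<close> is positive at both ends, hence on the whole segment, so it cannot define another
  basic point there. This determines the pivot.\<close>

lemma pivot_lift:
  assumes I: "trop_basic A b I" "k \<in> I" and piv: "is_trop_pivot A b I k I'"
  defines "x \<equiv> puiseux_basic_point \<AA> \<bb> I" and "x' \<equiv> puiseux_basic_point \<AA> \<bb> I'"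
  shows "0 < slack k x'" "I \<inter> I' = I - {k}"
    "\<And>z. z \<in> puiseux_face \<AA> \<bb> (I - {k}) \<longleftrightarrow> (\<exists>s. 0 \<le> s \<and> s \<le> 1 \<and> z = on_line x x' s)"
    "is_puiseux_pivot \<AA> \<bb> I k J \<longleftrightarrow> J = I'"
proof -
  note B = trop_basicD[OF I(1)] and L = basic_lift[OF I(1), folded x_def]
  obtain i where i: "i \<notin> I" "I' = insert i (I - {k})" and I': "trop_basic A b I'"
    and ne: "trop_basic_point A b I' \<noteq> trop_basic_point A b I"
    using piv by (auto simp: is_trop_pivot_def)
  note B' = trop_basicD[OF I'] and L' = basic_lift[OF I', folded x'_def]
  have im: "i < m" using B'(1) i by auto
  have km: "k < m" using B(1) I(2) by auto
  show kpos: "0 < slack k x'" using L'(6)[OF km] i I(2) by auto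
  show "I \<inter> I' = I - {k}" using i by auto
  have K: "I - {k} \<subseteq> {..<m}" using B(1) by auto
  have x'K: "slack l x' = 0" if "l \<in> I - {k}" for l using L'(5)[of l] that i by auto
  show seg: "z \<in> puiseux_face \<AA> \<bb> (I - {k}) \<longleftrightarrow> (\<exists>s. 0 \<le> s \<and> s \<le> 1 \<and> z = on_line x x' s)" for z
  proof
    assume "z \<in> puiseux_face \<AA> \<bb> (I - {k})"
    then have z: "z \<in> carrier_vec n" "\<And>l. l < m \<Longrightarrow> 0 \<le> slack l z" "\<And>l. l \<in> I - {k} \<Longrightarrow> slack l z = 0"
      by (auto simp: puiseux_face_iff[OF K])
    define s where "s = slack k z / slack k x'"
    have zs: "z = on_line x x' s" unfolding s_def x_def
      by (rule on_line_param[OF I L'(3)]) (use x'K kpos z in auto)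
    have "0 \<le> s" unfolding s_def using z(2)[OF km] kpos by simp
    moreover have "0 \<le> (1 - s) * slack i x"
      using z(2)[OF im] L'(5)[of i] i unfolding zs slack_on_line by simp
    then have "s \<le> 1" using L(6)[OF im i(1)] by (simp add: zero_le_mult_iff)
    ultimately show "\<exists>s. 0 \<le> s \<and> s \<le> 1 \<and> z = on_line x x' s" using zs by blast
  next
    assume "\<exists>s. 0 \<le> s \<and> s \<le> 1 \<and> z = on_line x x' s"
    then obtain s where s: "0 \<le> s" "s \<le> 1" "z = on_line x x' s" by blast
    have "0 \<le> slack l x" "0 \<le> slack l x'" if "l < m" for l
      using L(8) L'(8) that by (auto simp: puiseux_polyhedron_iff)
    then have "0 \<le> slack l z" if "l < m" for l
      unfolding s(3) slack_on_line using s that by (intro add_nonneg_nonneg mult_nonneg_nonneg) auto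
    moreover have "slack l z = 0" if "l \<in> I - {k}" for l
      unfolding s(3) slack_on_line using L(5)[of l] x'K[OF that] that by simp
    ultimately show "z \<in> puiseux_face \<AA> \<bb> (I - {k})"
      unfolding puiseux_face_iff[OF K] using s by (auto simp: on_line_def)
  qed
  have line1: "on_line x x' 1 = x'" using L'(3) by (intro eq_vecI) (auto simp: on_line_def)
  have line0: "on_line x x' 0 = x" using L(3) by (intro eq_vecI) (auto simp: on_line_def)
  have "x' \<in> puiseux_face \<AA> \<bb> (I - {k})" unfolding seg by (rule exI[of _ 1]) (simp add: line1)
  moreover have "x' \<noteq> x" using ne L(2) L'(2) by auto
  ultimately have is_piv: "is_puiseux_pivot \<AA> \<bb> I k I'"
    unfolding is_puiseux_pivot_def using i L'(1) by (auto simp: x_def x'_def)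
  show "is_puiseux_pivot \<AA> \<bb> I k J \<longleftrightarrow> J = I'"
  proof
    assume J: "is_puiseux_pivot \<AA> \<bb> I k J"
    then obtain i' where i': "i' \<notin> I" "J = insert i' (I - {k})" and bJ: "puiseux_basic \<AA> \<bb> J"
      and face: "puiseux_basic_point \<AA> \<bb> J \<in> puiseux_face \<AA> \<bb> (I - {k})"
      and neq: "puiseux_basic_point \<AA> \<bb> J \<noteq> x"
      by (auto simp: is_puiseux_pivot_def x_def)
    have Jm: "J \<subseteq> {..<m}" "card J = n" "det (submatrix \<AA> J UNIV) \<noteq> 0"
      using bJ by (auto simp: puiseux_basic_def lift_dims)
    obtain s where s: "0 \<le> s" "s \<le> 1" "puiseux_basic_point \<AA> \<bb> J = on_line x x' s" using face seg by blast
    show "J = I'"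
    proof (rule ccontr)
      assume "J \<noteq> I'"
      then have ii: "i' \<noteq> i" using i i' by auto
      have i'm: "i' < m" using Jm i' by auto
      have "0 < slack i' x" using L(6)[OF i'm i'(1)] .
      moreover have "0 < slack i' x'" using L'(6)[OF i'm] i i' ii by auto
      moreover have "(1 - s) * slack i' x + s * slack i' x' = 0"
        using basic_point(2)[OF Jm, of i'] i' unfolding s(3) slack_on_line by simp
      moreover have "s \<noteq> 0" using neq s(3) line0 by auto
      ultimately show False using s
        by (smt (verit) add_nonneg_pos diff_ge_0_iff_ge le_less less_irrefl mult_nonneg_nonneg mult_pos_pos)
    qed
  qed (use is_piv in simp)
qed

lemma val_half: "val (1 / 2) = 1"
proof -
  have "val (2 :: puiseux) = 1"
    using val_add_nonneg[of 1 1] by (simp add: plus_trop_def)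
  moreover have "val (1 / 2 :: puiseux) * val 2 = 1" by (simp flip: val_mult)
  ultimately show ?thesis by simp
qed

text \<open>For \<open>0 \<le> s \<le> 1\<close> the valuations of the weights \<open>1 - s\<close>
  and \<open>s\<close> run through exactly the pairs with tropical sum 1. The image thus depends
  only on the valuations of the end points, which makes it the same for all lifts.\<close>

lemma val_segment:
  assumes x: "x \<in> carrier_vec n" "\<And>j. j < n \<Longrightarrow> 0 < x $ j" and y: "y \<in> carrier_vec n" "\<And>j. j < n \<Longrightarrow> 0 < y $ j"
  shows "map_vec val ` {on_line x y s | s. 0 \<le> s \<and> s \<le> 1} =
    {vec n (\<lambda>j. \<alpha> * map_vec val x $ j + \<beta> * map_vec val y $ j) | \<alpha> \<beta>. \<alpha> + \<beta> = 1}"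
proof -
  have line: "map_vec val (on_line x y s) = vec n (\<lambda>j. val (1 - s) * map_vec val x $ j + val s * map_vec val y $ j)"
    if s: "0 \<le> s" "s \<le> 1" for s
  proof (intro eq_vecI)
    fix j assume "j < dim_vec (vec n (\<lambda>j. val (1 - s) * map_vec val x $ j + val s * map_vec val y $ j))"
    then have j: "j < n" by simp
    have "val ((1 - s) * x $ j + s * y $ j) = val ((1 - s) * x $ j) + val (s * y $ j)"
      using s x(2)[OF j] y(2)[OF j] by (intro val_add_nonneg mult_nonneg_nonneg) auto
    then show "map_vec val (on_line x y s) $ j = vec n (\<lambda>j. val (1 - s) * map_vec val x $ j + val s * map_vec val y $ j) $ j"
      using j x y by (simp add: on_line_def)
  qed (simp add: on_line_def)
  have one: "val (1 - s) + val s = 1" if "0 \<le> s" "s \<le> 1" for s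
    using val_add_nonneg[of "1 - s" s] that by simp
  have small: "\<exists>s. 0 \<le> s \<and> s \<le> 1 \<and> val s = \<beta> \<and> val (1 - s) = 1" if "\<beta> < 1" for \<beta>
  proof -
    define s where "s = unit_lift (of_trop \<beta>)"
    have "sval s = of_trop \<beta>" unfolding s_def by (rule sval_coeff_lift) auto
    then have s: "0 \<le> s" "val s = \<beta>" by (auto simp: sval_eq_of_trop)
    have "s \<le> 1" using val_mono[of 1 s] s(2) that by (metis le_cases not_le val_1 zero_le_one)
    with s one[of s] that show ?thesis by (auto simp: plus_trop_def max_def split: if_splits)
  qed
  have ex: "\<exists>s. 0 \<le> s \<and> s \<le> 1 \<and> val (1 - s) = \<alpha> \<and> val s = \<beta>" if "\<alpha> + \<beta> = 1" for \<alpha> \<beta>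
  proof -
    have "\<alpha> \<le> 1" "\<beta> \<le> 1" using that by (metis trop_add_le_iff order_refl)+
    moreover have "\<alpha> = 1 \<or> \<beta> = 1" using that by (auto simp: plus_trop_def max_def split: if_splits)
    ultimately consider "\<alpha> = 1" "\<beta> = 1" | "\<alpha> = 1" "\<beta> < 1" | "\<beta> = 1" "\<alpha> < 1"
      using less_le by blast
    then show ?thesis
    proof cases
      case 1
      \<comment> \<open>Both weights must have valuation 1, and the midpoint provides them.\<close>
      have "(1::puiseux) - 1 / 2 = 1 / 2" by simp
      then show ?thesis using 1 val_half by (intro exI[of _ "1 / 2"]) auto
    next
      case 2
      then show ?thesis using small by blast
    next
      case 3
      then obtain s where "0 \<le> s" "s \<le> 1" "val s = \<alpha>" "val (1 - s) = 1" using small by blast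
      then show ?thesis using 3 by (intro exI[of _ "1 - s"]) auto
    qed
  qed
  show ?thesis
  proof (intro equalityI subsetI)
    fix z assume "z \<in> map_vec val ` {on_line x y s | s. 0 \<le> s \<and> s \<le> 1}"
    then show "z \<in> {vec n (\<lambda>j. \<alpha> * map_vec val x $ j + \<beta> * map_vec val y $ j) | \<alpha> \<beta>. \<alpha> + \<beta> = 1}"
      using line one by fastforce
  next
    fix z assume "z \<in> {vec n (\<lambda>j. \<alpha> * map_vec val x $ j + \<beta> * map_vec val y $ j) | \<alpha> \<beta>. \<alpha> + \<beta> = 1}"
    then obtain \<alpha> \<beta> where z: "z = vec n (\<lambda>j. \<alpha> * map_vec val x $ j + \<beta> * map_vec val y $ j)" "\<alpha> + \<beta> = 1" by blast
    then obtain s where s: "0 \<le> s" "s \<le> 1" "val (1 - s) = \<alpha>" "val s = \<beta>" using ex by blast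
    then have "z = map_vec val (on_line x y s)" using line z(1) by simp
    then show "z \<in> map_vec val ` {on_line x y s | s. 0 \<le> s \<and> s \<le> 1}" using s by blast
  qed
qed

lemma val_edge:
  assumes I: "trop_basic A b I" "k \<in> I" and piv: "is_trop_pivot A b I k I'"
  shows "map_vec val ` puiseux_face \<AA> \<bb> (I - {k}) =
    {vec n (\<lambda>j. \<alpha> * trop_basic_point A b I $ j + \<beta> * trop_basic_point A b I' $ j) | \<alpha> \<beta>. \<alpha> + \<beta> = 1}"
proof -
  have I': "trop_basic A b I'" using piv by (simp add: is_trop_pivot_def)
  note L = basic_lift[OF I(1)] and L' = basic_lift[OF I']
  have "puiseux_face \<AA> \<bb> (I - {k}) =
    {on_line (puiseux_basic_point \<AA> \<bb> I) (puiseux_basic_point \<AA> \<bb> I') s | s. 0 \<le> s \<and> s \<le> 1}"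
    unfolding set_eq_iff mem_Collect_eq pivot_lift(3)[OF I piv] by blast
  then show ?thesis using val_segment[OF L(3,7) L'(3,7)] L(2) L'(2) by simp
qed

text \<open>Taking valuations respects the inequalities only for nonnegative coordinates; these are
  supplied by \<open>polyhedron_positive\<close>, with the given basic point as the positive
  reference point.\<close>

lemma edge_val_subset:
  assumes I: "trop_basic A b I" and K: "K \<subseteq> {..<m}"
  shows "map_vec val ` puiseux_face \<AA> \<bb> K \<subseteq> trop_face A b K"
proof
  fix z assume "z \<in> map_vec val ` puiseux_face \<AA> \<bb> K"
  then obtain y where y: "y \<in> puiseux_face \<AA> \<bb> K" "z = map_vec val y" by blast
  then have yp: "y \<in> puiseux_polyhedron \<AA> \<bb>" by (simp add: puiseux_face_def)
  have "0 \<le> y $ j" if "j < n" for j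
    using polyhedron_positive[OF basic_lift(8,7)[OF I] yp that] by simp
  from val_in_polyhedron[OF yp this] show "z \<in> trop_face A b K"
    using y K by (auto simp: trop_face_def puiseux_face_iff[OF K])
qed

end

section \<open>Uniqueness of pivots and lifts through a prescribed point\<close>

context trop_program
begin

text \<open>In one fixed lift every tropical pivot is a Puiseux pivot, and it is the only
  one.\<close>

lemma pivot_unique:
  assumes I: "trop_basic A b I" "k \<in> I"
  shows "\<exists>!I'. is_trop_pivot A b I k I'"
proof -
  obtain I' where I': "is_trop_pivot A b I k I'" using pivot_exists[OF I] by blast
  obtain \<AA> \<bb> \<cc> where "trop_lift n m A b c \<AA> \<bb> \<cc>" using coeff_lift_is_lift[of 1 1] by auto
  then interpret trop_lift n m A b c \<AA> \<bb> \<cc> .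
  have "J = I'" if "is_trop_pivot A b I k J" for J
    using pivot_lift(4)[OF I that] pivot_lift(4)[OF I I'] by blast
  with I' show ?thesis by blast
qed

lemma trop_pivot_eqI: "trop_basic A b I \<Longrightarrow> k \<in> I \<Longrightarrow> is_trop_pivot A b I k I' \<Longrightarrow> trop_pivot A b I k = I'"
  unfolding trop_pivot_def by (rule the1_equality[OF pivot_unique])

lemma trop_pivot: "trop_basic A b I \<Longrightarrow> k \<in> I \<Longrightarrow> is_trop_pivot A b I k (trop_pivot A b I k)"
  unfolding trop_pivot_def by (rule theI'[OF pivot_unique])

text \<open>With coefficient \<open>n + 2\<close> on the positive and 1 on the negative entries, the positive entry
  that attains the maximum of a row outweighs all the negative ones.\<close>

lemma heavy_lift_positive:
  assumes i: "i < m" and j0: "j0 \<le> n" "V w i j0 = Pos 0"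
  shows "0 < (\<Sum>j\<le>n. coeff_lift (real n + 2) 1 (W i j) * monomial 1 (- w j))"
proof -
  obtain S where S: "lev w i = Fin S" using lev_neq_0[OF i, of w] by (auto elim: trop_neq_0E)
  let ?t = "\<lambda>j. coeff_lift (real n + 2) 1 (W i j) * monomial 1 (- w j)"
  have sv: "sval (coeff_lift (real n + 2) 1 (W i j)) = W i j" for j by (rule sval_coeff_lift) auto
  have m1: "val (monomial 1 (- w j)) = Fin (w j)" for j
  proof -
    have "sval (monomial 1 (- w j)) = Pos (w j)" by simp
    then show ?thesis unfolding sval_eq_Pos by simp
  qed
  have vt: "val (?t j) \<le> Fin S" if "j \<le> n" for j
  proof -
    have "val (?t j) = modulus (W i j) * Fin (w j)" using sv[of j] m1 by (metis modulus_sval val_mult)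
    also have "\<dots> \<le> lev w i" unfolding lev_def
      using trop_le_sum[of "{..n}" j "\<lambda>j. modulus (W i j) * Fin (w j)"] that by simp
    finally show ?thesis using S by simp
  qed
  have mm: "monomial r e * monomial 1 e' = monomial r (e + e')" for r e e'
    by (rule puiseux_eqI) (simp add: pcoeff_monomial_mult pcoeff_monomial algebra_simps)
  have W0: "W i j0 = Pos (S - w j0)" using V_scale(2)[OF i, of w j0] S j0 by (cases "W i j0") auto
  have "pcoeff (?t j0) (- S) = real n + 2" by (simp add: W0 mm pcoeff_monomial)
  moreover have le1: "- 1 \<le> pcoeff (?t j) (- S)" for j
    by (cases "W i j") (auto simp: mm pcoeff_monomial)
  have "(\<Sum>j\<in>{..n} - {j0}. - 1) \<le> (\<Sum>j\<in>{..n} - {j0}. pcoeff (?t j) (- S))" by (rule sum_mono[OF le1])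
  moreover have "(\<Sum>j\<in>{..n} - {j0}. - 1 :: real) = - real n" using j0 by simp
  ultimately have "0 < (\<Sum>j\<le>n. pcoeff (?t j) (- S))"
    using sum.remove[of "{..n}" j0 "\<lambda>j. pcoeff (?t j) (- S)"] j0 by simp
  then have "0 < pcoeff (\<Sum>j\<le>n. ?t j) (- S)" by (simp add: pcoeff_sum)
  moreover have "val (\<Sum>j\<le>n. ?t j) \<le> Fin S" by (rule val_sum_le) (use vt in auto)
  ultimately show ?thesis using val_positive_iff by blast
qed

lemma balanced_tight:
  assumes i: "i < m" and pq: "p \<le> n" "V w i p = Pos 0" "q \<le> n" "V w i q = Neg 0"
  shows "balanced ((\<lambda>j. stimes (W i j) (Pos (w j))) ` {..n})"
proof -
  obtain S where S: "lev w i = Fin S" using lev_neq_0[OF i, of w] by (auto elim: trop_neq_0E)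
  have Wp: "stimes (W i p) (Pos (w p)) = Pos S" using V_scale(2)[OF i, of w p] S pq by (cases "W i p") auto
  have Wq: "stimes (W i q) (Pos (w q)) = Neg S" using V_scale(3)[OF i, of w q] S pq by (cases "W i q") auto
  let ?T = "(\<lambda>j. stimes (W i j) (Pos (w j))) ` {..n}"
  have T: "Pos S \<in> ?T" by (rule image_eqI[of _ _ p]) (simp_all add: Wp pq)
  have T': "Neg S \<in> ?T" by (rule image_eqI[of _ _ q]) (simp_all add: Wq pq)
  have M: "Max (modulus ` ?T) = Fin S"
  proof (rule Max_eqI)
    show "y \<le> Fin S" if "y \<in> modulus ` ?T" for y
      using that trop_le_sum[of "{..n}" _ "\<lambda>j. modulus (W i j) * Fin (w j)"] S unfolding lev_def by auto
    show "Fin S \<in> modulus ` ?T" using imageI[OF T, of modulus] by simp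
  qed simp
  have "\<exists>p\<in>?T. tpositive p \<and> modulus p = Fin S" by (rule bexI[OF _ T]) (simp add: tpositive_def)
  moreover have "\<exists>q\<in>?T. tnegative q \<and> modulus q = Fin S" by (rule bexI[OF _ T']) (simp add: tnegative_def)
  ultimately show ?thesis unfolding balanced_def M by (intro disjI2 conjI)
qed

text \<open>The point \<open>w\<close> is lifted to monomials with coefficient 1. The rows in
  \<open>K\<close> are lifted so that they vanish exactly there, and all other rows get heavy
  positive coefficients, which keep them positive. The lift depends on \<open>w\<close>.\<close>

lemma adapted_lift:
  assumes K: "K \<subseteq> {..<m}" and w: "w n = 0" "pt w \<in> trop_face A b K"
  shows "\<exists>\<AA> \<bb> \<cc>. trop_lift n m A b c \<AA> \<bb> \<cc> \<and> pt w \<in> map_vec val ` puiseux_face \<AA> \<bb> K"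
proof -
  have t: "tight w K" and pos: "\<And>i. i < m \<Longrightarrow> \<exists>j\<le>n. V w i j = Pos 0"
    using face_V[of w, OF w(1) K] w(2) by auto
  define X where "X j = monomial 1 (- w j)" for j
  have Xs: "sval (X j) = Pos (w j)" for j by (simp add: X_def)
  have "\<exists>\<ww>. (\<forall>j\<le>n. sval (\<ww> j) = W i j) \<and> (\<Sum>j\<le>n. \<ww> j * X j) = 0" if "i \<in> K" for i
  proof -
    have "balanced ((\<lambda>j. stimes (W i j) (sval (X j))) ` {..n})"
      unfolding Xs using balanced_tight t that K unfolding tight_def by blast
    from exact_lift[OF _ _ this] show ?thesis by auto
  qed
  then obtain \<ww> where ww: "\<And>i j. i \<in> K \<Longrightarrow> j \<le> n \<Longrightarrow> sval (\<ww> i j) = W i j"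
    "\<And>i. i \<in> K \<Longrightarrow> (\<Sum>j\<le>n. \<ww> i j * X j) = 0" by metis
  define \<LL> where "\<LL> i j = (if i \<in> K then \<ww> i j else coeff_lift (real n + 2) 1 (W i j))" for i j
  have L: "sval (\<LL> i j) = W i j" if "j \<le> n" for i j
    using ww(1)[OF _ that] by (auto simp: \<LL>_def intro!: sval_coeff_lift)
  define \<AA> where "\<AA> = mat m n (\<lambda>(i, j). \<LL> i j)"
  define \<bb> where "\<bb> = vec m (\<lambda>i. \<LL> i n)"
  define \<cc> where "\<cc> = map_vec (unit_lift \<circ> of_trop) c"
  have "sval (unit_lift x) = x" for x by (rule sval_coeff_lift) auto
  then have "map_vec sval \<cc> = map_vec of_trop c" by (intro eq_vecI) (auto simp: \<cc>_def)
  moreover have "map_mat sval \<AA> = A" using L dims W_simps by (intro eq_matI) (auto simp: \<AA>_def)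
  moreover have "map_vec sval \<bb> = b" using L dims W_simps by (intro eq_vecI) (auto simp: \<bb>_def)
  ultimately have "is_lift \<AA> \<bb> \<cc> A b c" by (simp add: is_lift_def)
  then have tl: "trop_lift n m A b c \<AA> \<bb> \<cc>" by unfold_locales
  then interpret trop_lift n m A b c \<AA> \<bb> \<cc> .
  define x where "x = vec n X"
  have "X n = 1" by (rule puiseux_eqI) (simp add: X_def w(1) pcoeff_monomial pcoeff_1)
  then have ph: "phom x j = X j" if "j \<le> n" for j using that by (auto simp: phom_def x_def)
  have WWL: "append_col \<AA> \<bb> $$ (i, j) = \<LL> i j" if "i < m" "j \<le> n" for i j
    using that by (auto simp: append_col_def \<AA>_def \<bb>_def)
  have slack: "slack i x = (\<Sum>j\<le>n. \<LL> i j * X j)" if "i < m" for i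
    unfolding slk_def using ph WWL[OF that] by simp
  have zero: "slack i x = 0" if "i \<in> K" for i
    using slack[of i] ww(2)[OF that] that K by (auto simp: \<LL>_def)
  have "0 \<le> slack i x" if i: "i < m" for i
  proof (cases "i \<in> K")
    case False
    obtain j where "j \<le> n" "V w i j = Pos 0" using pos[OF i] by blast
    from heavy_lift_positive[OF i this] show ?thesis
      unfolding slack[OF i] using False by (simp add: \<LL>_def X_def)
  qed (use zero in simp)
  then have "x \<in> puiseux_face \<AA> \<bb> K" using zero by (simp add: puiseux_face_iff[OF K] x_def)
  moreover have "val (X j) = Fin (w j)" for j using Xs[of j] unfolding sval_eq_Pos by simp
  then have "map_vec val x = pt w" by (intro eq_vecI) (auto simp: x_def pt_def)
  ultimately have "pt w \<in> map_vec val ` puiseux_face \<AA> \<bb> K" by (metis imageI)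
  with tl show ?thesis by blast
qed

end

text \<open>For the inclusion that does not follow from taking valuations, a point of the tropical
  edge lies in the image of the Puiseux edge of a lift adapted to it. By \<open>val_edge\<close>
  this image is the same tropical segment for every lift.\<close>

lemma (in trop_lift) edge_lift:
  assumes I: "trop_basic A b I" "k \<in> I" and piv: "is_trop_pivot A b I k I'"
  shows "trop_face A b (I - {k}) = map_vec val ` puiseux_face \<AA> \<bb> (I - {k})"
proof
  have K: "I - {k} \<subseteq> {..<m}" using trop_basicD(1)[OF I(1)] by auto
  show "map_vec val ` puiseux_face \<AA> \<bb> (I - {k}) \<subseteq> trop_face A b (I - {k})"
    by (rule edge_val_subset[OF I(1) K])
  show "trop_face A b (I - {k}) \<subseteq> map_vec val ` puiseux_face \<AA> \<bb> (I - {k})"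
  proof
    fix z assume z: "z \<in> trop_face A b (I - {k})"
    then obtain w where w: "w n = 0" "z = pt w" using face_finite by blast
    then obtain \<AA>' \<bb>' \<cc>' where l: "trop_lift n m A b c \<AA>' \<bb>' \<cc>'"
      and zi: "z \<in> map_vec val ` puiseux_face \<AA>' \<bb>' (I - {k})"
      using adapted_lift[OF K, of w] z by blast
    interpret L: trop_lift n m A b c \<AA>' \<bb>' \<cc>' by (rule l)
    show "z \<in> map_vec val ` puiseux_face \<AA> \<bb> (I - {k})"
      using zi unfolding val_edge[OF I piv] L.val_edge[OF I piv] .
  qed
qed

section \<open>Reduced costs\<close>

lemma strop_sgn_stimes: "strop_sgn (stimes x y) = strop_sgn x * strop_sgn y"
  by (cases x; cases y) auto

lemma sval_1 [simp]: "sval 1 = Pos 0"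
  by (simp add: sval_eq_Pos one_trop_def)

lemma val_prod: "val (prod f S) = (\<Prod>i\<in>S. val (f i))"
  by (induction S rule: infinite_finite_induct) auto

lemma sgn_sval_prod: "strop_sgn (sval (prod f S)) = (\<Prod>i\<in>S. strop_sgn (sval (f i)))"
  by (induction S rule: infinite_finite_induct) (auto simp: strop_sgn_stimes)

lemma sval_signof: "sval (signof \<pi> :: puiseux) = (if sign \<pi> = 1 then Pos 0 else Neg 0)"
  by (cases "evenperm \<pi>") (auto simp: sign_def)

lemma strop_sgn_sval: "strop_sgn (sval x) = 1 \<longleftrightarrow> 0 < x" "strop_sgn (sval x) = - 1 \<longleftrightarrow> x < 0"
  by (cases x rule: sval_cases; simp)+

text \<open>Sign genericity may leave several maximizing permutations, but their terms then have a
  common sign. They cannot cancel at the top level, so valuation and sign of the determinant can be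
  read off any one of them.\<close>

lemma sval_det:
  assumes M: "M \<in> carrier_mat k k" and U: "map_mat sval M = U"
    and a: "tper (map_mat modulus U) = Fin a" and reg: "\<not> trop_sign_singular U"
    and \<sigma>0: "maximizing_perm (map_mat modulus U) \<sigma>0"
  shows "sval (det M) = (if perm_term_sgn U \<sigma>0 = 1 then Pos a else Neg a)"
proof -
  let ?P = "{\<sigma>. \<sigma> permutes {0..<k}}"
  let ?T = "\<lambda>\<sigma>. signof \<sigma> * (\<Prod>i = 0..<k. M $$ (i, \<sigma> i))"
  have Uk: "U \<in> carrier_mat k k" using M U by auto
  have in_k: "\<sigma> i < k" if "\<sigma> \<in> ?P" "i < k" for \<sigma> i using permutes_in_image[of \<sigma> "{0..<k}" i] that by auto
  have entry: "sval (M $$ (i, \<sigma> i)) = U $$ (i, \<sigma> i)" if "\<sigma> \<in> ?P" "i < k" for \<sigma> i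
    using U M in_k[OF that] that(2) by auto
  have one: "val (signof \<sigma> :: puiseux) = 1" for \<sigma> :: "nat \<Rightarrow> nat"
    by (metis modulus.simps(2,3) modulus_sval one_trop_def sval_signof)
  have vT: "val (?T \<sigma>) = (\<Prod>i = 0..<k. map_mat modulus U $$ (i, \<sigma> i))" if "\<sigma> \<in> ?P" for \<sigma>
  proof -
    have "val (M $$ (i, \<sigma> i)) = map_mat modulus U $$ (i, \<sigma> i)" if "i < k" for i
      using entry[OF \<open>\<sigma> \<in> ?P\<close> that] Uk in_k[OF \<open>\<sigma> \<in> ?P\<close> that] that
      by (metis carrier_matD index_map_mat(1) modulus_sval)
    then show ?thesis by (simp add: val_prod one)
  qed
  have sT: "strop_sgn (sval (?T \<sigma>)) = perm_term_sgn U \<sigma>" if "\<sigma> \<in> ?P" for \<sigma>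
  proof -
    have "strop_sgn (sval (signof \<sigma> :: puiseux)) = sign \<sigma>" by (simp add: sval_signof sign_def)
    moreover have "(\<Prod>i = 0..<k. strop_sgn (sval (M $$ (i, \<sigma> i)))) = (\<Prod>i = 0..<k. strop_sgn (U $$ (i, \<sigma> i)))"
      using entry[OF that] by (intro prod.cong) auto
    ultimately show ?thesis using Uk unfolding perm_term_sgn_def sval_mult strop_sgn_stimes sgn_sval_prod by simp
  qed
  have max_iff: "maximizing_perm (map_mat modulus U) \<sigma> \<longleftrightarrow> \<sigma> \<in> ?P \<and> val (?T \<sigma>) = Fin a" for \<sigma>
    using vT[of \<sigma>] Uk a by (auto simp: maximizing_perm_def)
  have le: "val (?T \<sigma>) \<le> Fin a" if "\<sigma> \<in> ?P" for \<sigma>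
    unfolding vT[OF that] a[symmetric] tper_def
    using trop_le_sum[of ?P \<sigma> "\<lambda>\<sigma>. \<Prod>i = 0..<k. map_mat modulus U $$ (i, \<sigma> i)"] that Uk
    by (simp add: finite_permutations)
  have \<sigma>0P: "\<sigma>0 \<in> ?P" "val (?T \<sigma>0) = Fin a" using \<sigma>0 max_iff by auto
  have same: "perm_term_sgn U \<sigma> = perm_term_sgn U \<sigma>0 \<and> perm_term_sgn U \<sigma> \<in> {1, - 1}"
    if "maximizing_perm (map_mat modulus U) \<sigma>" for \<sigma>
  proof -
    have nz: "perm_term_sgn U \<tau> \<in> {1, - 1}" if "maximizing_perm (map_mat modulus U) \<tau>" for \<tau>
    proof -
      have "\<tau> \<in> ?P" "val (?T \<tau>) = Fin a" using that max_iff by auto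
      then show ?thesis unfolding sT[OF \<open>\<tau> \<in> ?P\<close>, symmetric]
        by (cases "?T \<tau>" rule: sval_cases) (simp_all del: sval_mult)
    qed
    have "perm_term_sgn U \<sigma> \<noteq> - perm_term_sgn U \<sigma>0"
      using reg that \<sigma>0 unfolding trop_sign_singular_def by blast
    then show ?thesis using nz[OF that] nz[OF \<sigma>0] by auto
  qed
  have det: "det M = (\<Sum>\<sigma>\<in>?P. ?T \<sigma>)" using det_def'[OF M] by simp
  have vdet: "val (det M) \<le> Fin a" unfolding det by (rule val_sum_le[OF le])
  have fin: "finite ?P" by (simp add: finite_permutations)
  have zero: "pcoeff (?T \<sigma>) (- a) = 0" if "\<sigma> \<in> ?P" "\<not> maximizing_perm (map_mat modulus U) \<sigma>" for \<sigma>
  proof -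
    have "val (?T \<sigma>) \<noteq> Fin a" using that max_iff by blast
    then have "val (?T \<sigma>) < Fin a" using le[OF that(1)] less_le by blast
    then show ?thesis using val_less_iff by blast
  qed
  have nn: "0 \<le> \<epsilon> * pcoeff (?T \<sigma>) (- a)"
    if "\<sigma> \<in> ?P" "\<And>\<sigma>. maximizing_perm (map_mat modulus U) \<sigma> \<Longrightarrow> 0 < \<epsilon> * pcoeff (?T \<sigma>) (- a)" for \<sigma> \<epsilon>
    using zero[OF that(1)] that(2)[of \<sigma>] by (cases "maximizing_perm (map_mat modulus U) \<sigma>") auto
  show ?thesis
  proof (cases "perm_term_sgn U \<sigma>0 = 1")
    case True
    have mx: "0 < pcoeff (?T \<sigma>) (- a)" if "maximizing_perm (map_mat modulus U) \<sigma>" for \<sigma>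
    proof -
      have s: "\<sigma> \<in> ?P" "val (?T \<sigma>) = Fin a" using that max_iff by auto
      have "strop_sgn (sval (?T \<sigma>)) = 1" unfolding sT[OF s(1)] using same[OF that] True by simp
      then show ?thesis using s(2) strop_sgn_sval(1) val_positive_iff by blast
    qed
    have "0 < (\<Sum>\<sigma>\<in>?P. pcoeff (?T \<sigma>) (- a))"
      by (rule sum_pos2[of ?P \<sigma>0 "\<lambda>\<sigma>. pcoeff (?T \<sigma>) (- a)", OF fin \<sigma>0P(1) mx[OF \<sigma>0]])
        (use nn[of _ 1] mx in simp)
    then have "0 < pcoeff (det M) (- a)" unfolding det pcoeff_sum .
    then show ?thesis using True vdet val_positive_iff[of "det M" a] by (simp add: sval_eq_Pos)
  next
    case False
    then have m1: "perm_term_sgn U \<sigma>0 = - 1" using same[OF \<sigma>0] by auto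
    have mx: "0 < - pcoeff (?T \<sigma>) (- a)" if "maximizing_perm (map_mat modulus U) \<sigma>" for \<sigma>
    proof -
      have s: "\<sigma> \<in> ?P" "val (?T \<sigma>) = Fin a" using that max_iff by auto
      have "strop_sgn (sval (?T \<sigma>)) = - 1" unfolding sT[OF s(1)] using same[OF that] m1 by simp
      then have "0 < - ?T \<sigma> \<and> val (- ?T \<sigma>) = Fin a" using s(2) strop_sgn_sval(2) by (metis neg_0_less_iff_less val_uminus)
      then have "0 < pcoeff (- ?T \<sigma>) (- a)" using val_positive_iff by blast
      then show ?thesis by (simp only: pcoeff_uminus)
    qed
    have "0 < (\<Sum>\<sigma>\<in>?P. - pcoeff (?T \<sigma>) (- a))"
      by (rule sum_pos2[of ?P \<sigma>0 "\<lambda>\<sigma>. - pcoeff (?T \<sigma>) (- a)", OF fin \<sigma>0P(1) mx[OF \<sigma>0]])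
        (use nn[of _ "- 1"] mx in simp)
    then have "0 < pcoeff (- det M) (- a)" unfolding pcoeff_uminus det pcoeff_sum by (simp only: sum_negf)
    then show ?thesis using False vdet val_positive_iff[of "- det M" a] by (simp add: sval_eq_Neg)
  qed
qed

lemma pick_lessThan: "j < k \<Longrightarrow> pick {..<k} j = j"
proof -
  assume j: "j < k"
  have "pick {..<k} j \<in> {..<k}" "card {a \<in> {..<k}. a < pick {..<k} j} = j"
    using pick_in_set_le[of j "{..<k}"] card_pick_le[of j "{..<k}"] j by auto
  moreover from this have "{a \<in> {..<k}. a < pick {..<k} j} = {..<pick {..<k} j}" by auto
  ultimately show ?thesis by simp
qed

text \<open>Reordering the columns changes the determinants of all lifts by the same sign.\<close>

lemma sval_det_columns:
  assumes gen: "trop_sign_generic B" and B: "B \<in> carrier_mat k l"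
    and B1: "map_mat sval B1 = B" and B2: "map_mat sval B2 = B"
    and e: "bij_betw e {..<k} C" "C \<subseteq> {..<l}"
  shows "sval (det (mat k k (\<lambda>(j, s). B1 $$ (j, e s)))) = sval (det (mat k k (\<lambda>(j, s). B2 $$ (j, e s))))"
proof -
  have finC: "finite C" using e(2) finite_subset by blast
  have cC: "card C = k" using bij_betw_same_card[OF e(1)] by simp
  have pC: "bij_betw (pick C) {..<k} C" using bij_betw_pick[OF finC] cC by simp
  define \<pi> where "\<pi> s = (if s < k then inv_into {..<k} (pick C) (e s) else s)" for s
  have "bij_betw (inv_into {..<k} (pick C) \<circ> e) {..<k} {..<k}"
    by (rule bij_betw_trans[OF e(1) bij_betw_inv_into[OF pC]])
  then have "bij_betw \<pi> {..<k} {..<k}"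
    by (rule bij_betw_cong[THEN iffD1, rotated]) (auto simp: \<pi>_def)
  then have perm: "\<pi> permutes {0..<k}"
    unfolding atLeast0LessThan by (rule bij_imp_permutes) (auto simp: \<pi>_def)
  have pk: "pick C (\<pi> s) = e s" "\<pi> s < k" if "s < k" for s
  proof -
    have "e s \<in> C" using bij_betwE[OF e(1)] that by simp
    then have "e s \<in> pick C ` {..<k}" using bij_betw_imp_surj_on[OF pC] by simp
    from f_inv_into_f[OF this] inv_into_into[OF this]
    show "pick C (\<pi> s) = e s" "\<pi> s < k" using that by (auto simp: \<pi>_def)
  qed
  have red: "det (mat k k (\<lambda>(j, s). B' $$ (j, e s))) = signof \<pi> * det (submatrix B' {..<k} C)"
    and car: "submatrix B' {..<k} C \<in> carrier_mat k k"
    if B': "map_mat sval B' = B" for B'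
  proof -
    have Bc: "B' \<in> carrier_mat k l" using B B' by auto
    define S where "S = submatrix B' {..<k} C"
    have S: "S \<in> carrier_mat k k" "\<And>j s. j < k \<Longrightarrow> s < k \<Longrightarrow> S $$ (j, s) = B' $$ (j, pick C s)"
      using submatrix_carrier[OF Bc subset_refl e(2)] cC by (auto simp: S_def pick_lessThan)
    show "submatrix B' {..<k} C \<in> carrier_mat k k" using S(1) by (simp add: S_def)
    let ?N = "mat k k (\<lambda>(j, s). B' $$ (j, e s))"
    have "transpose_mat ?N = mat k k (\<lambda>(s, j). transpose_mat S $$ (\<pi> s, j))"
      using S pk by (intro eq_matI) auto
    then have "det (transpose_mat ?N) = signof \<pi> * det (transpose_mat S)"
      using det_permute_rows[of "transpose_mat S" k \<pi>] S(1) perm by simp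
    then show "det ?N = signof \<pi> * det (submatrix B' {..<k} C)"
      using det_transpose[of ?N k] det_transpose[OF S(1)] by (simp add: S_def)
  qed
  let ?U = "submatrix B {..<k} C"
  have Us: "map_mat sval (submatrix B' {..<k} C) = ?U" if "map_mat sval B' = B" for B'
    using that by (simp add: map_mat_submatrix)
  have "?U \<in> square_submatrices B"
    unfolding square_submatrices_def mem_Collect_eq using B e(2) cC by (intro exI[of _ "{..<k}"] exI[of _ C]) auto
  then have reg: "tper (map_mat modulus ?U) = NegInf \<or> \<not> trop_sign_singular ?U"
    using gen by (simp add: trop_sign_generic_def)
  have "sval (det (submatrix B1 {..<k} C)) = sval (det (submatrix B2 {..<k} C))"
  proof (cases "tper (map_mat modulus ?U) = NegInf")
    case True
    then have "det (submatrix B' {..<k} C) = 0" if "map_mat sval B' = B" for B'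
      using tper_sval_neq_NegInf[OF car[OF that]] Us[OF that] by metis
    then show ?thesis using B1 B2 by simp
  next
    case False
    then obtain a where a: "tper (map_mat modulus ?U) = Fin a" by (cases "tper (map_mat modulus ?U)") auto
    have Uc: "?U \<in> carrier_mat k k" using car[OF B1] Us[OF B1] by (metis map_carrier_mat)
    then have dr: "dim_row (map_mat modulus ?U) = k" by simp
    have "tper (map_mat modulus ?U) \<noteq> 0" using a by simp
    then obtain \<sigma> where "maximizing_perm (map_mat modulus ?U) \<sigma>"
      using trop_sum_attained[of "{\<sigma>. \<sigma> permutes {0..<k}}" "\<lambda>\<sigma>. \<Prod>i = 0..<k. map_mat modulus ?U $$ (i, \<sigma> i)"]
        finite_permutations[of "{0..<k}"]
      unfolding tper_def maximizing_perm_def dr by blast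
    then show ?thesis using sval_det[OF car[OF B1] Us[OF B1] a] sval_det[OF car[OF B2] Us[OF B2] a] reg False by simp
  qed
  then show ?thesis by (simp add: red[OF B1] red[OF B2])
qed

section \<open>Reduced costs of a lift\<close>

context trop_lift
begin

lemma transpose_AA_prod: "y \<in> carrier_vec m \<Longrightarrow> j < n \<Longrightarrow> (transpose_mat \<AA> *\<^sub>v y) $ j = (\<Sum>i<m. \<AA> $$ (i, j) * y $ i)"
  using lift_dims by (simp add: scalar_prod_def atLeast0LessThan)

text \<open>Vectors supported on \<open>I\<close> turn the system for the full transpose into a
  square one with the matrix \<open>MT\<close>. The last claim is Cramer's rule without division,
  the place where minors of the matrix with the cost column appear.\<close>

lemma reduced_costs:
  assumes I: "I \<subseteq> {..<m}" "card I = n" "det (submatrix \<AA> I UNIV) \<noteq> 0"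
  defines "rc \<equiv> puiseux_reduced_costs \<AA> \<cc> I" and "MT \<equiv> transpose_mat (submatrix \<AA> I UNIV)"
  shows "rc \<in> carrier_vec m" "\<And>i. i < m \<Longrightarrow> i \<notin> I \<Longrightarrow> rc $ i = 0"
    "\<And>j. j < n \<Longrightarrow> (\<Sum>i<m. \<AA> $$ (i, j) * rc $ i) = \<cc> $ j"
    "\<And>y. y \<in> carrier_vec m \<Longrightarrow> (\<And>i. i < m \<Longrightarrow> i \<notin> I \<Longrightarrow> y $ i = 0) \<Longrightarrow>
      (\<And>j. j < n \<Longrightarrow> (\<Sum>i<m. \<AA> $$ (i, j) * y $ i) = \<cc> $ j) \<Longrightarrow> y = rc"
    "\<And>r. r < n \<Longrightarrow> rc $ pick I r * det MT = det (replace_col MT \<cc> r)"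
proof -
  note sub = submatrix_AA[OF I(1,2)]
  have MT: "MT \<in> carrier_mat n n" using sub(1) by (simp add: MT_def)
  have dMT: "det MT \<noteq> 0" unfolding MT_def using det_transpose[OF sub(1)] I(3) by simp
  have finI: "finite I" using I(1) finite_subset by blast
  have pI: "bij_betw (pick I) {..<n} I" using bij_betw_pick[OF finI] I(2) by simp
  let ?z = "\<lambda>y. vec n (\<lambda>r. y $ pick I r)"
  let ?Q = "\<lambda>y. y \<in> carrier_vec m \<and> (\<forall>i<m. i \<notin> I \<longrightarrow> y $ i = 0) \<and> transpose_mat \<AA> *\<^sub>v y = \<cc>"
  have sum_eq: "(MT *\<^sub>v ?z y) $ j = (\<Sum>i<m. \<AA> $$ (i, j) * y $ i)"
    if y: "\<And>i. i < m \<Longrightarrow> i \<notin> I \<Longrightarrow> y $ i = 0" and j: "j < n" for y j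
  proof -
    have "(MT *\<^sub>v ?z y) $ j = (\<Sum>r<n. \<AA> $$ (pick I r, j) * y $ pick I r)"
      using MT j sub by (simp add: scalar_prod_def atLeast0LessThan MT_def)
    also have "\<dots> = (\<Sum>i\<in>I. \<AA> $$ (i, j) * y $ i)"
      using sum.reindex_bij_betw[OF pI, of "\<lambda>i. \<AA> $$ (i, j) * y $ i"] .
    also have "\<dots> = (\<Sum>i<m. \<AA> $$ (i, j) * y $ i)"
      by (rule sum.mono_neutral_left) (use I(1) y in auto)
    finally show ?thesis .
  qed
  have Q: "?Q y \<longleftrightarrow> y \<in> carrier_vec m \<and> (\<forall>i<m. i \<notin> I \<longrightarrow> y $ i = 0) \<and> (\<forall>j<n. (\<Sum>i<m. \<AA> $$ (i, j) * y $ i) = \<cc> $ j)" for y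
  proof -
    have "transpose_mat \<AA> *\<^sub>v y = \<cc> \<longleftrightarrow> (\<forall>j<n. (\<Sum>i<m. \<AA> $$ (i, j) * y $ i) = \<cc> $ j)" if "y \<in> carrier_vec m"
      using transpose_AA_prod[OF that] lift_dims by (metis (no_types, lifting) carrier_vecD dim_mult_mat_vec eq_vecI index_transpose_mat(2))
    then show ?thesis by blast
  qed
  have QMT: "MT *\<^sub>v ?z y = \<cc>" if "?Q y" for y
    using that Q sum_eq[of y] MT lift_dims by (intro eq_vecI) auto
  obtain z where z: "z \<in> carrier_vec n" "MT *\<^sub>v z = \<cc>"
    using det_nonzero_solve(1)[OF MT dMT lift_dims(3)] by blast
  define y where "y = vec m (\<lambda>i. if i \<in> I then z $ inv_into {..<n} (pick I) i else 0)"
  have pm: "pick I r \<in> I" "pick I r < m" if "r < n" for r using bij_betwE[OF pI] that I(1) by auto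
  have "y $ pick I r = z $ r" if "r < n" for r
    using pm[OF that] that bij_betw_inv_into_left[OF pI] by (simp add: y_def)
  then have zy: "?z y = z" using z(1) by (intro eq_vecI) auto
  have y0: "y $ i = 0" if "i < m" "i \<notin> I" for i using that by (simp add: y_def)
  have "?Q y" unfolding Q using sum_eq[OF y0] zy z(2) y0 by (auto simp: y_def)
  moreover have "x = y" if x: "?Q x" for x
  proof -
    have "?z x = ?z y"
      by (rule det_nonzero_solve(2)[OF MT dMT]) (use QMT[OF x] QMT[OF \<open>?Q y\<close>] in auto)
    then have zz: "x $ pick I r = y $ pick I r" if "r < n" for r using that by (metis index_vec)
    show "x = y"
    proof (rule eq_vecI)
      fix i assume "i < dim_vec y"
      then have i: "i < m" by (simp add: y_def)
      show "x $ i = y $ i"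
      proof (cases "i \<in> I")
        case True
        then obtain r where "r < n" "pick I r = i" using pick_surj[OF I(1,2)] by blast
        then show ?thesis using zz by blast
      qed (use x i y0 in simp)
    qed (use x in \<open>simp add: y_def\<close>)
  qed
  ultimately have ex: "\<exists>!y. ?Q y" by blast
  have rc: "?Q rc" unfolding rc_def puiseux_reduced_costs_def lift_dims by (rule theI'[OF ex])
  then show "rc \<in> carrier_vec m" "\<And>i. i < m \<Longrightarrow> i \<notin> I \<Longrightarrow> rc $ i = 0" by auto
  show "\<And>j. j < n \<Longrightarrow> (\<Sum>i<m. \<AA> $$ (i, j) * rc $ i) = \<cc> $ j" using rc unfolding Q by blast
  show "y = rc" if "y \<in> carrier_vec m" "\<And>i. i < m \<Longrightarrow> i \<notin> I \<Longrightarrow> y $ i = 0"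
    "\<And>j. j < n \<Longrightarrow> (\<Sum>i<m. \<AA> $$ (i, j) * y $ i) = \<cc> $ j" for y
  proof -
    have "?Q y" unfolding Q using that by blast
    then show ?thesis using rc ex by blast
  qed
  show "rc $ pick I r * det MT = det (replace_col MT \<cc> r)" if "r < n" for r
    using cramer_lemma_mat[OF MT, of "?z rc" r] QMT[OF rc] that by simp
qed

lemma sval_reduced_costs:
  assumes I: "I \<subseteq> {..<m}" "card I = n" "det (submatrix \<AA> I UNIV) \<noteq> 0"
  shows "is_trop_reduced_costs A c I (map_vec sval (puiseux_reduced_costs \<AA> \<cc> I))"
proof -
  define rc where "rc = puiseux_reduced_costs \<AA> \<cc> I"
  note R = reduced_costs[OF I, folded rc_def]
  have "balanced (insert (sneg (of_trop (c $ j))) ((\<lambda>i. stimes (A $$ (i, j)) (map_vec sval rc $ i)) ` {..<m}))"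
    if j: "j < n" for j
  proof -
    \<comment> \<open>With the cost moved to the other side, equation \<open>j\<close> is a
      vanishing sum; \<open>None\<close> is the index of the cost term.\<close>
    define f where "f o' = (case o' of None \<Rightarrow> - \<cc> $ j | Some i \<Rightarrow> \<AA> $$ (i, j) * rc $ i)" for o'
    let ?S = "insert None (Some ` {..<m})"
    have "sum f ?S = f None + sum f (Some ` {..<m})" by (rule sum.insert) auto
    also have "sum f (Some ` {..<m}) = (\<Sum>i<m. \<AA> $$ (i, j) * rc $ i)"
      by (subst sum.reindex) (auto simp: f_def)
    finally have "sum f ?S = 0" using R(3)[OF j] by (simp add: f_def)
    from balanced_sval_sum_zero[OF _ _ this] have "balanced ((\<lambda>o'. sval (f o')) ` ?S)" by simp
    also have "(\<lambda>o'. sval (f o')) ` ?S =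
        insert (sneg (of_trop (c $ j))) ((\<lambda>i. stimes (A $$ (i, j)) (map_vec sval rc $ i)) ` {..<m})"
      using sval_cc[OF j] sval_AA j R(1) unfolding image_insert image_image
      by (intro arg_cong2[of _ _ _ _ insert] image_cong) (auto simp: f_def)
    finally show ?thesis .
  qed
  then show ?thesis using R(1,2) dims unfolding is_trop_reduced_costs_def by (auto simp: rc_def)
qed

text \<open>The objective as an affine function of the slacks of the basis: the reduced costs are
  its coefficients, and the second sum is a constant.\<close>

lemma cost_decomposition:
  assumes I: "I \<subseteq> {..<m}" "card I = n" "det (submatrix \<AA> I UNIV) \<noteq> 0" and x: "x \<in> carrier_vec n"
  defines "rc \<equiv> puiseux_reduced_costs \<AA> \<cc> I"
  shows "\<cc> \<bullet> x = (\<Sum>i\<in>I. rc $ i * slack i x) - (\<Sum>i\<in>I. rc $ i * \<bb> $ i)"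
proof -
  note R = reduced_costs[OF I, folded rc_def]
  have finI: "finite I" using I(1) finite_subset by blast
  have "\<cc> \<bullet> x = (\<Sum>j<n. (\<Sum>i<m. \<AA> $$ (i, j) * rc $ i) * x $ j)"
    using x R(3) by (simp add: scalar_prod_def atLeast0LessThan)
  also have "\<dots> = (\<Sum>i<m. rc $ i * (\<Sum>j<n. \<AA> $$ (i, j) * x $ j))"
    unfolding sum_distrib_left sum_distrib_right by (subst sum.swap) (simp add: mult_ac)
  also have "\<dots> = (\<Sum>i\<in>I. rc $ i * (\<Sum>j<n. \<AA> $$ (i, j) * x $ j))"
    by (rule sum.mono_neutral_right) (use I(1) R(2) in auto)
  also have "\<dots> = (\<Sum>i\<in>I. rc $ i * (slack i x - \<bb> $ i))"
  proof (rule sum.cong[OF refl])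
    fix i assume "i \<in> I"
    then have i: "i < m" using I(1) by auto
    show "rc $ i * (\<Sum>j<n. \<AA> $$ (i, j) * x $ j) = rc $ i * (slack i x - \<bb> $ i)"
      using slack_eq[OF x i] row_AA_prod[OF x i] by (metis add_diff_cancel_right')
  qed
  finally show ?thesis by (simp add: right_diff_distrib sum_subtractf)
qed

end

context trop_program
begin

text \<open>By Cramer's rule a reduced cost is a quotient of two maximal minors of the lifted matrix
  with the cost column. The signed valuations of both are the same in all lifts, and that of the
  denominator can be cancelled.\<close>

lemma reduced_costs_lift_independent:
  assumes I: "trop_basic A b I" "i \<in> I"
    and l1: "trop_lift n m A b c \<AA>1 \<bb>1 \<cc>1" and l2: "trop_lift n m A b c \<AA>2 \<bb>2 \<cc>2"
  shows "sval (puiseux_reduced_costs \<AA>1 \<cc>1 I $ i) = sval (puiseux_reduced_costs \<AA>2 \<cc>2 I $ i)"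
proof -
  interpret L1: trop_lift n m A b c \<AA>1 \<bb>1 \<cc>1 by (rule l1)
  interpret L2: trop_lift n m A b c \<AA>2 \<bb>2 \<cc>2 by (rule l2)
  note B = trop_basicD[OF I(1)]
  obtain r where r: "r < n" "pick I r = i" using L1.pick_surj[OF B(1,2) I(2)] .
  have pI: "bij_betw (pick I) {..<n} I" using bij_betw_pick[OF B(3)] B(2) by simp
  let ?B = "append_col (transpose_mat A) (map_vec of_trop c)"
  have gen: "trop_sign_generic ?B" using std by (simp add: standard_lp_def)
  have Bc: "?B \<in> carrier_mat n (Suc m)" using dims by (auto simp: append_col_def)
  \<comment> \<open>Column \<open>m\<close> of the augmented matrix is the cost vector; it takes the
    place of the column of row \<open>i\<close>, as in \<open>replace_col\<close>.\<close>
  define e where "e s = (if s = r then m else pick I s)" for s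
  have e: "bij_betw e {..<n} (insert m (I - {i}))"
  proof -
    have "bij_betw (pick I) ({..<n} - {r}) (I - {i})" using bij_betw_DiffI[OF pI, of "{r}" "{i}"] r I(2)
      by (simp add: bij_betw_def)
    then have "bij_betw e ({..<n} - {r}) (I - {i})"
      by (rule bij_betw_cong[THEN iffD1, rotated]) (auto simp: e_def)
    moreover have "m \<notin> I - {i}" using B(1) by auto
    ultimately have "bij_betw e (insert r ({..<n} - {r})) (insert m (I - {i}))"
      using notIn_Un_bij_betw[of r "{..<n} - {r}" e "I - {i}"] by (simp add: e_def)
    then show ?thesis using r by (simp add: insert_absorb)
  qed
  have im: "pick I s < m" if "s < n" for s using bij_betwE[OF pI] that B(1) by auto
  have lift: "map_mat sval (append_col (transpose_mat \<AA>) \<cc>) = ?B \<and>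
      transpose_mat (submatrix \<AA> I UNIV) = mat n n (\<lambda>(j, s). append_col (transpose_mat \<AA>) \<cc> $$ (j, pick I s)) \<and>
      replace_col (transpose_mat (submatrix \<AA> I UNIV)) \<cc> r = mat n n (\<lambda>(j, s). append_col (transpose_mat \<AA>) \<cc> $$ (j, e s))"
    if "trop_lift n m A b c \<AA> \<bb> \<cc>" for \<AA> \<bb> \<cc>
  proof -
    interpret L: trop_lift n m A b c \<AA> \<bb> \<cc> by (rule that)
    note s = L.submatrix_AA[OF B(1,2)]
    have "map_mat sval (append_col (transpose_mat \<AA>) \<cc>) = ?B"
      using L.lift_dims dims L.sval_AA L.sval_cc by (intro eq_matI) (auto simp: append_col_def)
    moreover have "transpose_mat (submatrix \<AA> I UNIV) = mat n n (\<lambda>(j, s). append_col (transpose_mat \<AA>) \<cc> $$ (j, pick I s))"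
      using s L.lift_dims im by (intro eq_matI) (auto simp: append_col_def less_SucI)
    moreover have "replace_col (transpose_mat (submatrix \<AA> I UNIV)) \<cc> r = mat n n (\<lambda>(j, s). append_col (transpose_mat \<AA>) \<cc> $$ (j, e s))"
      using s L.lift_dims im by (intro eq_matI) (auto simp: append_col_def replace_col_def e_def less_SucI)
    ultimately show ?thesis by blast
  qed
  note lf1 = lift[OF l1, THEN conjunct1] lift[OF l1, THEN conjunct2, THEN conjunct1] lift[OF l1, THEN conjunct2, THEN conjunct2]
  note lf2 = lift[OF l2, THEN conjunct1] lift[OF l2, THEN conjunct2, THEN conjunct1] lift[OF l2, THEN conjunct2, THEN conjunct2]
  let ?M1 = "transpose_mat (submatrix \<AA>1 I UNIV)" and ?M2 = "transpose_mat (submatrix \<AA>2 I UNIV)"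
  have "sval (det ?M1) = sval (det ?M2)"
    unfolding lf1(2) lf2(2) by (rule sval_det_columns[OF gen Bc lf1(1) lf2(1) pI]) (use B(1) in auto)
  moreover have "sval (det (replace_col ?M1 \<cc>1 r)) = sval (det (replace_col ?M2 \<cc>2 r))"
    unfolding lf1(3) lf2(3) by (rule sval_det_columns[OF gen Bc lf1(1) lf2(1) e]) (use B(1) in auto)
  moreover have "puiseux_reduced_costs \<AA>1 \<cc>1 I $ i * det ?M1 = det (replace_col ?M1 \<cc>1 r)"
    using L1.reduced_costs(5)[OF B(1,2) L1.basic_lift(4)[OF I(1)] r(1)] r(2) by simp
  moreover have "puiseux_reduced_costs \<AA>2 \<cc>2 I $ i * det ?M2 = det (replace_col ?M2 \<cc>2 r)"
    using L2.reduced_costs(5)[OF B(1,2) L2.basic_lift(4)[OF I(1)] r(1)] r(2) by simp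
  ultimately have "stimes (sval (puiseux_reduced_costs \<AA>1 \<cc>1 I $ i)) (sval (det ?M2)) =
      stimes (sval (puiseux_reduced_costs \<AA>2 \<cc>2 I $ i)) (sval (det ?M2))" by (metis sval_mult)
  moreover have "det ?M2 \<noteq> 0"
    using det_transpose[OF L2.submatrix_AA(1)[OF B(1,2)]] L2.basic_lift(4)[OF I(1)] by simp
  ultimately show ?thesis using stimes_right_cancel by (metis sval_eq_SNegInf)
qed

text \<open>Tropical reduced costs are the signed valuations of the reduced costs of a lift which is chosen
  such that their own unit lift solves the lifted system.\<close>

lemma trop_reduced_costs_adapted_lift:
  assumes I: "trop_basic A b I" and y: "is_trop_reduced_costs A c I y"
  shows "\<exists>\<AA> \<bb> \<cc>. trop_lift n m A b c \<AA> \<bb> \<cc> \<and> map_vec sval (puiseux_reduced_costs \<AA> \<cc> I) = y"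
proof -
  note B = trop_basicD[OF I]
  have yc: "y \<in> carrier_vec m" "\<And>i. i < m \<Longrightarrow> i \<notin> I \<Longrightarrow> y $ i = SNegInf"
    "\<And>j. j < n \<Longrightarrow> balanced (insert (sneg (of_trop (c $ j))) ((\<lambda>i. stimes (A $$ (i, j)) (y $ i)) ` {..<m}))"
    using y dims by (auto simp: is_trop_reduced_costs_def)
  have ul: "sval (unit_lift x) = x" for x by (rule sval_coeff_lift) auto
  define w where "w j o' = (case o' of None \<Rightarrow> of_trop (c $ j) | Some i \<Rightarrow> A $$ (i, j))" for j o'
  \<comment> \<open>The unknowns are fixed first, with \<open>- 1\<close> as the factor of the cost.
    \<open>exact_lift\<close> then chooses the coefficients of each equation, including its cost
    coefficient.\<close>
  define X where "X o' = (case o' of None \<Rightarrow> - 1 | Some i \<Rightarrow> unit_lift (y $ i))" for o'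
  let ?S = "insert None (Some ` {..<m})"
  have "\<exists>\<ww>. (\<forall>o'\<in>?S. sval (\<ww> o') = w j o') \<and> (\<Sum>o'\<in>?S. \<ww> o' * X o') = 0" if j: "j < n" for j
  proof (rule exact_lift)
    have "stimes x (Neg 0) = sneg x" for x by (cases x) auto
    then have "(\<lambda>o'. stimes (w j o') (sval (X o'))) ` ?S =
        insert (sneg (of_trop (c $ j))) ((\<lambda>i. stimes (A $$ (i, j)) (y $ i)) ` {..<m})"
      unfolding image_insert image_image by (simp add: w_def X_def ul)
    then show "balanced ((\<lambda>o'. stimes (w j o') (sval (X o'))) ` ?S)" using yc(3)[OF j] by simp
  qed auto
  then obtain \<ww> where ww: "\<And>j o'. j < n \<Longrightarrow> o' \<in> ?S \<Longrightarrow> sval (\<ww> j o') = w j o'"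
    "\<And>j. j < n \<Longrightarrow> (\<Sum>o'\<in>?S. \<ww> j o' * X o') = 0" by metis
  define \<AA> where "\<AA> = mat m n (\<lambda>(i, j). \<ww> j (Some i))"
  define \<bb> where "\<bb> = map_vec unit_lift b"
  define \<cc> where "\<cc> = vec n (\<lambda>j. \<ww> j None)"
  have "map_mat sval \<AA> = A" using ww(1) dims by (intro eq_matI) (auto simp: \<AA>_def w_def)
  moreover have "map_vec sval \<bb> = b" using ul by (intro eq_vecI) (auto simp: \<bb>_def)
  moreover have "map_vec sval \<cc> = map_vec of_trop c" using ww(1) dims by (intro eq_vecI) (auto simp: \<cc>_def w_def)
  ultimately have "is_lift \<AA> \<bb> \<cc> A b c" by (simp add: is_lift_def)
  then have tl: "trop_lift n m A b c \<AA> \<bb> \<cc>" by unfold_locales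
  then interpret trop_lift n m A b c \<AA> \<bb> \<cc> .
  have "(\<Sum>i<m. \<AA> $$ (i, j) * map_vec unit_lift y $ i) = \<cc> $ j" if j: "j < n" for j
  proof -
    have "(\<Sum>o'\<in>?S. \<ww> j o' * X o') = \<ww> j None * X None + (\<Sum>o'\<in>Some ` {..<m}. \<ww> j o' * X o')"
      by (rule sum.insert) auto
    also have "(\<Sum>o'\<in>Some ` {..<m}. \<ww> j o' * X o') = (\<Sum>i<m. \<AA> $$ (i, j) * map_vec unit_lift y $ i)"
      using yc(1) j by (subst sum.reindex) (auto simp: X_def \<AA>_def)
    finally show ?thesis using ww(2)[OF j] j by (simp add: X_def \<cc>_def)
  qed
  then have "map_vec unit_lift y = puiseux_reduced_costs \<AA> \<cc> I"
    using yc(1,2) by (intro reduced_costs(4)[OF B(1,2) basic_lift(4)[OF I]]) auto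
  moreover have "map_vec sval (map_vec unit_lift y) = y" using ul by (intro eq_vecI) auto
  ultimately show ?thesis using tl by metis
qed

text \<open>Any tropical solution comes from some lift, and all lifts yield the same signed
  valuations. This is the uniqueness part.\<close>

lemma trop_reduced_costs_lift:
  assumes I: "trop_basic A b I" and l: "trop_lift n m A b c \<AA> \<bb> \<cc>" and y: "is_trop_reduced_costs A c I y"
  shows "y = map_vec sval (puiseux_reduced_costs \<AA> \<cc> I)"
proof -
  obtain \<AA>' \<bb>' \<cc>' where l': "trop_lift n m A b c \<AA>' \<bb>' \<cc>'"
    and y': "map_vec sval (puiseux_reduced_costs \<AA>' \<cc>' I) = y"
    using trop_reduced_costs_adapted_lift[OF I y] by blast
  interpret L: trop_lift n m A b c \<AA> \<bb> \<cc> by (rule l)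
  interpret L': trop_lift n m A b c \<AA>' \<bb>' \<cc>' by (rule l')
  note B = trop_basicD[OF I]
  note R = L.reduced_costs[OF B(1,2) L.basic_lift(4)[OF I]] and R' = L'.reduced_costs[OF B(1,2) L'.basic_lift(4)[OF I]]
  have "sval (puiseux_reduced_costs \<AA>' \<cc>' I $ i) = sval (puiseux_reduced_costs \<AA> \<cc> I $ i)" if "i < m" for i
    using reduced_costs_lift_independent[OF I _ l' l, of i] R(2)[OF that] R'(2)[OF that] by (cases "i \<in> I") auto
  then show ?thesis unfolding y'[symmetric] using R(1) R'(1) by (intro eq_vecI) auto
qed

lemma reduced_costs_unique:
  assumes I: "trop_basic A b I"
  shows "\<exists>!y. is_trop_reduced_costs A c I y"
    "trop_lift n m A b c \<AA> \<bb> \<cc> \<Longrightarrow> trop_reduced_costs A c I = map_vec sval (puiseux_reduced_costs \<AA> \<cc> I)"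
    "is_trop_reduced_costs A c I y \<Longrightarrow> trop_reduced_costs A c I = y"
proof -
  note B = trop_basicD[OF I]
  obtain \<AA>0 \<bb>0 \<cc>0 where l0: "trop_lift n m A b c \<AA>0 \<bb>0 \<cc>0" using coeff_lift_is_lift[of 1 1] by auto
  interpret L: trop_lift n m A b c \<AA>0 \<bb>0 \<cc>0 by (rule l0)
  have ex: "is_trop_reduced_costs A c I (map_vec sval (puiseux_reduced_costs \<AA>0 \<cc>0 I))"
    by (rule L.sval_reduced_costs[OF B(1,2) L.basic_lift(4)[OF I]])
  show ex1: "\<exists>!y. is_trop_reduced_costs A c I y"
    using ex trop_reduced_costs_lift[OF I l0] by blast
  show eq: "trop_reduced_costs A c I = y" if "is_trop_reduced_costs A c I y" for y
    unfolding trop_reduced_costs_def by (rule the1_equality[OF ex1 that])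
  show "trop_reduced_costs A c I = map_vec sval (puiseux_reduced_costs \<AA> \<cc> I)"
    if "trop_lift n m A b c \<AA> \<bb> \<cc>"
    using trop_reduced_costs_lift[OF I that] eq ex by metis
qed

end

section \<open>The simplex algorithm\<close>

context trop_lift
begin

lemma reduced_cost_sign:
  assumes I: "trop_basic A b I" "k \<in> I"
  shows "tnegative (trop_reduced_costs A c I $ k) \<longleftrightarrow> puiseux_reduced_costs \<AA> \<cc> I $ k < 0"
proof -
  note B = trop_basicD[OF I(1)]
  have "k < dim_vec (puiseux_reduced_costs \<AA> \<cc> I)"
    using reduced_costs(1)[OF B(1,2) basic_lift(4)[OF I(1)]] B(1) I(2) by auto
  then show ?thesis using reduced_costs_unique(2)[OF I(1) trop_lift_axioms] by simp
qed

lemma improvable_iff: "trop_basic A b I \<Longrightarrow> trop_improvable A c I \<longleftrightarrow> puiseux_improvable \<AA> \<cc> I"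
  unfolding trop_improvable_def puiseux_improvable_def using reduced_cost_sign by blast

lemma puiseux_pivot_eq:
  assumes "trop_basic A b I" "k \<in> I"
  shows "puiseux_pivot \<AA> \<bb> I k = trop_pivot A b I k"
  unfolding puiseux_pivot_def pivot_lift(4)[OF assms trop_pivot[OF assms]] by simp

text \<open>Among the slacks of \<open>I\<close> only that of \<open>k\<close> is nonzero at the new
  point. It is positive there and enters the objective with a negative coefficient.\<close>

lemma cost_decrease:
  assumes I: "trop_basic A b I" "k \<in> I" and piv: "is_trop_pivot A b I k I'"
    and neg: "puiseux_reduced_costs \<AA> \<cc> I $ k < 0"
  shows "\<cc> \<bullet> puiseux_basic_point \<AA> \<bb> I' < \<cc> \<bullet> puiseux_basic_point \<AA> \<bb> I"
proof -
  define x x' rc where "x = puiseux_basic_point \<AA> \<bb> I" and "x' = puiseux_basic_point \<AA> \<bb> I'"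
    and "rc = puiseux_reduced_costs \<AA> \<cc> I"
  note B = trop_basicD[OF I(1)] and L = basic_lift[OF I(1), folded x_def]
  have I': "trop_basic A b I'" using piv by (simp add: is_trop_pivot_def)
  note L' = basic_lift[OF I', folded x'_def]
  note cost = cost_decomposition[OF B(1,2) L(4), folded rc_def]
  have "I - {k} \<subseteq> I'" using piv by (auto simp: is_trop_pivot_def)
  then have zero: "slack i x' = 0" if "i \<in> I - {k}" for i using L'(5)[of i] that by blast
  have "(\<Sum>i\<in>I. rc $ i * slack i x') = rc $ k * slack k x' + (\<Sum>i\<in>I - {k}. rc $ i * slack i x')"
    by (rule sum.remove[OF B(3) I(2)])
  also have "(\<Sum>i\<in>I - {k}. rc $ i * slack i x') = 0" by (rule sum.neutral) (simp add: zero)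
  finally have "(\<Sum>i\<in>I. rc $ i * slack i x') = rc $ k * slack k x'" by simp
  moreover have "(\<Sum>i\<in>I. rc $ i * slack i x) = 0" by (rule sum.neutral) (simp add: L(5))
  moreover have "rc $ k * slack k x' < 0"
    using neg pivot_lift(1)[OF I piv] by (simp add: rc_def x'_def mult_neg_pos)
  ultimately show ?thesis using cost[OF L(3)] cost[OF L'(3)] by (simp add: x_def x'_def)
qed

lemma cost_optimal:
  assumes I: "trop_basic A b I" "\<not> puiseux_improvable \<AA> \<cc> I" and z: "z \<in> puiseux_polyhedron \<AA> \<bb>"
  shows "\<cc> \<bullet> puiseux_basic_point \<AA> \<bb> I \<le> \<cc> \<bullet> z"
proof -
  define x rc where "x = puiseux_basic_point \<AA> \<bb> I" and "rc = puiseux_reduced_costs \<AA> \<cc> I"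
  note B = trop_basicD[OF I(1)] and L = basic_lift[OF I(1), folded x_def]
  note cost = cost_decomposition[OF B(1,2) L(4), folded rc_def]
  have "0 \<le> (\<Sum>i\<in>I. rc $ i * slack i z)"
  proof (rule sum_nonneg)
    fix i assume i: "i \<in> I"
    then have "0 \<le> rc $ i" using I(2) by (auto simp: puiseux_improvable_def rc_def not_less)
    then show "0 \<le> rc $ i * slack i z" using z i B(1) by (auto simp: puiseux_polyhedron_iff)
  qed
  moreover have "(\<Sum>i\<in>I. rc $ i * slack i x) = 0" by (rule sum.neutral) (simp add: L(5))
  ultimately show ?thesis using cost[OF L(3)] cost[of z] z by (simp add: x_def puiseux_polyhedron_iff)
qed

text \<open>The costs are unsigned tropical numbers, so their lifts are nonnegative and nothing
  cancels in the objective.\<close>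

lemma val_cost:
  assumes "x \<in> carrier_vec n" "\<And>j. j < n \<Longrightarrow> 0 \<le> x $ j"
  shows "0 \<le> \<cc> \<bullet> x" "val (\<cc> \<bullet> x) = c \<bullet> map_vec val x"
proof -
  have cc: "0 \<le> \<cc> $ j" "val (\<cc> $ j) = c $ j" if "j < n" for j
    using sval_cc[OF that] unfolding sval_eq_of_trop by auto
  have eq: "\<cc> \<bullet> x = (\<Sum>j<n. \<cc> $ j * x $ j)" using assms by (simp add: scalar_prod_def atLeast0LessThan)
  show "0 \<le> \<cc> \<bullet> x" unfolding eq using cc assms by (auto intro!: sum_nonneg)
  show "val (\<cc> \<bullet> x) = c \<bullet> map_vec val x"
    unfolding eq using cc assms
    by (subst val_sum_nonneg) (auto simp: scalar_prod_def atLeast0LessThan intro!: sum.cong)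
qed

end

section \<open>Optimality and termination\<close>

context trop_program
begin

text \<open>In an arbitrary lift the monomial lift of a competing point need not be feasible; in the
  heavy lift it is. Improvability does not depend on the lift, so the basic point is optimal in the
  heavy one as well, and the inequality passes to valuations.\<close>

lemma optimal_basic_point:
  assumes I: "trop_basic A b I" "\<not> trop_improvable A c I"
  shows "trop_optimal A b c (trop_basic_point A b I)"
  unfolding trop_optimal_def
proof (intro conjI ballI)
  note B = trop_basicD[OF I(1)]
  show "trop_basic_point A b I \<in> trop_polyhedron A b" using B(5) by (simp add: trop_face_def)
  fix z assume z: "z \<in> trop_polyhedron A b"
  then obtain w where w: "w n = 0" "z = pt w" using polyhedron_finite by blast
  let ?l = "coeff_lift (real n + 2) 1"
  define \<AA> \<bb> \<cc> where "\<AA> = map_mat ?l A" and "\<bb> = map_vec ?l b" and "\<cc> = map_vec (?l \<circ> of_trop) c"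
  have "trop_lift n m A b c \<AA> \<bb> \<cc>"
    unfolding \<AA>_def \<bb>_def \<cc>_def by (rule coeff_lift_is_lift) auto
  then interpret trop_lift n m A b c \<AA> \<bb> \<cc> .
  note L = basic_lift[OF I(1)]
  define X where "X j = monomial 1 (- w j)" for j
  define x where "x = vec n X"
  have "X n = 1" by (rule puiseux_eqI) (simp add: X_def w(1) pcoeff_monomial pcoeff_1)
  then have ph: "phom x j = X j" if "j \<le> n" for j using that by (auto simp: phom_def x_def)
  have WWL: "append_col \<AA> \<bb> $$ (i, j) = ?l (W i j)" if "i < m" "j \<le> n" for i j
    using that dims by (cases "j = n") (auto simp: append_col_def \<AA>_def \<bb>_def)
  have "0 \<le> slack i x" if i: "i < m" for i
  proof -
    obtain j where "j \<le> n" "V w i j = Pos 0" using polyhedron_V(1)[of w, OF w(1)] z w(2) i by blast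
    from heavy_lift_positive[OF i this] show ?thesis
      unfolding slk_def using ph WWL[OF i] by (simp add: X_def)
  qed
  then have x: "x \<in> puiseux_polyhedron \<AA> \<bb>" by (simp add: puiseux_polyhedron_iff x_def)
  have Xs: "0 < X j" "val (X j) = Fin (w j)" for j
    using sval_eq_Pos[of "X j" "w j"] by (simp_all add: X_def)
  then have "map_vec val x = z" by (intro eq_vecI) (auto simp: x_def w(2) pt_def)
  moreover have "0 \<le> x $ j" if "j < n" for j using Xs(1)[of j] that by (simp add: x_def)
  moreover have xc: "x \<in> carrier_vec n" by (simp add: x_def)
  ultimately have vz: "val (\<cc> \<bullet> x) = c \<bullet> z" using val_cost(2)[of x] by simp
  have vI: "0 \<le> \<cc> \<bullet> puiseux_basic_point \<AA> \<bb> I"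
    "val (\<cc> \<bullet> puiseux_basic_point \<AA> \<bb> I) = c \<bullet> trop_basic_point A b I"
    using val_cost[OF L(3)] L(7) L(2) by (auto simp: less_imp_le)
  have "\<cc> \<bullet> puiseux_basic_point \<AA> \<bb> I \<le> \<cc> \<bullet> x"
    using cost_optimal[OF I(1) _ x] I improvable_iff by blast
  from val_mono[OF vI(1) this] show "c \<bullet> trop_basic_point A b I \<le> c \<bullet> z" by (simp add: vz vI(2))
qed

text \<open>The pivots are recorded because the intersection of consecutive basic sets has to be
  recognized as the index set of the edge that was followed.\<close>

definition history :: "nat set list \<Rightarrow> bool" where
  "history h \<longleftrightarrow> h \<noteq> [] \<and> (\<forall>J\<in>set h. trop_basic A b J) \<and>
     (\<forall>r. Suc r < length h \<longrightarrow> (\<exists>k\<in>h ! r. is_trop_pivot A b (h ! r) k (h ! Suc r)))"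

lemma history_step:
  assumes rule: "trop_pivoting_rule A b c \<phi>" and h: "history h" "trop_improvable A c (last h)"
  shows "history (h @ [trop_pivot A b (last h) (\<phi> h)])" "\<phi> h \<in> last h"
    "tnegative (trop_reduced_costs A c (last h) $ \<phi> h)" "trop_basic A b (last h)"
proof -
  have h': "h \<noteq> []" "\<And>J. J \<in> set h \<Longrightarrow> trop_basic A b J" using h(1) by (auto simp: history_def)
  show k: "\<phi> h \<in> last h" "tnegative (trop_reduced_costs A c (last h) $ \<phi> h)"
    using rule h(2) h' unfolding trop_pivoting_rule_def by blast+
  show last: "trop_basic A b (last h)" using h' by simp
  note piv = trop_pivot[OF last k(1)]
  have "\<exists>k\<in>(h @ [trop_pivot A b (last h) (\<phi> h)]) ! r. is_trop_pivot A b ((h @ [trop_pivot A b (last h) (\<phi> h)]) ! r) k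
      ((h @ [trop_pivot A b (last h) (\<phi> h)]) ! Suc r)" if r: "r < length h" for r
  proof (cases "Suc r < length h")
    case True
    then show ?thesis using h(1) by (auto simp: history_def nth_append)
  next
    case False
    then have "Suc r = length h" using r by simp
    then have "h ! r = last h" using h'(1) by (simp add: last_conv_nth flip: \<open>Suc r = length h\<close>)
    then show ?thesis using \<open>Suc r = length h\<close> piv k(1) r by (auto simp: nth_append)
  qed
  then show "history (h @ [trop_pivot A b (last h) (\<phi> h)])"
    using h' piv unfolding history_def by (auto simp: is_trop_pivot_def)
qed

text \<open>The cost of the basic points in a lift decreases strictly, hence no basic set is visited twice.\<close>

lemma simplex_terminates:
  assumes rule: "trop_pivoting_rule A b c \<phi>" and I: "trop_basic A b I"
  obtains h where "trop_simplex A b c \<phi> I = Some h" "history h" "\<not> trop_improvable A c (last h)"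
proof -
  obtain \<AA> \<bb> \<cc> where "trop_lift n m A b c \<AA> \<bb> \<cc>" using coeff_lift_is_lift[of 1 1] by auto
  then interpret trop_lift n m A b c \<AA> \<bb> \<cc> .
  define v where "v J = \<cc> \<bullet> puiseux_basic_point \<AA> \<bb> J" for J
  \<comment> \<open>Counts the basic sets of smaller cost; the set is finite since basic sets are
    subsets of \<open>{..<m}\<close>.\<close>
  define \<mu> where "\<mu> h = card {J. trop_basic A b J \<and> v J < v (last h)}" for h
  have fin: "finite {J. trop_basic A b J \<and> v J < x}" for x
    by (rule finite_subset[of _ "Pow {..<m}"]) (use trop_basicD(1) in auto)
  have init: "history [I]" using I by (simp add: history_def)
  have step: "history (h @ [trop_pivot A b (last h) (\<phi> h)]) \<and> \<mu> (h @ [trop_pivot A b (last h) (\<phi> h)]) < \<mu> h"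
    if h: "history h" "trop_improvable A c (last h)" for h
  proof -
    note S = history_step[OF rule h]
    note piv = trop_pivot[OF S(4,2)]
    have I': "trop_basic A b (trop_pivot A b (last h) (\<phi> h))" using piv by (simp add: is_trop_pivot_def)
    have less: "v (trop_pivot A b (last h) (\<phi> h)) < v (last h)"
      unfolding v_def using cost_decrease[OF S(4,2) piv] reduced_cost_sign[OF S(4,2)] S(3) by blast
    have "\<mu> (h @ [trop_pivot A b (last h) (\<phi> h)]) < \<mu> h"
      unfolding \<mu>_def using fin
    proof (rule psubset_card_mono)
      show "{J. trop_basic A b J \<and> v J < v (last (h @ [trop_pivot A b (last h) (\<phi> h)]))} \<subset> {J. trop_basic A b J \<and> v J < v (last h)}"
        using less I' by auto
    qed
    then show ?thesis using S(1) by simp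
  qed
  obtain h where h: "trop_simplex A b c \<phi> I = Some h"
    using measure_while_option_Some[of history "\<lambda>h. trop_improvable A c (last h)"
        "\<lambda>h. h @ [trop_pivot A b (last h) (\<phi> h)]" \<mu> "[I]"] step init unfolding trop_simplex_def by blast
  moreover have "history h"
    by (rule while_option_rule[of history, OF _ h[unfolded trop_simplex_def] init]) (use step in blast)
  moreover have "\<not> trop_improvable A c (last h)"
    using while_option_stop[OF h[unfolded trop_simplex_def]] .
  ultimately show thesis by (rule that)
qed

end

text \<open>The two loops commute with the identity on histories. Compatibility of the rules applies
  because the visited sets are basic in both senses and both algorithms have to choose at the same
  time.\<close>

lemma (in trop_lift) simplex_lift:
  assumes rule: "trop_pivoting_rule A b c \<phi>" "puiseux_pivoting_rule \<AA> \<bb> \<cc> \<Phi>"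
    "compatible_rules A b c \<phi> \<AA> \<bb> \<cc> \<Phi>" and I: "trop_basic A b I"
  shows "puiseux_simplex \<AA> \<bb> \<cc> \<Phi> I = trop_simplex A b c \<phi> I"
proof -
  have "map_option id (while_option (\<lambda>h. trop_improvable A c (last h)) (\<lambda>h. h @ [trop_pivot A b (last h) (\<phi> h)]) [I]) =
      while_option (\<lambda>h. puiseux_improvable \<AA> \<cc> (last h)) (\<lambda>h. h @ [puiseux_pivot \<AA> \<bb> (last h) (\<Phi> h)]) (id [I])"
  proof (rule while_option_commute_invariant[where P = history])
    show "history [I]" using I by (simp add: history_def)
    fix h assume h: "history h"
    then have h': "h \<noteq> []" "\<And>J. J \<in> set h \<Longrightarrow> trop_basic A b J" by (auto simp: history_def)
    then show imp: "trop_improvable A c (last h) = puiseux_improvable \<AA> \<cc> (last (id h))"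
      using improvable_iff by simp
    assume t: "trop_improvable A c (last h)"
    note S = history_step[OF rule(1) h t]
    show "history (h @ [trop_pivot A b (last h) (\<phi> h)])" by (rule S)
    have "\<phi> h = \<Phi> h"
      using rule(3) h' t imp basic_lift(1) unfolding compatible_rules_def by simp
    then show "id (h @ [trop_pivot A b (last h) (\<phi> h)]) = id h @ [puiseux_pivot \<AA> \<bb> (last (id h)) (\<Phi> (id h))]"
      using puiseux_pivot_eq[OF S(4,2)] by simp
  qed
  then show ?thesis by (simp add: puiseux_simplex_def trop_simplex_def option.map_id)
qed

lemma (in trop_program) simplex_traces_lifts:
  assumes rule: "trop_pivoting_rule A b c \<phi>" and I: "trop_basic A b I"
  shows "\<exists>h. trop_simplex A b c \<phi> I = Some h \<and> trop_optimal A b c (trop_basic_point A b (last h)) \<and>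
     (\<forall>\<AA> \<bb> \<cc> \<Phi>.
        is_lift \<AA> \<bb> \<cc> A b c \<and> puiseux_pivoting_rule \<AA> \<bb> \<cc> \<Phi> \<and> compatible_rules A b c \<phi> \<AA> \<bb> \<cc> \<Phi> \<longrightarrow>
        puiseux_basic \<AA> \<bb> I \<and> puiseux_simplex \<AA> \<bb> \<cc> \<Phi> I = Some h \<and>
        (\<forall>J\<in>set h. trop_basic_point A b J = map_vec val (puiseux_basic_point \<AA> \<bb> J)) \<and>
        (\<forall>r. Suc r < length h \<longrightarrow>
           trop_face A b (h ! r \<inter> h ! Suc r) = map_vec val ` puiseux_face \<AA> \<bb> (h ! r \<inter> h ! Suc r)))"
proof -
  obtain h where h: "trop_simplex A b c \<phi> I = Some h" "history h" "\<not> trop_improvable A c (last h)"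
    using simplex_terminates[OF rule I] .
  have h': "h \<noteq> []" "\<And>J. J \<in> set h \<Longrightarrow> trop_basic A b J" using h(2) by (auto simp: history_def)
  have "trop_optimal A b c (trop_basic_point A b (last h))"
    using optimal_basic_point[OF _ h(3)] h' by simp
  moreover have "puiseux_basic \<AA> \<bb> I \<and> puiseux_simplex \<AA> \<bb> \<cc> \<Phi> I = Some h \<and>
        (\<forall>J\<in>set h. trop_basic_point A b J = map_vec val (puiseux_basic_point \<AA> \<bb> J)) \<and>
        (\<forall>r. Suc r < length h \<longrightarrow>
           trop_face A b (h ! r \<inter> h ! Suc r) = map_vec val ` puiseux_face \<AA> \<bb> (h ! r \<inter> h ! Suc r))"
    if L: "is_lift \<AA> \<bb> \<cc> A b c" "puiseux_pivoting_rule \<AA> \<bb> \<cc> \<Phi>" "compatible_rules A b c \<phi> \<AA> \<bb> \<cc> \<Phi>"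
    for \<AA> \<bb> \<cc> \<Phi>
  proof -
    interpret trop_lift n m A b c \<AA> \<bb> \<cc> by unfold_locales (rule L)
    have "trop_face A b (h ! r \<inter> h ! Suc r) = map_vec val ` puiseux_face \<AA> \<bb> (h ! r \<inter> h ! Suc r)"
      if r: "Suc r < length h" for r
    proof -
      obtain k where k: "k \<in> h ! r" "is_trop_pivot A b (h ! r) k (h ! Suc r)"
        using h(2) r by (auto simp: history_def)
      have J: "trop_basic A b (h ! r)" using h'(2) r by simp
      show ?thesis unfolding pivot_lift(2)[OF J k] by (rule edge_lift[OF J k])
    qed
    then show ?thesis
      using basic_lift(1)[OF I] basic_lift(2)[OF h'(2)] simplex_lift[OF rule L(2,3) I] h(1) by auto
  qed
  ultimately show ?thesis using h(1) by blast
qed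

section \<open>Reasoning about programs\<close>

text \<open>Total correctness: a terminating run exists, and the postcondition speaks about its cost
  as well as its final memory. The bounds of the theorem are of this form.\<close>

definition wp :: "com \<Rightarrow> (nat \<Rightarrow> memory \<Rightarrow> bool) \<Rightarrow> memory \<Rightarrow> bool" where
  "wp p Q s \<longleftrightarrow> (\<exists>t s'. exec p s t s' \<and> Q t s')"

notation Seq (infixr \<open>;;\<close> 60)

inductive_cases exec_SkipE: "exec Skip s t s'"
inductive_cases exec_SetRegE: "exec (SetReg r e) s t s'"
inductive_cases exec_SetIArrE: "exec (SetIArr a e f) s t s'"
inductive_cases exec_SetTArrE: "exec (SetTArr a e f) s t s'"
inductive_cases exec_SeqE: "exec (p ;; q) s t s'"
inductive_cases exec_CondE: "exec (Cond g p q) s t s'"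

lemma wp_Skip [simp]: "wp Skip Q s \<longleftrightarrow>
    Q 1 s"
proof
  show "wp Skip Q s \<Longrightarrow> Q 1 s"
    unfolding wp_def by (elim exE conjE exec_SkipE) simp
  show "Q 1 s \<Longrightarrow> wp Skip Q s"
    unfolding wp_def by (rule exI, rule exI, rule conjI, rule exec.intros(1))
qed

lemma wp_SetReg [simp]: "wp (SetReg r e) Q s \<longleftrightarrow>
    Q (1 + icost e) (s\<lparr>ireg := (ireg s)(r := ival e s)\<rparr>)"
proof
  show "wp (SetReg r e) Q s \<Longrightarrow> Q (1 + icost e) (s\<lparr>ireg := (ireg s)(r := ival e s)\<rparr>)"
    unfolding wp_def by (elim exE conjE exec_SetRegE) simp
  show "Q (1 + icost e) (s\<lparr>ireg := (ireg s)(r := ival e s)\<rparr>) \<Longrightarrow> wp (SetReg r e) Q s"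
    unfolding wp_def by (rule exI, rule exI, rule conjI, rule exec.intros(2))
qed

lemma wp_SetIArr [simp]: "wp (SetIArr a e f) Q s \<longleftrightarrow>
    Q (1 + icost e + icost f) (s\<lparr>iarr := (iarr s)(a := (iarr s a)(ival e s := ival f s))\<rparr>)"
proof
  show "wp (SetIArr a e f) Q s \<Longrightarrow> Q (1 + icost e + icost f) (s\<lparr>iarr := (iarr s)(a := (iarr s a)(ival e s := ival f s))\<rparr>)"
    unfolding wp_def by (elim exE conjE exec_SetIArrE) simp
  show "Q (1 + icost e + icost f) (s\<lparr>iarr := (iarr s)(a := (iarr s a)(ival e s := ival f s))\<rparr>) \<Longrightarrow> wp (SetIArr a e f) Q s"
    unfolding wp_def by (rule exI, rule exI, rule conjI, rule exec.intros(3))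
qed

lemma wp_SetTArr [simp]: "wp (SetTArr a e f) Q s \<longleftrightarrow>
    Q (1 + icost e + tcost f) (s\<lparr>tarr := (tarr s)(a := (tarr s a)(ival e s := tval f s))\<rparr>)"
proof
  show "wp (SetTArr a e f) Q s \<Longrightarrow> Q (1 + icost e + tcost f) (s\<lparr>tarr := (tarr s)(a := (tarr s a)(ival e s := tval f s))\<rparr>)"
    unfolding wp_def by (elim exE conjE exec_SetTArrE) simp
  show "Q (1 + icost e + tcost f) (s\<lparr>tarr := (tarr s)(a := (tarr s a)(ival e s := tval f s))\<rparr>) \<Longrightarrow> wp (SetTArr a e f) Q s"
    unfolding wp_def by (rule exI, rule exI, rule conjI, rule exec.intros(4))
qed

lemma wp_Seq [simp]: "wp (p ;; q) Q s \<longleftrightarrow> wp p (\<lambda>t. wp q (\<lambda>t'. Q (1 + t + t'))) s"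
proof
  assume "wp (p ;; q) Q s"
  then show "wp p (\<lambda>t. wp q (\<lambda>t'. Q (1 + t + t'))) s"
    unfolding wp_def by (elim exE conjE exec_SeqE) (intro exI conjI, assumption+, simp)
next
  assume "wp p (\<lambda>t. wp q (\<lambda>t'. Q (1 + t + t'))) s"
  then show "wp (p ;; q) Q s" unfolding wp_def using exec.intros(5) by blast
qed

lemma wp_Cond [simp]: "wp (Cond g p q) Q s \<longleftrightarrow>
    (if bval g s then wp p (\<lambda>t. Q (1 + bcost g + t)) s else wp q (\<lambda>t. Q (1 + bcost g + t)) s)"
proof
  assume "wp (Cond g p q) Q s"
  then show "if bval g s then wp p (\<lambda>t. Q (1 + bcost g + t)) s else wp q (\<lambda>t. Q (1 + bcost g + t)) s"
    unfolding wp_def by (elim exE conjE exec_CondE) (auto intro!: exI)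
next
  assume "if bval g s then wp p (\<lambda>t. Q (1 + bcost g + t)) s else wp q (\<lambda>t. Q (1 + bcost g + t)) s"
  then show "wp (Cond g p q) Q s"
    unfolding wp_def by (auto split: if_splits) (metis exec.intros(6,7) plus_1_eq_Suc add_Suc)+
qed

lemma wp_mono: "wp p Q s \<Longrightarrow> (\<And>t s'. Q t s' \<Longrightarrow> Q' t s') \<Longrightarrow> wp p Q' s"
  unfolding wp_def by blast

lemma wp_SeqI:
  assumes "wp p (\<lambda>t s'. t \<le> T \<and> P s') s" "\<And>s'. P s' \<Longrightarrow> wp q (\<lambda>t s''. t \<le> T' \<and> P' s'') s'"
  shows "wp (p ;; q) (\<lambda>t s''. t \<le> 1 + T + T' \<and> P' s'') s"
  unfolding wp_Seq using assms(1) by (rule wp_mono) (auto intro: wp_mono[OF assms(2)])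

lemma wp_weaken: "wp p (\<lambda>t s'. t \<le> T \<and> P s') s \<Longrightarrow> T \<le> T' \<Longrightarrow> (\<And>s'. P s' \<Longrightarrow> P' s') \<Longrightarrow>
    wp p (\<lambda>t s'. t \<le> T' \<and> P' s') s"
  by (erule wp_mono) auto

section \<open>Counting loops and frame conditions\<close>

definition for_loop :: "string \<Rightarrow> iexp \<Rightarrow> com \<Rightarrow> com" where
  "for_loop r e p = SetReg r (INum 0) ;;
     While (ILess (IReg r) e) (p ;; SetReg r (IPlus (IReg r) (INum 1)))"

text \<open>The limit is \<open>n\<close>, \<open>m\<close> or \<open>n + 1\<close>, hence its cost
  is at most 3. An iteration then costs at most 6 for the test and 5 for the increment and the
  sequencing, besides the body; initialization and the last test account for the 10.\<close>

lemma wp_for_loop: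
  assumes e: "icost e \<le> 3"
    and init: "Inv 0 (s\<lparr>ireg := (ireg s)(r := 0)\<rparr>)"
    and bound: "\<And>k s. Inv k s \<Longrightarrow> ireg s r = k \<and> ival e s = N"
    and body: "\<And>k s. k < N \<Longrightarrow> Inv k s \<Longrightarrow>
      wp p (\<lambda>t s'. t \<le> T \<and> Inv (Suc k) (s'\<lparr>ireg := (ireg s')(r := Suc (ireg s' r))\<rparr>)) s"
  shows "wp (for_loop r e p) (\<lambda>t s'. t \<le> N * (T + 11) + 10 \<and> Inv N s') s"
proof -
  let ?q = "p ;; SetReg r (IPlus (IReg r) (INum 1))"
  have loop: "wp (While (ILess (IReg r) e) ?q) (\<lambda>t s'. t \<le> d * (T + 11) + 6 \<and> Inv N s') s"
    if "k + d = N" "Inv k s" for k d s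
    using that
  proof (induction d arbitrary: k s)
    case 0
    then have "\<not> bval (ILess (IReg r) e) s" using bound by auto
    from exec.intros(8)[OF this, of ?q] show ?case unfolding wp_def using 0 e by (intro exI conjI) auto
  next
    case (Suc d)
    have g: "bval (ILess (IReg r) e) s" using bound[OF Suc.prems(2)] Suc.prems(1) by simp
    have "wp ?q (\<lambda>t s'. t \<le> T + 5 \<and> Inv (Suc k) s') s"
      using body[OF _ Suc.prems(2)] Suc.prems(1) by (auto intro: wp_mono)
    then obtain t s' where t: "exec ?q s t s'" "t \<le> T + 5" "Inv (Suc k) s'" unfolding wp_def by blast
    from Suc.IH[OF _ t(3)] Suc.prems(1) obtain t' s'' where
      t': "exec (While (ILess (IReg r) e) ?q) s' t' s''" "t' \<le> d * (T + 11) + 6" "Inv N s''"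
      unfolding wp_def by auto
    have "1 + bcost (ILess (IReg r) e) + t + t' \<le> Suc d * (T + 11) + 6" using e t(2) t'(2) by simp
    then show ?case unfolding wp_def using exec.intros(9)[OF g t(1) t'(1)] t'(3) by blast
  qed
  from loop[of 0 N, OF _ init] show ?thesis unfolding for_loop_def by (auto intro: wp_mono)
qed

lemma wp_for_loopI:
  assumes "Inv 0 (s\<lparr>ireg := (ireg s)(r := 0)\<rparr>)" "icost e \<le> 3"
    and "\<And>k s. Inv k s \<Longrightarrow> ireg s r = k \<and> ival e s = N"
    and "\<And>k s. k < N \<Longrightarrow> Inv k s \<Longrightarrow>
      wp p (\<lambda>t s'. t \<le> T \<and> Inv (Suc k) (s'\<lparr>ireg := (ireg s')(r := Suc (ireg s' r))\<rparr>)) s"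
    and "\<And>t s'. t \<le> N * (T + 11) + 10 \<Longrightarrow> Inv N s' \<Longrightarrow> Q t s'"
  shows "wp (for_loop r e p) Q s"
  using wp_for_loop[of e Inv s r N p T] assms by (blast intro: wp_mono)

text \<open>A frame condition listing what may have changed. Registers, index arrays and arrays of
  tropical numbers have separate name spaces, so one name may stand for different things in the
  three sets.\<close>

definition agree :: "string set \<Rightarrow> string set \<Rightarrow> string set \<Rightarrow> memory \<Rightarrow> memory \<Rightarrow> bool" where
  "agree R J T s s' \<longleftrightarrow> (\<forall>r. r \<notin> R \<longrightarrow> ireg s' r = ireg s r) \<and>
     (\<forall>a. a \<notin> J \<longrightarrow> iarr s' a = iarr s a) \<and> (\<forall>a. a \<notin> T \<longrightarrow> tarr s' a = tarr s a)"

lemma agreeD: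
  assumes "agree R J T s s'"
  shows "r \<notin> R \<Longrightarrow> ireg s' r = ireg s r" "a \<notin> J \<Longrightarrow> iarr s' a = iarr s a" "a \<notin> T \<Longrightarrow> tarr s' a = tarr s a"
  using assms by (auto simp: agree_def)

lemma agree_trans:
  "agree R J T s s' \<Longrightarrow> agree R' J' T' s' s'' \<Longrightarrow> R \<union> R' \<subseteq> R'' \<Longrightarrow> J \<union> J' \<subseteq> J'' \<Longrightarrow> T \<union> T' \<subseteq> T'' \<Longrightarrow> agree R'' J'' T'' s s''"
  unfolding agree_def by (metis (no_types, lifting) UnI1 UnI2 subsetD)

lemma stores_state_agree:
  assumes "agree R J T s s'" "''n'' \<notin> R" "''m'' \<notin> R" "''I'' \<notin> J" "''A'' \<notin> T" "''b'' \<notin> T" "''c'' \<notin> T" "''x'' \<notin> T"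
    "stores_state s n m A b c I x"
  shows "stores_state s' n m A b c I x"
  using assms by (simp add: stores_state_def agreeD)

section \<open>Normalizing the matrix\<close>

text \<open>Row \<open>i\<close> of the normalized matrix is stored in \<open>V\<close> from position \<open>o i\<close> on, and \<open>S i\<close> is the scaling
  factor of the row. There is no multiplication of indices, so \<open>a\<close> and \<open>v\<close> run through the positions
  of the rows of \<open>A\<close> and \<open>V\<close>.\<close>

definition raise_max :: "iexp \<Rightarrow> com" where
  "raise_max e = Cond (TLess (TArr ''S'' (IReg ''i'')) (TArr ''V'' e))
     (SetTArr ''S'' (IReg ''i'') (TAbs (TArr ''V'' e))) Skip"

definition fill_row :: com where
  "fill_row = for_loop ''j'' (IReg ''n'')
     (SetTArr ''V'' (IPlus (IReg ''v'') (IReg ''j''))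
        (TTimes (TArr ''A'' (IPlus (IReg ''a'') (IReg ''j''))) (TArr ''x'' (IReg ''j''))) ;;
      raise_max (IPlus (IReg ''v'') (IReg ''j'')))"

definition scale_row :: com where
  "scale_row = for_loop ''j'' (IPlus (IReg ''n'') (INum 1))
     (SetTArr ''V'' (IPlus (IReg ''v'') (IReg ''j''))
        (TTimes (TArr ''V'' (IPlus (IReg ''v'') (IReg ''j''))) (TInv (TArr ''S'' (IReg ''i'')))))"

definition begin_row :: com where
  "begin_row = SetIArr ''o'' (IReg ''i'') (IReg ''v'') ;; SetTArr ''S'' (IReg ''i'') TNegInf"

text \<open>Column \<open>n\<close> belongs to the homogeneous coordinate 1, so its entry is taken
  over without a factor.\<close>

definition last_entry :: com where
  "last_entry = SetTArr ''V'' (IPlus (IReg ''v'') (IReg ''n'')) (TArr ''b'' (IReg ''i'')) ;;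
     raise_max (IPlus (IReg ''v'') (IReg ''n''))"

definition next_row :: com where
  "next_row = SetReg ''a'' (IPlus (IReg ''a'') (IReg ''n'')) ;;
     SetReg ''v'' (IPlus (IReg ''v'') (IPlus (IReg ''n'') (INum 1)))"

definition normalize_row :: com where
  "normalize_row = begin_row ;; fill_row ;; last_entry ;; scale_row ;; next_row"

definition normalize :: com where
  "normalize = SetReg ''a'' (INum 0) ;; SetReg ''v'' (INum 0) ;; for_loop ''i'' (IReg ''m'') normalize_row"

context trop_program
begin

definition normalized :: "memory \<Rightarrow> (nat \<Rightarrow> real) \<Rightarrow> nat \<Rightarrow> bool" where
  "normalized s u k \<longleftrightarrow> (\<forall>i<k. iarr s ''o'' i = i * Suc n \<and> tarr s ''S'' i = of_trop (lev u i) \<and>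
     (\<forall>j\<le>n. tarr s ''V'' (i * Suc n + j) = V u i j))"

lemma fill_row_wp:
  assumes st: "stores_state s n m A b c I (pt u)"
    and i: "ireg s ''i'' = i" "i < m" "ireg s ''a'' = i * n" "ireg s ''v'' = v0" "tarr s ''S'' i = SNegInf"
  shows "wp fill_row (\<lambda>t s'. t \<le> 50 * n + 10 \<and> agree {''j''} {} {''V'', ''S''} s s' \<and>
    (\<forall>l<v0. tarr s' ''V'' l = tarr s ''V'' l) \<and> (\<forall>l. l \<noteq> i \<longrightarrow> tarr s' ''S'' l = tarr s ''S'' l) \<and>
    tarr s' ''S'' i = of_trop (\<Sum>j<n. modulus (W i j) * Fin (u j)) \<and>
    (\<forall>j<n. tarr s' ''V'' (v0 + j) = stimes (W i j) (Pos (u j)))) s"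
proof -
  define \<Sigma> where "\<Sigma> k = (\<Sum>j<k. modulus (W i j) * Fin (u j))" for k
  define Inv where "Inv k s' \<longleftrightarrow> ireg s' ''j'' = k \<and> agree {''j''} {} {''V'', ''S''} s s' \<and>
    (\<forall>l<v0. tarr s' ''V'' l = tarr s ''V'' l) \<and> (\<forall>l. l \<noteq> i \<longrightarrow> tarr s' ''S'' l = tarr s ''S'' l) \<and>
    tarr s' ''S'' i = of_trop (\<Sigma> k) \<and> (\<forall>j<k. tarr s' ''V'' (v0 + j) = stimes (W i j) (Pos (u j)))" for k s'
  show ?thesis unfolding fill_row_def
  proof (rule wp_for_loopI[where N = n and T = 39 and Inv = Inv], goal_cases)
    case (4 k s')
    then have inv: "ireg s' ''j'' = k" "agree {''j''} {} {''V'', ''S''} s s'" "tarr s' ''S'' i = of_trop (\<Sigma> k)"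
      by (auto simp: Inv_def)
    have data: "tarr s ''A'' (i * n + k) = W i k" "tarr s ''x'' k = Pos (u k)"
      using st i 4 by (auto simp: stores_state_def W_simps pt_def)
    have "\<Sigma> (Suc k) = \<Sigma> k + modulus (W i k) * Fin (u k)" by (simp add: \<Sigma>_def)
    then have "\<Sigma> k < modulus (W i k) * Fin (u k) \<Longrightarrow> \<Sigma> (Suc k) = modulus (W i k) * Fin (u k)"
      "\<not> \<Sigma> k < modulus (W i k) * Fin (u k) \<Longrightarrow> \<Sigma> (Suc k) = \<Sigma> k"
      by (auto simp: plus_trop_def max_def)
    then show ?case using 4 data i agreeD[OF inv(2)] by (auto simp: raise_max_def less_Suc_eq Inv_def agree_def)
  qed (use i st in \<open>auto simp: stores_state_def agree_def Inv_def \<Sigma>_def\<close>)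
qed

lemma scale_row_wp:
  assumes n: "ireg s ''n'' = n" and i: "ireg s ''i'' = i" "ireg s ''v'' = v0"
  shows "wp scale_row (\<lambda>t s'. t \<le> 50 * n + 50 \<and> agree {''j''} {} {''V''} s s' \<and>
    (\<forall>l<v0. tarr s' ''V'' l = tarr s ''V'' l) \<and>
    (\<forall>j\<le>n. tarr s' ''V'' (v0 + j) = stimes (tarr s ''V'' (v0 + j)) (sinv (tarr s ''S'' i)))) s"
proof -
  define Inv where "Inv k s' \<longleftrightarrow> ireg s' ''j'' = k \<and> agree {''j''} {} {''V''} s s' \<and>
    (\<forall>l<v0. tarr s' ''V'' l = tarr s ''V'' l) \<and>
    (\<forall>j<k. tarr s' ''V'' (v0 + j) = stimes (tarr s ''V'' (v0 + j)) (sinv (tarr s ''S'' i))) \<and>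
    (\<forall>j\<ge>k. tarr s' ''V'' (v0 + j) = tarr s ''V'' (v0 + j))" for k s'
  show ?thesis unfolding scale_row_def
  proof (rule wp_for_loopI[where N = "Suc n" and T = 20 and Inv = Inv], goal_cases)
    case (4 k s')
    then have inv: "ireg s' ''j'' = k" "agree {''j''} {} {''V''} s s'"
      by (auto simp: Inv_def)
    then show ?case using 4 i agreeD[OF inv(2)] by (auto simp: less_Suc_eq Inv_def agree_def)
  qed (use i n in \<open>auto simp: agree_def Inv_def less_Suc_eq_le\<close>)
qed

lemma normalize_row_wp:
  assumes st: "stores_state s n m A b c I (pt u)" and u: "u n = 0" and norm: "normalized s u i"
    and i: "ireg s ''i'' = i" "i < m" "ireg s ''a'' = i * n" "ireg s ''v'' = i * Suc n"
  shows "wp normalize_row (\<lambda>t s'. t \<le> 200 * Suc n \<and> agree {''j'', ''a'', ''v''} {''o''} {''V'', ''S''} s s' \<and>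
    ireg s' ''a'' = Suc i * n \<and> ireg s' ''v'' = Suc i * Suc n \<and> normalized s' u (Suc i)) s"
proof -
  define v0 where "v0 = i * Suc n"
  have iv: "ireg s ''v'' = v0" using i by (simp add: v0_def)
  define s1 where "s1 = s\<lparr>iarr := (iarr s)(''o'' := (iarr s ''o'')(i := v0)), tarr := (tarr s)(''S'' := (tarr s ''S'')(i := SNegInf))\<rparr>"
  have st1: "stores_state s1 n m A b c I (pt u)" using st by (simp add: stores_state_def s1_def)
  have i1: "ireg s1 ''i'' = i" "ireg s1 ''a'' = i * n" "ireg s1 ''v'' = v0" "tarr s1 ''S'' i = SNegInf" "ireg s1 ''n'' = n"
    using i iv st by (auto simp: s1_def stores_state_def)
  define \<Sigma> where "\<Sigma> = (\<Sum>j<n. modulus (W i j) * Fin (u j))"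
  have lev: "lev u i = \<Sigma> + modulus (W i n)"
    using u by (simp add: lev_def \<Sigma>_def lessThan_Suc_atMost[symmetric] one_trop_def[symmetric])
  have Wb: "tarr s ''b'' i = W i n" using st i by (simp add: stores_state_def W_simps)
  \<comment> \<open>The rows already normalized end before \<open>v0\<close>, so writing from there
    on leaves them intact.\<close>
  have low: "k * Suc n + j < v0" if "k < i" "j \<le> n" for k j
  proof -
    have "k * Suc n + j < Suc k * Suc n" using that by simp
    also have "\<dots> \<le> v0" unfolding v0_def using that by (intro mult_right_mono) auto
    finally show ?thesis .
  qed
  have p1: "wp begin_row (\<lambda>t s'. t \<le> 10 \<and> s' = s1) s" by (simp add: begin_row_def i(1) iv s1_def)
  note p2 = fill_row_wp[OF st1 i1(1) i(2) i1(2-4)]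
  have p3: "wp last_entry (\<lambda>t s'. t \<le> 30 \<and> agree {} {} {''V'', ''S''} s2 s' \<and>
      tarr s' ''V'' = (tarr s2 ''V'')(v0 + n := W i n) \<and> tarr s' ''S'' = (tarr s2 ''S'')(i := of_trop (lev u i))) s2"
    if a2: "agree {''j''} {} {''V'', ''S''} s1 s2" and S2: "tarr s2 ''S'' i = of_trop \<Sigma>" for s2
  proof -
    have r2: "ireg s2 ''v'' = v0" "ireg s2 ''n'' = n" "ireg s2 ''i'' = i" "tarr s2 ''b'' = tarr s ''b''"
      using agreeD[OF a2] i1 by (simp_all add: s1_def)
    show ?thesis using S2 Wb
      by (auto simp: last_entry_def raise_max_def r2 lev agree_def plus_trop_def max_def)
  qed
  have p4: "wp scale_row (\<lambda>t s'. t \<le> 50 * n + 50 \<and> agree {''j''} {} {''V''} s3 s' \<and>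
      (\<forall>l<v0. tarr s' ''V'' l = tarr s3 ''V'' l) \<and>
      (\<forall>j\<le>n. tarr s' ''V'' (v0 + j) = stimes (tarr s3 ''V'' (v0 + j)) (sinv (tarr s3 ''S'' i)))) s3"
    if "agree {''j''} {} {''V'', ''S''} s1 s2" "agree {} {} {''V'', ''S''} s2 s3" for s2 s3
    by (rule scale_row_wp) (use agreeD[OF that(1)] agreeD[OF that(2)] i1 in simp_all)
  have fin: "wp next_row (\<lambda>t s'. t \<le> 20 \<and> agree {''j'', ''a'', ''v''} {''o''} {''V'', ''S''} s s' \<and>
      ireg s' ''a'' = Suc i * n \<and> ireg s' ''v'' = Suc i * Suc n \<and> normalized s' u (Suc i)) s4"
    if a2: "agree {''j''} {} {''V'', ''S''} s1 s2"
      and V2: "\<forall>l<v0. tarr s2 ''V'' l = tarr s1 ''V'' l" "\<forall>l. l \<noteq> i \<longrightarrow> tarr s2 ''S'' l = tarr s1 ''S'' l"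
        "\<forall>j<n. tarr s2 ''V'' (v0 + j) = stimes (W i j) (Pos (u j))"
      and a3: "agree {} {} {''V'', ''S''} s2 s3"
      and V3: "tarr s3 ''V'' = (tarr s2 ''V'')(v0 + n := W i n)" "tarr s3 ''S'' = (tarr s2 ''S'')(i := of_trop (lev u i))"
      and a4: "agree {''j''} {} {''V''} s3 s4" and V4: "\<forall>l<v0. tarr s4 ''V'' l = tarr s3 ''V'' l"
        "\<forall>j\<le>n. tarr s4 ''V'' (v0 + j) = stimes (tarr s3 ''V'' (v0 + j)) (sinv (tarr s3 ''S'' i))"
    for s2 s3 s4
  proof -
    have Vn: "tarr s4 ''V'' (v0 + j) = V u i j" if j: "j \<le> n" for j
    proof (cases "j = n")
      case True
      have "stimes (W i n) (Pos 0) = W i n" by (cases "W i n") auto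
      then show ?thesis using V4(2) V3 True u by (simp add: V_def)
    next
      case False
      then show ?thesis using V4(2) V3 V2(3) j by (simp add: V_def)
    qed
    have S4: "tarr s4 ''S'' l = (if l = i then of_trop (lev u i) else tarr s ''S'' l)" for l
      using agreeD(3)[OF a4, of "''S''"] V3(2) V2(2) by (simp add: s1_def)
    have O4: "iarr s4 ''o'' = (iarr s ''o'')(i := v0)"
      using agreeD[OF a4] agreeD[OF a3] agreeD[OF a2] by (simp add: s1_def)
    have L4: "tarr s4 ''V'' l = tarr s ''V'' l" if "l < v0" for l
      using V4(1) V3(1) V2(1) that by (simp add: s1_def)
    have norm4: "normalized s4 u (Suc i)"
      unfolding normalized_def
    proof (intro allI impI)
      fix k assume k: "k < Suc i"
      show "iarr s4 ''o'' k = k * Suc n \<and> tarr s4 ''S'' k = of_trop (lev u k) \<and> (\<forall>j\<le>n. tarr s4 ''V'' (k * Suc n + j) = V u k j)"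
      proof (cases "k = i")
        case True
        then show ?thesis using Vn S4 O4 by (simp add: v0_def)
      next
        case False
        then have "k < i" using k by simp
        then show ?thesis using norm S4 O4 L4[OF low[OF \<open>k < i\<close>]] by (auto simp: normalized_def)
      qed
    qed
    have ag: "agree {''j'', ''a'', ''v''} {''o''} {''V'', ''S''} s s4"
      using agreeD[OF a4] agreeD[OF a3] agreeD[OF a2] by (simp add: agree_def s1_def)
    have "ireg s4 ''a'' = i * n" "ireg s4 ''v'' = v0" "ireg s4 ''n'' = n"
      using agreeD[OF a4] agreeD[OF a3] agreeD[OF a2] i1 by simp_all
    then show ?thesis using ag norm4 by (simp add: next_row_def agree_def normalized_def v0_def)
  qed
  have "wp normalize_row (\<lambda>t s'. t \<le> 1 + 10 + (1 + (50 * n + 10) + (1 + 30 + (1 + (50 * n + 50) + 20))) \<and>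
      agree {''j'', ''a'', ''v''} {''o''} {''V'', ''S''} s s' \<and>
      ireg s' ''a'' = Suc i * n \<and> ireg s' ''v'' = Suc i * Suc n \<and> normalized s' u (Suc i)) s"
    unfolding normalize_row_def
    apply (rule wp_SeqI[OF p1])
    apply (simp only:)
    apply (rule wp_SeqI[OF p2])
    apply (elim conjE)
    apply (rule wp_SeqI[OF p3])
      apply assumption
     apply (simp only: \<Sigma>_def)
    apply (elim conjE)
    apply (rule wp_SeqI[OF p4])
      apply assumption
     apply assumption
    apply (elim conjE)
    apply (rule fin; assumption)
    done
  then show ?thesis by (rule wp_weaken) auto
qed

lemma normalize_wp:
  assumes st: "stores_state s n m A b c I (pt u)" and u: "u n = 0"
  shows "wp normalize (\<lambda>t s'. t \<le> 250 * Suc m * Suc n \<and>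
    agree {''i'', ''j'', ''a'', ''v''} {''o''} {''V'', ''S''} s s' \<and> normalized s' u m) s"
proof -
  define Inv where "Inv k s' \<longleftrightarrow> ireg s' ''i'' = k \<and> ireg s' ''a'' = k * n \<and> ireg s' ''v'' = k * Suc n \<and>
    agree {''i'', ''j'', ''a'', ''v''} {''o''} {''V'', ''S''} s s' \<and> normalized s' u k" for k s'
  have "wp (for_loop ''i'' (IReg ''m'') normalize_row) (\<lambda>t s'. t \<le> m * (200 * Suc n + 11) + 10 \<and> Inv m s') (s\<lparr>ireg := (ireg s)(''a'' := 0, ''v'' := 0)\<rparr>)"
  proof (rule wp_for_loopI[where N = m and T = "200 * Suc n" and Inv = Inv], goal_cases)
    case (4 k s')
    then have inv: "ireg s' ''i'' = k" "agree {''i'', ''j'', ''a'', ''v''} {''o''} {''V'', ''S''} s s'"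
      "normalized s' u k" "ireg s' ''a'' = k * n" "ireg s' ''v'' = k * Suc n"
      by (auto simp: Inv_def)
    have st': "stores_state s' n m A b c I (pt u)"
      by (rule stores_state_agree[OF inv(2) _ _ _ _ _ _ _ st]) auto
    show ?case
      by (rule wp_mono[OF normalize_row_wp[OF st' u inv(3,1) 4(1) inv(4,5)]])
        (use inv(1,2) in \<open>auto simp: Inv_def agree_def normalized_def\<close>)
  qed (use st in \<open>auto simp: Inv_def normalized_def stores_state_def agree_def\<close>)
  then have "wp normalize (\<lambda>t s'. t \<le> m * (200 * Suc n + 11) + 20 \<and> Inv m s') s"
    unfolding normalize_def by (auto elim!: wp_mono)
  then show ?thesis by (rule wp_weaken) (auto simp: Inv_def algebra_simps)
qed

end

section \<open>Computing the tangent graph\<close>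

abbreviation entry :: "iexp \<Rightarrow> iexp \<Rightarrow> texp" where
  "entry e f \<equiv> TArr ''V'' (IPlus (IArr ''o'' e) f)"

definition find_args :: com where
  "find_args = for_loop ''r'' (IReg ''n'') (for_loop ''j'' (IPlus (IReg ''n'') (INum 1))
     (Cond (TLess (entry (IArr ''I'' (IReg ''r'')) (IReg ''j'')) TOne) Skip
       (Cond (TPos (entry (IArr ''I'' (IReg ''r'')) (IReg ''j'')))
         (SetIArr ''p'' (IReg ''r'') (IReg ''j'')) (SetIArr ''q'' (IReg ''r'') (IReg ''j'')))))"

definition prepare :: com where
  "prepare = normalize ;; find_args"

context trop_program
begin

definition args_found :: "(nat \<Rightarrow> real) \<Rightarrow> memory \<Rightarrow> nat \<Rightarrow> bool" where
  "args_found u s k \<longleftrightarrow> (\<forall>r<k. iarr s ''p'' r \<le> n \<and> V u (iarr s ''I'' r) (iarr s ''p'' r) = Pos 0 \<and>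
     iarr s ''q'' r \<le> n \<and> V u (iarr s ''I'' r) (iarr s ''q'' r) = Neg 0)"

lemma entry_eval:
  assumes "normalized s u m" "ival e s < m" "ival f s \<le> n"
  shows "tval (entry e f) s = V u (ival e s) (ival f s)"
  using assms by (simp add: normalized_def)

lemma normalized_agree: "agree R J T s s' \<Longrightarrow> ''o'' \<notin> J \<Longrightarrow> ''V'' \<notin> T \<Longrightarrow> ''S'' \<notin> T \<Longrightarrow> normalized s u k \<Longrightarrow> normalized s' u k"
  by (simp add: normalized_def agreeD)

lemma find_args_wp:
  assumes st: "stores_state s n m A b c I (pt u)" and norm: "normalized s u m" and t: "tight u I"
  shows "wp find_args (\<lambda>t s'. t \<le> 100 * Suc n * Suc n \<and> agree {''r'', ''j''} {''p'', ''q''} {} s s' \<and> args_found u s' n) s"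
proof -
  have bij: "bij_betw (iarr s ''I'') {..<n} I" and n: "ireg s ''n'' = n" using st by (auto simp: stores_state_def)
  have Im: "iarr s ''I'' r < m" "iarr s ''I'' r \<in> I" if "r < n" for r
    using bij_betwE[OF bij] that t by (auto simp: tight_def)
  define Inv where "Inv k s' \<longleftrightarrow> ireg s' ''r'' = k \<and> agree {''r'', ''j''} {''p'', ''q''} {} s s' \<and> args_found u s' k" for k s'
  have "wp find_args (\<lambda>t s'. t \<le> n * ((Suc n * (50 + 11) + 10) + 11) + 10 \<and> Inv n s') s"
    unfolding find_args_def
  proof (rule wp_for_loop, goal_cases)
    case (4 k s1)
    then have r: "ireg s1 ''r'' = k" and ag: "agree {''r'', ''j''} {''p'', ''q''} {} s s1" and af: "args_found u s1 k"
      by (auto simp: Inv_def)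
    define i where "i = iarr s ''I'' k"
    have i: "i < m" "i \<in> I" using Im[OF 4(1)] by (auto simp: i_def)
    have norm1: "normalized s1 u m" by (rule normalized_agree[OF ag _ _ _ norm]) auto
    have n1: "ireg s1 ''n'' = n" "iarr s1 ''I'' = iarr s ''I''" using agreeD[OF ag] n by simp_all
    define Inv' where "Inv' l s' \<longleftrightarrow> ireg s' ''j'' = l \<and> agree {''j''} {''p'', ''q''} {} s1 s' \<and>
      (\<forall>r. r \<noteq> k \<longrightarrow> iarr s' ''p'' r = iarr s1 ''p'' r \<and> iarr s' ''q'' r = iarr s1 ''q'' r) \<and>
      ((\<exists>j<l. V u i j = Pos 0) \<longrightarrow> iarr s' ''p'' k \<le> n \<and> V u i (iarr s' ''p'' k) = Pos 0) \<and>
      ((\<exists>j<l. V u i j = Neg 0) \<longrightarrow> iarr s' ''q'' k \<le> n \<and> V u i (iarr s' ''q'' k) = Neg 0)" for l s'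
    have "wp (for_loop ''j'' (IPlus (IReg ''n'') (INum 1))
     (Cond (TLess (entry (IArr ''I'' (IReg ''r'')) (IReg ''j'')) TOne) Skip
       (Cond (TPos (entry (IArr ''I'' (IReg ''r'')) (IReg ''j'')))
         (SetIArr ''p'' (IReg ''r'') (IReg ''j'')) (SetIArr ''q'' (IReg ''r'') (IReg ''j'')))))
        (\<lambda>t s'. t \<le> Suc n * (50 + 11) + 10 \<and> Inv' (Suc n) s') s1"
    proof (rule wp_for_loop, goal_cases)
      case (4 l s2)
      then have j: "ireg s2 ''j'' = l" "l \<le> n" and ag2: "agree {''j''} {''p'', ''q''} {} s1 s2" by (auto simp: Inv'_def)
      have norm2: "normalized s2 u m" by (rule normalized_agree[OF ag2 _ _ _ norm1]) auto
      have r2: "ireg s2 ''r'' = k" "iarr s2 ''I'' = iarr s ''I''" using agreeD[OF ag2] r n1 by simp_all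
      have e: "tval (entry (IArr ''I'' (IReg ''r'')) (IReg ''j'')) s2 = V u i l"
        using entry_eval[OF norm2, of "IArr ''I'' (IReg ''r'')" "IReg ''j''"] i j r2 by (simp add: i_def)
      have le: "modulus (V u i l) \<le> 1" by (rule V_le_1[OF i(1) j(2)])
      have c: "modulus (V u i l) < 1 \<Longrightarrow> V u i l \<noteq> Pos 0 \<and> V u i l \<noteq> Neg 0"
        "\<not> modulus (V u i l) < 1 \<Longrightarrow> tpositive (V u i l) \<Longrightarrow> V u i l = Pos 0"
        "\<not> modulus (V u i l) < 1 \<Longrightarrow> \<not> tpositive (V u i l) \<Longrightarrow> V u i l = Neg 0"
        using le modulus_eq_1[of "V u i l"] by (auto simp: one_trop_def tpositive_def less_le)
      have b1: "bval (TLess (entry (IArr ''I'' (IReg ''r'')) (IReg ''j'')) TOne) s2 \<longleftrightarrow> modulus (V u i l) < 1"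
        unfolding bval.simps e by (simp add: one_trop_def)
      have b2: "bval (TPos (entry (IArr ''I'' (IReg ''r'')) (IReg ''j''))) s2 \<longleftrightarrow> tpositive (V u i l)"
        unfolding bval.simps e ..
      note inv = 4(2)[unfolded Inv'_def agree_def]
      consider "modulus (V u i l) < 1" | "\<not> modulus (V u i l) < 1" "tpositive (V u i l)"
        | "\<not> modulus (V u i l) < 1" "\<not> tpositive (V u i l)" by blast
      then show ?case
      proof cases
        case 1
        then show ?thesis unfolding wp_Cond b1 b2 using inv c(1) by (simp add: Inv'_def agree_def Ex_less_Suc)
      next
        case 2
        then show ?thesis unfolding wp_Cond b1 b2 using inv c(2) j r2 by (simp add: Inv'_def agree_def Ex_less_Suc)
      next
        case 3
        then show ?thesis unfolding wp_Cond b1 b2 using inv c(3) j r2 by (simp add: Inv'_def agree_def Ex_less_Suc)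
      qed
    qed (use n1 in \<open>auto simp: Inv'_def agree_def\<close>)
    then show ?case
    proof (rule wp_weaken)
      fix s2 assume inv: "Inv' (Suc n) s2"
      then have ag2: "agree {''j''} {''p'', ''q''} {} s1 s2"
        and other: "\<And>r. r \<noteq> k \<Longrightarrow> iarr s2 ''p'' r = iarr s1 ''p'' r \<and> iarr s2 ''q'' r = iarr s1 ''q'' r" by (auto simp: Inv'_def)
      have "(\<exists>j\<le>n. V u i j = Pos 0) \<and> (\<exists>j\<le>n. V u i j = Neg 0)" using t i by (simp add: tight_def)
      then have pq: "iarr s2 ''p'' k \<le> n \<and> V u i (iarr s2 ''p'' k) = Pos 0" "iarr s2 ''q'' k \<le> n \<and> V u i (iarr s2 ''q'' k) = Neg 0"
        using inv by (auto simp: Inv'_def less_Suc_eq_le)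
      have I2: "iarr s2 ''I'' = iarr s ''I''" using agreeD[OF ag2] n1 by simp
      have "args_found u s2 (Suc k)"
        using af other pq I2 n1 unfolding args_found_def by (auto simp: less_Suc_eq i_def)
      moreover have "agree {''r'', ''j''} {''p'', ''q''} {} s s2" by (rule agree_trans[OF ag ag2]) auto
      moreover have "ireg s2 ''r'' = k" using agreeD[OF ag2] r by simp
      ultimately show "Inv (Suc k) (s2\<lparr>ireg := (ireg s2)(''r'' := Suc (ireg s2 ''r''))\<rparr>)"
        by (auto simp: Inv_def agree_def args_found_def)
    qed simp
  qed (use n in \<open>auto simp: Inv_def agree_def args_found_def\<close>)
  then show ?thesis by (rule wp_weaken) (auto simp: Inv_def algebra_simps)
qed

definition prepared :: "memory \<Rightarrow> (nat \<Rightarrow> real) \<Rightarrow> nat set \<Rightarrow> bool" where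
  "prepared s u I \<longleftrightarrow> stores_state s n m A b c I (pt u) \<and> normalized s u m \<and> args_found u s n"

lemma prepared_agree:
  assumes "agree R J T s s'" "prepared s u I" "''n'' \<notin> R" "''m'' \<notin> R" "J \<inter> {''I'', ''o'', ''p'', ''q''} = {}"
    "T \<inter> {''A'', ''b'', ''c'', ''x'', ''V'', ''S''} = {}"
  shows "prepared s' u I"
proof -
  have "stores_state s' n m A b c I (pt u)"
    by (rule stores_state_agree[OF assms(1)]) (use assms in \<open>auto simp: prepared_def\<close>)
  moreover have "normalized s' u m" by (rule normalized_agree[OF assms(1)]) (use assms in \<open>auto simp: prepared_def\<close>)
  moreover have "iarr s' a = iarr s a" if "a \<in> {''I'', ''p'', ''q''}" for a
    using agreeD(2)[OF assms(1)] assms(5) that by blast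
  then have "args_found u s' n" using assms(2) by (simp add: prepared_def args_found_def)
  ultimately show ?thesis by (simp add: prepared_def)
qed

lemma preparedD:
  assumes "prepared s u I" "tight u I"
  shows "ireg s ''n'' = n" "ireg s ''m'' = m" "bij_betw (iarr s ''I'') {..<n} I"
    "\<And>r. r < n \<Longrightarrow> iarr s ''I'' r \<in> I" "\<And>r. r < n \<Longrightarrow> iarr s ''I'' r < m"
    "\<And>r. r < n \<Longrightarrow> iarr s ''p'' r \<le> n \<and> V u (iarr s ''I'' r) (iarr s ''p'' r) = Pos 0"
    "\<And>r. r < n \<Longrightarrow> iarr s ''q'' r \<le> n \<and> V u (iarr s ''I'' r) (iarr s ''q'' r) = Neg 0"
    "\<And>i. i < m \<Longrightarrow> iarr s ''o'' i = i * Suc n" "\<And>i. i < m \<Longrightarrow> tarr s ''S'' i = of_trop (lev u i)"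
    "\<And>i j. i < m \<Longrightarrow> j \<le> n \<Longrightarrow> tarr s ''V'' (i * Suc n + j) = V u i j"
    "\<And>j. j < n \<Longrightarrow> tarr s ''x'' j = Pos (u j)" "\<And>j. j < n \<Longrightarrow> tarr s ''c'' j = of_trop (c $ j)"
proof -
  show *: "ireg s ''n'' = n" "ireg s ''m'' = m" "bij_betw (iarr s ''I'') {..<n} I"
    using assms by (auto simp: prepared_def stores_state_def)
  show "\<And>r. r < n \<Longrightarrow> iarr s ''I'' r \<in> I" using bij_betwE[OF *(3)] by auto
  then show "\<And>r. r < n \<Longrightarrow> iarr s ''I'' r < m" using assms(2) by (auto simp: tight_def)
qed (use assms in \<open>auto simp: prepared_def args_found_def normalized_def stores_state_def pt_def\<close>)

definition basis_ok :: "(nat \<Rightarrow> real) \<Rightarrow> nat set \<Rightarrow> bool" where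
  "basis_ok u I \<longleftrightarrow> u n = 0 \<and> trop_basic A b I \<and> trop_basic_point A b I = pt u \<and> tight u I \<and> card I = n \<and> I \<subseteq> {..<m}"

lemma basis_okE:
  assumes "trop_basic A b I"
  obtains u where "basis_ok u I"
proof -
  note B = trop_basicD[OF assms]
  obtain u where u: "u n = 0" "trop_basic_point A b I = pt u" using face_finite[OF B(5)] .
  then have "tight u I" using face_V[of u, OF u(1) B(1)] B(5) by simp
  then show thesis by (intro that[of u]) (simp add: basis_ok_def u assms B(1,2))
qed

lemma prepare_wp:
  assumes st: "stores_state s n m A b c I (pt u)" and ok: "basis_ok u I"
  shows "wp prepare (\<lambda>t s'. t \<le> 500 * Suc m * Suc n \<and>
    agree {''i'', ''j'', ''a'', ''v'', ''r''} {''o'', ''p'', ''q''} {''V'', ''S''} s s' \<and> prepared s' u I) s"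
proof -
  have u: "u n = 0" "tight u I" using ok by (auto simp: basis_ok_def)
  \<comment> \<open>The basis consists of \<open>n\<close> of the \<open>m\<close> rows. This lets
    terms quadratic in \<open>n\<close> be absorbed into the bound.\<close>
  have "n \<le> m" using ok card_mono[of "{..<m}" I] by (auto simp: basis_ok_def)
  have "wp prepare (\<lambda>t s'. t \<le> 1 + 250 * Suc m * Suc n + 100 * Suc n * Suc n \<and>
      agree {''i'', ''j'', ''a'', ''v'', ''r''} {''o'', ''p'', ''q''} {''V'', ''S''} s s' \<and> prepared s' u I) s"
    unfolding prepare_def
  proof (rule wp_SeqI[OF normalize_wp[OF st u(1)]])
    fix s1 assume s1: "agree {''i'', ''j'', ''a'', ''v''} {''o''} {''V'', ''S''} s s1 \<and> normalized s1 u m"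
    have st1: "stores_state s1 n m A b c I (pt u)"
      by (rule stores_state_agree[OF conjunct1[OF s1] _ _ _ _ _ _ _ st]) auto
    show "wp find_args (\<lambda>t s'. t \<le> 100 * Suc n * Suc n \<and>
      agree {''i'', ''j'', ''a'', ''v'', ''r''} {''o'', ''p'', ''q''} {''V'', ''S''} s s' \<and> prepared s' u I) s1"
    proof (rule wp_weaken[OF find_args_wp[OF st1 conjunct2[OF s1] u(2)] order_refl], elim conjE, intro conjI)
      fix s2 assume s2: "agree {''r'', ''j''} {''p'', ''q''} {} s1 s2" "args_found u s2 n"
      show "agree {''i'', ''j'', ''a'', ''v'', ''r''} {''o'', ''p'', ''q''} {''V'', ''S''} s s2"
        by (rule agree_trans[OF conjunct1[OF s1] s2(1)]) auto
      have "stores_state s2 n m A b c I (pt u)" by (rule stores_state_agree[OF s2(1) _ _ _ _ _ _ _ st1]) auto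
      moreover have "normalized s2 u m" by (rule normalized_agree[OF s2(1) _ _ _ conjunct2[OF s1]]) auto
      ultimately show "prepared s2 u I" using s2(2) by (simp add: prepared_def)
    qed
  qed
  then show ?thesis
  proof (rule wp_weaken)
    have "Suc n * Suc n \<le> Suc m * Suc n" using \<open>n \<le> m\<close> by (intro mult_le_mono) auto
    moreover have "1 \<le> Suc m * Suc n" by simp
    ultimately show "1 + 250 * Suc m * Suc n + 100 * Suc n * Suc n \<le> 500 * Suc m * Suc n"
      unfolding mult.assoc by linarith
  qed
qed

end

section \<open>Matching rows and columns\<close>

text \<open>\<open>e\<close> marks the columns reached so far. A row whose two tangent columns carry
  different marks leads out of the marked set, and \<open>g\<close> is its unmarked end.\<close>

definition find_crossing :: com where
  "find_crossing = for_loop ''r'' (IReg ''n'')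
     (Cond (ILess (IArr ''e'' (IArr ''p'' (IReg ''r''))) (IArr ''e'' (IArr ''q'' (IReg ''r''))))
       (SetReg ''f'' (IReg ''r'') ;; SetReg ''g'' (IArr ''p'' (IReg ''r'')))
       (Cond (ILess (IArr ''e'' (IArr ''q'' (IReg ''r''))) (IArr ''e'' (IArr ''p'' (IReg ''r''))))
         (SetReg ''f'' (IReg ''r'') ;; SetReg ''g'' (IArr ''q'' (IReg ''r''))) Skip))"

text \<open>Starting at the extra column \<open>n\<close> leaves exactly the columns of the matrix
  to be matched, each with the row through which it is reached. Every round scans all rows again,
  which costs \<open>O(n)\<close> per column.\<close>

definition match_columns :: com where
  "match_columns = for_loop ''j'' (IPlus (IReg ''n'') (INum 1)) (SetIArr ''e'' (IReg ''j'') (INum 0)) ;;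
     SetIArr ''e'' (IReg ''n'') (INum 1) ;;
     for_loop ''t'' (IReg ''n'') (find_crossing ;; SetIArr ''w'' (IReg ''g'') (IReg ''f'') ;; SetIArr ''e'' (IReg ''g'') (INum 1))"

context trop_program
begin

text \<open>Both tangent columns of a used row are marked, so that it never crosses again. This
  keeps \<open>w\<close> injective.\<close>

definition match_inv :: "(nat \<Rightarrow> nat) \<Rightarrow> (nat \<Rightarrow> nat) \<Rightarrow> nat \<Rightarrow> (nat \<Rightarrow> nat) \<Rightarrow> (nat \<Rightarrow> nat) \<Rightarrow> bool" where
  "match_inv p q k e w \<longleftrightarrow> (\<forall>j\<le>n. e j \<le> 1) \<and> e n = 1 \<and> card {j. j \<le> n \<and> e j = 1} = Suc k \<and>
     (\<forall>j<n. e j = 1 \<longrightarrow> w j < n \<and> (j = p (w j) \<or> j = q (w j)) \<and> e (p (w j)) = 1 \<and> e (q (w j)) = 1) \<and>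
     inj_on w {j. j < n \<and> e j = 1}"

definition crosses :: "(nat \<Rightarrow> nat) \<Rightarrow> (nat \<Rightarrow> nat) \<Rightarrow> (nat \<Rightarrow> nat) \<Rightarrow> nat \<Rightarrow> nat \<Rightarrow> bool" where
  "crosses p q e f g \<longleftrightarrow> f < n \<and> (g = p f \<and> e (p f) < e (q f) \<or> g = q f \<and> e (q f) < e (p f))"

lemma match_step:
  assumes inv: "match_inv p q k e w" and pq: "\<And>r. r < n \<Longrightarrow> p r \<le> n \<and> q r \<le> n" and fg: "crosses p q e f g"
  shows "match_inv p q (Suc k) (e(g := 1)) (w(g := f))"
proof -
  have I: "\<And>j. j \<le> n \<Longrightarrow> e j \<le> 1" "e n = 1" "card {j. j \<le> n \<and> e j = 1} = Suc k"
    "\<And>j. j < n \<Longrightarrow> e j = 1 \<Longrightarrow> w j < n \<and> (j = p (w j) \<or> j = q (w j)) \<and> e (p (w j)) = 1 \<and> e (q (w j)) = 1"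
    "inj_on w {j. j < n \<and> e j = 1}" using inv by (auto simp: match_inv_def)
  have f: "f < n" "g = p f \<or> g = q f" using fg by (auto simp: crosses_def)
  have le: "e (p f) \<le> 1" "e (q f) \<le> 1" using pq[OF f(1)] I(1) by auto
  have eg: "e g = 0" and new: "(e(g := 1)) (p f) = 1" "(e(g := 1)) (q f) = 1"
    using fg le by (auto simp: crosses_def)
  have gn: "g \<le> n" "g \<noteq> n" using pq[OF f(1)] f(2) eg I(2) by auto
  have wf: "w j \<noteq> f" if "j < n" "e j = 1" for j
    using I(4)[OF that] fg by (auto simp: crosses_def)
  have "{j. j \<le> n \<and> (e(g := 1)) j = 1} = insert g {j. j \<le> n \<and> e j = 1}" using gn by auto
  then have "card {j. j \<le> n \<and> (e(g := 1)) j = 1} = Suc (Suc k)" using I(3) eg by simp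
  moreover have "inj_on (w(g := f)) {j. j < n \<and> (e(g := 1)) j = 1}"
  proof (rule inj_onI)
    fix x y assume xy: "x \<in> {j. j < n \<and> (e(g := 1)) j = 1}" "y \<in> {j. j < n \<and> (e(g := 1)) j = 1}" "(w(g := f)) x = (w(g := f)) y"
    show "x = y"
      using xy wf[of x] wf[of y] inj_onD[OF I(5), of x y] by (cases "x = g"; cases "y = g") (auto split: if_splits)
  qed
  moreover have "(w(g := f)) j < n \<and> (j = p ((w(g := f)) j) \<or> j = q ((w(g := f)) j)) \<and>
      (e(g := 1)) (p ((w(g := f)) j)) = 1 \<and> (e(g := 1)) (q ((w(g := f)) j)) = 1"
    if "j < n" "(e(g := 1)) j = 1" for j
    using f new I(4)[of j] that by (cases "j = g") auto
  ultimately show ?thesis using I(1,2) gn unfolding match_inv_def by auto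
qed

text \<open>While fewer than \<open>n + 1\<close> columns are marked they form a proper cut, and the
  tangent graph is connected.\<close>

lemma crossing_exists:
  assumes ok: "basis_ok u I" and \<rho>: "bij_betw \<rho> {..<n} I"
    and p: "\<And>r. r < n \<Longrightarrow> p r \<le> n \<and> V u (\<rho> r) (p r) = Pos 0" and q: "\<And>r. r < n \<Longrightarrow> q r \<le> n \<and> V u (\<rho> r) (q r) = Neg 0"
    and inv: "match_inv p q k e w" and k: "k < n"
  shows "\<exists>r<n. e (p r) \<noteq> e (q r)"
proof -
  have t: "tight u I" "card I = n" using ok by (auto simp: basis_ok_def)
  let ?Q = "{j. j \<le> n \<and> e j = 1}"
  have I: "e n = 1" "card ?Q = Suc k" using inv by (auto simp: match_inv_def)
  have "?Q \<noteq> {..n}" using I(2) k by (metis card_atMost nat_less_le Suc_inject)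
  moreover have "?Q \<noteq> {}" using I(1) by auto
  ultimately obtain i where i: "i \<in> I" "args u i \<inter> ?Q \<noteq> {}" "args u i - ?Q \<noteq> {}"
    using tight_crossing[OF t, of ?Q] by blast
  obtain r where r: "r < n" "\<rho> r = i" using i(1) \<rho> by (metis bij_betw_imp_surj_on imageE lessThan_iff)
  have "{p r, q r} \<subseteq> args u i" "p r \<noteq> q r" using p[OF r(1)] q[OF r(1)] r(2) by (auto simp: args_iff)
  then have "{p r, q r} = args u i" using tight_two_args[OF t i(1)] by (intro card_subset_eq) auto
  then have eq: "args u i = {p r, q r}" by simp
  have "e (p r) \<noteq> e (q r)" using i(2,3) p[OF r(1)] q[OF r(1)] unfolding eq by auto
  then show ?thesis using r(1) by blast
qed

lemma find_crossing_wp: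
  assumes n: "ireg s ''n'' = n" and ex: "\<exists>r<n. iarr s ''e'' (iarr s ''p'' r) \<noteq> iarr s ''e'' (iarr s ''q'' r)"
  shows "wp find_crossing (\<lambda>t s'. t \<le> 60 * n + 10 \<and> agree {''r'', ''f'', ''g''} {} {} s s' \<and>
    crosses (iarr s ''p'') (iarr s ''q'') (iarr s ''e'') (ireg s' ''f'') (ireg s' ''g'')) s"
proof -
  define p q e where "p = iarr s ''p''" and "q = iarr s ''q''" and "e = iarr s ''e''"
  define Inv where "Inv l s' \<longleftrightarrow> l \<le> n \<and> ireg s' ''r'' = l \<and> agree {''r'', ''f'', ''g''} {} {} s s' \<and>
    ((\<exists>r<l. e (p r) \<noteq> e (q r)) \<longrightarrow> crosses p q e (ireg s' ''f'') (ireg s' ''g''))" for l s'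
  have "wp find_crossing (\<lambda>t s'. t \<le> n * (49 + 11) + 10 \<and> Inv n s') s"
    unfolding find_crossing_def
  proof (rule wp_for_loop, goal_cases)
    case (4 l s')
    then have l: "ireg s' ''r'' = l" by (simp add: Inv_def)
    note inv = 4(2)[unfolded Inv_def agree_def]
    consider "e (p l) < e (q l)" | "e (q l) < e (p l)" | "e (p l) = e (q l)" by linarith
    then show ?case
    proof cases
      case 1
      then show ?thesis using inv 4(1) by (simp add: l p_def q_def e_def Inv_def agree_def crosses_def)
    next
      case 2
      then show ?thesis using inv 4(1) by (simp add: l p_def q_def e_def Inv_def agree_def crosses_def)
    next
      case 3
      then show ?thesis using inv 4(1) by (simp add: l p_def q_def e_def Inv_def agree_def Ex_less_Suc)
    qed
  qed (use n in \<open>auto simp: Inv_def agree_def\<close>)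
  then show ?thesis by (rule wp_weaken) (use ex in \<open>auto simp: Inv_def p_def q_def e_def\<close>)
qed

definition matched :: "(nat \<Rightarrow> real) \<Rightarrow> memory \<Rightarrow> bool" where
  "matched u s \<longleftrightarrow> inj_on (iarr s ''w'') {..<n} \<and>
     (\<forall>j<n. iarr s ''w'' j < n \<and> modulus (V u (iarr s ''I'' (iarr s ''w'' j)) j) = 1)"

lemma match_columns_wp:
  assumes prep: "prepared s u I" and ok: "basis_ok u I"
  shows "wp match_columns (\<lambda>t s'. t \<le> 200 * Suc n * Suc n \<and>
    agree {''t'', ''r'', ''j'', ''f'', ''g''} {''e'', ''w''} {} s s' \<and> matched u s') s"
proof -
  have t: "tight u I" using ok by (simp add: basis_ok_def)
  note P = preparedD[OF prep t]
  define p q \<rho> where "p = iarr s ''p''" and "q = iarr s ''q''" and "\<rho> = iarr s ''I''"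
  define Inv0 where "Inv0 l s' \<longleftrightarrow> ireg s' ''j'' = l \<and> agree {''t'', ''r'', ''j'', ''f'', ''g''} {''e'', ''w''} {} s s' \<and>
    (\<forall>j<l. iarr s' ''e'' j = 0)" for l s'
  have w0: "wp (for_loop ''j'' (IPlus (IReg ''n'') (INum 1)) (SetIArr ''e'' (IReg ''j'') (INum 0)))
      (\<lambda>t s'. t \<le> Suc n * (5 + 11) + 10 \<and> Inv0 (Suc n) s') s"
  proof (rule wp_for_loop, goal_cases)
    case (4 l s')
    then show ?case by (auto simp: Inv0_def agree_def less_Suc_eq)
  qed (use P(1) in \<open>auto simp: Inv0_def agree_def\<close>)
  define Inv where "Inv k s' \<longleftrightarrow> ireg s' ''t'' = k \<and> agree {''t'', ''r'', ''j'', ''f'', ''g''} {''e'', ''w''} {} s s' \<and>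
    match_inv p q k (iarr s' ''e'') (iarr s' ''w'')" for k s'
  have init: "Inv 0 (s'\<lparr>iarr := (iarr s')(''e'' := (iarr s' ''e'')(n := 1)), ireg := (ireg s')(''t'' := 0)\<rparr>)"
    if "Inv0 (Suc n) s'" for s'
  proof -
    have e0: "iarr s' ''e'' j = 0" if "j \<le> n" for j using that \<open>Inv0 (Suc n) s'\<close> by (auto simp: Inv0_def)
    then have "{j. j \<le> n \<and> ((iarr s' ''e'')(n := 1)) j = 1} = {n}" by auto
    then have "match_inv p q 0 ((iarr s' ''e'')(n := 1)) (iarr s' ''w'')"
      unfolding match_inv_def using e0 by (auto simp: inj_on_def)
    then show ?thesis using that by (auto simp: Inv_def Inv0_def agree_def)
  qed
  have loop: "wp (for_loop ''t'' (IReg ''n'') (find_crossing ;; SetIArr ''w'' (IReg ''g'') (IReg ''f'') ;; SetIArr ''e'' (IReg ''g'') (INum 1)))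
      (\<lambda>t s'. t \<le> n * ((60 * n + 30) + 11) + 10 \<and> Inv n s') s1"
    if i0: "Inv 0 (s1\<lparr>ireg := (ireg s1)(''t'' := 0)\<rparr>)" for s1
  proof (rule wp_for_loop, goal_cases)
    case (4 k s')
    then have ag: "agree {''t'', ''r'', ''j'', ''f'', ''g''} {''e'', ''w''} {} s s'" and k: "ireg s' ''t'' = k"
      and inv: "match_inv p q k (iarr s' ''e'') (iarr s' ''w'')" by (auto simp: Inv_def)
    have arr: "iarr s' ''p'' = p" "iarr s' ''q'' = q" "ireg s' ''n'' = n" using agreeD[OF ag] P(1) by (simp_all add: p_def q_def)
    have "\<exists>r<n. iarr s' ''e'' (p r) \<noteq> iarr s' ''e'' (q r)"
      by (rule crossing_exists[OF ok P(3) _ _ inv 4(1)]) (use P(6,7) in \<open>auto simp: p_def q_def\<close>)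
    from find_crossing_wp[of s', OF arr(3), unfolded arr(1,2), OF this]
    have cr: "wp find_crossing (\<lambda>t s''. t \<le> 60 * n + 10 \<and> agree {''r'', ''f'', ''g''} {} {} s' s'' \<and>
       crosses p q (iarr s' ''e'') (ireg s'' ''f'') (ireg s'' ''g'')) s'" .
    have pq: "p r \<le> n \<and> q r \<le> n" if "r < n" for r using P(6,7)[OF that] by (auto simp: p_def q_def)
    have "wp (find_crossing ;; SetIArr ''w'' (IReg ''g'') (IReg ''f'') ;; SetIArr ''e'' (IReg ''g'') (INum 1))
      (\<lambda>t s'. t \<le> 1 + (60 * n + 10) + 9 \<and> Inv (Suc k) (s'\<lparr>ireg := (ireg s')(''t'' := Suc (ireg s' ''t''))\<rparr>)) s'"
    proof (rule wp_SeqI[OF cr], elim conjE)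
      fix s'' assume a: "agree {''r'', ''f'', ''g''} {} {} s' s''" and c: "crosses p q (iarr s' ''e'') (ireg s'' ''f'') (ireg s'' ''g'')"
      have arr'': "iarr s'' ''e'' = iarr s' ''e''" "iarr s'' ''w'' = iarr s' ''w''" "ireg s'' ''t'' = k" using agreeD[OF a] k by simp_all
      have "agree {''t'', ''r'', ''j'', ''f'', ''g''} {''e'', ''w''} {} s s''" by (rule agree_trans[OF ag a]) auto
      then show "wp (SetIArr ''w'' (IReg ''g'') (IReg ''f'') ;; SetIArr ''e'' (IReg ''g'') (INum 1))
         (\<lambda>t s'. t \<le> 9 \<and> Inv (Suc k) (s'\<lparr>ireg := (ireg s')(''t'' := Suc (ireg s' ''t''))\<rparr>)) s''"
        using match_step[OF inv pq c] arr'' by (simp add: Inv_def agree_def)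
    qed
    then show ?case by (rule wp_weaken) auto
  qed (use i0 P(1) in \<open>auto simp: Inv_def agree_def\<close>)
  have "wp match_columns (\<lambda>t s'. t \<le> 1 + (Suc n * (5 + 11) + 10) + (1 + 5 + (n * ((60 * n + 30) + 11) + 10)) \<and> Inv n s') s"
    unfolding match_columns_def
  proof (rule wp_SeqI[OF w0])
    fix s1 assume i: "Inv0 (Suc n) s1"
    then have n1: "ireg s1 ''n'' = n" using P(1) by (auto simp: Inv0_def agree_def)
    show "wp (SetIArr ''e'' (IReg ''n'') (INum 1) ;; for_loop ''t'' (IReg ''n'')
        (find_crossing ;; SetIArr ''w'' (IReg ''g'') (IReg ''f'') ;; SetIArr ''e'' (IReg ''g'') (INum 1)))
       (\<lambda>t s'. t \<le> 1 + 5 + (n * ((60 * n + 30) + 11) + 10) \<and> Inv n s') s1"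
    proof (rule wp_SeqI[where P = "\<lambda>s'. s' = s1\<lparr>iarr := (iarr s1)(''e'' := (iarr s1 ''e'')(n := 1))\<rparr>"], goal_cases)
      case 1
      then show ?case using n1 by simp
    next
      case (2 s')
      show ?case by (rule loop) (use init[OF i] in \<open>simp add: 2\<close>)
    qed
  qed
  then show ?thesis
  proof (rule wp_weaken)
    show "1 + (Suc n * (5 + 11) + 10) + (1 + 5 + (n * ((60 * n + 30) + 11) + 10)) \<le> 200 * Suc n * Suc n"
      by (simp add: algebra_simps)
    fix s' assume "Inv n s'"
    then have ag: "agree {''t'', ''r'', ''j'', ''f'', ''g''} {''e'', ''w''} {} s s'"
      and inv: "match_inv p q n (iarr s' ''e'') (iarr s' ''w'')" by (auto simp: Inv_def)
    have "card {j. j \<le> n \<and> iarr s' ''e'' j = 1} = card {..n}" using inv by (simp add: match_inv_def)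
    then have "{j. j \<le> n \<and> iarr s' ''e'' j = 1} = {..n}" by (intro card_subset_eq) auto
    then have e1: "iarr s' ''e'' j = 1" if "j \<le> n" for j using that by blast
    then have "{j. j < n \<and> iarr s' ''e'' j = 1} = {..<n}" by auto
    then have inj: "inj_on (iarr s' ''w'') {..<n}" using inv by (auto simp: match_inv_def)
    have wj: "iarr s' ''w'' j < n \<and> (j = p (iarr s' ''w'' j) \<or> j = q (iarr s' ''w'' j))" if "j < n" for j
      using inv e1[of j] that by (auto simp: match_inv_def)
    have "modulus (V u (\<rho> (iarr s' ''w'' j)) j) = 1" if "j < n" for j
      using wj[OF that] P(6,7)[of "iarr s' ''w'' j"] by (auto simp: p_def q_def \<rho>_def one_trop_def)
    then show "agree {''t'', ''r'', ''j'', ''f'', ''g''} {''e'', ''w''} {} s s' \<and> matched u s'"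
      using ag inj wj agreeD(2)[OF ag, of "''I''"] by (simp add: matched_def \<rho>_def)
  qed
qed

end

section \<open>Computing reduced costs\<close>

text \<open>Column \<open>g\<close> is matched with a row whose normalized entries are \<open>v g j\<close>. The columns are
  finished in the order of decreasing moduli of the labels \<open>T\<close>, the right-hand sides of the
  equations once the terms of the finished rows have been subtracted.\<close>

locale cost_search =
  fixes n :: nat and v :: "nat \<Rightarrow> nat \<Rightarrow> strop" and c' :: "nat \<Rightarrow> strop"
  assumes v_le: "\<And>g j. g < n \<Longrightarrow> j < n \<Longrightarrow> modulus (v g j) \<le> 1"
    and v_diag: "\<And>g. g < n \<Longrightarrow> modulus (v g g) = 1"
begin

text \<open>\<open>T j\<close> is the dominant term on the right-hand side of equation
  \<open>j\<close>, which the row matched with \<open>j\<close> has to cancel. It is either the cost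
  or minus the term of a finished row. Normalized entries are at most 1, so a row finished with a
  small label contributes nothing larger than that label, and the columns finished before it keep
  theirs.\<close>

definition cost_inv :: "nat set \<Rightarrow> (nat \<Rightarrow> strop) \<Rightarrow> bool" where
  "cost_inv D T \<longleftrightarrow> D \<subseteq> {..<n} \<and> (\<forall>j\<in>D. \<forall>l<n. l \<notin> D \<longrightarrow> modulus (T l) \<le> modulus (T j)) \<and>
     (\<forall>j<n. modulus (c' j) \<le> modulus (T j)) \<and>
     (\<forall>g\<in>D. \<forall>j<n. modulus (v g j) * modulus (T g) \<le> modulus (T j)) \<and>
     (\<forall>j<n. T j = c' j \<or> (\<exists>g\<in>D. g \<noteq> j \<and> T j = sneg (stimes (v g j) (stimes (T g) (v g g)))))"

lemma cost_step:
  assumes inv: "cost_inv D T" and g: "g < n" "g \<notin> D" "\<And>l. l < n \<Longrightarrow> l \<notin> D \<Longrightarrow> modulus (T l) \<le> modulus (T g)"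
    and T': "\<And>j. j < n \<Longrightarrow> T' j = (if j \<notin> insert g D \<and> modulus (T j) < modulus (v g j) * modulus (T g)
      then sneg (stimes (v g j) (stimes (T g) (v g g))) else T j)"
  shows "cost_inv (insert g D) T'"
proof -
  have I: "D \<subseteq> {..<n}" "\<And>j l. j \<in> D \<Longrightarrow> l < n \<Longrightarrow> l \<notin> D \<Longrightarrow> modulus (T l) \<le> modulus (T j)"
    "\<And>j. j < n \<Longrightarrow> modulus (c' j) \<le> modulus (T j)"
    "\<And>h j. h \<in> D \<Longrightarrow> j < n \<Longrightarrow> modulus (v h j) * modulus (T h) \<le> modulus (T j)"
    "\<And>j. j < n \<Longrightarrow> T j = c' j \<or> (\<exists>g\<in>D. g \<noteq> j \<and> T j = sneg (stimes (v g j) (stimes (T g) (v g g))))"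
    using inv by (auto simp: cost_inv_def)
  have same: "T' j = T j" if "j \<in> insert g D" for j using T'[of j] that g(1) I(1) by auto
  have vg: "modulus (v g j) * modulus (T g) \<le> modulus (T g)" if "j < n" for j
    using trop_mult_mono[OF v_le[OF g(1) that] order_refl[of "modulus (T g)"]] by simp
  have new: "modulus (sneg (stimes (v g j) (stimes (T g) (v g g)))) = modulus (v g j) * modulus (T g)" for j
    using v_diag[OF g(1)] by simp
  have ge: "modulus (T j) \<le> modulus (T' j)" if "j < n" for j
    using T'[OF that] new[of j] by auto
  \<comment> \<open>A relaxed label stays below the label just finished, which preserves the
    decreasing order.\<close>
  have le: "modulus (T' j) \<le> modulus (T g)" if "j < n" "j \<notin> insert g D" for j
    using T'[OF that(1)] new[of j] vg[OF that(1)] g(3)[OF that(1)] that(2) by auto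
  have 2: "modulus (T' l) \<le> modulus (T' j)" if "j \<in> insert g D" "l < n" "l \<notin> insert g D" for j l
    using le[OF that(2,3)] I(2)[of j g] g that same[OF that(1)] by (cases "j = g") auto
  have 4: "modulus (v h j) * modulus (T' h) \<le> modulus (T' j)" if "h \<in> insert g D" "j < n" for h j
  proof (cases "h = g")
    case True
    show ?thesis
    proof (cases "j \<in> insert g D")
      case jD: True
      then have "modulus (T g) \<le> modulus (T j)" using I(2)[of j g] g by (cases "j = g") auto
      then show ?thesis using vg[OF that(2)] True same[OF jD] same[OF that(1)] by auto
    next
      case False
      then show ?thesis using T'[OF that(2)] new[of j] True same[OF that(1)] by auto
    qed
  next
    case False
    then have "modulus (v h j) * modulus (T h) \<le> modulus (T j)" using I(4)[of h j] that by simp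
    then show ?thesis using ge[OF that(2)] same[OF that(1)] by auto
  qed
  have 5: "T' j = c' j \<or> (\<exists>h\<in>insert g D. h \<noteq> j \<and> T' j = sneg (stimes (v h j) (stimes (T' h) (v h h))))" if "j < n" for j
  proof (cases "j \<notin> insert g D \<and> modulus (T j) < modulus (v g j) * modulus (T g)")
    case True
    then show ?thesis using T'[OF that] same[of g] by auto
  next
    case False
    then have "T' j = T j" using T'[OF that] by auto
    then show ?thesis using I(5)[OF that] same by auto
  qed
  have 3: "modulus (c' j) \<le> modulus (T' j)" if "j < n" for j
    using I(3)[OF that] ge[OF that] by (rule order_trans)
  show ?thesis unfolding cost_inv_def using I(1) g(1) 2 3 4 5 by auto
qed

end

context trop_program
begin

text \<open>In equation \<open>j\<close> the maximal modulus is that of \<open>T j\<close>. It is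
  attained with the sign of \<open>T j\<close> by the row matched with \<open>j\<close>, whose entry
  there is 1 up to sign, and with the opposite sign by the term from which the label
  originates.\<close>

lemma cost_result:
  assumes ok: "basis_ok u I" and \<rho>: "bij_betw \<rho> {..<n} I"
    and diag: "\<And>g. g < n \<Longrightarrow> modulus (V u (\<rho> g) g) = 1"
    and inv: "cost_search.cost_inv n (\<lambda>g. V u (\<rho> g)) (\<lambda>j. stimes (of_trop (c $ j)) (Pos (u j))) {..<n} T"
    and y: "y \<in> carrier_vec m" "\<And>g. g < n \<Longrightarrow> y $ \<rho> g = stimes (stimes (T g) (V u (\<rho> g) g)) (sinv (of_trop (lev u (\<rho> g))))"
      "\<And>i. i < m \<Longrightarrow> i \<notin> I \<Longrightarrow> y $ i = SNegInf"
  shows "is_trop_reduced_costs A c I y"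
proof -
  have I: "I \<subseteq> {..<m}" "tight u I" using ok by (auto simp: basis_ok_def)
  have \<rho>m: "\<rho> g < m" "\<rho> g \<in> I" if "g < n" for g using bij_betwE[OF \<rho>] that I(1) by auto
  interpret cost_search n "\<lambda>g. V u (\<rho> g)" "\<lambda>j. stimes (of_trop (c $ j)) (Pos (u j))"
    by unfold_locales (use V_le_1 \<rho>m diag in auto)
  have T: "\<And>j. j < n \<Longrightarrow> modulus (stimes (of_trop (c $ j)) (Pos (u j))) \<le> modulus (T j)"
    "\<And>h j. h < n \<Longrightarrow> j < n \<Longrightarrow> modulus (V u (\<rho> h) j) * modulus (T h) \<le> modulus (T j)"
    "\<And>j. j < n \<Longrightarrow> T j = stimes (of_trop (c $ j)) (Pos (u j)) \<or>
      (\<exists>g<n. g \<noteq> j \<and> T j = sneg (stimes (V u (\<rho> g) j) (stimes (T g) (V u (\<rho> g) g))))"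
    using inv by (auto simp: cost_inv_def)
  have "balanced (insert (sneg (of_trop (c $ j))) ((\<lambda>i. stimes (A $$ (i, j)) (y $ i)) ` {..<m}))" if j: "j < n" for j
  proof -
    let ?S = "insert (sneg (of_trop (c $ j))) ((\<lambda>i. stimes (A $$ (i, j)) (y $ i)) ` {..<m})"
    \<comment> \<open>Undoes the factor \<open>u j\<close> of column \<open>j\<close>; it multiplies
      the whole equation by a positive number and does not affect balance.\<close>
    define unscale where "unscale z = stimes z (Pos (- u j))" for z
    have prod: "stimes (A $$ (\<rho> g, j)) (y $ \<rho> g) = unscale (stimes (V u (\<rho> g) j) (stimes (T g) (V u (\<rho> g) g)))" if g: "g < n" for g
    proof -
      obtain a where a: "lev u (\<rho> g) = Fin a" using lev_neq_0[OF \<rho>m(1)[OF g], of u] by (auto elim: trop_neq_0E)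
      have "stimes x (stimes z (sinv (Pos a))) = unscale (stimes (stimes (stimes x (Pos (u j))) (sinv (Pos a))) z)" for x z
        by (cases x; cases z) (auto simp: unscale_def)
      then show ?thesis unfolding y(2)[OF g] V_def[of u "\<rho> g" j] a using W_simps(1)[OF \<rho>m(1)[OF g] j] by simp
    qed
    have mod: "modulus (unscale z) = modulus z * Fin (- u j)" for z by (simp add: unscale_def)
    have pn: "tpositive (unscale z) \<longleftrightarrow> tpositive z" "tnegative (unscale z) \<longleftrightarrow> tnegative z" for z
      by (cases z; simp add: unscale_def tpositive_def tnegative_def)+
    have cterm: "sneg (of_trop (c $ j)) = unscale (sneg (stimes (of_trop (c $ j)) (Pos (u j))))"
      by (cases "c $ j") (auto simp: unscale_def)
    have mem: "unscale (stimes (V u (\<rho> g) j) (stimes (T g) (V u (\<rho> g) g))) \<in> ?S" if "g < n" for g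
    proof -
      have "stimes (A $$ (\<rho> g, j)) (y $ \<rho> g) \<in> ?S" using \<rho>m(1)[OF that] by blast
      then show ?thesis using prod[OF that] by simp
    qed
    have own: "stimes (V u (\<rho> j) j) (stimes (T j) (V u (\<rho> j) j)) = T j"
      using diag[OF j] modulus_eq_1[of "V u (\<rho> j) j"] by (cases "T j") auto
    have TS: "unscale (T j) \<in> ?S" using mem[OF j] own by simp
    \<comment> \<open>The origin of the label: the negated cost, or the term of the earlier row
      whose negative is \<open>T j\<close>.\<close>
    have sTS: "unscale (sneg (T j)) \<in> ?S"
      using T(3)[OF j]
    proof
      assume "T j = stimes (of_trop (c $ j)) (Pos (u j))"
      then show ?thesis using cterm by simp
    next
      have ss: "sneg (sneg z) = z" for z by (cases z) auto
      assume "\<exists>g<n. g \<noteq> j \<and> T j = sneg (stimes (V u (\<rho> g) j) (stimes (T g) (V u (\<rho> g) g)))"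
      then obtain g where "g < n" "sneg (T j) = stimes (V u (\<rho> g) j) (stimes (T g) (V u (\<rho> g) g))" using ss by metis
      then show ?thesis using mem[of g] by simp
    qed
    have bound: "modulus z \<le> modulus (unscale (T j))" if zS: "z \<in> ?S" for z
    proof -
      consider "z = sneg (of_trop (c $ j))" | i where "i < m" "z = stimes (A $$ (i, j)) (y $ i)" using zS by auto
      then show ?thesis
      proof cases
        case 1
        have "modulus (sneg (stimes (of_trop (c $ j)) (Pos (u j)))) * Fin (- u j) \<le> modulus (T j) * Fin (- u j)"
          using T(1)[OF j] by (intro trop_mult_mono) auto
        then show ?thesis unfolding 1 cterm mod .
      next
        case 2
        show ?thesis
        proof (cases "i \<in> I")
          case True
          then obtain g where g: "g < n" "\<rho> g = i" using \<rho> by (metis bij_betw_imp_surj_on imageE lessThan_iff)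
          have "modulus (stimes (V u (\<rho> g) j) (stimes (T g) (V u (\<rho> g) g))) \<le> modulus (T j)"
            using T(2)[OF g(1) j] diag[OF g(1)] by simp
          then have "modulus (stimes (V u (\<rho> g) j) (stimes (T g) (V u (\<rho> g) g))) * Fin (- u j) \<le> modulus (T j) * Fin (- u j)"
            by (intro trop_mult_mono) auto
          moreover have "z = unscale (stimes (V u (\<rho> g) j) (stimes (T g) (V u (\<rho> g) g)))" using prod[OF g(1)] 2(2) g(2) by simp
          ultimately show ?thesis unfolding mod[symmetric] by simp
        next
          case False
          then have "z = SNegInf" using y(3)[OF 2(1)] 2(2) by (cases "A $$ (i, j)") auto
          then show ?thesis by (simp flip: zero_trop_def)
        qed
      qed
    qed
    have Max: "Max (modulus ` ?S) = modulus (unscale (T j))"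
    proof (rule Max_eqI)
      show "z \<le> modulus (unscale (T j))" if "z \<in> modulus ` ?S" for z using that by (rule imageE) (simp only: bound)
      show "modulus (unscale (T j)) \<in> modulus ` ?S" by (rule imageI[OF TS])
    qed simp
    show ?thesis
    proof (cases "T j = SNegInf")
      case True
      then show ?thesis unfolding balanced_def Max mod by simp
    next
      case False
      then have "tpositive (T j) \<and> tnegative (sneg (T j)) \<or> tpositive (sneg (T j)) \<and> tnegative (T j)"
        by (cases "T j") (auto simp: tpositive_def tnegative_def)
      moreover have ms: "modulus (unscale (sneg (T j))) = modulus (unscale (T j))" by (simp add: mod)
      ultimately have "(\<exists>p\<in>?S. tpositive p \<and> modulus p = modulus (unscale (T j))) \<and>
          (\<exists>q\<in>?S. tnegative q \<and> modulus q = modulus (unscale (T j)))"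
      proof (elim disjE conjE)
        assume "tpositive (T j)" "tnegative (sneg (T j))"
        then show ?thesis using pn by (intro conjI bexI[OF _ TS] bexI[OF _ sTS]) (simp_all add: ms)
      next
        assume "tpositive (sneg (T j))" "tnegative (T j)"
        then show ?thesis using pn by (intro conjI bexI[OF _ TS] bexI[OF _ sTS]) (simp_all add: ms)
      qed
      then show ?thesis unfolding balanced_def Max by (rule disjI2)
    qed
  qed
  then show ?thesis unfolding is_trop_reduced_costs_def using y(1,3) dims by simp
qed

end

section \<open>The program for reduced costs\<close>

definition init_labels :: com where
  "init_labels = for_loop ''j'' (IReg ''n'')
     (SetTArr ''T'' (IReg ''j'') (TTimes (TArr ''c'' (IReg ''j'')) (TArr ''x'' (IReg ''j''))) ;;
      SetIArr ''z'' (IReg ''j'') (INum 0))"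

definition init_costs :: com where
  "init_costs = for_loop ''i'' (IReg ''m'') (SetTArr ''y'' (IReg ''i'') TNegInf)"

text \<open>\<open>g = n\<close> stands for no selection, since columns are smaller than
  \<open>n\<close>. A label minus infinity cannot serve for this purpose: such a column has to be
  finished as well.\<close>

definition select_label :: com where
  "select_label = SetReg ''g'' (IReg ''n'') ;; for_loop ''j'' (IReg ''n'')
     (Cond (ILess (IArr ''z'' (IReg ''j'')) (INum 1))
       (Cond (ILess (IReg ''g'') (IReg ''n''))
         (Cond (TLess (TArr ''T'' (IReg ''g'')) (TArr ''T'' (IReg ''j''))) (SetReg ''g'' (IReg ''j'')) Skip)
         (SetReg ''g'' (IReg ''j'')))
       Skip)"

text \<open>The matched entry is 1 or its negative, hence its own inverse, so multiplying by it
  solves for the unknown. Dividing by \<open>S\<close> undoes the scaling of the row.\<close>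

definition finish_label :: com where
  "finish_label = SetIArr ''z'' (IReg ''g'') (INum 1) ;;
     SetReg ''i'' (IArr ''I'' (IArr ''w'' (IReg ''g''))) ;;
     SetTArr ''P'' (INum 0) (TTimes (TArr ''T'' (IReg ''g'')) (entry (IReg ''i'') (IReg ''g''))) ;;
     SetTArr ''y'' (IReg ''i'') (TTimes (TArr ''P'' (INum 0)) (TInv (TArr ''S'' (IReg ''i''))))"

definition relax_labels :: com where
  "relax_labels = for_loop ''j'' (IReg ''n'')
     (Cond (ILess (IArr ''z'' (IReg ''j'')) (INum 1))
       (Cond (TLess (TArr ''T'' (IReg ''j'')) (TTimes (entry (IReg ''i'') (IReg ''j'')) (TArr ''P'' (INum 0))))
         (SetTArr ''T'' (IReg ''j'') (TNeg (TTimes (entry (IReg ''i'') (IReg ''j'')) (TArr ''P'' (INum 0)))))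
         Skip)
       Skip)"

definition compute_costs :: com where
  "compute_costs = init_labels ;; init_costs ;;
     for_loop ''t'' (IReg ''n'') (select_label ;; finish_label ;; relax_labels)"

definition costs_program :: com where
  "costs_program = prepare ;; match_columns ;; compute_costs"

lemma select_label_wp:
  assumes n: "ireg s ''n'' = n" and ex: "j0 < n" "iarr s ''z'' j0 = 0"
  shows "wp select_label (\<lambda>t s'. t \<le> 100 * n + 100 \<and> agree {''j'', ''g''} {} {} s s' \<and>
    ireg s' ''g'' < n \<and> iarr s ''z'' (ireg s' ''g'') = 0 \<and>
    (\<forall>j<n. iarr s ''z'' j = 0 \<longrightarrow> modulus (tarr s ''T'' j) \<le> modulus (tarr s ''T'' (ireg s' ''g'')))) s"
proof -
  define z T where "z = iarr s ''z''" and "T = tarr s ''T''"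
  define Inv where "Inv l s' \<longleftrightarrow> ireg s' ''j'' = l \<and> agree {''j'', ''g''} {} {} s s' \<and>
    (ireg s' ''g'' = n \<and> (\<forall>j<l. z j \<noteq> 0) \<or>
     ireg s' ''g'' < n \<and> z (ireg s' ''g'') = 0 \<and> (\<forall>j<l. z j = 0 \<longrightarrow> modulus (T j) \<le> modulus (T (ireg s' ''g''))))" for l s'
  have "wp select_label (\<lambda>t s'. t \<le> 1 + 2 + (n * (40 + 11) + 10) \<and> Inv n s') s"
    unfolding select_label_def
  proof (rule wp_SeqI[where P = "\<lambda>s'. s' = s\<lparr>ireg := (ireg s)(''g'' := n)\<rparr>"], goal_cases)
    case 1
    then show ?case using n by simp
  next
    case (2 s1)
    show ?case
    proof (rule wp_for_loop, goal_cases)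
      case (4 l s')
      then have l: "ireg s' ''j'' = l" and ag: "agree {''j'', ''g''} {} {} s s'" by (auto simp: Inv_def)
      have arr: "iarr s' ''z'' = z" "tarr s' ''T'' = T" "ireg s' ''n'' = n" using agreeD[OF ag] n by (simp_all add: z_def T_def)
      have ag': "agree {''j'', ''g''} {} {} s (s'\<lparr>ireg := (ireg s')(''j'' := x)\<rparr>)"
        "agree {''j'', ''g''} {} {} s (s'\<lparr>ireg := (ireg s')(''g'' := y, ''j'' := x)\<rparr>)" for x y
        using ag by (auto simp: agree_def)
      from 4(2) consider "ireg s' ''g'' = n" "\<forall>j<l. z j \<noteq> 0"
        | "ireg s' ''g'' < n" "z (ireg s' ''g'') = 0" "\<forall>j<l. z j = 0 \<longrightarrow> modulus (T j) \<le> modulus (T (ireg s' ''g''))"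
        by (auto simp: Inv_def)
      then show ?case
      proof cases
        case 1
        then show ?thesis using 4(1) by (cases "z l = 0") (auto simp: arr l Inv_def ag' less_Suc_eq)
      next
        case 2
        then show ?thesis using 4(1)
          by (cases "z l = 0"; cases "modulus (T (ireg s' ''g'')) < modulus (T l)")
            (auto simp: arr l Inv_def ag' less_Suc_eq intro: order_trans less_imp_le)
      qed
    qed (use n 2 in \<open>auto simp: Inv_def agree_def\<close>)
  qed
  then show ?thesis by (rule wp_weaken) (use ex in \<open>auto simp: Inv_def z_def T_def\<close>)
qed

context trop_program
begin

lemma relax_labels_wp:
  assumes n: "ireg s ''n'' = n" and norm: "normalized s u m" and i: "ireg s ''i'' = i" "i < m"
  shows "wp relax_labels (\<lambda>t s'. t \<le> 100 * n + 10 \<and> agree {''j''} {} {''T''} s s' \<and>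
    (\<forall>j<n. tarr s' ''T'' j = (if iarr s ''z'' j = 0 \<and> modulus (tarr s ''T'' j) < modulus (V u i j) * modulus (tarr s ''P'' 0)
       then sneg (stimes (V u i j) (tarr s ''P'' 0)) else tarr s ''T'' j))) s"
proof -
  define new where "new j = (if iarr s ''z'' j = 0 \<and> modulus (tarr s ''T'' j) < modulus (V u i j) * modulus (tarr s ''P'' 0)
       then sneg (stimes (V u i j) (tarr s ''P'' 0)) else tarr s ''T'' j)" for j
  define Inv where "Inv l s' \<longleftrightarrow> ireg s' ''j'' = l \<and> agree {''j''} {} {''T''} s s' \<and>
    (\<forall>j<l. tarr s' ''T'' j = new j) \<and> (\<forall>j\<ge>l. tarr s' ''T'' j = tarr s ''T'' j)" for l s'
  have "wp relax_labels (\<lambda>t s'. t \<le> n * (60 + 11) + 10 \<and> Inv n s') s"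
    unfolding relax_labels_def
  proof (rule wp_for_loop, goal_cases)
    case (4 l s')
    then have l: "ireg s' ''j'' = l" and ag: "agree {''j''} {} {''T''} s s'" and Tl: "tarr s' ''T'' l = tarr s ''T'' l"
      and low: "\<And>j. j < l \<Longrightarrow> tarr s' ''T'' j = new j" and high: "\<And>j. l \<le> j \<Longrightarrow> tarr s' ''T'' j = tarr s ''T'' j" by (auto simp: Inv_def)
    have norm': "normalized s' u m" by (rule normalized_agree[OF ag _ _ _ norm]) auto
    have arr: "iarr s' ''z'' = iarr s ''z''" "tarr s' ''P'' = tarr s ''P''" "ireg s' ''i'' = i" using agreeD[OF ag] i by simp_all
    have e: "tval (entry (IReg ''i'') (IReg ''j'')) s' = V u i l"
      using entry_eval[OF norm', of "IReg ''i''" "IReg ''j''"] i 4(1) l arr by simp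
    have e2: "tval (TTimes (entry (IReg ''i'') (IReg ''j'')) (TArr ''P'' (INum 0))) s' = stimes (V u i l) (tarr s ''P'' 0)"
      unfolding tval.simps(4) e using arr by simp
    have b1: "bval (ILess (IArr ''z'' (IReg ''j'')) (INum 1)) s' \<longleftrightarrow> iarr s ''z'' l = 0" using arr l by simp
    have b2: "bval (TLess (TArr ''T'' (IReg ''j'')) (TTimes (entry (IReg ''i'') (IReg ''j'')) (TArr ''P'' (INum 0)))) s'
        \<longleftrightarrow> modulus (tarr s ''T'' l) < modulus (V u i l) * modulus (tarr s ''P'' 0)"
      unfolding bval.simps e2 using l Tl by simp
    have ag': "agree {''j''} {} {''T''} s (s'\<lparr>ireg := (ireg s')(''j'' := x)\<rparr>)"
      "agree {''j''} {} {''T''} s (s'\<lparr>tarr := (tarr s')(''T'' := y), ireg := (ireg s')(''j'' := x)\<rparr>)" for x y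
      using ag by (auto simp: agree_def)
    have e3: "tval (TNeg (TTimes (entry (IReg ''i'') (IReg ''j'')) (TArr ''P'' (INum 0)))) s' = sneg (stimes (V u i l) (tarr s ''P'' 0))"
      unfolding tval.simps(6) e2 ..
    show ?case
    proof (cases "iarr s ''z'' l = 0 \<and> modulus (tarr s ''T'' l) < modulus (V u i l) * modulus (tarr s ''P'' 0)")
      case True
      then have "new l = sneg (stimes (V u i l) (tarr s ''P'' 0))" by (simp add: new_def)
      then show ?thesis unfolding wp_Cond b1 b2 wp_SetTArr e3 using True ag' l low high
        by (auto simp: Inv_def less_Suc_eq)
    next
      case False
      then have "new l = tarr s ''T'' l" by (auto simp: new_def)
      then have "Inv (Suc l) (s'\<lparr>ireg := (ireg s')(''j'' := Suc (ireg s' ''j''))\<rparr>)"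
        using ag' l low high by (simp add: Inv_def less_Suc_eq)
      then show ?thesis unfolding wp_Cond b1 b2 using False by auto
    qed
  qed (use n in \<open>auto simp: Inv_def agree_def\<close>)
  then show ?thesis by (rule wp_weaken) (auto simp: Inv_def new_def)
qed

lemma compute_costs_wp:
  assumes prep: "prepared s u I" "matched u s" and ok: "basis_ok u I"
  shows "wp compute_costs (\<lambda>t s'. t \<le> 500 * Suc m * Suc n \<and> agree {''i'', ''j'', ''g'', ''t''} {''z''} {''T'', ''P'', ''y''} s s' \<and>
    stores_costs s' m (trop_reduced_costs A c I)) s"
proof -
  have t: "tight u I" and basic: "trop_basic A b I" using ok by (auto simp: basis_ok_def)
  have nm: "n \<le> m" using ok card_mono[of "{..<m}" I] by (auto simp: basis_ok_def)
  note P = preparedD[OF prep(1) t]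
  let ?ag = "agree {''i'', ''j'', ''g'', ''t''} {''z''} {''T'', ''P'', ''y''} s"
  define \<rho> where "\<rho> g = iarr s ''I'' (iarr s ''w'' g)" for g
  define c' where "c' j = stimes (of_trop (c $ j)) (Pos (u j))" for j
  have w: "inj_on (iarr s ''w'') {..<n}" "\<And>j. j < n \<Longrightarrow> iarr s ''w'' j < n"
    and diag: "\<And>j. j < n \<Longrightarrow> modulus (V u (\<rho> j) j) = 1" using prep(2) by (auto simp: matched_def \<rho>_def)
  have "bij_betw (iarr s ''w'') {..<n} {..<n}"
    unfolding bij_betw_def using w endo_inj_surj[of "{..<n}" "iarr s ''w''"] by auto
  from bij_betw_trans[OF this P(3)] have \<rho>: "bij_betw \<rho> {..<n} I" unfolding \<rho>_def comp_def .
  have \<rho>m: "\<rho> g < m" "\<rho> g \<in> I" if "g < n" for g using P(4,5) w(2)[OF that] by (auto simp: \<rho>_def)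
  have \<rho>inj: "\<rho> g = \<rho> h \<longleftrightarrow> g = h" if "g < n" "h < n" for g h
    using bij_betw_imp_inj_on[OF \<rho>] that by (auto simp: inj_on_def)
  interpret C: cost_search n "\<lambda>g. V u (\<rho> g)" c'
    by unfold_locales (use V_le_1 \<rho>m diag in auto)
  define Y where "Y g T = stimes (stimes (T g) (V u (\<rho> g) g)) (sinv (of_trop (lev u (\<rho> g))))" for g and T :: "nat \<Rightarrow> strop"
  define Inv1 where "Inv1 l s' \<longleftrightarrow> ireg s' ''j'' = l \<and> ?ag s' \<and> (\<forall>j<l. tarr s' ''T'' j = c' j \<and> iarr s' ''z'' j = 0)" for l s'
  have p1: "wp init_labels (\<lambda>t s'. t \<le> n * (20 + 11) + 10 \<and> Inv1 n s') s"
    unfolding init_labels_def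
  proof (rule wp_for_loop, goal_cases)
    case (4 l s')
    then have ag: "?ag s'" and l: "ireg s' ''j'' = l" by (auto simp: Inv1_def)
    have "tarr s' ''c'' l = of_trop (c $ l)" "tarr s' ''x'' l = Pos (u l)" using agreeD[OF ag] P(11,12) 4(1) by simp_all
    then show ?case using 4 l by (auto simp: Inv1_def agree_def less_Suc_eq c'_def)
  qed (use P(1) in \<open>auto simp: Inv1_def agree_def\<close>)
  define Inv2 where "Inv2 l s' \<longleftrightarrow> ireg s' ''i'' = l \<and> ?ag s' \<and> (\<forall>j<n. tarr s' ''T'' j = c' j \<and> iarr s' ''z'' j = 0) \<and>
    (\<forall>i<l. tarr s' ''y'' i = SNegInf)" for l s'
  have p2: "wp init_costs (\<lambda>t s'. t \<le> m * (20 + 11) + 10 \<and> Inv2 m s') s1" if "Inv1 n s1" for s1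
    unfolding init_costs_def
  proof (rule wp_for_loop, goal_cases)
    case (4 l s')
    then show ?case by (auto simp: Inv2_def agree_def less_Suc_eq)
  qed (use P(2) that in \<open>auto simp: Inv1_def Inv2_def agree_def\<close>)
  \<comment> \<open>\<open>z\<close> marks the finished columns. Their number equals the number of
    rounds, so after \<open>n\<close> rounds all are finished; rows not yet used still have reduced
    cost minus infinity.\<close>
  define Inv where "Inv k s' \<longleftrightarrow> ireg s' ''t'' = k \<and> ?ag s' \<and> card {j. j < n \<and> iarr s' ''z'' j \<noteq> 0} = k \<and>
    C.cost_inv {j. j < n \<and> iarr s' ''z'' j \<noteq> 0} (tarr s' ''T'') \<and>
    (\<forall>g<n. iarr s' ''z'' g \<noteq> 0 \<longrightarrow> tarr s' ''y'' (\<rho> g) = Y g (tarr s' ''T'')) \<and>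
    (\<forall>i<m. (\<forall>g<n. iarr s' ''z'' g \<noteq> 0 \<longrightarrow> \<rho> g \<noteq> i) \<longrightarrow> tarr s' ''y'' i = SNegInf)" for k s'
  have init: "Inv 0 (s'\<lparr>ireg := (ireg s')(''t'' := 0)\<rparr>)" if i2: "Inv2 m s'" for s'
  proof -
    have i2': "?ag s'" "\<And>j. j < n \<Longrightarrow> tarr s' ''T'' j = c' j" "\<And>j. j < n \<Longrightarrow> iarr s' ''z'' j = 0" "\<And>i. i < m \<Longrightarrow> tarr s' ''y'' i = SNegInf"
      using i2 by (simp_all add: Inv2_def)
    have D0: "{j. j < n \<and> iarr s' ''z'' j \<noteq> 0} = {}" using i2'(3) by auto
    have ci: "C.cost_inv {} (tarr s' ''T'')" using i2'(2) by (simp add: C.cost_inv_def)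
    have "?ag (s'\<lparr>ireg := (ireg s')(''t'' := 0)\<rparr>)" using i2'(1) by (simp add: agree_def)
    moreover have D1: "{j. j < n \<and> 0 < iarr s' ''z'' j} = {}" using D0 by simp
    ultimately show ?thesis unfolding Inv_def using ci i2'(3,4) by (simp add: D1)
  qed
  have p3: "wp (for_loop ''t'' (IReg ''n'') (select_label ;; finish_label ;; relax_labels))
      (\<lambda>t s'. t \<le> n * ((1 + (100 * n + 100) + (1 + 40 + (100 * n + 10))) + 11) + 10 \<and> Inv n s') s2"
    if i2: "Inv2 m s2" for s2
  proof (rule wp_for_loop, goal_cases)
    case (4 k s3)
    define z T where "z = iarr s3 ''z''" and "T = tarr s3 ''T''"
    have ag3: "?ag s3" and k: "ireg s3 ''t'' = k" and card: "card {j. j < n \<and> z j \<noteq> 0} = k"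
      and inv: "C.cost_inv {j. j < n \<and> z j \<noteq> 0} T"
      and y3: "\<And>g. g < n \<Longrightarrow> z g \<noteq> 0 \<Longrightarrow> tarr s3 ''y'' (\<rho> g) = Y g T"
      and y3': "\<And>i. i < m \<Longrightarrow> (\<And>g. g < n \<Longrightarrow> z g \<noteq> 0 \<Longrightarrow> \<rho> g \<noteq> i) \<Longrightarrow> tarr s3 ''y'' i = SNegInf"
      using 4(2) unfolding Inv_def z_def T_def by blast+
    have n3: "ireg s3 ''n'' = n" using agreeD[OF ag3] P(1) by simp
    have "\<exists>j0<n. z j0 = 0"
    proof (rule ccontr)
      assume "\<not> ?thesis"
      then have "{j. j < n \<and> z j \<noteq> 0} = {..<n}" unfolding lessThan_def by (intro Collect_cong) auto
      then show False using card 4(1) by simp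
    qed
    then obtain j0 where j0: "j0 < n" "iarr s3 ''z'' j0 = 0" unfolding z_def by blast
    show ?case
    proof (rule wp_SeqI[OF select_label_wp[OF n3 j0]], elim conjE)
      fix s4 :: memory
      define g where "g = ireg s4 ''g''"
      assume ag4: "agree {''j'', ''g''} {} {} s3 s4" and g: "ireg s4 ''g'' < n" "iarr s3 ''z'' (ireg s4 ''g'') = 0"
        and max: "\<forall>j<n. iarr s3 ''z'' j = 0 \<longrightarrow> modulus (tarr s3 ''T'' j) \<le> modulus (tarr s3 ''T'' (ireg s4 ''g''))"
      have gn: "g < n" "z g = 0" using g by (auto simp: g_def z_def)
      have arr4: "iarr s4 ''z'' = z" "tarr s4 ''T'' = T" "iarr s4 ''I'' = iarr s ''I''" "iarr s4 ''w'' = iarr s ''w''"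
        "tarr s4 ''S'' = tarr s ''S''" "tarr s4 ''y'' = tarr s3 ''y''" "tarr s4 ''V'' = tarr s ''V''" "iarr s4 ''o'' = iarr s ''o''"
        using agreeD[OF ag4] agreeD[OF ag3] by (simp_all add: z_def T_def)
      have ag4': "?ag s4" by (rule agree_trans[OF ag3 ag4]) auto
      have Vg: "tarr s ''V'' (iarr s ''o'' (\<rho> g) + g) = V u (\<rho> g) g" using P(8,10) \<rho>m(1)[OF gn(1)] gn(1) by simp
      define P5 where "P5 s5 \<longleftrightarrow> ?ag s5 \<and> ireg s5 ''t'' = k \<and> ireg s5 ''i'' = \<rho> g \<and> iarr s5 ''z'' = z(g := 1) \<and> tarr s5 ''T'' = T \<and>
        tarr s5 ''P'' 0 = stimes (T g) (V u (\<rho> g) g) \<and> tarr s5 ''y'' = (tarr s3 ''y'')(\<rho> g := Y g T)" for s5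
      have fin: "wp finish_label (\<lambda>t s'. t \<le> 40 \<and> P5 s') s4"
        using ag4' P(9)[OF \<rho>m(1)[OF gn(1)]] Vg agreeD(1)[OF ag4, of "''t''"] k
        by (auto simp: finish_label_def P5_def arr4 g_def[symmetric] \<rho>_def[symmetric] Y_def agree_def)
      show "wp (finish_label ;; relax_labels)
         (\<lambda>t s'. t \<le> 1 + 40 + (100 * n + 10) \<and> Inv (Suc k) (s'\<lparr>ireg := (ireg s')(''t'' := Suc (ireg s' ''t''))\<rparr>)) s4"
      proof (rule wp_SeqI[OF fin])
        fix s5 assume "P5 s5"
        then have ag5: "?ag s5" and i5: "ireg s5 ''i'' = \<rho> g" and k5: "ireg s5 ''t'' = k" and arr5: "iarr s5 ''z'' = z(g := 1)"
          "tarr s5 ''T'' = T" "tarr s5 ''P'' 0 = stimes (T g) (V u (\<rho> g) g)" "tarr s5 ''y'' = (tarr s3 ''y'')(\<rho> g := Y g T)"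
          by (auto simp: P5_def)
        have "normalized s5 u m" by (rule normalized_agree[OF ag5]) (use prep(1) in \<open>auto simp: prepared_def\<close>)
        moreover have "ireg s5 ''n'' = n" using agreeD[OF ag5] P(1) by simp
        ultimately have rl: "wp relax_labels (\<lambda>t s'. t \<le> 100 * n + 10 \<and> agree {''j''} {} {''T''} s5 s' \<and>
          (\<forall>j<n. tarr s' ''T'' j = (if (z(g := 1)) j = 0 \<and> modulus (T j) < modulus (V u (\<rho> g) j) * modulus (stimes (T g) (V u (\<rho> g) g))
             then sneg (stimes (V u (\<rho> g) j) (stimes (T g) (V u (\<rho> g) g))) else T j))) s5"
          using relax_labels_wp[of s5 u "\<rho> g"] i5 \<rho>m(1)[OF gn(1)] by (simp only: arr5)
        show "wp relax_labels (\<lambda>t s'. t \<le> 100 * n + 10 \<and> Inv (Suc k) (s'\<lparr>ireg := (ireg s')(''t'' := Suc (ireg s' ''t''))\<rparr>)) s5"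
        proof (rule wp_weaken[OF rl order_refl], elim conjE)
          fix s6
          assume ag6: "agree {''j''} {} {''T''} s5 s6" and T6: "\<forall>j<n. tarr s6 ''T'' j =
            (if (z(g := 1)) j = 0 \<and> modulus (T j) < modulus (V u (\<rho> g) j) * modulus (stimes (T g) (V u (\<rho> g) g))
             then sneg (stimes (V u (\<rho> g) j) (stimes (T g) (V u (\<rho> g) g))) else T j)"
          have D: "{j. j < n \<and> (z(g := 1)) j \<noteq> 0} = insert g {j. j < n \<and> z j \<noteq> 0}" using gn by auto
          have ci: "C.cost_inv (insert g {j. j < n \<and> z j \<noteq> 0}) (tarr s6 ''T'')"
          proof (rule C.cost_step[OF inv gn(1)])
            show "modulus (T l) \<le> modulus (T g)" if "l < n" "l \<notin> {j. j < n \<and> z j \<noteq> 0}" for l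
              using max that by (auto simp: z_def T_def g_def)
            show "tarr s6 ''T'' j = (if j \<notin> insert g {j. j < n \<and> z j \<noteq> 0} \<and> modulus (T j) < modulus (V u (\<rho> g) j) * modulus (T g)
               then sneg (stimes (V u (\<rho> g) j) (stimes (T g) (V u (\<rho> g) g))) else T j)" if "j < n" for j
              using T6 that diag[OF gn(1)] gn by auto
          qed (use gn in simp)
          have z6: "iarr s6 ''z'' = z(g := 1)" "tarr s6 ''y'' = (tarr s3 ''y'')(\<rho> g := Y g T)" "ireg s6 ''t'' = k"
            using agreeD[OF ag6] arr5 k5 by simp_all
          have "card {j. j < n \<and> (z(g := 1)) j \<noteq> 0} = Suc k" unfolding D using card gn by simp
          moreover have "tarr s6 ''y'' (\<rho> h) = Y h (tarr s6 ''T'')" if "h < n" "(z(g := 1)) h \<noteq> 0" for h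
          proof (cases "h = g")
            case True
            have "tarr s6 ''T'' g = T g" using T6 gn(1) by simp
            then show ?thesis using True z6(2) by (simp add: Y_def)
          next
            case False
            then have "tarr s6 ''T'' h = T h" "z h \<noteq> 0" using T6 that by auto
            then show ?thesis using False z6(2) y3[OF that(1)] \<rho>inj[OF that(1) gn(1)] by (simp add: Y_def)
          qed
          moreover have "tarr s6 ''y'' i = SNegInf" if "i < m" "\<forall>h<n. (z(g := 1)) h \<noteq> 0 \<longrightarrow> \<rho> h \<noteq> i" for i
          proof -
            have "\<rho> g \<noteq> i" using that(2) gn(1) by auto
            moreover have "\<rho> h \<noteq> i" if "h < n" "z h \<noteq> 0" for h using \<open>\<forall>h<n. (z(g := 1)) h \<noteq> 0 \<longrightarrow> \<rho> h \<noteq> i\<close> that by auto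
            ultimately show ?thesis using z6(2) y3'[OF that(1)] by simp
          qed
          moreover have "?ag s6" by (rule agree_trans[OF ag5 ag6]) auto
          ultimately show "Inv (Suc k) (s6\<lparr>ireg := (ireg s6)(''t'' := Suc (ireg s6 ''t''))\<rparr>)"
            using ci D z6(1,3) by (simp add: Inv_def agree_def)
        qed
      qed
    qed
  qed (use init[OF i2] i2 P(1) in \<open>auto simp: Inv_def agree_def\<close>)
  have "wp compute_costs (\<lambda>t s'. t \<le> 1 + (n * (20 + 11) + 10) + (1 + (m * (20 + 11) + 10) +
      (n * ((1 + (100 * n + 100) + (1 + 40 + (100 * n + 10))) + 11) + 10)) \<and> Inv n s') s"
    unfolding compute_costs_def by (rule wp_SeqI[OF p1], rule wp_SeqI[OF p2 p3])
  then show ?thesis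
  proof (rule wp_weaken)
    have "1 + (n * (20 + 11) + 10) + (1 + (m * (20 + 11) + 10) +
      (n * ((1 + (100 * n + 100) + (1 + 40 + (100 * n + 10))) + 11) + 10)) = 200 * (n * n) + 194 * n + 31 * m + 32"
      by (simp add: algebra_simps)
    moreover have "500 * Suc m * Suc n = 500 * (m * n) + 500 * m + 500 * n + 500" by (simp add: algebra_simps)
    moreover have "n * n \<le> m * n" using nm by simp
    ultimately show "1 + (n * (20 + 11) + 10) + (1 + (m * (20 + 11) + 10) +
      (n * ((1 + (100 * n + 100) + (1 + 40 + (100 * n + 10))) + 11) + 10)) \<le> 500 * Suc m * Suc n"
      by linarith
    fix s' assume inv: "Inv n s'"
    have "{j. j < n \<and> iarr s' ''z'' j \<noteq> 0} = {..<n}"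
      by (rule card_subset_eq) (use inv in \<open>auto simp: Inv_def\<close>)
    then have D: "\<And>j. j < n \<Longrightarrow> iarr s' ''z'' j \<noteq> 0" "C.cost_inv {..<n} (tarr s' ''T'')"
      using inv by (auto simp: Inv_def)
    define y where "y = vec m (tarr s' ''y'')"
    have "is_trop_reduced_costs A c I y"
    proof (rule cost_result[OF ok \<rho> diag D(2)[unfolded c'_def]])
      show "y $ \<rho> g = stimes (stimes (tarr s' ''T'' g) (V u (\<rho> g) g)) (sinv (of_trop (lev u (\<rho> g))))" if "g < n" for g
        using inv D(1)[OF that] that \<rho>m(1)[OF that] by (simp add: Inv_def Y_def y_def)
      show "y $ i = SNegInf" if "i < m" "i \<notin> I" for i
        using inv \<rho>m(2) that by (auto simp: Inv_def y_def)
    qed (simp_all add: y_def)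
    then have "trop_reduced_costs A c I = y" by (rule reduced_costs_unique(3)[OF basic])
    then show "?ag s' \<and> stores_costs s' m (trop_reduced_costs A c I)"
      using inv by (simp add: Inv_def stores_costs_def y_def)
  qed
qed

lemma costs_program_wp:
  assumes st: "stores_state s n m A b c I (trop_basic_point A b I)" and I: "trop_basic A b I"
  shows "wp costs_program (\<lambda>t s'. t \<le> 1500 * Suc m * Suc n \<and>
    stores_state s' n m A b c I (trop_basic_point A b I) \<and> stores_costs s' m (trop_reduced_costs A c I)) s"
proof -
  obtain u where ok: "basis_ok u I" using basis_okE[OF I] .
  then have t: "tight u I" and pt: "trop_basic_point A b I = pt u" by (auto simp: basis_ok_def)
  have nm: "n \<le> m" using ok card_mono[of "{..<m}" I] by (auto simp: basis_ok_def)
  have st': "stores_state s n m A b c I (pt u)" using st pt by simp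
  have c3: "wp compute_costs (\<lambda>t s'. t \<le> 500 * Suc m * Suc n \<and> stores_state s' n m A b c I (pt u) \<and>
      stores_costs s' m (trop_reduced_costs A c I)) s2" if "prepared s2 u I" "matched u s2" for s2
  proof (rule wp_weaken[OF compute_costs_wp[OF that ok] order_refl], elim conjE, rule conjI)
    fix s' assume ag: "agree {''i'', ''j'', ''g'', ''t''} {''z''} {''T'', ''P'', ''y''} s2 s'"
    show "stores_state s' n m A b c I (pt u)"
      by (rule stores_state_agree[OF ag]) (use that in \<open>auto simp: prepared_def\<close>)
  qed
  have "wp costs_program (\<lambda>t s'. t \<le> 1 + 500 * Suc m * Suc n + (1 + 200 * Suc n * Suc n + 500 * Suc m * Suc n) \<and>
      stores_state s' n m A b c I (pt u) \<and> stores_costs s' m (trop_reduced_costs A c I)) s"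
    unfolding costs_program_def
  proof (rule wp_SeqI[OF prepare_wp[OF st' ok]], elim conjE)
    fix s1 assume s1: "prepared s1 u I"
    show "wp (match_columns ;; compute_costs) (\<lambda>t s'. t \<le> 1 + 200 * Suc n * Suc n + 500 * Suc m * Suc n \<and>
      stores_state s' n m A b c I (pt u) \<and> stores_costs s' m (trop_reduced_costs A c I)) s1"
    proof (rule wp_SeqI[OF match_columns_wp[OF s1 ok]], elim conjE, rule c3)
      fix s2 assume ag: "agree {''t'', ''r'', ''j'', ''f'', ''g''} {''e'', ''w''} {} s1 s2"
      show "prepared s2 u I" by (rule prepared_agree[OF ag s1]) auto
    qed
  qed
  then show ?thesis unfolding pt
  proof (rule wp_weaken)
    have "Suc n * Suc n \<le> Suc m * Suc n" using nm by (intro mult_le_mono) auto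
    moreover have "1 \<le> Suc m * Suc n" by simp
    ultimately show "1 + 500 * Suc m * Suc n + (1 + 200 * Suc n * Suc n + 500 * Suc m * Suc n) \<le> 1500 * Suc m * Suc n"
      unfolding mult.assoc by linarith
  qed
qed

end

section \<open>Computing a pivot\<close>

text \<open>The register \<open>h\<close> is the position of \<open>k\<close> in \<open>I\<close>, the array \<open>u\<close> marks the members of \<open>I\<close>, and \<open>z\<close>
  marks the treated rows of the search; \<open>d\<close>, \<open>G\<close> and \<open>g\<close> are as in \<open>edge_search\<close>. The register \<open>l\<close> is
  the entering index.\<close>

definition locate_row :: com where
  "locate_row = for_loop ''r'' (IReg ''n'')
     (Cond (ILess (IArr ''I'' (IReg ''r'')) (IReg ''k'')) Skip
       (Cond (ILess (IReg ''k'') (IArr ''I'' (IReg ''r''))) Skip (SetReg ''h'' (IReg ''r''))))"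

definition mark_basis :: com where
  "mark_basis = for_loop ''i'' (IReg ''m'') (SetIArr ''u'' (IReg ''i'') (INum 0)) ;;
     for_loop ''r'' (IReg ''n'') (SetIArr ''u'' (IArr ''I'' (IReg ''r'')) (INum 1))"

definition init_search :: com where
  "init_search = for_loop ''j'' (IPlus (IReg ''n'') (INum 1)) (SetTArr ''d'' (IReg ''j'') TNegInf) ;;
     for_loop ''r'' (IReg ''n'') (SetIArr ''z'' (IReg ''r'') (INum 0) ;; SetTArr ''G'' (IReg ''r'') TNegInf) ;;
     SetIArr ''z'' (IReg ''h'') (INum 1) ;; SetReg ''g'' (IArr ''p'' (IReg ''h'')) ;; SetTArr ''d'' (IReg ''g'') TOne"

abbreviation key_term :: texp where
  "key_term \<equiv> TTimes (entry (IArr ''I'' (IReg ''r'')) (IReg ''g'')) (TArr ''d'' (IReg ''g''))"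

definition relax_keys :: com where
  "relax_keys = for_loop ''r'' (IReg ''n'')
     (Cond (ILess (IArr ''z'' (IReg ''r'')) (INum 1))
       (Cond (TLess (TArr ''G'' (IReg ''r'')) key_term) (SetTArr ''G'' (IReg ''r'') key_term) Skip) Skip)"

text \<open>The comparison is strict, so rows with key minus infinity are never selected. If
  \<open>B\<close> is still minus infinity at the end, the round is idle and \<open>f\<close> is
  meaningless.\<close>

definition select_key :: com where
  "select_key = SetTArr ''B'' (INum 0) TNegInf ;; for_loop ''r'' (IReg ''n'')
     (Cond (ILess (IArr ''z'' (IReg ''r'')) (INum 1))
       (Cond (TLess (TArr ''B'' (INum 0)) (TArr ''G'' (IReg ''r'')))
         (SetReg ''f'' (IReg ''r'') ;; SetTArr ''B'' (INum 0) (TArr ''G'' (IReg ''r''))) Skip) Skip)"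

text \<open>A row tipped to one side by its dominant raised term is balanced by its tangent column
  of the other sign. The entry there has modulus 1, so the column is raised to the level of the key
  itself.\<close>

definition raise_column :: com where
  "raise_column = Cond (TLess TNegInf (TArr ''B'' (INum 0)))
     (SetIArr ''z'' (IReg ''f'') (INum 1) ;;
      Cond (TPos (TArr ''B'' (INum 0))) (SetReg ''g'' (IArr ''q'' (IReg ''f''))) (SetReg ''g'' (IArr ''p'' (IReg ''f''))) ;;
      SetTArr ''d'' (IReg ''g'') (TAbs (TArr ''B'' (INum 0)))) Skip"

definition search_edge :: com where
  "search_edge = init_search ;; for_loop ''t'' (IReg ''n'') (relax_keys ;; select_key ;; raise_column)"

abbreviation row_term :: texp where
  "row_term \<equiv> TTimes (entry (IReg ''i'') (IReg ''j'')) (TArr ''d'' (IReg ''j''))"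

definition row_values :: com where
  "row_values = SetTArr ''P'' (INum 0) TNegInf ;; SetTArr ''N'' (INum 0) TNegInf ;;
     for_loop ''j'' (IPlus (IReg ''n'') (INum 1))
       (Cond (TPos row_term)
         (Cond (TLess (TArr ''P'' (INum 0)) row_term) (SetTArr ''P'' (INum 0) (TAbs row_term)) Skip)
         (Cond (TLess (TArr ''N'' (INum 0)) row_term) (SetTArr ''N'' (INum 0) (TAbs row_term)) Skip))"

definition ratio_test :: com where
  "ratio_test = SetTArr ''B'' (INum 0) TNegInf ;; for_loop ''i'' (IReg ''m'')
     (Cond (ILess (IArr ''u'' (IReg ''i'')) (INum 1))
       (row_values ;;
        Cond (TLess (TArr ''P'' (INum 0)) (TArr ''N'' (INum 0)))
          (Cond (TLess (TArr ''B'' (INum 0)) (TArr ''N'' (INum 0)))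
            (SetTArr ''B'' (INum 0) (TArr ''N'' (INum 0)) ;; SetReg ''l'' (IReg ''i'')) Skip) Skip)
       Skip)"

text \<open>The array \<open>z\<close> holds the coordinates \<open>1 + d / B\<close> of the new
  point relative to the old one; dividing by entry \<open>n\<close> makes the last homogeneous
  coordinate 1 again. The entering index takes over position \<open>h\<close> of the leaving
  one.\<close>

definition move_point :: com where
  "move_point = SetIArr ''I'' (IReg ''h'') (IReg ''l'') ;;
     for_loop ''j'' (IPlus (IReg ''n'') (INum 1))
       (SetTArr ''z'' (IReg ''j'') (TTimes (TArr ''d'' (IReg ''j'')) (TInv (TArr ''B'' (INum 0)))) ;;
        Cond (TLess (TArr ''z'' (IReg ''j'')) TOne) (SetTArr ''z'' (IReg ''j'') TOne) Skip) ;;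
     for_loop ''j'' (IReg ''n'')
       (SetTArr ''x'' (IReg ''j'') (TTimes (TArr ''x'' (IReg ''j''))
          (TTimes (TArr ''z'' (IReg ''j'')) (TInv (TArr ''z'' (IReg ''n''))))))"

definition pivot_program :: com where
  "pivot_program = prepare ;; locate_row ;; mark_basis ;; search_edge ;; ratio_test ;; move_point"

section \<open>Correctness and running time of the pivot program\<close>

lemma locate_row_wp:
  assumes n: "ireg s ''n'' = n" and k: "ireg s ''k'' \<in> iarr s ''I'' ` {..<n}"
  shows "wp locate_row (\<lambda>t s'. t \<le> 50 * n + 10 \<and> agree {''r'', ''h''} {} {} s s' \<and>
    ireg s' ''h'' < n \<and> iarr s ''I'' (ireg s' ''h'') = ireg s ''k'') s"
proof -
  define Inv where "Inv l s' \<longleftrightarrow> l \<le> n \<and> ireg s' ''r'' = l \<and> agree {''r'', ''h''} {} {} s s' \<and>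
    ((\<exists>r<l. iarr s ''I'' r = ireg s ''k'') \<longrightarrow> ireg s' ''h'' < n \<and> iarr s ''I'' (ireg s' ''h'') = ireg s ''k'')" for l s'
  have "wp locate_row (\<lambda>t s'. t \<le> n * (39 + 11) + 10 \<and> Inv n s') s"
    unfolding locate_row_def
  proof (rule wp_for_loop, goal_cases)
    case (4 l s')
    then have l: "ireg s' ''r'' = l" by (simp add: Inv_def)
    note inv = 4(2)[unfolded Inv_def agree_def]
    consider "iarr s ''I'' l < ireg s ''k''" | "ireg s ''k'' < iarr s ''I'' l" | "iarr s ''I'' l = ireg s ''k''" by linarith
    then show ?case
    proof cases
      case 1
      then show ?thesis using inv 4(1) by (simp add: l Inv_def agree_def Ex_less_Suc)
    next
      case 2
      then show ?thesis using inv 4(1) by (simp add: l Inv_def agree_def Ex_less_Suc)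
    next
      case 3
      then show ?thesis using inv 4(1) by (simp add: l Inv_def agree_def)
    qed
  qed (use n in \<open>auto simp: Inv_def agree_def\<close>)
  then show ?thesis by (rule wp_weaken) (use k in \<open>auto simp: Inv_def\<close>)
qed

lemma mark_basis_wp:
  assumes n: "ireg s ''n'' = n" and m: "ireg s ''m'' = m"
  shows "wp mark_basis (\<lambda>t s'. t \<le> 20 * m + 20 * n + 30 \<and> agree {''i'', ''r''} {''u''} {} s s' \<and>
    (\<forall>i<m. iarr s' ''u'' i = 0 \<longleftrightarrow> i \<notin> iarr s ''I'' ` {..<n})) s"
proof -
  define Inv1 where "Inv1 l s' \<longleftrightarrow> ireg s' ''i'' = l \<and> agree {''i'', ''r''} {''u''} {} s s' \<and> (\<forall>i<l. iarr s' ''u'' i = 0)" for l s'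
  define Inv2 where "Inv2 l s' \<longleftrightarrow> ireg s' ''r'' = l \<and> agree {''i'', ''r''} {''u''} {} s s' \<and>
    (\<forall>i<m. iarr s' ''u'' i = 0 \<longleftrightarrow> i \<notin> iarr s ''I'' ` {..<l})" for l s'
  have p1: "wp (for_loop ''i'' (IReg ''m'') (SetIArr ''u'' (IReg ''i'') (INum 0))) (\<lambda>t s'. t \<le> m * (9 + 11) + 10 \<and> Inv1 m s') s"
  proof (rule wp_for_loop, goal_cases)
    case (4 l s')
    then show ?case by (auto simp: Inv1_def agree_def less_Suc_eq)
  qed (use m in \<open>auto simp: Inv1_def agree_def\<close>)
  have p2: "wp (for_loop ''r'' (IReg ''n'') (SetIArr ''u'' (IArr ''I'' (IReg ''r'')) (INum 1))) (\<lambda>t s'. t \<le> n * (9 + 11) + 10 \<and> Inv2 n s') s1"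
    if "Inv1 m s1" for s1
  proof (rule wp_for_loop, goal_cases)
    case (4 l s')
    then show ?case by (auto simp: Inv2_def agree_def lessThan_Suc)
  qed (use n that in \<open>auto simp: Inv1_def Inv2_def agree_def\<close>)
  have "wp mark_basis (\<lambda>t s'. t \<le> 1 + (m * (9 + 11) + 10) + (n * (9 + 11) + 10) \<and> Inv2 n s') s"
    unfolding mark_basis_def by (rule wp_SeqI[OF p1 p2])
  then show ?thesis by (rule wp_weaken) (auto simp: Inv2_def)
qed

lemma init_search_wp:
  assumes n: "ireg s ''n'' = n" and h: "ireg s ''h'' = rk" "rk < n"
  shows "wp init_search (\<lambda>t s'. t \<le> 50 * n + 100 \<and> agree {''j'', ''r'', ''g''} {''z''} {''d'', ''G''} s s' \<and>
    ireg s' ''g'' = iarr s ''p'' rk \<and> (\<forall>j\<le>n. tarr s' ''d'' j = ((\<lambda>_. SNegInf)(iarr s ''p'' rk := Pos 0)) j) \<and>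
    (\<forall>r<n. iarr s' ''z'' r = 0 \<longleftrightarrow> r \<noteq> rk) \<and> (\<forall>r<n. tarr s' ''G'' r = SNegInf)) s"
proof -
  let ?ag = "agree {''j'', ''r'', ''g''} {''z''} {''d'', ''G''} s"
  define Inv1 where "Inv1 l s' \<longleftrightarrow> ireg s' ''j'' = l \<and> ?ag s' \<and> (\<forall>j<l. tarr s' ''d'' j = SNegInf)" for l s'
  define Inv2 where "Inv2 l s' \<longleftrightarrow> ireg s' ''r'' = l \<and> ?ag s' \<and> (\<forall>j\<le>n. tarr s' ''d'' j = SNegInf) \<and>
    (\<forall>r<l. iarr s' ''z'' r = 0 \<and> tarr s' ''G'' r = SNegInf)" for l s'
  have p1: "wp (for_loop ''j'' (IPlus (IReg ''n'') (INum 1)) (SetTArr ''d'' (IReg ''j'') TNegInf)) (\<lambda>t s'. t \<le> Suc n * (9 + 11) + 10 \<and> Inv1 (Suc n) s') s"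
  proof (rule wp_for_loop, goal_cases)
    case (4 l s')
    then show ?case by (auto simp: Inv1_def agree_def less_Suc_eq)
  qed (use n in \<open>auto simp: Inv1_def agree_def\<close>)
  have p2: "wp (for_loop ''r'' (IReg ''n'') (SetIArr ''z'' (IReg ''r'') (INum 0) ;; SetTArr ''G'' (IReg ''r'') TNegInf))
      (\<lambda>t s'. t \<le> n * (9 + 11) + 10 \<and> Inv2 n s') s1" if "Inv1 (Suc n) s1" for s1
  proof (rule wp_for_loop, goal_cases)
    case (4 l s')
    then show ?case by (auto simp: Inv2_def agree_def less_Suc_eq)
  qed (use n that in \<open>auto simp: Inv1_def Inv2_def agree_def\<close>)
  define Fin' where "Fin' s' \<longleftrightarrow> ?ag s' \<and> ireg s' ''g'' = iarr s ''p'' rk \<and> (\<forall>j\<le>n. tarr s' ''d'' j = ((\<lambda>_. SNegInf)(iarr s ''p'' rk := Pos 0)) j) \<and>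
    (\<forall>r<n. iarr s' ''z'' r = 0 \<longleftrightarrow> r \<noteq> rk) \<and> (\<forall>r<n. tarr s' ''G'' r = SNegInf)" for s'
  have p3: "wp (SetIArr ''z'' (IReg ''h'') (INum 1) ;; SetReg ''g'' (IArr ''p'' (IReg ''h'')) ;; SetTArr ''d'' (IReg ''g'') TOne)
      (\<lambda>t s'. t \<le> 20 \<and> Fin' s') s2" if i2: "Inv2 n s2" for s2
  proof -
    have ag: "?ag s2" and d: "\<And>j. j \<le> n \<Longrightarrow> tarr s2 ''d'' j = SNegInf"
      "\<And>r. r < n \<Longrightarrow> iarr s2 ''z'' r = 0" "\<And>r. r < n \<Longrightarrow> tarr s2 ''G'' r = SNegInf" using i2 by (auto simp: Inv2_def)
    have "ireg s2 ''h'' = rk" "iarr s2 ''p'' = iarr s ''p''" using agreeD[OF ag] h by simp_all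
    then show ?thesis using d ag by (simp add: Fin'_def agree_def)
  qed
  have "wp init_search (\<lambda>t s'. t \<le> 1 + (Suc n * (9 + 11) + 10) + (1 + (n * (9 + 11) + 10) + 20) \<and> Fin' s') s"
    unfolding init_search_def by (rule wp_SeqI[OF p1], rule wp_SeqI[OF p2 p3])
  then show ?thesis by (rule wp_weaken) (auto simp: Fin'_def)
qed

lemma select_key_wp:
  assumes n: "ireg s ''n'' = n"
  shows "wp select_key (\<lambda>t s'. t \<le> 50 * n + 20 \<and> agree {''r'', ''f''} {} {''B''} s s' \<and>
    (tarr s' ''B'' 0 = SNegInf \<and> (\<forall>r<n. iarr s ''z'' r = 0 \<longrightarrow> tarr s ''G'' r = SNegInf) \<or>
     tarr s' ''B'' 0 \<noteq> SNegInf \<and> ireg s' ''f'' < n \<and> iarr s ''z'' (ireg s' ''f'') = 0 \<and>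
       tarr s' ''B'' 0 = tarr s ''G'' (ireg s' ''f'') \<and>
       (\<forall>r<n. iarr s ''z'' r = 0 \<longrightarrow> modulus (tarr s ''G'' r) \<le> modulus (tarr s' ''B'' 0)))) s"
proof -
  define z G where "z = iarr s ''z''" and "G = tarr s ''G''"
  define Inv where "Inv l s' \<longleftrightarrow> ireg s' ''r'' = l \<and> agree {''r'', ''f''} {} {''B''} s s' \<and>
    (tarr s' ''B'' 0 = SNegInf \<and> (\<forall>r<l. z r = 0 \<longrightarrow> G r = SNegInf) \<or>
     tarr s' ''B'' 0 \<noteq> SNegInf \<and> ireg s' ''f'' < n \<and> z (ireg s' ''f'') = 0 \<and> tarr s' ''B'' 0 = G (ireg s' ''f'') \<and>
       (\<forall>r<l. z r = 0 \<longrightarrow> modulus (G r) \<le> modulus (tarr s' ''B'' 0)))" for l s'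
  have "wp select_key (\<lambda>t s'. t \<le> 1 + 5 + (n * (39 + 11) + 10) \<and> Inv n s') s"
    unfolding select_key_def
  proof (rule wp_SeqI[where P = "\<lambda>s'. s' = s\<lparr>tarr := (tarr s)(''B'' := (tarr s ''B'')(0 := SNegInf))\<rparr>"], goal_cases)
    case 1
    then show ?case by simp
  next
    case (2 s1)
    show ?case
    proof (rule wp_for_loop, goal_cases)
      case (4 l s')
      then have l: "ireg s' ''r'' = l" and ag: "agree {''r'', ''f''} {} {''B''} s s'" by (auto simp: Inv_def)
      have arr: "iarr s' ''z'' = z" "tarr s' ''G'' = G" using agreeD[OF ag] by (simp_all add: z_def G_def)
      have ag': "agree {''r'', ''f''} {} {''B''} s (s'\<lparr>ireg := (ireg s')(''r'' := x)\<rparr>)"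
        "agree {''r'', ''f''} {} {''B''} s (s'\<lparr>ireg := (ireg s')(''f'' := y, ''r'' := x), tarr := (tarr s')(''B'' := w)\<rparr>)"
        "agree {''r'', ''f''} {} {''B''} s (s'\<lparr>ireg := (ireg s')(''f'' := y), tarr := (tarr s')(''B'' := w), ireg := (ireg s')(''f'' := y, ''r'' := x)\<rparr>)"
        "agree {''r'', ''f''} {} {''B''} s (s'\<lparr>tarr := (tarr s')(''B'' := w), ireg := (ireg s')(''f'' := y, ''r'' := x)\<rparr>)" for x y w
        using ag by (auto simp: agree_def)
      have inv: "tarr s' ''B'' 0 = SNegInf \<and> (\<forall>r<l. z r = 0 \<longrightarrow> G r = SNegInf) \<or>
         tarr s' ''B'' 0 \<noteq> SNegInf \<and> ireg s' ''f'' < n \<and> z (ireg s' ''f'') = 0 \<and> tarr s' ''B'' 0 = G (ireg s' ''f'') \<and>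
           (\<forall>r<l. z r = 0 \<longrightarrow> modulus (G r) \<le> modulus (tarr s' ''B'' 0))" using 4(2) by (simp add: Inv_def)
      show ?case
      proof (cases "z l = 0 \<and> modulus (tarr s' ''B'' 0) < modulus (G l)")
        case True
        then have "G l \<noteq> SNegInf" by (metis modulus_eq_0 trop_not_less_zero)
        moreover have "modulus (G r) \<le> modulus (G l)" if "r < Suc l" "z r = 0" for r
        proof (cases "r = l")
          case False
          then have "r < l" using that by simp
          then have "modulus (G r) \<le> modulus (tarr s' ''B'' 0)" using inv that(2) by (auto simp flip: zero_trop_def)
          then show ?thesis using True by (meson order_trans less_imp_le)
        qed simp
        ultimately show ?thesis using True 4(1) by (simp add: arr l Inv_def ag')
      next
        case False
        then have "Inv (Suc l) (s'\<lparr>ireg := (ireg s')(''r'' := Suc (ireg s' ''r''))\<rparr>)"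
          using inv ag' by (auto simp: Inv_def l less_Suc_eq not_less simp flip: zero_trop_def)
        then show ?thesis using False by (auto simp: arr l)
      qed
    qed (use n 2 in \<open>auto simp: Inv_def agree_def\<close>)
  qed
  then show ?thesis by (rule wp_weaken) (auto simp: Inv_def z_def G_def)
qed

context trop_program
begin

lemma relax_keys_wp:
  assumes prep: "prepared s u I" "tight u I" and g: "ireg s ''g'' = g" "g \<le> n"
  shows "wp relax_keys (\<lambda>t s'. t \<le> 100 * n + 10 \<and> agree {''r''} {} {''G''} s s' \<and>
    (\<forall>r<n. tarr s' ''G'' r = (if iarr s ''z'' r = 0 \<and> modulus (tarr s ''G'' r) < modulus (stimes (V u (iarr s ''I'' r) g) (tarr s ''d'' g))
       then stimes (V u (iarr s ''I'' r) g) (tarr s ''d'' g) else tarr s ''G'' r))) s"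
proof -
  note P = preparedD[OF prep]
  define new where "new r = (if iarr s ''z'' r = 0 \<and> modulus (tarr s ''G'' r) < modulus (stimes (V u (iarr s ''I'' r) g) (tarr s ''d'' g))
       then stimes (V u (iarr s ''I'' r) g) (tarr s ''d'' g) else tarr s ''G'' r)" for r
  define Inv where "Inv l s' \<longleftrightarrow> ireg s' ''r'' = l \<and> agree {''r''} {} {''G''} s s' \<and>
    (\<forall>r<l. tarr s' ''G'' r = new r) \<and> (\<forall>r\<ge>l. tarr s' ''G'' r = tarr s ''G'' r)" for l s'
  have "wp relax_keys (\<lambda>t s'. t \<le> n * (60 + 11) + 10 \<and> Inv n s') s"
    unfolding relax_keys_def
  proof (rule wp_for_loop, goal_cases)
    case (4 l s')
    then have l: "ireg s' ''r'' = l" and ag: "agree {''r''} {} {''G''} s s'" and Gl: "tarr s' ''G'' l = tarr s ''G'' l"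
      and low: "\<And>r. r < l \<Longrightarrow> tarr s' ''G'' r = new r" and high: "\<And>r. l \<le> r \<Longrightarrow> tarr s' ''G'' r = tarr s ''G'' r" by (auto simp: Inv_def)
    have norm': "normalized s' u m" by (rule normalized_agree[OF ag]) (use prep in \<open>auto simp: prepared_def\<close>)
    have arr: "iarr s' ''z'' = iarr s ''z''" "tarr s' ''d'' = tarr s ''d''" "ireg s' ''g'' = g" "iarr s' ''I'' = iarr s ''I''"
      using agreeD[OF ag] g by simp_all
    have e: "tval key_term s' = stimes (V u (iarr s ''I'' l) g) (tarr s ''d'' g)"
      using entry_eval[OF norm', of "IArr ''I'' (IReg ''r'')" "IReg ''g''"] g 4(1) l arr P(5)[OF 4(1)] by simp
    have b1: "bval (ILess (IArr ''z'' (IReg ''r'')) (INum 1)) s' \<longleftrightarrow> iarr s ''z'' l = 0" using arr l by simp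
    have b2: "bval (TLess (TArr ''G'' (IReg ''r'')) key_term) s' \<longleftrightarrow>
        modulus (tarr s ''G'' l) < modulus (stimes (V u (iarr s ''I'' l) g) (tarr s ''d'' g))"
      unfolding bval.simps e using l Gl by simp
    have ag': "agree {''r''} {} {''G''} s (s'\<lparr>ireg := (ireg s')(''r'' := x)\<rparr>)"
      "agree {''r''} {} {''G''} s (s'\<lparr>tarr := (tarr s')(''G'' := y), ireg := (ireg s')(''r'' := x)\<rparr>)" for x y
      using ag by (auto simp: agree_def)
    show ?case
    proof (cases "iarr s ''z'' l = 0 \<and> modulus (tarr s ''G'' l) < modulus (stimes (V u (iarr s ''I'' l) g) (tarr s ''d'' g))")
      case True
      then have "new l = stimes (V u (iarr s ''I'' l) g) (tarr s ''d'' g)" by (simp add: new_def)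
      then have "Inv (Suc l) (s'\<lparr>tarr := (tarr s')(''G'' := (tarr s' ''G'')(l := stimes (V u (iarr s ''I'' l) g) (tarr s ''d'' g))),
          ireg := (ireg s')(''r'' := Suc l)\<rparr>)"
        using ag' low high by (simp add: Inv_def less_Suc_eq)
      then show ?thesis unfolding wp_Cond b1 b2 wp_SetTArr e using True by (simp add: l)
    next
      case False
      then have "new l = tarr s ''G'' l" by (auto simp: new_def)
      then have "Inv (Suc l) (s'\<lparr>ireg := (ireg s')(''r'' := Suc (ireg s' ''r''))\<rparr>)"
        using ag' l low high by (simp add: Inv_def less_Suc_eq)
      then show ?thesis unfolding wp_Cond b1 b2 using False by auto
    qed
  qed (use P(1) in \<open>auto simp: Inv_def agree_def\<close>)
  then show ?thesis by (rule wp_weaken) (auto simp: Inv_def new_def)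
qed

end

text \<open>Memory outside the used index range is arbitrary, so arrays match the functions of the
  abstract search only where the indices are in range.\<close>

lemma (in edge_search) search_inv_cong:
  assumes inv: "search_inv t d F G g" and eq: "\<And>j. j \<le> n \<Longrightarrow> d' j = d j" "\<And>r. r < n \<Longrightarrow> G' r = G r"
  shows "search_inv t d' F G' g"
proof -
  have "{j. j \<le> n \<and> d' j \<noteq> SNegInf} = {j. j \<le> n \<and> d j \<noteq> SNegInf}" using eq(1) by auto
  moreover have "p rk \<le> n" using p[OF rk] by simp
  moreover have "g \<le> n" using inv by (simp add: search_inv_def)
  ultimately show ?thesis using inv unfolding search_inv_def exhausted_def
    by (simp add: eq cong: conj_cong imp_cong)
qed

context trop_program
begin

lemma search_edge_wp:
  assumes prep: "prepared s u I" and t: "tight u I" and h: "ireg s ''h'' = rk" "rk < n" "iarr s ''I'' rk = k"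
  shows "wp search_edge (\<lambda>t s'. t \<le> 500 * Suc n * Suc n \<and> agree {''j'', ''r'', ''g'', ''f'', ''t''} {''z''} {''d'', ''G'', ''B''} s s' \<and>
    edge_direction u I k (\<lambda>j. modulus (tarr s' ''d'' j)) \<and> (\<forall>j\<le>n. tarr s' ''d'' j = SNegInf \<or> (\<exists>a. tarr s' ''d'' j = Pos a))) s"
proof -
  let ?ag = "agree {''j'', ''r'', ''g'', ''f'', ''t''} {''z''} {''d'', ''G'', ''B''} s"
  note P = preparedD[OF prep t]
  interpret S: edge_search n "\<lambda>r. V u (iarr s ''I'' r)" "iarr s ''p''" "iarr s ''q''" rk
    by unfold_locales (use V_le_1 P(5,6,7) h in auto)
  let ?F = "\<lambda>z. {r. r < n \<and> z r \<noteq> (0::nat)}"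
  define Inv where "Inv l s' \<longleftrightarrow> ireg s' ''t'' = l \<and> ?ag s' \<and>
    S.search_inv l (tarr s' ''d'') (?F (iarr s' ''z'')) (tarr s' ''G'') (ireg s' ''g'')" for l s'
  have init: "Inv 0 (s1\<lparr>ireg := (ireg s1)(''t'' := 0)\<rparr>)"
    if s1: "agree {''j'', ''r'', ''g''} {''z''} {''d'', ''G''} s s1"
      "ireg s1 ''g'' = iarr s ''p'' rk" "\<And>j. j \<le> n \<Longrightarrow> tarr s1 ''d'' j = ((\<lambda>_. SNegInf)(iarr s ''p'' rk := Pos 0)) j"
      "\<And>r. r < n \<Longrightarrow> iarr s1 ''z'' r = 0 \<longleftrightarrow> r \<noteq> rk" "\<And>r. r < n \<Longrightarrow> tarr s1 ''G'' r = SNegInf" for s1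
  proof -
    have "r < n \<and> iarr s1 ''z'' r \<noteq> 0 \<longleftrightarrow> r = rk" for r using s1(4)[of r] h(2) by (cases "r < n") auto
    then have F: "?F (iarr s1 ''z'') = {rk}" by (simp only:) simp
    have "S.search_inv 0 (tarr s1 ''d'') (?F (iarr s1 ''z'')) (tarr s1 ''G'') (ireg s1 ''g'')"
      unfolding F s1(2) by (rule S.search_inv_cong[OF S.search_init s1(3,5)])
    moreover have "?ag (s1\<lparr>ireg := (ireg s1)(''t'' := 0)\<rparr>)" using s1(1) by (simp add: agree_def)
    ultimately show ?thesis by (simp add: Inv_def)
  qed
  have loop: "wp (for_loop ''t'' (IReg ''n'') (relax_keys ;; select_key ;; raise_column))
      (\<lambda>t s'. t \<le> n * ((1 + (100 * n + 10) + (1 + (50 * n + 20) + 40)) + 11) + 10 \<and> Inv n s') s0"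
    if s0: "Inv 0 (s0\<lparr>ireg := (ireg s0)(''t'' := 0)\<rparr>)" for s0
  proof (rule wp_for_loop, goal_cases)
    case (4 l s1)
    define z d G g where "z = iarr s1 ''z''" and "d = tarr s1 ''d''" and "G = tarr s1 ''G''" and "g = ireg s1 ''g''"
    have ag1: "?ag s1" and l: "ireg s1 ''t'' = l" and inv: "S.search_inv l d (?F z) G g"
      using 4(2) by (auto simp: Inv_def z_def d_def G_def g_def)
    let ?R = "S.relaxed d (?F z) G g"
    have gn: "g \<le> n" using inv by (simp add: S.search_inv_def)
    have prep1: "prepared s1 u I" by (rule prepared_agree[OF ag1 prep]) auto
    have I1: "iarr s1 ''I'' = iarr s ''I''" using agreeD[OF ag1] by simp
    note rk = relax_keys_wp[OF prep1 t g_def[symmetric] gn, unfolded I1, folded z_def d_def G_def]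
    show ?case
    proof (rule wp_SeqI[OF rk], elim conjE)
      fix s2 assume ag2: "agree {''r''} {} {''G''} s1 s2"
        and G2: "\<forall>r<n. tarr s2 ''G'' r = (if z r = 0 \<and> modulus (G r) < modulus (stimes (V u (iarr s ''I'' r) g) (d g))
           then stimes (V u (iarr s ''I'' r) g) (d g) else G r)"
      have G2': "tarr s2 ''G'' r = ?R r" if "r < n" for r using G2 that by (simp add: S.relaxed_def)
      have n2: "ireg s2 ''n'' = n" using agreeD[OF ag2] preparedD(1)[OF prep1 t] by simp
      have z2: "iarr s2 ''z'' = z" using agreeD[OF ag2] by (simp add: z_def)
      show "wp (select_key ;; raise_column) (\<lambda>t s'. t \<le> 1 + (50 * n + 20) + 40 \<and>
          Inv (Suc l) (s'\<lparr>ireg := (ireg s')(''t'' := Suc (ireg s' ''t''))\<rparr>)) s2"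
      proof (rule wp_SeqI[OF select_key_wp[OF n2, unfolded z2]], elim conjE)
        fix s3 assume ag3: "agree {''r'', ''f''} {} {''B''} s2 s3"
          and sel: "tarr s3 ''B'' 0 = SNegInf \<and> (\<forall>r<n. z r = 0 \<longrightarrow> tarr s2 ''G'' r = SNegInf) \<or>
             tarr s3 ''B'' 0 \<noteq> SNegInf \<and> ireg s3 ''f'' < n \<and> z (ireg s3 ''f'') = 0 \<and>
             tarr s3 ''B'' 0 = tarr s2 ''G'' (ireg s3 ''f'') \<and>
             (\<forall>r<n. z r = 0 \<longrightarrow> modulus (tarr s2 ''G'' r) \<le> modulus (tarr s3 ''B'' 0))"
        have "agree {''r''} {} {''G''} s1 s2" by fact
        then have ag': "agree {''r'', ''f''} {} {''G'', ''B''} s1 s3" by (rule agree_trans[OF _ ag3]) auto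
        have ag3': "?ag s3" by (rule agree_trans[OF ag1 ag']) auto
        have arr: "iarr s3 ''z'' = z" "tarr s3 ''d'' = d" "ireg s3 ''g'' = g" "ireg s3 ''t'' = l"
          "iarr s3 ''p'' = iarr s ''p''" "iarr s3 ''q'' = iarr s ''q''"
          using agreeD[OF ag'] l agreeD[OF ag3'] by (simp_all add: z_def d_def g_def)
        have G3: "tarr s3 ''G'' r = ?R r" if "r < n" for r using agreeD[OF ag3] G2'[OF that] by simp
        from sel show "wp raise_column (\<lambda>t s'. t \<le> 40 \<and> Inv (Suc l) (s'\<lparr>ireg := (ireg s')(''t'' := Suc (ireg s' ''t''))\<rparr>)) s3"
        \<comment> \<open>The two outcomes of the selection are the idle round,
          \<open>search_stop\<close>, and the proper one, \<open>search_step\<close>.\<close>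
        proof (elim disjE conjE)
          assume B: "tarr s3 ''B'' 0 = SNegInf" and none: "\<forall>r<n. z r = 0 \<longrightarrow> tarr s2 ''G'' r = SNegInf"
          have "?R r = SNegInf" if "r < n" "r \<notin> ?F z" for r
          proof -
            have "tarr s2 ''G'' r = SNegInf" using none that by auto
            then show ?thesis using G2'[OF that(1)] by simp
          qed
          then have "S.search_inv (Suc l) d (?F z) ?R g" by (rule S.search_stop[OF inv])
          then have "S.search_inv (Suc l) d (?F z) (tarr s3 ''G'') g" by (rule S.search_inv_cong) (use G3 in auto)
          moreover have "?ag (s3\<lparr>ireg := (ireg s3)(''t'' := Suc (ireg s3 ''t''))\<rparr>)" using ag3' by (simp add: agree_def)
          ultimately have "Inv (Suc l) (s3\<lparr>ireg := (ireg s3)(''t'' := Suc (ireg s3 ''t''))\<rparr>)"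
            unfolding Inv_def using arr by simp
          then show ?thesis using B by (simp add: raise_column_def)
        next
          define f where "f = ireg s3 ''f''"
          assume B: "tarr s3 ''B'' 0 \<noteq> SNegInf" and f': "ireg s3 ''f'' < n" "z (ireg s3 ''f'') = 0"
            "tarr s3 ''B'' 0 = tarr s2 ''G'' (ireg s3 ''f'')"
            and max: "\<forall>r<n. z r = 0 \<longrightarrow> modulus (tarr s2 ''G'' r) \<le> modulus (tarr s3 ''B'' 0)"
          have f: "f < n" "z f = 0" "tarr s3 ''B'' 0 = ?R f" using f' G2' by (auto simp: f_def)
          define g' where "g' = (if tpositive (?R f) then iarr s ''q'' f else iarr s ''p'' f)"
          have step: "S.search_inv (Suc l) (d(g' := of_trop (modulus (?R f)))) (insert f (?F z)) ?R g'"
          proof (rule S.search_step[OF inv f(1) _ _ _ g'_def refl])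
            show "f \<notin> ?F z" using f(2) by simp
            show "?R f \<noteq> SNegInf" using B f(3) by simp
            show "modulus (?R r) \<le> modulus (?R f)" if "r < n" "r \<notin> ?F z" for r
            proof -
              have "modulus (tarr s2 ''G'' r) \<le> modulus (tarr s3 ''B'' 0)" using max that by auto
              then show ?thesis using G2'[OF that(1)] f(3) by simp
            qed
          qed
          have F: "insert f (?F z) = ?F (z(f := 1))" using f(1) by auto
          define d' where "d' = d(g' := of_trop (modulus (?R f)))"
          have step': "S.search_inv (Suc l) d' (?F (z(f := 1))) (tarr s3 ''G'') g'"
            by (rule S.search_inv_cong[OF step[unfolded F]]) (use G3 in \<open>auto simp: d'_def\<close>)
          define s4 where "s4 = s3\<lparr>iarr := (iarr s3)(''z'' := z(f := 1)), ireg := (ireg s3)(''g'' := g'),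
            tarr := (tarr s3)(''d'' := d')\<rparr>"
          have "?ag (s4\<lparr>ireg := (ireg s4)(''t'' := Suc (ireg s4 ''t''))\<rparr>)" using ag3' by (simp add: agree_def s4_def)
          then have "Inv (Suc l) (s4\<lparr>ireg := (ireg s4)(''t'' := Suc (ireg s4 ''t''))\<rparr>)"
            using step' arr(4) by (simp add: Inv_def s4_def)
          then have "wp (Cond (TPos (TArr ''B'' (INum 0))) (SetReg ''g'' (IArr ''q'' (IReg ''f''))) (SetReg ''g'' (IArr ''p'' (IReg ''f''))) ;;
             SetTArr ''d'' (IReg ''g'') (TAbs (TArr ''B'' (INum 0))))
             (\<lambda>t s'. t \<le> 30 \<and> Inv (Suc l) (s'\<lparr>ireg := (ireg s')(''t'' := Suc (ireg s' ''t''))\<rparr>)) (s3\<lparr>iarr := (iarr s3)(''z'' := z(f := 1))\<rparr>)"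
            using f(3) arr by (cases "tpositive (?R f)") (simp_all add: s4_def g'_def d'_def f_def[symmetric])
          moreover have "modulus SNegInf < modulus (tarr s3 ''B'' 0)" using B by (cases "tarr s3 ''B'' 0") (auto simp: less_le)
          ultimately show ?thesis
            unfolding raise_column_def wp_Cond by (auto simp: arr f_def[symmetric] elim!: wp_mono)
        qed
      qed
    qed
  qed (use s0 P(1) in \<open>auto simp: Inv_def agree_def\<close>)
  have "wp search_edge (\<lambda>t s'. t \<le> 1 + (50 * n + 100) + (n * ((1 + (100 * n + 10) + (1 + (50 * n + 20) + 40)) + 11) + 10) \<and> Inv n s') s"
    unfolding search_edge_def
    by (rule wp_SeqI[OF init_search_wp[OF P(1) h(1,2)]], elim conjE, rule loop, rule init) blast+
  then show ?thesis
  proof (rule wp_weaken)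
    show "1 + (50 * n + 100) + (n * ((1 + (100 * n + 10) + (1 + (50 * n + 20) + 40)) + 11) + 10) \<le> 500 * Suc n * Suc n"
      by (simp add: algebra_simps)
    fix s' assume inv: "Inv n s'"
    then have "S.search_inv n (tarr s' ''d'') (?F (iarr s' ''z'')) (tarr s' ''G'') (ireg s' ''g'')" by (simp add: Inv_def)
    note R = S.search_result[OF this]
    define \<delta> where "\<delta> j = modulus (tarr s' ''d'' j)" for j
    have "vp u i \<delta> = vn u i \<delta>" if i: "i \<in> I - {k}" for i
    proof -
      have "i \<in> iarr s ''I'' ` {..<n}" using bij_betw_imp_surj_on[OF P(3)] i by simp
      then obtain r where "r < n" "iarr s ''I'' r = i" by (elim imageE) simp
      then show ?thesis using R(5)[of r] i h by (auto simp: vp_def vn_def \<delta>_def)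
    qed
    then have "edge_direction u I k \<delta>"
      using R(1,2,4) h by (auto simp: edge_direction_def \<delta>_def vp_def)
    then have "edge_direction u I k (\<lambda>j. modulus (tarr s' ''d'' j))" unfolding \<delta>_def[abs_def] .
    then show "?ag s' \<and> edge_direction u I k (\<lambda>j. modulus (tarr s' ''d'' j)) \<and> (\<forall>j\<le>n. tarr s' ''d'' j = SNegInf \<or> (\<exists>a. tarr s' ''d'' j = Pos a))"
      using inv R(3) by (simp add: Inv_def)
  qed
qed

lemma row_values_wp:
  assumes prep: "prepared s u I" and t: "tight u I" and i: "ireg s ''i'' = i" "i < m"
    and d: "\<And>j. j \<le> n \<Longrightarrow> tarr s ''d'' j = SNegInf \<or> (\<exists>a. tarr s ''d'' j = Pos a)"
    and \<delta>: "\<And>j. \<delta> j = modulus (tarr s ''d'' j)"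
  shows "wp row_values (\<lambda>t s'. t \<le> 100 * n + 100 \<and> agree {''j''} {} {''P'', ''N''} s s' \<and>
    tarr s' ''P'' 0 = of_trop (vp u i \<delta>) \<and> tarr s' ''N'' 0 = of_trop (vn u i \<delta>)) s"
proof -
  let ?ag = "agree {''j''} {} {''P'', ''N''} s"
  note P = preparedD[OF prep t]
  define \<Sigma>p \<Sigma>n where "\<Sigma>p l = (\<Sum>j<l. pos_part (V u i j) * \<delta> j)" and "\<Sigma>n l = (\<Sum>j<l. neg_part (V u i j) * \<delta> j)" for l
  define Inv where "Inv l s' \<longleftrightarrow> ireg s' ''j'' = l \<and> ?ag s' \<and> tarr s' ''P'' 0 = of_trop (\<Sigma>p l) \<and> tarr s' ''N'' 0 = of_trop (\<Sigma>n l)" for l s'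
  define s0 where "s0 = s\<lparr>tarr := (tarr s)(''P'' := (tarr s ''P'')(0 := SNegInf), ''N'' := (tarr s ''N'')(0 := SNegInf))\<rparr>"
  have loop: "wp (for_loop ''j'' (IPlus (IReg ''n'') (INum 1))
       (Cond (TPos row_term)
         (Cond (TLess (TArr ''P'' (INum 0)) row_term) (SetTArr ''P'' (INum 0) (TAbs row_term)) Skip)
         (Cond (TLess (TArr ''N'' (INum 0)) row_term) (SetTArr ''N'' (INum 0) (TAbs row_term)) Skip)))
      (\<lambda>t s'. t \<le> Suc n * (50 + 11) + 10 \<and> Inv (Suc n) s') s0"
  proof (rule wp_for_loop, goal_cases)
    case (4 l s')
    then have l: "ireg s' ''j'' = l" "l \<le> n" and ag: "?ag s'"
      and PN: "tarr s' ''P'' 0 = of_trop (\<Sigma>p l)" "tarr s' ''N'' 0 = of_trop (\<Sigma>n l)" by (auto simp: Inv_def)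
    have norm': "normalized s' u m" by (rule normalized_agree[OF ag]) (use prep in \<open>auto simp: prepared_def\<close>)
    define x where "x = stimes (V u i l) (tarr s ''d'' l)"
    have arr: "tarr s' ''d'' = tarr s ''d''" "ireg s' ''i'' = i" using agreeD[OF ag] i by simp_all
    have e: "tval row_term s' = x"
      using entry_eval[OF norm', of "IReg ''i''" "IReg ''j''"] i l arr by (simp add: x_def)
    have e': "tval (TAbs row_term) s' = of_trop (modulus x)" unfolding tval.simps(7) e ..
    have b1: "bval (TPos row_term) s' \<longleftrightarrow> tpositive x"
      "bval (TLess (TArr ''P'' (INum 0)) row_term) s' \<longleftrightarrow> \<Sigma>p l < modulus x"
      "bval (TLess (TArr ''N'' (INum 0)) row_term) s' \<longleftrightarrow> \<Sigma>n l < modulus x"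
      unfolding bval.simps e using PN by simp_all
    \<comment> \<open>\<open>d\<close> has no negative entries, so a term has the sign of the matrix
      entry. Terms minus infinity fall into the negative branch and never change a maximum.\<close>
    have pos: "pos_part (V u i l) * \<delta> l = (if tpositive x then modulus x else 0)"
      and neg: "neg_part (V u i l) * \<delta> l = (if tpositive x then 0 else modulus x)"
      using d[OF l(2)] unfolding x_def \<delta> by (cases "V u i l"; auto simp: tpositive_def simp flip: zero_trop_def)+
    have plus: "y + modulus x = (if y < modulus x then modulus x else y)" for y by (auto simp: plus_trop_def max_def)
    have S: "\<Sigma>p (Suc l) = (if tpositive x \<and> \<Sigma>p l < modulus x then modulus x else \<Sigma>p l)"
      "\<Sigma>n (Suc l) = (if \<not> tpositive x \<and> \<Sigma>n l < modulus x then modulus x else \<Sigma>n l)"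
      by (cases "tpositive x"; simp add: \<Sigma>p_def \<Sigma>n_def pos neg plus)+
    have ag': "?ag (s'\<lparr>ireg := (ireg s')(''j'' := y)\<rparr>)"
      "?ag (s'\<lparr>tarr := (tarr s')(''P'' := w), ireg := (ireg s')(''j'' := y)\<rparr>)"
      "?ag (s'\<lparr>tarr := (tarr s')(''N'' := w), ireg := (ireg s')(''j'' := y)\<rparr>)" for y w
      using ag by (simp_all add: agree_def)
    show ?case unfolding wp_Cond b1 wp_SetTArr e'
      by (cases "tpositive x"; cases "\<Sigma>p l < modulus x"; cases "\<Sigma>n l < modulus x") (simp_all add: Inv_def S ag' l PN)
  qed (use P(1) in \<open>auto simp: Inv_def agree_def s0_def \<Sigma>p_def \<Sigma>n_def\<close>)
  then have "wp row_values (\<lambda>t s'. t \<le> Suc n * (50 + 11) + 30 \<and> Inv (Suc n) s') s"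
    unfolding row_values_def by (auto simp: s0_def elim!: wp_mono)
  then show ?thesis
    by (rule wp_weaken) (auto simp: Inv_def \<Sigma>p_def \<Sigma>n_def vp_def vn_def lessThan_Suc_atMost)
qed

lemma ratio_test_wp:
  assumes prep: "prepared s u I" and t: "tight u I" and k: "k \<in> I"
    and d: "\<And>j. j \<le> n \<Longrightarrow> tarr s ''d'' j = SNegInf \<or> (\<exists>a. tarr s ''d'' j = Pos a)"
    and \<delta>: "\<And>j. \<delta> j = modulus (tarr s ''d'' j)" and dir: "edge_direction u I k \<delta>"
    and marks: "\<And>i. i < m \<Longrightarrow> iarr s ''u'' i = 0 \<longleftrightarrow> i \<notin> I"
  shows "wp ratio_test (\<lambda>t s'. t \<le> 300 * Suc m * Suc n \<and> agree {''i'', ''j'', ''l''} {} {''P'', ''N'', ''B''} s s' \<and>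
    blocks u I \<delta> (ireg s' ''l'') \<and> tarr s' ''B'' 0 = of_trop (vn u (ireg s' ''l'') \<delta>) \<and>
    (\<forall>i. blocks u I \<delta> i \<longrightarrow> vn u i \<delta> \<le> vn u (ireg s' ''l'') \<delta>)) s"
proof -
  let ?ag = "agree {''i'', ''j'', ''l''} {} {''P'', ''N'', ''B''} s"
  note P = preparedD[OF prep t]
  define Inv where "Inv l s' \<longleftrightarrow> ireg s' ''i'' = l \<and> ?ag s' \<and>
    (tarr s' ''B'' 0 = SNegInf \<and> (\<forall>i<l. \<not> blocks u I \<delta> i) \<or>
     blocks u I \<delta> (ireg s' ''l'') \<and> tarr s' ''B'' 0 = of_trop (vn u (ireg s' ''l'') \<delta>) \<and>
       (\<forall>i<l. blocks u I \<delta> i \<longrightarrow> vn u i \<delta> \<le> vn u (ireg s' ''l'') \<delta>))" for l s'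
  define s0 where "s0 = s\<lparr>tarr := (tarr s)(''B'' := (tarr s ''B'')(0 := SNegInf))\<rparr>"
  let ?upd = "Cond (TLess (TArr ''P'' (INum 0)) (TArr ''N'' (INum 0)))
          (Cond (TLess (TArr ''B'' (INum 0)) (TArr ''N'' (INum 0)))
            (SetTArr ''B'' (INum 0) (TArr ''N'' (INum 0)) ;; SetReg ''l'' (IReg ''i'')) Skip) Skip"
  have loop: "wp (for_loop ''i'' (IReg ''m'') (Cond (ILess (IArr ''u'' (IReg ''i'')) (INum 1)) (row_values ;; ?upd) Skip))
      (\<lambda>t s'. t \<le> m * (100 * n + 150 + 11) + 10 \<and> Inv m s') s0"
  proof (rule wp_for_loop, goal_cases)
    case (4 l s')
    then have l: "ireg s' ''i'' = l" and ag: "?ag s'"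
      and inv: "tarr s' ''B'' 0 = SNegInf \<and> (\<forall>i<l. \<not> blocks u I \<delta> i) \<or>
        blocks u I \<delta> (ireg s' ''l'') \<and> tarr s' ''B'' 0 = of_trop (vn u (ireg s' ''l'') \<delta>) \<and>
         (\<forall>i<l. blocks u I \<delta> i \<longrightarrow> vn u i \<delta> \<le> vn u (ireg s' ''l'') \<delta>)" by (auto simp: Inv_def)
    have arr: "iarr s' ''u'' = iarr s ''u''" "tarr s' ''d'' = tarr s ''d''" using agreeD[OF ag] by simp_all
    have prep': "prepared s' u I" by (rule prepared_agree[OF ag prep]) auto
    show ?case
    proof (cases "l \<in> I")
      case True
      then have "\<not> blocks u I \<delta> l" by (simp add: blocks_def)
      then have "Inv (Suc l) (s'\<lparr>ireg := (ireg s')(''i'' := Suc (ireg s' ''i''))\<rparr>)"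
        using inv ag l by (auto simp: Inv_def agree_def less_Suc_eq)
      moreover have "iarr s ''u'' l \<noteq> 0" using marks[OF 4(1)] True by simp
      ultimately show ?thesis by (simp add: l arr)
    next
      case False
      have upd: "wp ?upd (\<lambda>t s''. t \<le> 30 \<and> Inv (Suc l) (s''\<lparr>ireg := (ireg s'')(''i'' := Suc (ireg s'' ''i''))\<rparr>)) s1"
        if s1: "agree {''j''} {} {''P'', ''N''} s' s1" "tarr s1 ''P'' 0 = of_trop (vp u l \<delta>)" "tarr s1 ''N'' 0 = of_trop (vn u l \<delta>)" for s1
      proof -
        have ag1: "?ag s1" by (rule agree_trans[OF ag s1(1)]) auto
        have arr1: "ireg s1 ''l'' = ireg s' ''l''" "tarr s1 ''B'' = tarr s' ''B''" "ireg s1 ''i'' = l" using agreeD[OF s1(1)] l by simp_all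
        have ag': "?ag (s1\<lparr>ireg := (ireg s1)(''i'' := y)\<rparr>)"
          "?ag (s1\<lparr>tarr := (tarr s1)(''B'' := w), ireg := (ireg s1)(''l'' := x, ''i'' := y)\<rparr>)" for y w x
          using ag1 by (simp_all add: agree_def)
        have bl: "blocks u I \<delta> l \<longleftrightarrow> vp u l \<delta> < vn u l \<delta>" using False 4(1) by (simp add: blocks_def)
        show ?thesis
        proof (cases "blocks u I \<delta> l \<and> modulus (tarr s' ''B'' 0) < vn u l \<delta>")
          case True
          have "vn u i \<delta> \<le> vn u l \<delta>" if "i < Suc l" "blocks u I \<delta> i" for i
          proof (cases "i = l")
            case False
            then have "i < l" using that by simp
            then have "vn u i \<delta> \<le> modulus (tarr s' ''B'' 0)" using inv that by auto
            then show ?thesis using True by (meson order_trans less_imp_le)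
          qed simp
          then have "Inv (Suc l) (s1\<lparr>tarr := (tarr s1)(''B'' := (tarr s1 ''B'')(0 := of_trop (vn u l \<delta>))), ireg := (ireg s1)(''l'' := l, ''i'' := Suc l)\<rparr>)"
            using True ag' by (simp add: Inv_def)
          then show ?thesis using True bl s1 arr1 by simp
        next
          case no: False
          have "Inv (Suc l) (s1\<lparr>ireg := (ireg s1)(''i'' := Suc (ireg s1 ''i''))\<rparr>)"
          proof (cases "blocks u I \<delta> l")
            case True
            then have "vn u l \<delta> \<le> modulus (tarr s' ''B'' 0)" using no by (simp add: not_less)
            \<comment> \<open>A blocking row has a finite negative side, so the initial value minus
              infinity of \<open>B\<close> cannot conceal the first one.\<close>
            moreover have "vn u l \<delta> \<noteq> 0" using True by (auto simp: blocks_def)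
            ultimately show ?thesis using inv ag' arr1 by (auto simp: Inv_def less_Suc_eq simp flip: zero_trop_def)
          next
            case False
            then show ?thesis using inv ag' arr1 by (auto simp: Inv_def less_Suc_eq)
          qed
          then show ?thesis using no bl s1 arr1 by auto
        qed
      qed
      have d': "tarr s' ''d'' j = SNegInf \<or> (\<exists>a. tarr s' ''d'' j = Pos a)" if "j \<le> n" for j using d[OF that] arr by simp
      have \<delta>': "\<delta> j = modulus (tarr s' ''d'' j)" for j using \<delta> arr by simp
      have "wp (row_values ;; ?upd) (\<lambda>t s''. t \<le> 1 + (100 * n + 100) + 30 \<and> Inv (Suc l) (s''\<lparr>ireg := (ireg s'')(''i'' := Suc (ireg s'' ''i''))\<rparr>)) s'"
        by (rule wp_SeqI, rule row_values_wp[OF prep' t l 4(1)], erule d', rule \<delta>', elim conjE, rule upd)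
      then have "wp (row_values ;; ?upd) (\<lambda>t s''. 1 + bcost (ILess (IArr ''u'' (IReg ''i'')) (INum 1)) + t \<le> 100 * n + 150 \<and>
          Inv (Suc l) (s''\<lparr>ireg := (ireg s'')(''i'' := Suc (ireg s'' ''i''))\<rparr>)) s'"
        by (rule wp_mono) auto
      moreover have "bval (ILess (IArr ''u'' (IReg ''i'')) (INum 1)) s'" using marks[OF 4(1)] False l arr by simp
      ultimately show ?thesis unfolding wp_Cond by (simp only: if_True)
    qed
  qed (use P(2) in \<open>auto simp: Inv_def agree_def s0_def\<close>)
  then have "wp ratio_test (\<lambda>t s'. t \<le> m * (100 * n + 150 + 11) + 20 \<and> Inv m s') s"
    unfolding ratio_test_def by (auto simp: s0_def elim!: wp_mono)
  then show ?thesis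
  proof (rule wp_weaken)
    show "m * (100 * n + 150 + 11) + 20 \<le> 300 * Suc m * Suc n" by (simp add: algebra_simps)
    fix s' assume inv: "Inv m s'"
    have "I \<subseteq> {..<m}" using t by (auto simp: tight_def)
    \<comment> \<open>Edges are bounded, hence the scan has met a blocking row and register
      \<open>l\<close> holds one.\<close>
    from edge_blocked[OF this k dir] obtain i where "blocks u I \<delta> i" ..
    moreover have "i < m" if "blocks u I \<delta> i" for i using that by (simp add: blocks_def)
    ultimately show "?ag s' \<and> blocks u I \<delta> (ireg s' ''l'') \<and> tarr s' ''B'' 0 = of_trop (vn u (ireg s' ''l'') \<delta>) \<and>
      (\<forall>i. blocks u I \<delta> i \<longrightarrow> vn u i \<delta> \<le> vn u (ireg s' ''l'') \<delta>)" using inv by (auto simp: Inv_def)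
  qed
qed

end

lemma move_point_wp:
  assumes n: "ireg s ''n'' = n" and B: "tarr s ''B'' 0 = Pos \<beta>" and x: "\<And>j. j < n \<Longrightarrow> tarr s ''x'' j = Pos (u j)"
    and d: "\<And>j. j \<le> n \<Longrightarrow> tarr s ''d'' j = SNegInf \<or> (\<exists>a. tarr s ''d'' j = Pos a)"
    and \<zeta>: "\<And>j. j \<le> n \<Longrightarrow> 1 + Fin (- \<beta>) * modulus (tarr s ''d'' j) = Fin (\<zeta> j)"
  shows "wp move_point (\<lambda>t s'. t \<le> 100 * n + 100 \<and> agree {''j''} {''I''} {''z'', ''x''} s s' \<and>
    iarr s' ''I'' = (iarr s ''I'')(ireg s ''h'' := ireg s ''l'') \<and> (\<forall>j<n. tarr s' ''x'' j = Pos (u j + \<zeta> j - \<zeta> n))) s"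
proof -
  let ?ag = "\<lambda>s'. agree {''j''} {''I''} {''z'', ''x''} s s' \<and> iarr s' ''I'' = (iarr s ''I'')(ireg s ''h'' := ireg s ''l'')"
  define s0 where "s0 = s\<lparr>iarr := (iarr s)(''I'' := (iarr s ''I'')(ireg s ''h'' := ireg s ''l''))\<rparr>"
  define Inv1 where "Inv1 l s' \<longleftrightarrow> ireg s' ''j'' = l \<and> ?ag s' \<and> tarr s' ''x'' = tarr s ''x'' \<and> (\<forall>j<l. tarr s' ''z'' j = Pos (\<zeta> j))" for l s'
  define Inv2 where "Inv2 l s' \<longleftrightarrow> ireg s' ''j'' = l \<and> ?ag s' \<and> (\<forall>j\<le>n. tarr s' ''z'' j = Pos (\<zeta> j)) \<and>
    (\<forall>j<l. tarr s' ''x'' j = Pos (u j + \<zeta> j - \<zeta> n)) \<and> (\<forall>j\<ge>l. tarr s' ''x'' j = tarr s ''x'' j)" for l s'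
  have p0: "wp (SetIArr ''I'' (IReg ''h'') (IReg ''l'')) (\<lambda>t s'. t \<le> 3 \<and> s' = s0) s" by (simp add: s0_def)
  have p1: "wp (for_loop ''j'' (IPlus (IReg ''n'') (INum 1))
       (SetTArr ''z'' (IReg ''j'') (TTimes (TArr ''d'' (IReg ''j'')) (TInv (TArr ''B'' (INum 0)))) ;;
        Cond (TLess (TArr ''z'' (IReg ''j'')) TOne) (SetTArr ''z'' (IReg ''j'') TOne) Skip))
       (\<lambda>t s'. t \<le> Suc n * (30 + 11) + 10 \<and> Inv1 (Suc n) s') s0"
  proof (rule wp_for_loop, goal_cases)
    case (4 l s')
    then have l: "ireg s' ''j'' = l" "l \<le> n" and ag: "?ag s'" and x1: "tarr s' ''x'' = tarr s ''x''"
      and low: "\<And>j. j < l \<Longrightarrow> tarr s' ''z'' j = Pos (\<zeta> j)" by (auto simp: Inv1_def)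
    have arr: "tarr s' ''d'' = tarr s ''d''" "tarr s' ''B'' = tarr s ''B''" using agreeD[OF conjunct1[OF ag]] by simp_all
    define w where "w = stimes (tarr s ''d'' l) (Pos (- \<beta>))"
    have w: "(if modulus w < Fin 0 then Pos 0 else w) = Pos (\<zeta> l)"
      using d[OF l(2)] \<zeta>[OF l(2)] unfolding w_def
      by (auto simp: one_trop_def plus_trop_def max_def not_less split: if_splits dest!: less_imp_le)
    have ag': "agree {''j''} {''I''} {''z'', ''x''} s (s'\<lparr>tarr := (tarr s')(''z'' := y), ireg := (ireg s')(''j'' := k)\<rparr>)" for y k
      using ag by (simp add: agree_def)
    show ?case using w low ag x1 ag' by (simp add: l arr B Inv1_def less_Suc_eq split: if_splits flip: w_def)
  qed (use n in \<open>auto simp: Inv1_def agree_def s0_def\<close>)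
  have p2: "wp (for_loop ''j'' (IReg ''n'')
       (SetTArr ''x'' (IReg ''j'') (TTimes (TArr ''x'' (IReg ''j''))
          (TTimes (TArr ''z'' (IReg ''j'')) (TInv (TArr ''z'' (IReg ''n'')))))))
       (\<lambda>t s'. t \<le> n * (30 + 11) + 10 \<and> Inv2 n s') s1" if i1: "Inv1 (Suc n) s1" for s1
  proof (rule wp_for_loop, goal_cases)
    case (4 l s')
    then have l: "ireg s' ''j'' = l" "l < n" and ag: "?ag s'" and z: "\<And>j. j \<le> n \<Longrightarrow> tarr s' ''z'' j = Pos (\<zeta> j)"
      and low: "\<And>j. j < l \<Longrightarrow> tarr s' ''x'' j = Pos (u j + \<zeta> j - \<zeta> n)" and high: "\<And>j. l \<le> j \<Longrightarrow> tarr s' ''x'' j = tarr s ''x'' j"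
      by (auto simp: Inv2_def)
    have n': "ireg s' ''n'' = n" using agreeD[OF conjunct1[OF ag]] n by simp
    have ag': "agree {''j''} {''I''} {''z'', ''x''} s (s'\<lparr>tarr := (tarr s')(''x'' := y), ireg := (ireg s')(''j'' := k)\<rparr>)" for y k
      using ag by (simp add: agree_def)
    have "tarr s' ''x'' l = Pos (u l)" using high[of l] x[OF l(2)] by simp
    moreover have "tarr s' ''z'' l = Pos (\<zeta> l)" using z l by simp
    ultimately show ?case using ag ag' low high z by (simp add: l n' Inv2_def less_Suc_eq add_diff_eq)
  qed (use n i1 in \<open>auto simp: Inv1_def Inv2_def agree_def less_Suc_eq_le\<close>)
  have "wp move_point (\<lambda>t s'. t \<le> 1 + 3 + (1 + (Suc n * (30 + 11) + 10) + (n * (30 + 11) + 10)) \<and> Inv2 n s') s"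
    unfolding move_point_def by (rule wp_SeqI[OF p0], simp only:, rule wp_SeqI[OF p1 p2])
  then show ?thesis by (rule wp_weaken) (auto simp: Inv2_def)
qed

context trop_program
begin

lemma pivot_program_wp:
  assumes st: "stores_state s n m A b c I (trop_basic_point A b I)" and I: "trop_basic A b I"
    and k: "ireg s ''k'' = k" "k \<in> I"
  shows "wp pivot_program (\<lambda>t s'. t \<le> 2000 * Suc m * Suc n \<and>
    stores_state s' n m A b c (trop_pivot A b I k) (trop_basic_point A b (trop_pivot A b I k))) s"
proof -
  obtain u where ok: "basis_ok u I" using basis_okE[OF I] .
  then have t: "tight u I" and pt: "trop_basic_point A b I = pt u" and u: "u n = 0" and cI: "card I = n" "I \<subseteq> {..<m}"
    by (auto simp: basis_ok_def)
  have nm: "n \<le> m" using cI card_mono[of "{..<m}" I] by auto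
  have st': "stores_state s n m A b c I (pt u)" using st pt by simp
  have face: "pt u \<in> trop_face A b I" using trop_basicD(5)[OF I] pt by simp
  let ?Q = "\<lambda>s'. stores_state s' n m A b c (trop_pivot A b I k) (trop_basic_point A b (trop_pivot A b I k))"
  define P1 where "P1 s' \<longleftrightarrow> prepared s' u I \<and> ireg s' ''k'' = k" for s'
  define P2 where "P2 s' \<longleftrightarrow> prepared s' u I \<and> ireg s' ''h'' < n \<and> iarr s' ''I'' (ireg s' ''h'') = k" for s'
  define P3 where "P3 s' \<longleftrightarrow> P2 s' \<and> (\<forall>i<m. iarr s' ''u'' i = 0 \<longleftrightarrow> i \<notin> I)" for s'
  define \<delta> where "\<delta> s' = (\<lambda>j. modulus (tarr s' ''d'' j))" for s' :: memory
  define P4 where "P4 s' \<longleftrightarrow> P3 s' \<and> edge_direction u I k (\<delta> s') \<and> (\<forall>j\<le>n. tarr s' ''d'' j = SNegInf \<or> (\<exists>a. tarr s' ''d'' j = Pos a))" for s'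
  define P5 where "P5 s' \<longleftrightarrow> P4 s' \<and> blocks u I (\<delta> s') (ireg s' ''l'') \<and> tarr s' ''B'' 0 = of_trop (vn u (ireg s' ''l'') (\<delta> s')) \<and>
    (\<forall>i. blocks u I (\<delta> s') i \<longrightarrow> vn u i (\<delta> s') \<le> vn u (ireg s' ''l'') (\<delta> s'))" for s'
  have c1: "wp prepare (\<lambda>t s'. t \<le> 500 * Suc m * Suc n \<and> P1 s') s"
  proof (rule wp_weaken[OF prepare_wp[OF st' ok] order_refl], elim conjE)
    fix s' assume "agree {''i'', ''j'', ''a'', ''v'', ''r''} {''o'', ''p'', ''q''} {''V'', ''S''} s s'" "prepared s' u I"
    then show "P1 s'" using k by (simp add: P1_def agree_def)
  qed
  have c2: "wp locate_row (\<lambda>t s'. t \<le> 50 * n + 10 \<and> P2 s') s1" if s1: "P1 s1" for s1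
  proof -
    have prep: "prepared s1 u I" and k1: "ireg s1 ''k'' = k" using s1 by (auto simp: P1_def)
    note P = preparedD[OF prep t]
    have "ireg s1 ''k'' \<in> iarr s1 ''I'' ` {..<n}" using bij_betw_imp_surj_on[OF P(3)] k1 k(2) by simp
    from locate_row_wp[OF P(1) this] show ?thesis
    proof (rule wp_weaken[OF _ order_refl], elim conjE)
      fix s' assume ag: "agree {''r'', ''h''} {} {} s1 s'" and h: "ireg s' ''h'' < n" "iarr s1 ''I'' (ireg s' ''h'') = ireg s1 ''k''"
      have "prepared s' u I" by (rule prepared_agree[OF ag prep]) auto
      then show "P2 s'" using h k1 agreeD[OF ag] by (simp add: P2_def)
    qed
  qed
  have c3: "wp mark_basis (\<lambda>t s'. t \<le> 20 * m + 20 * n + 30 \<and> P3 s') s2" if s2: "P2 s2" for s2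
  proof -
    have prep: "prepared s2 u I" using s2 by (auto simp: P2_def)
    note P = preparedD[OF prep t]
    from mark_basis_wp[OF P(1,2)] show ?thesis
    proof (rule wp_weaken[OF _ order_refl], elim conjE)
      fix s' assume ag: "agree {''i'', ''r''} {''u''} {} s2 s'" and mk: "\<forall>i<m. (iarr s' ''u'' i = 0) = (i \<notin> iarr s2 ''I'' ` {..<n})"
      have "prepared s' u I" by (rule prepared_agree[OF ag prep]) auto
      then show "P3 s'" using s2 mk agreeD[OF ag] bij_betw_imp_surj_on[OF P(3)] by (simp add: P3_def P2_def)
    qed
  qed
  have c4: "wp search_edge (\<lambda>t s'. t \<le> 500 * Suc n * Suc n \<and> P4 s') s3" if s3: "P3 s3" for s3
  proof -
    have prep: "prepared s3 u I" and h: "ireg s3 ''h'' < n" "iarr s3 ''I'' (ireg s3 ''h'') = k" using s3 by (auto simp: P3_def P2_def)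
    from search_edge_wp[OF prep t refl h] show ?thesis
    proof (rule wp_weaken[OF _ order_refl], elim conjE)
      fix s' assume ag: "agree {''j'', ''r'', ''g'', ''f'', ''t''} {''z''} {''d'', ''G'', ''B''} s3 s'"
        and dir: "edge_direction u I k (\<lambda>j. modulus (tarr s' ''d'' j))" "\<forall>j\<le>n. tarr s' ''d'' j = SNegInf \<or> (\<exists>a. tarr s' ''d'' j = Pos a)"
      have "prepared s' u I" by (rule prepared_agree[OF ag prep]) auto
      then show "P4 s'" using s3 dir agreeD[OF ag] by (simp add: P4_def P3_def P2_def \<delta>_def)
    qed
  qed
  have c5: "wp ratio_test (\<lambda>t s'. t \<le> 300 * Suc m * Suc n \<and> P5 s') s4" if s4: "P4 s4" for s4
  proof -
    have prep: "prepared s4 u I" and dir: "edge_direction u I k (\<delta> s4)"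
      and d: "\<And>j. j \<le> n \<Longrightarrow> tarr s4 ''d'' j = SNegInf \<or> (\<exists>a. tarr s4 ''d'' j = Pos a)"
      and mk: "\<And>i. i < m \<Longrightarrow> iarr s4 ''u'' i = 0 \<longleftrightarrow> i \<notin> I" using s4 by (auto simp: P4_def P3_def P2_def)
    have \<delta>4: "\<delta> s4 j = modulus (tarr s4 ''d'' j)" for j by (simp add: \<delta>_def)
    show ?thesis
    proof (rule wp_weaken[OF ratio_test_wp[OF prep t k(2) d \<delta>4 dir mk] order_refl]; (elim conjE)?)
      fix s' assume ag: "agree {''i'', ''j'', ''l''} {} {''P'', ''N'', ''B''} s4 s'"
        and res: "blocks u I (\<delta> s4) (ireg s' ''l'')" "tarr s' ''B'' 0 = of_trop (vn u (ireg s' ''l'') (\<delta> s4))"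
          "\<forall>i. blocks u I (\<delta> s4) i \<longrightarrow> vn u i (\<delta> s4) \<le> vn u (ireg s' ''l'') (\<delta> s4)"
      have "prepared s' u I" by (rule prepared_agree[OF ag prep]) auto
      moreover have "\<delta> s' = \<delta> s4" using agreeD[OF ag] by (simp add: \<delta>_def)
      ultimately show "P5 s'" using s4 res agreeD[OF ag] by (simp add: P5_def P4_def P3_def P2_def)
    qed
  qed
  have c6: "wp move_point (\<lambda>t s'. t \<le> 100 * n + 100 \<and> ?Q s') s5" if s5: "P5 s5" for s5
  proof -
    define l h where "l = ireg s5 ''l''" and "h = ireg s5 ''h''"
    have prep: "prepared s5 u I" and h: "h < n" "iarr s5 ''I'' h = k" and dir: "edge_direction u I k (\<delta> s5)"
      and d: "\<And>j. j \<le> n \<Longrightarrow> tarr s5 ''d'' j = SNegInf \<or> (\<exists>a. tarr s5 ''d'' j = Pos a)"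
      and bl: "blocks u I (\<delta> s5) l" and B: "tarr s5 ''B'' 0 = of_trop (vn u l (\<delta> s5))"
      and max: "\<And>i. blocks u I (\<delta> s5) i \<Longrightarrow> vn u i (\<delta> s5) \<le> vn u l (\<delta> s5)"
      using s5 by (auto simp: P5_def P4_def P3_def P2_def l_def h_def)
    note P = preparedD[OF prep t]
    have "vn u l (\<delta> s5) \<noteq> 0" using bl by (auto simp: blocks_def)
    then obtain \<beta> where \<beta>: "vn u l (\<delta> s5) = Fin \<beta>" by (auto elim: trop_neq_0E)
    have "\<exists>e. 1 + Fin (- \<beta>) * \<delta> s5 j = Fin e" for j
      by (cases "\<delta> s5 j") (auto simp: plus_trop_def one_trop_def max_def)
    then obtain \<zeta> where \<zeta>: "\<And>j. 1 + Fin (- \<beta>) * \<delta> s5 j = Fin (\<zeta> j)" by metis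
    let ?I' = "insert l (I - {k})"
    have step: "pt (\<lambda>j. u j + \<zeta> j - \<zeta> n) \<in> trop_face A b ?I'" "is_trop_pivot A b I k ?I'"
      using edge_step[OF cI(2,1) k(2) u face dir bl max \<beta> \<zeta>] by blast+
    have piv: "trop_pivot A b I k = ?I'" by (rule trop_pivot_eqI[OF I k(2) step(2)])
    have "trop_basic A b ?I'" using step(2) by (simp add: is_trop_pivot_def)
    then have bp: "trop_basic_point A b ?I' = pt (\<lambda>j. u j + \<zeta> j - \<zeta> n)" by (rule trop_basicD(6)[OF _ step(1)])
    have lI: "l \<notin> I" using bl by (simp add: blocks_def)
    have bij: "bij_betw ((iarr s5 ''I'')(h := l)) {..<n} ?I'"
    proof -
      have "bij_betw (iarr s5 ''I'') ({..<n} - {h}) (I - {k})"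
        using bij_betw_DiffI[OF P(3), of "{h}" "{k}"] h k(2) by (auto simp: bij_betw_def)
      then have "bij_betw ((iarr s5 ''I'')(h := l)) ({..<n} - {h}) (I - {k})"
        by (rule bij_betw_cong[THEN iffD1, rotated]) auto
      then have "bij_betw ((iarr s5 ''I'')(h := l)) (({..<n} - {h}) \<union> {h}) ((I - {k}) \<union> {l})"
        by (rule bij_betw_combine) (use lI in \<open>auto simp: bij_betw_def\<close>)
      moreover have "({..<n} - {h}) \<union> {h} = {..<n}" "(I - {k}) \<union> {l} = ?I'" using h(1) by auto
      ultimately show ?thesis by simp
    qed
    have B': "tarr s5 ''B'' 0 = Pos \<beta>" using B \<beta> by simp
    have "wp move_point (\<lambda>t s'. t \<le> 100 * n + 100 \<and> agree {''j''} {''I''} {''z'', ''x''} s5 s' \<and>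
      iarr s' ''I'' = (iarr s5 ''I'')(h := l) \<and> (\<forall>j<n. tarr s' ''x'' j = Pos (u j + \<zeta> j - \<zeta> n))) s5"
      unfolding h_def l_def by (rule move_point_wp[OF P(1) B' P(11) d]) (use \<zeta> in \<open>auto simp: \<delta>_def\<close>)
    then show ?thesis
    proof (rule wp_weaken[OF _ order_refl], elim conjE)
      fix s' assume ag: "agree {''j''} {''I''} {''z'', ''x''} s5 s'" and I': "iarr s' ''I'' = (iarr s5 ''I'')(h := l)"
        and x': "\<forall>j<n. tarr s' ''x'' j = Pos (u j + \<zeta> j - \<zeta> n)"
      have "stores_state s5 n m A b c I (pt u)" using prep by (simp add: prepared_def)
      then show "?Q s'" unfolding piv bp stores_state_def using bij I' x' agreeD[OF ag] by (simp add: pt_def)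
    qed
  qed
  have "wp pivot_program (\<lambda>t s'. t \<le> 1 + 500 * Suc m * Suc n + (1 + (50 * n + 10) + (1 + (20 * m + 20 * n + 30) +
      (1 + 500 * Suc n * Suc n + (1 + 300 * Suc m * Suc n + (100 * n + 100))))) \<and> ?Q s') s"
    unfolding pivot_program_def
    by (rule wp_SeqI[OF c1], rule wp_SeqI[OF c2], assumption, rule wp_SeqI[OF c3], assumption,
        rule wp_SeqI[OF c4], assumption, rule wp_SeqI[OF c5 c6])
  then show ?thesis
  proof (rule wp_weaken)
    have "Suc n * Suc n \<le> Suc m * Suc n" using nm by (intro mult_le_mono) auto
    moreover have "Suc m * Suc n = m * n + m + n + 1" by simp
    ultimately show "1 + 500 * Suc m * Suc n + (1 + (50 * n + 10) + (1 + (20 * m + 20 * n + 30) +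
      (1 + 500 * Suc n * Suc n + (1 + 300 * Suc m * Suc n + (100 * n + 100))))) \<le> 2000 * Suc m * Suc n"
      unfolding mult.assoc by linarith
  qed
qed

end

theorem theorem1p1:
  shows
    "(\<forall>n m A b c I \<phi>.
        trop_lp n m A b c \<and> standard_lp A b c \<and> trop_basic A b I \<and> trop_pivoting_rule A b c \<phi> \<longrightarrow>
        (\<exists>h. trop_simplex A b c \<phi> I = Some h \<and>
             trop_optimal A b c (trop_basic_point A b (last h)) \<and>
             (\<forall>\<AA> \<bb> \<cc> \<Phi>.
                is_lift \<AA> \<bb> \<cc> A b c \<and> puiseux_pivoting_rule \<AA> \<bb> \<cc> \<Phi> \<and>
                compatible_rules A b c \<phi> \<AA> \<bb> \<cc> \<Phi> \<longrightarrow>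
                puiseux_basic \<AA> \<bb> I \<and>
                puiseux_simplex \<AA> \<bb> \<cc> \<Phi> I = Some h \<and>
                (\<forall>J\<in>set h. trop_basic_point A b J = map_vec val (puiseux_basic_point \<AA> \<bb> J)) \<and>
                (\<forall>r. Suc r < length h \<longrightarrow>
                   trop_face A b (h ! r \<inter> h ! Suc r) =
                   map_vec val ` puiseux_face \<AA> \<bb> (h ! r \<inter> h ! Suc r)))))
     \<and>
     (\<forall>n m A b c I.
        trop_lp n m A b c \<and> standard_lp A b c \<and> trop_basic A b I \<longrightarrow>
        (\<exists>!x. x \<in> trop_face A b I) \<and>
        (\<exists>!y. is_trop_reduced_costs A c I y) \<and>
        (\<forall>k\<in>I. \<exists>!I'. is_trop_pivot A b I k I'))
     \<and>
     (\<exists>pivot costs C.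
        \<forall>n m A b c I s.
          trop_lp n m A b c \<and> standard_lp A b c \<and> trop_basic A b I \<and>
          stores_state s n m A b c I (trop_basic_point A b I) \<longrightarrow>
          (\<exists>t s'. exec costs s t s' \<and> t \<le> C * (n * (m + n)) \<and>
             stores_state s' n m A b c I (trop_basic_point A b I) \<and>
             stores_costs s' m (trop_reduced_costs A c I)) \<and>
          (\<forall>k\<in>I. tnegative (trop_reduced_costs A c I $ k) \<and> ireg s ''k'' = k \<longrightarrow>
             (\<exists>t s'. exec (Seq pivot costs) s t s' \<and> t \<le> C * (n * (m + n)) \<and>
                stores_state s' n m A b c (trop_pivot A b I k)
                  (trop_basic_point A b (trop_pivot A b I k)) \<and>
                stores_costs s' m (trop_reduced_costs A c (trop_pivot A b I k)))))"
proof (intro conjI, goal_cases)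
  case 1
  show ?case
  proof (intro allI impI, elim conjE)
    fix n m A b c I \<phi>
    assume P: "trop_lp n m A b c" "standard_lp A b c" "trop_basic A b I" "trop_pivoting_rule A b c \<phi>"
    interpret trop_program n m A b c by unfold_locales (rule P)+
    show "\<exists>h. trop_simplex A b c \<phi> I = Some h \<and>
             trop_optimal A b c (trop_basic_point A b (last h)) \<and>
             (\<forall>\<AA> \<bb> \<cc> \<Phi>.
                is_lift \<AA> \<bb> \<cc> A b c \<and> puiseux_pivoting_rule \<AA> \<bb> \<cc> \<Phi> \<and>
                compatible_rules A b c \<phi> \<AA> \<bb> \<cc> \<Phi> \<longrightarrow>
                puiseux_basic \<AA> \<bb> I \<and>
                puiseux_simplex \<AA> \<bb> \<cc> \<Phi> I = Some h \<and>
                (\<forall>J\<in>set h. trop_basic_point A b J = map_vec val (puiseux_basic_point \<AA> \<bb> J)) \<and>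
                (\<forall>r. Suc r < length h \<longrightarrow>
                   trop_face A b (h ! r \<inter> h ! Suc r) =
                   map_vec val ` puiseux_face \<AA> \<bb> (h ! r \<inter> h ! Suc r)))"
      by (rule simplex_traces_lifts[OF P(4,3)])
  qed
next
  case 2
  show ?case
  proof (intro allI impI, elim conjE)
    fix n m A b c I
    assume P: "trop_lp n m A b c" "standard_lp A b c" "trop_basic A b I"
    interpret trop_program n m A b c by unfold_locales (rule P)+
    show "(\<exists>!x. x \<in> trop_face A b I) \<and> (\<exists>!y. is_trop_reduced_costs A c I y) \<and> (\<forall>k\<in>I. \<exists>!I'. is_trop_pivot A b I k I')"
      by (intro conjI ballI trop_basicD(4)[OF P(3)] reduced_costs_unique(1)[OF P(3)] pivot_unique[OF P(3)])
  qed
next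
  case 3
  show ?case
  proof (rule exI[of _ pivot_program], rule exI[of _ costs_program], rule exI[of _ 20000], intro allI impI, elim conjE)
    fix n m A b c I s
    assume P: "trop_lp n m A b c" "standard_lp A b c" "trop_basic A b I"
      and st: "stores_state s n m A b c I (trop_basic_point A b I)"
    interpret trop_program n m A b c by unfold_locales (rule P)+
    note B = trop_basicD[OF P(3)]
    have n0: "0 < n" using P(1) by (simp add: trop_lp_def)
    have nm: "n \<le> m" using B(1,2) card_mono[of "{..<m}" I] by auto
    \<comment> \<open>From \<open>0 < n \<le> m\<close> the product is at most four times
      \<open>n * (m + n)\<close>. A pivot followed by new reduced costs needs at most
      \<open>1 + 2000 + 1500\<close> times \<open>Suc m * Suc n\<close>, which 5000 covers; this
      gives the constant 20000.\<close>
    have "Suc m * Suc n \<le> (2 * m) * (2 * n)" by (rule mult_le_mono) (use n0 nm in auto)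
    also have "\<dots> \<le> 4 * (n * (m + n))" by (simp add: algebra_simps)
    finally have time: "5000 * (Suc m * Suc n) \<le> 20000 * (n * (m + n))" by simp
    have costs: "\<exists>t s'. exec costs_program s t s' \<and> t \<le> 20000 * (n * (m + n)) \<and>
        stores_state s' n m A b c I (trop_basic_point A b I) \<and> stores_costs s' m (trop_reduced_costs A c I)"
      unfolding wp_def[symmetric]
    proof (rule wp_weaken[OF costs_program_wp[OF st P(3)]])
      show "1500 * Suc m * Suc n \<le> 20000 * (n * (m + n))" using time unfolding mult.assoc by linarith
    qed
    have "\<exists>t s'. exec (Seq pivot_program costs_program) s t s' \<and> t \<le> 20000 * (n * (m + n)) \<and>
        stores_state s' n m A b c (trop_pivot A b I k) (trop_basic_point A b (trop_pivot A b I k)) \<and>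
        stores_costs s' m (trop_reduced_costs A c (trop_pivot A b I k))"
      if k: "k \<in> I" "ireg s ''k'' = k" for k
    proof -
      have I': "trop_basic A b (trop_pivot A b I k)" using trop_pivot[OF P(3) k(1)] by (simp add: is_trop_pivot_def)
      show ?thesis unfolding wp_def[symmetric]
      proof (rule wp_weaken[OF wp_SeqI[OF pivot_program_wp[OF st P(3) k(2,1)] costs_program_wp[OF _ I']]])
        have "1 \<le> Suc m * Suc n" by simp
        then show "1 + 2000 * Suc m * Suc n + 1500 * Suc m * Suc n \<le> 20000 * (n * (m + n))"
          using time unfolding mult.assoc by linarith
      qed
    qed
    with costs show "(\<exists>t s'. exec costs_program s t s' \<and> t \<le> 20000 * (n * (m + n)) \<and>
             stores_state s' n m A b c I (trop_basic_point A b I) \<and>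
             stores_costs s' m (trop_reduced_costs A c I)) \<and>
          (\<forall>k\<in>I. tnegative (trop_reduced_costs A c I $ k) \<and> ireg s ''k'' = k \<longrightarrow>
             (\<exists>t s'. exec (Seq pivot_program costs_program) s t s' \<and> t \<le> 20000 * (n * (m + n)) \<and>
                stores_state s' n m A b c (trop_pivot A b I k)
                  (trop_basic_point A b (trop_pivot A b I k)) \<and>
                stores_costs s' m (trop_reduced_costs A c (trop_pivot A b I k))))" by blast
  qed
qed

end
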